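(* Let $\Sigma$ be a signature, let $\mathcal{R}$ be any rewriting system on the PROP $\mathbf{S}_\Sigma$, and let $d,e\colon n\to m$ be arrows of $\mathbf{S}_\Sigma$. Then $$d\Rightarrow_{\mathcal{R}}e\quad\Longleftrightarrow\quad\Phi(\ulcorner d\urcorner)\Rrightarrow_{\Phi(\ulcorner\mathcal{R}\urcorner)}\Phi(\ulcorner e\urcorner),$$ where $\Rrightarrow$ denotes a convex DPO rewriting step.
   Context: Composition is written in diagrammatic order: $f;g$ is first $f$, then $g$. PROPs. A PROP is a symmetric strict monoidal category whose objects are the natural numbers, with monoidal product $\oplus$ given on objects by addition; $\sigma_{n,m}\colon n+m\to m+n$ are the symmetries. Morphisms of PROPs are identity-on-objects strict symmetric monoidal functors. A signature $\Sigma$ is a set of generators $o\colon n\to m$ with arity $n$ and coarity $m$ in $\mathbb{N}$. $\mathbf{S}_\Sigma$ is the PROP freely generated by $\Sigma$ with no equations. $\mathbf{Frob}$ is the PROP freely generated by $\mu\colon 2\to 1$, $\eta\colon 0\to 1$, $\delta\colon 1\to 2$, $\varepsilon\colon 1\to 0$ subject to: $(\mu,\eta)$ is a commutative monoid, $(\delta,\varepsilon)$ is a cocommutative comonoid, $(\delta\oplus \mathrm{id}_1);(\mathrm{id}_1\oplus\mu)=\mu;\delta=(\mathrm{id}_1\oplus\delta);(\mu\oplus\mathrm{id}_1)$, and $\delta;\mu=\mathrm{id}_1$. $\mathbf{S}_\Sigma+\mathbf{Frob}$ is the coproduct in the category of PROPs; arrows of $\mathbf{S}_\Sigma$ are regarded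 as arrows of $\mathbf{S}_\Sigma+\mathbf{Frob}$ via the coproduct injection. Rewriting in a PROP $\mathbf{X}$. A rewriting rule of type $(i,j)$ is a pair $\langle l,r\rangle$ of arrows $l,r\colon i\to j$ of $\mathbf{X}$; a rewriting system $\mathcal{R}$ is a set of rules. For $d,e\colon n\to m$, $d\Rightarrow_{\mathcal{R}}e$ iff there are $\langle l,r\rangle\colon(i,j)$ in $\mathcal{R}$, $k\in\mathbb{N}$, and arrows $c_1\colon n\to k+i$, $c_2\colon k+j\to m$ of $\mathbf{X}$ with $d=c_1;(\mathrm{id}_k\oplus l);c_2$ and $e=c_1;(\mathrm{id}_k\oplus r);c_2$. Bending. In $\mathbf{S}_\Sigma+\mathbf{Frob}$, caps $\mathrm{cap}_n\colon 0\to n+n$ are defined by $\mathrm{cap}_0=\mathrm{id}_0$, $\mathrm{cap}_1=\eta;\delta$, $\mathrm{cap}_{n+1}=(\mathrm{cap}_1\oplus\mathrm{cap}_n);(\mathrm{id}_1\oplus\sigma_{1,n}\oplus\mathrm{id}_n)$. For $d\colon n\to m$, $\ulcorner d\urcorner=\mathrm{cap}_n;(\mathrm{id}_n\oplus d)\colon 0\to n+m$, and $\ulcorner\mathcal{R}\urcorner=\{\langle\ulcorner l\urcorner,\ulcorner r\urcorner\rangle\mid\langle l,r\rangle\in\mathcal{R}\}$. Hypergraphs. A (finite directed) hypergraph has a finite set of nodes and a finite set of hyperedges, each hyperedge having an ordered list of $k$ source nodes and an ordered list of $l$ target nodes for some $k,l\in\mathbb{N}$. A $\Sigma$-hypergraph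 is a hypergraph in which each hyperedge with $k$ sources and $l$ targets is labelled by a generator $k\to l$ of $\Sigma$; $\mathbf{Hyp}_\Sigma$ is the category of $\Sigma$-hypergraphs and homomorphisms (preserving ordered sources, targets and labels); pushouts are computed pointwise. $n\in\mathbb{N}$ is identified with the discrete hypergraph (no hyperedges) with node set $\{0,\dots,n-1\}$. $\mathbf{FTerm}_\Sigma$ is the PROP whose arrows $n\to m$ are isomorphism classes of cospans $n\to G\leftarrow m$ in $\mathbf{Hyp}_\Sigma$, with composition by pushout and $\oplus$ disjoint union. The isomorphism $\Phi$. $\Phi\colon\mathbf{S}_\Sigma+\mathbf{Frob}\to\mathbf{FTerm}_\Sigma$ is the PROP isomorphism which sends a generator $o\colon n\to m$ of $\Sigma$ to the cospan $n\to G_o\leftarrow m$, where $G_o$ has $n+m$ distinct nodes and a single hyperedge labelled $o$ whose ordered sources are the first $n$ nodes (the image of the left leg, in order) and whose ordered targets are the last $m$ nodes (the image of the right leg, in order), and which sends $\mu,\eta,\delta,\varepsilon$ to the discrete cospans $2\to1\leftarrow1$, $0\to1\leftarrow1$, $1\to1\leftarrow2$, $1\to1\leftarrow0$ respectively. $\Phi(\ulcorner\mathcal{R}\urcorner)$ is regarded as a set of DPO rules: for $\langle l,r\rangle\colon(i,j)$ in $\mathcal{R}$, writing $\Phi(\ulcorner l\urcorner)=(0\to L\xleftarrow{[a_1,a_2]}i+j)$ and $\Phi(\ulcorner r\urcorner)=(0\to R\xleftarrow{[b_1,b_2]}i+j)$, the rule is the span $L\xleftarrow{[a_1,a_2]}i+j\xrightarrow{[b_1,b_2]}R$.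 Monogamicity. The indegree of a node $v$ is the number of pairs $(h,i)$ with $h$ a hyperedge having $v$ as its $i$-th target; the outdegree is the number of pairs $(h,j)$ with $h$ having $v$ as its $j$-th source. A cospan $m\xrightarrow{f}G\xleftarrow{g}n$ (with $m,n$ discrete) is monogamous if $f,g$ are mono and every node $v$ has indegree $0$ if $v\in\mathrm{im}(f)$ and $1$ otherwise, and outdegree $0$ if $v\in\mathrm{im}(g)$ and $1$ otherwise. Convexity. A directed path from a node $v$ to a node $v'$ is a non-empty sequence of hyperedges $[h_1,\dots,h_n]$ such that $v$ is a source of $h_1$, $v'$ is a target of $h_n$, and for each $i<n$ some target of $h_i$ is a source of $h_{i+1}$. A sub-hypergraph $H\subseteq G$ is convex if for all nodes $v,v'$ of $H$ and every directed path $p$ in $G$ from $v$ to $v'$, every hyperedge of $p$ is in $H$. A convex matching is a mono $f\colon L\to G$ in $\mathbf{Hyp}_\Sigma$ whose image is convex. Boundary complement. Given monogamous cospans $i\xrightarrow{a_1}L\xleftarrow{a_2}j$ and $n\xrightarrow{b_1}G\xleftarrow{b_2}m$ and a mono $f\colon L\to G$, a pushout complement $i+j\xrightarrow{c=[c_1,c_2]}L^\perp\xrightarrow{g}G$ of $i+j\xrightarrow{[a_1,a_2]}L\xrightarrow{f}G$ (i.e. the square $[a_1,a_2];f=c;g$ is a pushout) is a boundary complement if $c$ is mono and there are $d_1\colon n\to L^\perp$, $d_2\colon m\to L^\perp$ with $[d_1,d_2];g=[b_1,b_2]$ such that $j+n\xrightarrow{[c_2,d_1]}L^\perp\xleftarrow{[c_1,d_2]}m+i$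 is a monogamous cospan. Convex DPO step. For a set $\mathcal{S}$ of DPO rules, $(0\to D\xleftarrow{[q_1,q_2]}n+m)\Rrightarrow_{\mathcal{S}}(0\to E\xleftarrow{[p_1,p_2]}n+m)$ holds when there are a rule $L\xleftarrow{[a_1,a_2]}i+j\xrightarrow{[b_1,b_2]}R$ in $\mathcal{S}$, an object $C$ with arrows $i+j\to C\leftarrow n+m$, and arrows $f\colon L\to D$, $C\to D$, $C\to E$, $R\to E$ in $\mathbf{Hyp}_\Sigma$ such that: the squares $(i+j\to L\xrightarrow{f}D)=(i+j\to C\to D)$ and $(i+j\to R\to E)=(i+j\to C\to E)$ are pushouts; $n+m\to C\to D$ equals $[q_1,q_2]$ and $n+m\to C\to E$ equals $[p_1,p_2]$; $f$ is a convex matching; and $i+j\to C\to D$ is a boundary complement with respect to the monogamous cospans $i\xrightarrow{a_1}L\xleftarrow{a_2}j$ and $n\xrightarrow{q_1}D\xleftarrow{q_2}m$, with the given arrow $n+m\to C$ playing the role of $[d_1,d_2]$. *)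

theory Defs
  imports Main "HOL-Library.Nat_Bijection"
begin

section \<open>PROPs\<close>

text \<open>Composition \<open>cmp X f g\<close> is written in diagrammatic order: first \<open>f\<close>, then \<open>g\<close>.
  Objects are natural numbers; the operations are only meaningful on \<open>arrs X\<close>.\<close>

record 'a prop_data =
  arrs :: "'a set"
  src :: "'a \<Rightarrow> nat"
  trg :: "'a \<Rightarrow> nat"
  idt :: "nat \<Rightarrow> 'a"
  cmp :: "'a \<Rightarrow> 'a \<Rightarrow> 'a"
  tens :: "'a \<Rightarrow> 'a \<Rightarrow> 'a"
  symm :: "nat \<Rightarrow> nat \<Rightarrow> 'a"

definition homset :: "('a, 'x) prop_data_scheme \<Rightarrow> nat \<Rightarrow> nat \<Rightarrow> 'a set" where
  "homset X n m = {f \<in> arrs X. src X f = n \<and> trg X f = m}"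

locale prop_cat =
  fixes X :: "'a prop_data"
  assumes idt_hom: "idt X n \<in> homset X n n"
    and cmp_hom: "f \<in> homset X n m \<Longrightarrow> g \<in> homset X m k \<Longrightarrow> cmp X f g \<in> homset X n k"
    and tens_hom: "f \<in> homset X n m \<Longrightarrow> g \<in> homset X n' m' \<Longrightarrow>
      tens X f g \<in> homset X (n + n') (m + m')"
    and symm_hom: "symm X n m \<in> homset X (n + m) (m + n)"
    and cmp_idt_left: "f \<in> homset X n m \<Longrightarrow> cmp X (idt X n) f = f"
    and cmp_idt_right: "f \<in> homset X n m \<Longrightarrow> cmp X f (idt X m) = f"
    and cmp_assoc: "f \<in> homset X n m \<Longrightarrow> g \<in> homset X m k \<Longrightarrow> h \<in> homset X k l \<Longrightarrow>
      cmp X (cmp X f g) h = cmp X f (cmp X g h)"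
    and tens_idt: "tens X (idt X n) (idt X m) = idt X (n + m)"
    and interchange: "f \<in> homset X n m \<Longrightarrow> g \<in> homset X m k \<Longrightarrow>
      f' \<in> homset X n' m' \<Longrightarrow> g' \<in> homset X m' k' \<Longrightarrow>
      tens X (cmp X f g) (cmp X f' g') = cmp X (tens X f f') (tens X g g')"
    and tens_unit_left: "f \<in> homset X n m \<Longrightarrow> tens X (idt X 0) f = f"
    and tens_unit_right: "f \<in> homset X n m \<Longrightarrow> tens X f (idt X 0) = f"
    and tens_assoc: "f \<in> homset X n m \<Longrightarrow> g \<in> homset X n' m' \<Longrightarrow> h \<in> homset X n'' m'' \<Longrightarrow>
      tens X (tens X f g) h = tens X f (tens X g h)"
    and symm_natural: "f \<in> homset X n m \<Longrightarrow> g \<in> homset X n' m' \<Longrightarrow>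
      cmp X (tens X f g) (symm X m m') = cmp X (symm X n n') (tens X g f)"
    and symm_inverse: "cmp X (symm X n m) (symm X m n) = idt X (n + m)"
    and symm_hexagon: "symm X n (m + k) =
      cmp X (tens X (symm X n m) (idt X k)) (tens X (idt X m) (symm X n k))"

definition prop_hom :: "'a prop_data \<Rightarrow> 'b prop_data \<Rightarrow> ('a \<Rightarrow> 'b) \<Rightarrow> bool" where
  "prop_hom X Y F \<longleftrightarrow>
    (\<forall>n m. \<forall>f \<in> homset X n m. F f \<in> homset Y n m) \<and>
    (\<forall>n. F (idt X n) = idt Y n) \<and>
    (\<forall>n m. F (symm X n m) = symm Y n m) \<and>
    (\<forall>f \<in> arrs X. \<forall>g \<in> arrs X. trg X f = src X g \<longrightarrow> F (cmp X f g) = cmp Y (F f) (F g)) \<and>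
    (\<forall>f \<in> arrs X. \<forall>g \<in> arrs X. F (tens X f g) = tens Y (F f) (F g))"


section \<open>PROPs presented by generators and equations\<close>

record 'g signature =
  gens :: "'g set"
  arity :: "'g \<Rightarrow> nat"
  coarity :: "'g \<Rightarrow> nat"

datatype 'g tm =
    TId nat
  | TSym nat nat
  | TGen 'g
  | TSeq "'g tm" "'g tm"
  | TPar "'g tm" "'g tm"

primrec tdom :: "'g signature \<Rightarrow> 'g tm \<Rightarrow> nat" where
  "tdom S (TId n) = n"
| "tdom S (TSym n m) = n + m"
| "tdom S (TGen g) = arity S g"
| "tdom S (TSeq s t) = tdom S s"
| "tdom S (TPar s t) = tdom S s + tdom S t"

primrec tcod :: "'g signature \<Rightarrow> 'g tm \<Rightarrow> nat" where
  "tcod S (TId n) = n"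
| "tcod S (TSym n m) = m + n"
| "tcod S (TGen g) = coarity S g"
| "tcod S (TSeq s t) = tcod S t"
| "tcod S (TPar s t) = tcod S s + tcod S t"

primrec wt :: "'g signature \<Rightarrow> 'g tm \<Rightarrow> bool" where
  "wt S (TId n) \<longleftrightarrow> True"
| "wt S (TSym n m) \<longleftrightarrow> True"
| "wt S (TGen g) \<longleftrightarrow> g \<in> gens S"
| "wt S (TSeq s t) \<longleftrightarrow> wt S s \<and> wt S t \<and> tcod S s = tdom S t"
| "wt S (TPar s t) \<longleftrightarrow> wt S s \<and> wt S t"

text \<open>The least congruence on well-typed terms containing the equations \<open>E\<close> and the laws of
  symmetric strict monoidal categories.\<close>

inductive tm_eq :: "'g signature \<Rightarrow> ('g tm \<times> 'g tm) set \<Rightarrow> 'g tm \<Rightarrow> 'g tm \<Rightarrow> bool"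
  for S :: "'g signature" and E :: "('g tm \<times> 'g tm) set" where
  refl: "wt S s \<Longrightarrow> tm_eq S E s s"
| sym: "tm_eq S E s t \<Longrightarrow> tm_eq S E t s"
| trans: "tm_eq S E s t \<Longrightarrow> tm_eq S E t u \<Longrightarrow> tm_eq S E s u"
| seq_cong: "tm_eq S E s s' \<Longrightarrow> tm_eq S E t t' \<Longrightarrow> tcod S s = tdom S t \<Longrightarrow>
    tm_eq S E (TSeq s t) (TSeq s' t')"
| par_cong: "tm_eq S E s s' \<Longrightarrow> tm_eq S E t t' \<Longrightarrow> tm_eq S E (TPar s t) (TPar s' t')"
| equation: "(s, t) \<in> E \<Longrightarrow> wt S s \<Longrightarrow> wt S t \<Longrightarrow> tdom S s = tdom S t \<Longrightarrow> tcod S s = tcod S t \<Longrightarrow>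
    tm_eq S E s t"
| seq_id_left: "wt S s \<Longrightarrow> tm_eq S E (TSeq (TId (tdom S s)) s) s"
| seq_id_right: "wt S s \<Longrightarrow> tm_eq S E (TSeq s (TId (tcod S s))) s"
| seq_assoc: "wt S (TSeq (TSeq s t) u) \<Longrightarrow> tm_eq S E (TSeq (TSeq s t) u) (TSeq s (TSeq t u))"
| par_id: "tm_eq S E (TPar (TId n) (TId m)) (TId (n + m))"
| interchange: "wt S (TSeq s t) \<Longrightarrow> wt S (TSeq s' t') \<Longrightarrow>
    tm_eq S E (TPar (TSeq s t) (TSeq s' t')) (TSeq (TPar s s') (TPar t t'))"
| par_unit_left: "wt S s \<Longrightarrow> tm_eq S E (TPar (TId 0) s) s"
| par_unit_right: "wt S s \<Longrightarrow> tm_eq S E (TPar s (TId 0)) s"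
| par_assoc: "wt S (TPar (TPar s t) u) \<Longrightarrow> tm_eq S E (TPar (TPar s t) u) (TPar s (TPar t u))"
| sym_natural: "wt S s \<Longrightarrow> wt S t \<Longrightarrow>
    tm_eq S E (TSeq (TPar s t) (TSym (tcod S s) (tcod S t)))
      (TSeq (TSym (tdom S s) (tdom S t)) (TPar t s))"
| sym_inverse: "tm_eq S E (TSeq (TSym n m) (TSym m n)) (TId (n + m))"
| sym_hexagon: "tm_eq S E (TSym n (m + k))
    (TSeq (TPar (TSym n m) (TId k)) (TPar (TId m) (TSym n k)))"

definition tm_class :: "'g signature \<Rightarrow> ('g tm \<times> 'g tm) set \<Rightarrow> 'g tm \<Rightarrow> 'g tm set" where
  "tm_class S E t = {s. tm_eq S E t s}"

definition rep :: "'a set \<Rightarrow> 'a" where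
  "rep A = (SOME t. t \<in> A)"

definition presented :: "'g signature \<Rightarrow> ('g tm \<times> 'g tm) set \<Rightarrow> 'g tm set prop_data" where
  "presented S E =
    \<lparr> arrs = tm_class S E ` {t. wt S t},
      src = (\<lambda>A. tdom S (rep A)),
      trg = (\<lambda>A. tcod S (rep A)),
      idt = (\<lambda>n. tm_class S E (TId n)),
      cmp = (\<lambda>A B. tm_class S E (TSeq (rep A) (rep B))),
      tens = (\<lambda>A B. tm_class S E (TPar (rep A) (rep B))),
      symm = (\<lambda>n m. tm_class S E (TSym n m)) \<rparr>"

primrec interp :: "'a prop_data \<Rightarrow> ('g \<Rightarrow> 'a) \<Rightarrow> 'g tm \<Rightarrow> 'a" where
  "interp X \<gamma> (TId n) = idt X n"
| "interp X \<gamma> (TSym n m) = symm X n m"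
| "interp X \<gamma> (TGen g) = \<gamma> g"
| "interp X \<gamma> (TSeq s t) = cmp X (interp X \<gamma> s) (interp X \<gamma> t)"
| "interp X \<gamma> (TPar s t) = tens X (interp X \<gamma> s) (interp X \<gamma> t)"

text \<open>The map out of a presented PROP determined by the images \<open>\<gamma>\<close> of the generators.\<close>

definition induced :: "'a prop_data \<Rightarrow> ('g \<Rightarrow> 'a) \<Rightarrow> 'g tm set \<Rightarrow> 'a" where
  "induced X \<gamma> A = interp X \<gamma> (rep A)"

lemma tm_eq_wt:
  assumes "tm_eq S E s t"
  shows "wt S s \<and> wt S t \<and> tdom S s = tdom S t \<and> tcod S s = tcod S t"
  using assms by (induction) auto

lemma tm_class_eq_iff:
  assumes "wt S s"
  shows "tm_class S E s = tm_class S E t \<longleftrightarrow> tm_eq S E s t"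
proof
  assume "tm_class S E s = tm_class S E t"
  with assms have "s \<in> tm_class S E t"
    by (metis mem_Collect_eq tm_class_def tm_eq.refl)
  then show "tm_eq S E s t" by (simp add: tm_class_def tm_eq.sym)
next
  assume "tm_eq S E s t"
  then show "tm_class S E s = tm_class S E t"
    unfolding tm_class_def by (auto intro: tm_eq.sym tm_eq.trans)
qed

lemma tm_class_eqI: "tm_eq S E s t \<Longrightarrow> tm_class S E s = tm_class S E t"
  using tm_class_eq_iff tm_eq_wt by blast

lemma tm_eq_rep:
  assumes "wt S t"
  shows "tm_eq S E t (rep (tm_class S E t))"
proof -
  have "t \<in> tm_class S E t" using assms by (simp add: tm_class_def tm_eq.refl)
  then have "rep (tm_class S E t) \<in> tm_class S E t" unfolding rep_def by (rule someI)
  then show ?thesis by (simp add: tm_class_def)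
qed

lemma presented_simps:
  "idt (presented S E) n = tm_class S E (TId n)"
  "symm (presented S E) n m = tm_class S E (TSym n m)"
  "wt S s \<Longrightarrow> src (presented S E) (tm_class S E s) = tdom S s"
  "wt S s \<Longrightarrow> trg (presented S E) (tm_class S E s) = tcod S s"
  "wt S s \<Longrightarrow> tm_class S E s \<in> arrs (presented S E)"
  "wt S s \<Longrightarrow> wt S t \<Longrightarrow> tcod S s = tdom S t \<Longrightarrow>
    cmp (presented S E) (tm_class S E s) (tm_class S E t) = tm_class S E (TSeq s t)"
  "wt S s \<Longrightarrow> wt S t \<Longrightarrow>
    tens (presented S E) (tm_class S E s) (tm_class S E t) = tm_class S E (TPar s t)"
proof -
  show "src (presented S E) (tm_class S E s) = tdom S s" if "wt S s"
    using tm_eq_wt[OF tm_eq_rep[OF that]] by (simp add: presented_def)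
  show "trg (presented S E) (tm_class S E s) = tcod S s" if "wt S s"
    using tm_eq_wt[OF tm_eq_rep[OF that]] by (simp add: presented_def)
  show "cmp (presented S E) (tm_class S E s) (tm_class S E t) = tm_class S E (TSeq s t)"
    if "wt S s" "wt S t" "tcod S s = tdom S t"
  proof -
    have "tm_class S E (TSeq s t) = tm_class S E (TSeq (rep (tm_class S E s)) (rep (tm_class S E t)))"
      using that by (intro tm_class_eqI tm_eq.seq_cong tm_eq_rep) auto
    then show ?thesis by (simp add: presented_def)
  qed
  show "tens (presented S E) (tm_class S E s) (tm_class S E t) = tm_class S E (TPar s t)"
    if "wt S s" "wt S t"
  proof -
    have "tm_class S E (TPar s t) = tm_class S E (TPar (rep (tm_class S E s)) (rep (tm_class S E t)))"
      using that by (intro tm_class_eqI tm_eq.par_cong tm_eq_rep) auto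
    then show ?thesis by (simp add: presented_def)
  qed
qed (auto simp: presented_def)

lemma homset_presented:
  "f \<in> homset (presented S E) n m \<longleftrightarrow>
    (\<exists>t. f = tm_class S E t \<and> wt S t \<and> tdom S t = n \<and> tcod S t = m)"
proof -
  have "f \<in> arrs (presented S E) \<longleftrightarrow> (\<exists>t. f = tm_class S E t \<and> wt S t)"
    by (auto simp: presented_def)
  then show ?thesis
    by (auto simp: homset_def presented_simps(3,4))
qed

lemma prop_cat_presented: "prop_cat (presented S E)"
proof
  note S = presented_simps homset_presented
  show "cmp (presented S E) f g \<in> homset (presented S E) n k"
    if "f \<in> homset (presented S E) n m" "g \<in> homset (presented S E) m k" for f g n m k
  proof -
    from that obtain s t where "f = tm_class S E s" "g = tm_class S E t" "wt S (TSeq s t)"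
      "tdom S s = n" "tcod S t = k" by (auto simp: homset_presented)
    then show ?thesis unfolding homset_presented
      by (intro exI[of _ "TSeq s t"]) (auto simp: S)
  qed
  show "tens (presented S E) f g \<in> homset (presented S E) (n + n') (m + m')"
    if "f \<in> homset (presented S E) n m" "g \<in> homset (presented S E) n' m'" for f g n m n' m'
  proof -
    from that obtain s t where "f = tm_class S E s" "g = tm_class S E t" "wt S s" "wt S t"
      "tdom S s = n" "tcod S s = m" "tdom S t = n'" "tcod S t = m'" by (auto simp: homset_presented)
    then show ?thesis unfolding homset_presented
      by (intro exI[of _ "TPar s t"]) (auto simp: S)
  qed
  show "idt (presented S E) n \<in> homset (presented S E) n n" for n
    unfolding homset_presented by (rule exI[of _ "TId n"]) (simp add: S)
  show "symm (presented S E) n m \<in> homset (presented S E) (n + m) (m + n)" for n m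
    unfolding homset_presented by (rule exI[of _ "TSym n m"]) (simp add: S)
  show "cmp (presented S E) (idt (presented S E) n) f = f"
    if "f \<in> homset (presented S E) n m" for f n m
    using that by (clarsimp simp: S) (rule tm_class_eqI, rule tm_eq.seq_id_left, simp)
  show "cmp (presented S E) f (idt (presented S E) m) = f"
    if "f \<in> homset (presented S E) n m" for f n m
    using that by (clarsimp simp: S) (rule tm_class_eqI, rule tm_eq.seq_id_right, simp)
  show "cmp (presented S E) (cmp (presented S E) f g) h = cmp (presented S E) f (cmp (presented S E) g h)"
    if "f \<in> homset (presented S E) n m" "g \<in> homset (presented S E) m k"
      "h \<in> homset (presented S E) k l" for f g h n m k l
    using that by (clarsimp simp: S) (rule tm_class_eqI, rule tm_eq.seq_assoc, simp_all)
  show "tens (presented S E) (idt (presented S E) n) (idt (presented S E) m) =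
      idt (presented S E) (n + m)" for n m
    by (simp add: S) (rule tm_class_eqI, rule tm_eq.par_id)
  show "tens (presented S E) (cmp (presented S E) f g) (cmp (presented S E) f' g') =
      cmp (presented S E) (tens (presented S E) f f') (tens (presented S E) g g')"
    if "f \<in> homset (presented S E) n m" "g \<in> homset (presented S E) m k"
      "f' \<in> homset (presented S E) n' m'" "g' \<in> homset (presented S E) m' k'"
    for f g f' g' n m k n' m' k'
    using that by (clarsimp simp: S) (rule tm_class_eqI, rule tm_eq.interchange, simp_all)
  show "tens (presented S E) (idt (presented S E) 0) f = f"
    if "f \<in> homset (presented S E) n m" for f n m
    using that by (clarsimp simp: S) (rule tm_class_eqI, rule tm_eq.par_unit_left, simp_all)
  show "tens (presented S E) f (idt (presented S E) 0) = f"
    if "f \<in> homset (presented S E) n m" for f n m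
    using that by (clarsimp simp: S) (rule tm_class_eqI, rule tm_eq.par_unit_right, simp_all)
  show "tens (presented S E) (tens (presented S E) f g) h = tens (presented S E) f (tens (presented S E) g h)"
    if "f \<in> homset (presented S E) n m" "g \<in> homset (presented S E) n' m'"
      "h \<in> homset (presented S E) n'' m''" for f g h n m n' m' n'' m''
    using that by (clarsimp simp: S) (rule tm_class_eqI, rule tm_eq.par_assoc, simp_all)
  show "cmp (presented S E) (tens (presented S E) f g) (symm (presented S E) m m') =
      cmp (presented S E) (symm (presented S E) n n') (tens (presented S E) g f)"
    if "f \<in> homset (presented S E) n m" "g \<in> homset (presented S E) n' m'" for f g n m n' m'
    using that by (clarsimp simp: S) (rule tm_class_eqI, rule tm_eq.sym_natural, simp_all)
  show "cmp (presented S E) (symm (presented S E) n m) (symm (presented S E) m n) =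
      idt (presented S E) (n + m)" for n m
    by (simp add: S) (rule tm_class_eqI, rule tm_eq.sym_inverse)
  show "symm (presented S E) n (m + k) =
      cmp (presented S E) (tens (presented S E) (symm (presented S E) n m) (idt (presented S E) k))
        (tens (presented S E) (idt (presented S E) m) (symm (presented S E) n k))" for n m k
    by (simp add: S) (rule tm_class_eqI, rule tm_eq.sym_hexagon)
qed

lemma interp_hom:
  assumes X: "prop_cat X" and \<gamma>: "\<And>g. g \<in> gens S \<Longrightarrow> \<gamma> g \<in> homset X (arity S g) (coarity S g)"
  shows "wt S t \<Longrightarrow> interp X \<gamma> t \<in> homset X (tdom S t) (tcod S t)"
proof -
  interpret prop_cat X by fact
  show "wt S t \<Longrightarrow> interp X \<gamma> t \<in> homset X (tdom S t) (tcod S t)"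
    by (induction t) (auto intro: idt_hom symm_hom cmp_hom tens_hom \<gamma>)
qed

lemma interp_sound:
  assumes X: "prop_cat X" and \<gamma>: "\<And>g. g \<in> gens S \<Longrightarrow> \<gamma> g \<in> homset X (arity S g) (coarity S g)"
    and E: "\<And>s t. (s, t) \<in> E \<Longrightarrow> wt S s \<Longrightarrow> wt S t \<Longrightarrow> interp X \<gamma> s = interp X \<gamma> t"
    and "tm_eq S E s t"
  shows "interp X \<gamma> s = interp X \<gamma> t"
proof -
  interpret prop_cat X by fact
  have H: "wt S t \<Longrightarrow> interp X \<gamma> t \<in> homset X (tdom S t) (tcod S t)" for t
    by (rule interp_hom[OF X \<gamma>])
  show ?thesis using assms(4)
  proof (induction)
    case (equation s t)
    then show ?case by (intro E)
  next
    case (seq_id_left s)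
    show ?case using cmp_idt_left[OF H[OF seq_id_left]] by simp
  next
    case (seq_id_right s)
    show ?case using cmp_idt_right[OF H[OF seq_id_right]] by simp
  next
    case (seq_assoc s t u)
    then have "wt S s" "wt S t" "wt S u" "tcod S s = tdom S t" "tcod S t = tdom S u" by auto
    then show ?case using cmp_assoc[OF H[of s] _ H[of u]] H[of t] by simp
  next
    case (interchange s t s' t')
    then have "wt S s" "wt S t" "wt S s'" "wt S t'" "tcod S s = tdom S t" "tcod S s' = tdom S t'"
      by auto
    then show ?case
      using prop_cat.interchange[OF X H[of s] _ H[of s'], of "interp X \<gamma> t" _ "interp X \<gamma> t'"]
        H[of t] H[of t'] by simp
  next
    case (par_unit_left s)
    show ?case using tens_unit_left[OF H[OF par_unit_left]] by simp
  next
    case (par_unit_right s)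
    show ?case using tens_unit_right[OF H[OF par_unit_right]] by simp
  next
    case (par_assoc s t u)
    then show ?case using tens_assoc[OF H[of s] H[of t] H[of u]] by simp
  next
    case (sym_natural s t)
    then show ?case using symm_natural[OF H[of s] H[of t]] by simp
  next
    case (sym_hexagon n m k)
    show ?case using symm_hexagon[of n m k] by simp
  qed (simp_all add: tens_idt symm_inverse)
qed

lemma induced_class:
  assumes "prop_cat X" "\<And>g. g \<in> gens S \<Longrightarrow> \<gamma> g \<in> homset X (arity S g) (coarity S g)"
    and "\<And>s t. (s, t) \<in> E \<Longrightarrow> wt S s \<Longrightarrow> wt S t \<Longrightarrow> interp X \<gamma> s = interp X \<gamma> t"
    and "wt S t"
  shows "induced X \<gamma> (tm_class S E t) = interp X \<gamma> t"
  unfolding induced_def using interp_sound[OF assms(1-3) tm_eq_rep[OF assms(4)]] by simp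

lemma induced_prop_hom:
  assumes X: "prop_cat X" "\<And>g. g \<in> gens S \<Longrightarrow> \<gamma> g \<in> homset X (arity S g) (coarity S g)"
    "\<And>s t. (s, t) \<in> E \<Longrightarrow> wt S s \<Longrightarrow> wt S t \<Longrightarrow> interp X \<gamma> s = interp X \<gamma> t"
  shows "prop_hom (presented S E) X (induced X \<gamma>)"
proof -
  note C = induced_class[of X S \<gamma> E, OF X]
  have A: "f \<in> arrs (presented S E) \<Longrightarrow> \<exists>t. f = tm_class S E t \<and> wt S t" for f
    by (auto simp: presented_def)
  show ?thesis
    unfolding prop_hom_def
  proof (intro conjI allI ballI impI)
    fix n m f assume "f \<in> homset (presented S E) n m"
    then show "induced X \<gamma> f \<in> homset X n m"
      by (auto simp: homset_presented C intro: interp_hom[OF X(1,2)])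
  next
    fix f g assume "f \<in> arrs (presented S E)" "g \<in> arrs (presented S E)"
      "trg (presented S E) f = src (presented S E) g"
    then show "induced X \<gamma> (cmp (presented S E) f g) = cmp X (induced X \<gamma> f) (induced X \<gamma> g)"
      by (auto dest!: A simp: presented_simps C)
  next
    fix f g assume "f \<in> arrs (presented S E)" "g \<in> arrs (presented S E)"
    then show "induced X \<gamma> (tens (presented S E) f g) = tens X (induced X \<gamma> f) (induced X \<gamma> g)"
      by (auto dest!: A simp: presented_simps C)
  qed (simp_all add: presented_simps C)
qed

lemma prop_hom_cmp:
  "prop_hom X Y F \<Longrightarrow> f \<in> arrs X \<Longrightarrow> g \<in> arrs X \<Longrightarrow> trg X f = src X g \<Longrightarrow>
    F (cmp X f g) = cmp Y (F f) (F g)"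
  unfolding prop_hom_def by blast

lemma prop_hom_tens:
  "prop_hom X Y F \<Longrightarrow> f \<in> arrs X \<Longrightarrow> g \<in> arrs X \<Longrightarrow> F (tens X f g) = tens Y (F f) (F g)"
  unfolding prop_hom_def by blast

lemma prop_hom_class:
  assumes F: "prop_hom (presented S E) X F"
  shows "wt S t \<Longrightarrow> F (tm_class S E t) = interp X (\<lambda>g. F (tm_class S E (TGen g))) t"
proof (induction t)
  case (TSeq s t)
  then have "F (tm_class S E (TSeq s t)) = F (cmp (presented S E) (tm_class S E s) (tm_class S E t))"
    by (simp add: presented_simps)
  also have "\<dots> = cmp X (F (tm_class S E s)) (F (tm_class S E t))"
    using TSeq by (intro prop_hom_cmp[OF F]) (auto simp: presented_simps)
  finally show ?case using TSeq by simp
next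
  case (TPar s t)
  then have "F (tm_class S E (TPar s t)) = F (tens (presented S E) (tm_class S E s) (tm_class S E t))"
    by (simp add: presented_simps)
  also have "\<dots> = tens X (F (tm_class S E s)) (F (tm_class S E t))"
    using TPar by (intro prop_hom_tens[OF F]) (auto simp: presented_simps)
  finally show ?case using TPar by simp
next
  case (TId n)
  then show ?case using F unfolding prop_hom_def presented_simps by simp
next
  case (TSym n m)
  then show ?case using F unfolding prop_hom_def presented_simps by simp
qed simp

lemma interp_cong:
  "wt S t \<Longrightarrow> (\<And>g. g \<in> gens S \<Longrightarrow> \<gamma> g = \<gamma>' g) \<Longrightarrow> interp X \<gamma> t = interp X \<gamma>' t"
  by (induction t) auto

text \<open>A PROP morphism out of a presented PROP is the induced one; in particular the map \<open>Phi\<close>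
  below is the only candidate for a PROP morphism with the prescribed values on generators.\<close>

lemma induced_unique:
  assumes F: "prop_hom (presented S E) X F"
    and gens: "\<And>g. g \<in> gens S \<Longrightarrow> F (tm_class S E (TGen g)) = \<gamma> g"
    and f: "f \<in> arrs (presented S E)"
  shows "F f = induced X \<gamma> f"
proof -
  from f obtain t where t: "f = tm_class S E t" "wt S t" by (auto simp: presented_def)
  let ?r = "rep f"
  have "tm_eq S E t ?r" using t tm_eq_rep by blast
  then have r: "wt S ?r" "f = tm_class S E ?r"
    using tm_eq_wt t tm_class_eq_iff[of S t E ?r] by auto
  then have "F f = interp X (\<lambda>g. F (tm_class S E (TGen g))) ?r"
    using prop_hom_class[OF F r(1)] by simp
  also have "\<dots> = interp X \<gamma> ?r" using r(1) gens by (rule interp_cong)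
  finally show ?thesis by (simp add: induced_def)
qed


section \<open>Free PROPs, coproducts and Frobenius structure\<close>

definition free_prop :: "'g signature \<Rightarrow> 'g tm set prop_data" where
  "free_prop S = presented S {}"

definition sig_sum :: "'g signature \<Rightarrow> 'h signature \<Rightarrow> ('g + 'h) signature" where
  "sig_sum S T = \<lparr> gens = gens S <+> gens T, arity = case_sum (arity S) (arity T),
     coarity = case_sum (coarity S) (coarity T) \<rparr>"

definition eqs_sum ::
  "('g tm \<times> 'g tm) set \<Rightarrow> ('h tm \<times> 'h tm) set \<Rightarrow> (('g + 'h) tm \<times> ('g + 'h) tm) set" where
  "eqs_sum E F = map_prod (map_tm Inl) (map_tm Inl) ` E \<union> map_prod (map_tm Inr) (map_tm Inr) ` F"

text \<open>The coproduct of two presented PROPs, with its injections; the universal property is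
  lemma \<open>coprod_universal\<close>.\<close>

definition coprod_presented :: "'g signature \<Rightarrow> ('g tm \<times> 'g tm) set \<Rightarrow>
    'h signature \<Rightarrow> ('h tm \<times> 'h tm) set \<Rightarrow> ('g + 'h) tm set prop_data" where
  "coprod_presented S E T F = presented (sig_sum S T) (eqs_sum E F)"

definition coprod_inl :: "'g signature \<Rightarrow> ('g tm \<times> 'g tm) set \<Rightarrow>
    'h signature \<Rightarrow> ('h tm \<times> 'h tm) set \<Rightarrow> 'g tm set \<Rightarrow> ('g + 'h) tm set" where
  "coprod_inl S E T F = induced (coprod_presented S E T F)
     (\<lambda>g. tm_class (sig_sum S T) (eqs_sum E F) (TGen (Inl g)))"

definition coprod_inr :: "'g signature \<Rightarrow> ('g tm \<times> 'g tm) set \<Rightarrow>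
    'h signature \<Rightarrow> ('h tm \<times> 'h tm) set \<Rightarrow> 'h tm set \<Rightarrow> ('g + 'h) tm set" where
  "coprod_inr S E T F = induced (coprod_presented S E T F)
     (\<lambda>g. tm_class (sig_sum S T) (eqs_sum E F) (TGen (Inr g)))"

datatype frob_gen = Mu | Eta | Delta | Eps

definition frob_sig :: "frob_gen signature" where
  "frob_sig = \<lparr> gens = UNIV,
     arity = (\<lambda>g. case g of Mu \<Rightarrow> 2 | Eta \<Rightarrow> 0 | Delta \<Rightarrow> 1 | Eps \<Rightarrow> 1),
     coarity = (\<lambda>g. case g of Mu \<Rightarrow> 1 | Eta \<Rightarrow> 1 | Delta \<Rightarrow> 2 | Eps \<Rightarrow> 0) \<rparr>"

definition frob_eqs :: "(frob_gen tm \<times> frob_gen tm) set" where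
  "frob_eqs = (let \<mu> = TGen Mu; \<eta> = TGen Eta; \<delta> = TGen Delta; \<epsilon> = TGen Eps; i = TId 1 in
    { (TSeq (TPar \<mu> i) \<mu>, TSeq (TPar i \<mu>) \<mu>),
      (TSeq (TPar \<eta> i) \<mu>, i),
      (TSeq (TPar i \<eta>) \<mu>, i),
      (TSeq (TSym 1 1) \<mu>, \<mu>),
      (TSeq \<delta> (TPar \<delta> i), TSeq \<delta> (TPar i \<delta>)),
      (TSeq \<delta> (TPar \<epsilon> i), i),
      (TSeq \<delta> (TPar i \<epsilon>), i),
      (TSeq \<delta> (TSym 1 1), \<delta>),
      (TSeq (TPar \<delta> i) (TPar i \<mu>), TSeq \<mu> \<delta>),
      (TSeq \<mu> \<delta>, TSeq (TPar i \<delta>) (TPar \<mu> i)),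
      (TSeq \<delta> \<mu>, i) })"

definition frob :: "frob_gen tm set prop_data" where
  "frob = presented frob_sig frob_eqs"

definition free_plus_frob :: "'g signature \<Rightarrow> ('g + frob_gen) tm set prop_data" where
  "free_plus_frob S = coprod_presented S {} frob_sig frob_eqs"

definition free_inj :: "'g signature \<Rightarrow> 'g tm set \<Rightarrow> ('g + frob_gen) tm set" where
  "free_inj S = coprod_inl S {} frob_sig frob_eqs"

lemma frob_eqs_wt:
  "(s, t) \<in> frob_eqs \<Longrightarrow> wt frob_sig s \<and> wt frob_sig t \<and>
    tdom frob_sig s = tdom frob_sig t \<and> tcod frob_sig s = tcod frob_sig t"
  by (auto simp: frob_eqs_def frob_sig_def Let_def)

lemma map_tm_typing:
  "tdom (sig_sum S T) (map_tm Inl t) = tdom S t"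
  "tcod (sig_sum S T) (map_tm Inl t) = tcod S t"
  "wt (sig_sum S T) (map_tm Inl t) = wt S t"
  "tdom (sig_sum S T) (map_tm Inr u) = tdom T u"
  "tcod (sig_sum S T) (map_tm Inr u) = tcod T u"
  "wt (sig_sum S T) (map_tm Inr u) = wt T u"
proof -
  show 1: "tdom (sig_sum S T) (map_tm Inl t) = tdom S t" for t
    by (induction t) (auto simp: sig_sum_def)
  show 2: "tcod (sig_sum S T) (map_tm Inl t) = tcod S t" for t
    by (induction t) (auto simp: sig_sum_def)
  show "wt (sig_sum S T) (map_tm Inl t) = wt S t"
  proof (induction t)
    case (TGen x) then show ?case by (auto simp: sig_sum_def)
  qed (auto simp: 1 2)
  show 3: "tdom (sig_sum S T) (map_tm Inr u) = tdom T u" for u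
    by (induction u) (auto simp: sig_sum_def)
  show 4: "tcod (sig_sum S T) (map_tm Inr u) = tcod T u" for u
    by (induction u) (auto simp: sig_sum_def)
  show "wt (sig_sum S T) (map_tm Inr u) = wt T u"
  proof (induction u)
    case (TGen x) then show ?case by (auto simp: sig_sum_def)
  qed (auto simp: 3 4)
qed

lemma interp_map_tm: "interp X \<gamma> (map_tm f t) = interp X (\<lambda>g. \<gamma> (f g)) t"
  by (induction t) auto

lemma interp_presented:
  assumes "\<And>g. g \<in> gens S \<Longrightarrow> wt T (TGen (\<iota> g)) \<and> arity T (\<iota> g) = arity S g \<and> coarity T (\<iota> g) = coarity S g"
    and "wt S t"
  shows "wt T (map_tm \<iota> t) \<and> tdom T (map_tm \<iota> t) = tdom S t \<and> tcod T (map_tm \<iota> t) = tcod S t \<and>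
    interp (presented T E) (\<lambda>g. tm_class T E (TGen (\<iota> g))) t = tm_class T E (map_tm \<iota> t)"
  using assms(2) by (induction t) (auto simp: presented_simps assms(1)[simplified])

lemma coprod_universal:
  fixes S :: "'g signature" and T :: "'h signature" and Z :: "'z prop_data"
  assumes Et: "\<And>s t. (s, t) \<in> E \<Longrightarrow> wt S s \<and> wt S t \<and> tdom S s = tdom S t \<and> tcod S s = tcod S t"
    and Ft: "\<And>s t. (s, t) \<in> F \<Longrightarrow> wt T s \<and> wt T t \<and> tdom T s = tdom T t \<and> tcod T s = tcod T t"
  shows "prop_cat (coprod_presented S E T F)"
    and "prop_hom (presented S E) (coprod_presented S E T F) (coprod_inl S E T F)"
    and "prop_hom (presented T F) (coprod_presented S E T F) (coprod_inr S E T F)"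
    and "\<lbrakk> prop_cat Z; prop_hom (presented S E) Z P; prop_hom (presented T F) Z Q \<rbrakk> \<Longrightarrow>
      \<exists>H. prop_hom (coprod_presented S E T F) Z H \<and>
        (\<forall>a \<in> arrs (presented S E). H (coprod_inl S E T F a) = P a) \<and>
        (\<forall>a \<in> arrs (presented T F). H (coprod_inr S E T F a) = Q a) \<and>
        (\<forall>H'. prop_hom (coprod_presented S E T F) Z H' \<longrightarrow>
          (\<forall>a \<in> arrs (presented S E). H' (coprod_inl S E T F a) = P a) \<longrightarrow>
          (\<forall>a \<in> arrs (presented T F). H' (coprod_inr S E T F a) = Q a) \<longrightarrow>
          (\<forall>a \<in> arrs (coprod_presented S E T F). H' a = H a))"
proof -
  define U where "U = sig_sum S T"
  define D where "D = eqs_sum E F"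
  have CP: "coprod_presented S E T F = presented U D"
    by (simp add: coprod_presented_def U_def D_def)
  show C: "prop_cat (coprod_presented S E T F)"
    unfolding CP by (rule prop_cat_presented)
  have gl: "g \<in> gens S \<Longrightarrow> wt U (TGen (Inl g)) \<and> arity U (Inl g) = arity S g \<and>
      coarity U (Inl g) = coarity S g" for g
    by (auto simp: U_def sig_sum_def)
  have gr: "g \<in> gens T \<Longrightarrow> wt U (TGen (Inr g)) \<and> arity U (Inr g) = arity T g \<and>
      coarity U (Inr g) = coarity T g" for g
    by (auto simp: U_def sig_sum_def)
  have hl: "g \<in> gens S \<Longrightarrow> tm_class U D (TGen (Inl g)) \<in> homset (presented U D) (arity S g) (coarity S g)" for g
    unfolding homset_presented using gl[of g] by (intro exI[of _ "TGen (Inl g)"]) auto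
  have hr: "g \<in> gens T \<Longrightarrow> tm_class U D (TGen (Inr g)) \<in> homset (presented U D) (arity T g) (coarity T g)" for g
    unfolding homset_presented using gr[of g] by (intro exI[of _ "TGen (Inr g)"]) auto
  have el: "interp (presented U D) (\<lambda>g. tm_class U D (TGen (Inl g))) s =
      interp (presented U D) (\<lambda>g. tm_class U D (TGen (Inl g))) t" if "(s, t) \<in> E" for s t
  proof -
    have D': "(map_tm Inl s, map_tm Inl t) \<in> D" using that by (force simp: D_def eqs_sum_def)
    have "tm_eq U D (map_tm Inl s) (map_tm Inl t)"
      using Et[OF that] by (intro tm_eq.equation[OF D']) (auto simp: U_def map_tm_typing)
    then show ?thesis
      using interp_presented[of S U Inl s D] interp_presented[of S U Inl t D] gl Et[OF that]
      by (simp add: tm_class_eq_iff)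
  qed
  have er: "interp (presented U D) (\<lambda>g. tm_class U D (TGen (Inr g))) s =
      interp (presented U D) (\<lambda>g. tm_class U D (TGen (Inr g))) t" if "(s, t) \<in> F" for s t
  proof -
    have D': "(map_tm Inr s, map_tm Inr t) \<in> D" using that by (force simp: D_def eqs_sum_def)
    have "tm_eq U D (map_tm Inr s) (map_tm Inr t)"
      using Ft[OF that] by (intro tm_eq.equation[OF D']) (auto simp: U_def map_tm_typing)
    then show ?thesis
      using interp_presented[of T U Inr s D] interp_presented[of T U Inr t D] gr Ft[OF that]
      by (simp add: tm_class_eq_iff)
  qed
  have inl_def: "coprod_inl S E T F = induced (presented U D) (\<lambda>g. tm_class U D (TGen (Inl g)))"
    by (simp add: coprod_inl_def coprod_presented_def U_def D_def)
  have inr_def: "coprod_inr S E T F = induced (presented U D) (\<lambda>g. tm_class U D (TGen (Inr g)))"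
    by (simp add: coprod_inr_def coprod_presented_def U_def D_def)
  show "prop_hom (presented S E) (coprod_presented S E T F) (coprod_inl S E T F)"
    unfolding inl_def CP by (rule induced_prop_hom[OF prop_cat_presented hl el])
  show "prop_hom (presented T F) (coprod_presented S E T F) (coprod_inr S E T F)"
    unfolding inr_def CP by (rule induced_prop_hom[OF prop_cat_presented hr er])
  have inl_class: "coprod_inl S E T F (tm_class S E t) = tm_class U D (map_tm Inl t)" if "wt S t" for t
    unfolding inl_def
    using induced_class[OF prop_cat_presented hl el that] interp_presented[OF gl that, of D] by simp
  have inr_class: "coprod_inr S E T F (tm_class T F t) = tm_class U D (map_tm Inr t)" if "wt T t" for t
    unfolding inr_def
    using induced_class[OF prop_cat_presented hr er that] interp_presented[OF gr that, of D] by simp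
  assume Z: "prop_cat Z" and P: "prop_hom (presented S E) Z P" and Q: "prop_hom (presented T F) Z Q"
  define \<gamma> where "\<gamma> = case_sum (\<lambda>g. P (tm_class S E (TGen g))) (\<lambda>g. Q (tm_class T F (TGen g)))"
  have P': "P (tm_class S E t) = interp Z \<gamma> (map_tm Inl t)" if "wt S t" for t
    using prop_hom_class[OF P that] by (simp add: interp_map_tm \<gamma>_def)
  have Q': "Q (tm_class T F t) = interp Z \<gamma> (map_tm Inr t)" if "wt T t" for t
    using prop_hom_class[OF Q that] by (simp add: interp_map_tm \<gamma>_def)
  have h: "\<gamma> g \<in> homset Z (arity U g) (coarity U g)" if "g \<in> gens U" for g
  proof (cases g)
    case (Inl x)
    then have "x \<in> gens S" using that by (auto simp: U_def sig_sum_def)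
    then have "tm_class S E (TGen x) \<in> homset (presented S E) (arity S x) (coarity S x)"
      unfolding homset_presented by (intro exI[of _ "TGen x"]) auto
    then show ?thesis using P Inl by (auto simp: \<gamma>_def prop_hom_def U_def sig_sum_def)
  next
    case (Inr x)
    then have "x \<in> gens T" using that by (auto simp: U_def sig_sum_def)
    then have "tm_class T F (TGen x) \<in> homset (presented T F) (arity T x) (coarity T x)"
      unfolding homset_presented by (intro exI[of _ "TGen x"]) auto
    then show ?thesis using Q Inr by (auto simp: \<gamma>_def prop_hom_def U_def sig_sum_def)
  qed
  have e: "interp Z \<gamma> s = interp Z \<gamma> t" if "(s, t) \<in> D" for s t
  proof -
    from that consider s' t' where "(s', t') \<in> E" "s = map_tm Inl s'" "t = map_tm Inl t'"
      | s' t' where "(s', t') \<in> F" "s = map_tm Inr s'" "t = map_tm Inr t'"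
      by (auto simp: D_def eqs_sum_def)
    then show ?thesis
    proof cases
      case 1
      then have "tm_class S E s' = tm_class S E t'"
        using Et[OF 1(1)] by (simp add: tm_class_eq_iff tm_eq.equation)
      then show ?thesis using P'[of s'] P'[of t'] Et[OF 1(1)] 1 by simp
    next
      case 2
      then have "tm_class T F s' = tm_class T F t'"
        using Ft[OF 2(1)] by (simp add: tm_class_eq_iff tm_eq.equation)
      then show ?thesis using Q'[of s'] Q'[of t'] Ft[OF 2(1)] 2 by simp
    qed
  qed
  have hom: "prop_hom (presented U D) Z (induced Z \<gamma>)"
    by (rule induced_prop_hom[OF Z h e])
  have ind: "induced Z \<gamma> (tm_class U D t) = interp Z \<gamma> t" if "wt U t" for t
    by (rule induced_class[OF Z h e that])
  have aS: "a \<in> arrs (presented S E) \<Longrightarrow> \<exists>t. a = tm_class S E t \<and> wt S t" for a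
    by (auto simp: presented_def)
  have aT: "a \<in> arrs (presented T F) \<Longrightarrow> \<exists>t. a = tm_class T F t \<and> wt T t" for a
    by (auto simp: presented_def)
  show "\<exists>H. prop_hom (coprod_presented S E T F) Z H \<and>
        (\<forall>a \<in> arrs (presented S E). H (coprod_inl S E T F a) = P a) \<and>
        (\<forall>a \<in> arrs (presented T F). H (coprod_inr S E T F a) = Q a) \<and>
        (\<forall>H'. prop_hom (coprod_presented S E T F) Z H' \<longrightarrow>
          (\<forall>a \<in> arrs (presented S E). H' (coprod_inl S E T F a) = P a) \<longrightarrow>
          (\<forall>a \<in> arrs (presented T F). H' (coprod_inr S E T F a) = Q a) \<longrightarrow>
          (\<forall>a \<in> arrs (coprod_presented S E T F). H' a = H a))"
  proof (intro exI[of _ "induced Z \<gamma>"] conjI allI impI)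
    show "prop_hom (coprod_presented S E T F) Z (induced Z \<gamma>)" using hom by (simp add: CP)
    show "\<forall>a \<in> arrs (presented S E). induced Z \<gamma> (coprod_inl S E T F a) = P a"
      by (auto dest!: aS simp: inl_class ind P' map_tm_typing[of S T, folded U_def])
    show "\<forall>a \<in> arrs (presented T F). induced Z \<gamma> (coprod_inr S E T F a) = Q a"
      by (auto dest!: aT simp: inr_class ind Q' map_tm_typing[of S T, folded U_def])
    fix H' assume H': "prop_hom (coprod_presented S E T F) Z H'"
      and l: "\<forall>a \<in> arrs (presented S E). H' (coprod_inl S E T F a) = P a"
      and r: "\<forall>a \<in> arrs (presented T F). H' (coprod_inr S E T F a) = Q a"
    have "H' (tm_class U D (TGen g)) = \<gamma> g" if "g \<in> gens U" for g
    proof (cases g)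
      case (Inl x)
      then have "wt S (TGen x)" using that by (auto simp: U_def sig_sum_def)
      then show ?thesis
        using l inl_class[of "TGen x"] presented_simps(5)[of S "TGen x" E] Inl
        by (fastforce simp: \<gamma>_def)
    next
      case (Inr x)
      then have "wt T (TGen x)" using that by (auto simp: U_def sig_sum_def)
      then show ?thesis
        using r inr_class[of "TGen x"] presented_simps(5)[of T "TGen x" F] Inr
        by (fastforce simp: \<gamma>_def)
    qed
    then show "\<forall>a \<in> arrs (coprod_presented S E T F). H' a = induced Z \<gamma> a"
      using induced_unique[OF H'[unfolded CP]] by (simp add: CP)
  qed
qed

lemmas free_plus_frob_coproduct =
  coprod_universal[where E = "{}" and T = frob_sig and F = frob_eqs, OF _ frob_eqs_wt, simplified,
    folded free_prop_def frob_def free_plus_frob_def free_inj_def]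


section \<open>Rewriting in a PROP and bending\<close>

definition rewriting_system :: "'a prop_data \<Rightarrow> ('a \<times> 'a) set \<Rightarrow> bool" where
  "rewriting_system X R \<longleftrightarrow> (\<forall>(l, r) \<in> R. \<exists>i j. l \<in> homset X i j \<and> r \<in> homset X i j)"

definition rewrites_to :: "'a prop_data \<Rightarrow> ('a \<times> 'a) set \<Rightarrow> 'a \<Rightarrow> 'a \<Rightarrow> bool" where
  "rewrites_to X R d e \<longleftrightarrow>
    (\<exists>n m l r i j k c\<^sub>1 c\<^sub>2. (l, r) \<in> R \<and> l \<in> homset X i j \<and> r \<in> homset X i j \<and>
      c\<^sub>1 \<in> homset X n (k + i) \<and> c\<^sub>2 \<in> homset X (k + j) m \<and>
      d = cmp X (cmp X c\<^sub>1 (tens X (idt X k) l)) c\<^sub>2 \<and>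
      e = cmp X (cmp X c\<^sub>1 (tens X (idt X k) r)) c\<^sub>2)"

definition frob_arr :: "'g signature \<Rightarrow> frob_gen \<Rightarrow> ('g + frob_gen) tm set" where
  "frob_arr S g = tm_class (sig_sum S frob_sig) (eqs_sum {} frob_eqs) (TGen (Inr g))"

fun cap :: "'g signature \<Rightarrow> nat \<Rightarrow> ('g + frob_gen) tm set" where
  "cap S 0 = idt (free_plus_frob S) 0"
| "cap S (Suc 0) = cmp (free_plus_frob S) (frob_arr S Eta) (frob_arr S Delta)"
| "cap S (Suc (Suc n)) = (let X = free_plus_frob S in
     cmp X (tens X (cap S (Suc 0)) (cap S (Suc n)))
       (tens X (tens X (idt X 1) (symm X 1 (Suc n))) (idt X (Suc n))))"

definition bend :: "'g signature \<Rightarrow> ('g + frob_gen) tm set \<Rightarrow> ('g + frob_gen) tm set" where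
  "bend S d = (let X = free_plus_frob S; n = src X d in
     cmp X (cap S n) (tens X (idt X n) d))"


section \<open>Hypergraphs\<close>

text \<open>Finite hypergraphs are taken with nodes and hyperedges in \<open>nat\<close>: every finite hypergraph is
  isomorphic to one of this kind, so this is the category of finite hypergraphs up to
  equivalence, and the isomorphism classes of cospans form a set.\<close>

record 'g hgraph =
  nodes :: "nat set"
  edges :: "nat set"
  sources :: "nat \<Rightarrow> nat list"
  targets :: "nat \<Rightarrow> nat list"
  label :: "nat \<Rightarrow> 'g"

definition hyp :: "'g signature \<Rightarrow> 'g hgraph \<Rightarrow> bool" where
  "hyp S G \<longleftrightarrow> finite (nodes G) \<and> finite (edges G) \<and>
    (\<forall>h \<in> edges G. set (sources G h) \<subseteq> nodes G \<and> set (targets G h) \<subseteq> nodes G \<and>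
      label G h \<in> gens S \<and> length (sources G h) = arity S (label G h) \<and>
      length (targets G h) = coarity S (label G h))"

record hmap =
  nmap :: "nat \<Rightarrow> nat"
  emap :: "nat \<Rightarrow> nat"

definition hyp_hom :: "'g signature \<Rightarrow> 'g hgraph \<Rightarrow> 'g hgraph \<Rightarrow> hmap \<Rightarrow> bool" where
  "hyp_hom S G H f \<longleftrightarrow> hyp S G \<and> hyp S H \<and>
    (\<forall>v \<in> nodes G. nmap f v \<in> nodes H) \<and>
    (\<forall>h \<in> edges G. emap f h \<in> edges H \<and> sources H (emap f h) = map (nmap f) (sources G h) \<and>
      targets H (emap f h) = map (nmap f) (targets G h) \<and> label H (emap f h) = label G h)"

text \<open>Equality of homomorphisms with domain \<open>G\<close>; values of the underlying functions outside
  \<open>G\<close> are irrelevant.\<close>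

definition heq :: "'g hgraph \<Rightarrow> hmap \<Rightarrow> hmap \<Rightarrow> bool" where
  "heq G f g \<longleftrightarrow> (\<forall>v \<in> nodes G. nmap f v = nmap g v) \<and> (\<forall>h \<in> edges G. emap f h = emap g h)"

definition hid :: hmap where
  "hid = \<lparr> nmap = (\<lambda>v. v), emap = (\<lambda>h. h) \<rparr>"

definition hcomp :: "hmap \<Rightarrow> hmap \<Rightarrow> hmap" (infixl \<open>\<then>\<close> 65) where
  "f \<then> g = \<lparr> nmap = (\<lambda>v. nmap g (nmap f v)), emap = (\<lambda>h. emap g (emap f h)) \<rparr>"

definition hyp_iso :: "'g signature \<Rightarrow> 'g hgraph \<Rightarrow> 'g hgraph \<Rightarrow> hmap \<Rightarrow> bool" where
  "hyp_iso S G H f \<longleftrightarrow> hyp_hom S G H f \<and>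
    (\<exists>g. hyp_hom S H G g \<and> heq G (f \<then> g) hid \<and> heq H (g \<then> f) hid)"

definition hyp_mono :: "'g signature \<Rightarrow> 'g hgraph \<Rightarrow> 'g hgraph \<Rightarrow> hmap \<Rightarrow> bool" where
  "hyp_mono S G H f \<longleftrightarrow> hyp_hom S G H f \<and>
    (\<forall>T u v. hyp_hom S T G u \<longrightarrow> hyp_hom S T G v \<longrightarrow> heq T (u \<then> f) (v \<then> f) \<longrightarrow> heq T u v)"

definition is_pushout :: "'g signature \<Rightarrow> 'g hgraph \<Rightarrow> 'g hgraph \<Rightarrow> 'g hgraph \<Rightarrow> 'g hgraph \<Rightarrow>
    hmap \<Rightarrow> hmap \<Rightarrow> hmap \<Rightarrow> hmap \<Rightarrow> bool" where
  "is_pushout S A B C P f g p q \<longleftrightarrow>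
    hyp_hom S A B f \<and> hyp_hom S A C g \<and> hyp_hom S B P p \<and> hyp_hom S C P q \<and>
    heq A (f \<then> p) (g \<then> q) \<and>
    (\<forall>T u v. hyp_hom S B T u \<longrightarrow> hyp_hom S C T v \<longrightarrow> heq A (f \<then> u) (g \<then> v) \<longrightarrow>
      (\<exists>w. hyp_hom S P T w \<and> heq B (p \<then> w) u \<and> heq C (q \<then> w) v \<and>
        (\<forall>w'. hyp_hom S P T w' \<and> heq B (p \<then> w') u \<and> heq C (q \<then> w') v \<longrightarrow> heq P w' w)))"

definition discrete :: "nat \<Rightarrow> 'g hgraph" where
  "discrete n = \<lparr> nodes = {..<n}, edges = {}, sources = (\<lambda>_. []), targets = (\<lambda>_. []),
     label = (\<lambda>_. undefined) \<rparr>"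

text \<open>Homomorphisms out of discrete hypergraphs, and the copairing \<open>[f, g] : i + j \<rightarrow> G\<close> of
  \<open>f : i \<rightarrow> G\<close> and \<open>g : j \<rightarrow> G\<close>.\<close>

definition node_map :: "(nat \<Rightarrow> nat) \<Rightarrow> hmap" where
  "node_map f = \<lparr> nmap = f, emap = (\<lambda>h. h) \<rparr>"

definition copair :: "nat \<Rightarrow> hmap \<Rightarrow> hmap \<Rightarrow> hmap" where
  "copair i f g = node_map (\<lambda>k. if k < i then nmap f k else nmap g (k - i))"

definition node_inl :: "nat \<Rightarrow> nat" where
  "node_inl x = sum_encode (Inl x)"

definition node_inr :: "nat \<Rightarrow> nat" where
  "node_inr x = sum_encode (Inr x)"

definition hyp_sum :: "'g hgraph \<Rightarrow> 'g hgraph \<Rightarrow> 'g hgraph" where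
  "hyp_sum G H =
    \<lparr> nodes = sum_encode ` (nodes G <+> nodes H),
      edges = sum_encode ` (edges G <+> edges H),
      sources = (\<lambda>h. case sum_decode h of Inl x \<Rightarrow> map node_inl (sources G x)
                                        | Inr y \<Rightarrow> map node_inr (sources H y)),
      targets = (\<lambda>h. case sum_decode h of Inl x \<Rightarrow> map node_inl (targets G x)
                                        | Inr y \<Rightarrow> map node_inr (targets H y)),
      label = (\<lambda>h. case sum_decode h of Inl x \<Rightarrow> label G x | Inr y \<Rightarrow> label H y) \<rparr>"


section \<open>The PROP of cospans\<close>

datatype 'g cospan =
  Cospan (cdom: nat) (ccod: nat) (apex: "'g hgraph") (lleg: hmap) (rleg: hmap)

definition cospan :: "'g signature \<Rightarrow> 'g cospan \<Rightarrow> bool" where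
  "cospan S c \<longleftrightarrow> hyp_hom S (discrete (cdom c)) (apex c) (lleg c) \<and>
    hyp_hom S (discrete (ccod c)) (apex c) (rleg c)"

definition cospan_iso :: "'g signature \<Rightarrow> 'g cospan \<Rightarrow> 'g cospan \<Rightarrow> bool" where
  "cospan_iso S c d \<longleftrightarrow> cospan S c \<and> cospan S d \<and> cdom c = cdom d \<and> ccod c = ccod d \<and>
    (\<exists>f. hyp_iso S (apex c) (apex d) f \<and>
      heq (discrete (cdom c) :: 'g hgraph) (lleg c \<then> f) (lleg d) \<and>
      heq (discrete (ccod c) :: 'g hgraph) (rleg c \<then> f) (rleg d))"

definition cospan_class :: "'g signature \<Rightarrow> 'g cospan \<Rightarrow> 'g cospan set" where
  "cospan_class S c = {d. cospan_iso S c d}"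

definition cospan_sum :: "'g cospan \<Rightarrow> 'g cospan \<Rightarrow> 'g cospan" where
  "cospan_sum c d = Cospan (cdom c + cdom d) (ccod c + ccod d) (hyp_sum (apex c) (apex d))
    (copair (cdom c) (lleg c \<then> node_map node_inl) (lleg d \<then> node_map node_inr))
    (copair (ccod c) (rleg c \<then> node_map node_inl) (rleg d \<then> node_map node_inr))"

text \<open>Since pushouts are only determined up to isomorphism, composition collects the isomorphism
  classes of all composites of representatives (they all coincide).\<close>

definition fterm :: "'g signature \<Rightarrow> 'g cospan set prop_data" where
  "fterm S =
    \<lparr> arrs = cospan_class S ` {c. cospan S c},
      src = (\<lambda>A. cdom (rep A)),
      trg = (\<lambda>A. ccod (rep A)),
      idt = (\<lambda>n. cospan_class S (Cospan n n (discrete n) hid hid)),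
      cmp = (\<lambda>A B. \<Union> {cospan_class S (Cospan (cdom c) (ccod d) P (lleg c \<then> p) (rleg d \<then> q)) |
         c d P p q. c \<in> A \<and> d \<in> B \<and> ccod c = cdom d \<and>
         is_pushout S (discrete (ccod c)) (apex c) (apex d) P (rleg c) (lleg d) p q}),
      tens = (\<lambda>A B. \<Union> {cospan_class S (cospan_sum c d) | c d. c \<in> A \<and> d \<in> B}),
      symm = (\<lambda>n m. cospan_class S (Cospan (n + m) (m + n) (discrete (n + m)) hid
         (node_map (\<lambda>k. if k < m then n + k else k - m)))) \<rparr>"

text \<open>\<open>Phi\<close> extends the values prescribed on the generators of the signature and of the Frobenius
  structure; by lemma \<open>induced_unique\<close>, every PROP morphism with these values agrees with it.\<close>

definition gen_hyp :: "'g signature \<Rightarrow> 'g \<Rightarrow> 'g hgraph" where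
  "gen_hyp S g = \<lparr> nodes = {..<arity S g + coarity S g}, edges = {0},
     sources = (\<lambda>_. [0..<arity S g]), targets = (\<lambda>_. [arity S g..<arity S g + coarity S g]),
     label = (\<lambda>_. g) \<rparr>"

definition gen_cospan :: "'g signature \<Rightarrow> 'g \<Rightarrow> 'g cospan" where
  "gen_cospan S g = Cospan (arity S g) (coarity S g) (gen_hyp S g) hid (node_map (\<lambda>k. arity S g + k))"

definition frob_cospan :: "frob_gen \<Rightarrow> 'g cospan" where
  "frob_cospan g = Cospan (arity frob_sig g) (coarity frob_sig g) (discrete 1)
     (node_map (\<lambda>_. 0)) (node_map (\<lambda>_. 0))"

definition Phi :: "'g signature \<Rightarrow> ('g + frob_gen) tm set \<Rightarrow> 'g cospan set" where
  "Phi S = induced (fterm S)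
     (case_sum (\<lambda>g. cospan_class S (gen_cospan S g)) (\<lambda>g. cospan_class S (frob_cospan g)))"


section \<open>Monogamicity, convexity and convex DPO rewriting\<close>

definition indegree :: "'g hgraph \<Rightarrow> nat \<Rightarrow> nat" where
  "indegree G v = card {(h, i). h \<in> edges G \<and> i < length (targets G h) \<and> targets G h ! i = v}"

definition outdegree :: "'g hgraph \<Rightarrow> nat \<Rightarrow> nat" where
  "outdegree G v = card {(h, j). h \<in> edges G \<and> j < length (sources G h) \<and> sources G h ! j = v}"

definition monogamous :: "'g signature \<Rightarrow> nat \<Rightarrow> nat \<Rightarrow> 'g hgraph \<Rightarrow> hmap \<Rightarrow> hmap \<Rightarrow> bool" where
  "monogamous S m n G f g \<longleftrightarrow>
    hyp_mono S (discrete m) G f \<and> hyp_mono S (discrete n) G g \<and>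
    (\<forall>v \<in> nodes G. indegree G v = (if v \<in> nmap f ` {..<m} then 0 else 1) \<and>
      outdegree G v = (if v \<in> nmap g ` {..<n} then 0 else 1))"

definition directed_path :: "'g hgraph \<Rightarrow> nat \<Rightarrow> nat list \<Rightarrow> nat \<Rightarrow> bool" where
  "directed_path G v hs v' \<longleftrightarrow> hs \<noteq> [] \<and> set hs \<subseteq> edges G \<and>
    v \<in> set (sources G (hd hs)) \<and> v' \<in> set (targets G (last hs)) \<and>
    (\<forall>i. Suc i < length hs \<longrightarrow> set (targets G (hs ! i)) \<inter> set (sources G (hs ! Suc i)) \<noteq> {})"

definition convex_sub :: "'g hgraph \<Rightarrow> 'g hgraph \<Rightarrow> bool" where
  "convex_sub H G \<longleftrightarrow> (\<forall>v \<in> nodes H. \<forall>v' \<in> nodes H. \<forall>hs.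
    directed_path G v hs v' \<longrightarrow> set hs \<subseteq> edges H)"

definition image_hyp :: "hmap \<Rightarrow> 'g hgraph \<Rightarrow> 'g hgraph \<Rightarrow> 'g hgraph" where
  "image_hyp f L G = G\<lparr> nodes := nmap f ` nodes L, edges := emap f ` edges L \<rparr>"

definition convex_matching :: "'g signature \<Rightarrow> 'g hgraph \<Rightarrow> 'g hgraph \<Rightarrow> hmap \<Rightarrow> bool" where
  "convex_matching S L G f \<longleftrightarrow> hyp_mono S L G f \<and> convex_sub (image_hyp f L G) G"

definition boundary_complement :: "'g signature \<Rightarrow>
    nat \<Rightarrow> nat \<Rightarrow> 'g hgraph \<Rightarrow> hmap \<Rightarrow> hmap \<Rightarrow>
    nat \<Rightarrow> nat \<Rightarrow> 'g hgraph \<Rightarrow> hmap \<Rightarrow> hmap \<Rightarrow> hmap \<Rightarrow>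
    'g hgraph \<Rightarrow> hmap \<Rightarrow> hmap \<Rightarrow> hmap \<Rightarrow> hmap \<Rightarrow> hmap \<Rightarrow> bool" where
  "boundary_complement S i j L a\<^sub>1 a\<^sub>2 n m G b\<^sub>1 b\<^sub>2 f C c\<^sub>1 c\<^sub>2 g d\<^sub>1 d\<^sub>2 \<longleftrightarrow>
    monogamous S i j L a\<^sub>1 a\<^sub>2 \<and> monogamous S n m G b\<^sub>1 b\<^sub>2 \<and> hyp_mono S L G f \<and>
    is_pushout S (discrete (i + j)) L C G (copair i a\<^sub>1 a\<^sub>2) (copair i c\<^sub>1 c\<^sub>2) f g \<and>
    hyp_mono S (discrete (i + j)) C (copair i c\<^sub>1 c\<^sub>2) \<and>
    hyp_hom S (discrete n) C d\<^sub>1 \<and> hyp_hom S (discrete m) C d\<^sub>2 \<and>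
    heq (discrete (n + m) :: 'g hgraph) (copair n d\<^sub>1 d\<^sub>2 \<then> g) (copair n b\<^sub>1 b\<^sub>2) \<and>
    monogamous S (j + n) (m + i) C (copair j c\<^sub>2 d\<^sub>1) (copair m d\<^sub>2 c\<^sub>1)"

datatype 'g dpo_rule =
  DPO_Rule (rule_i: nat) (rule_j: nat)
    (lhs: "'g hgraph") (lhs_leg: hmap) (lhs_leg': hmap)
    (rhs: "'g hgraph") (rhs_leg: hmap) (rhs_leg': hmap)

text \<open>The type \<open>(i, j)\<close> of a rule cannot be recovered from its bent version of type
  \<open>(0, i + j)\<close>, so it is recorded in the DPO rule
  \<open>L \<leftarrow> i + j \<rightarrow> R\<close>. All representatives of the isomorphism classes are included.\<close>

definition dpo_rules :: "'g signature \<Rightarrow> ('g tm set \<times> 'g tm set) set \<Rightarrow> 'g dpo_rule set" where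
  "dpo_rules S R = {DPO_Rule i j L a\<^sub>1 a\<^sub>2 Q b\<^sub>1 b\<^sub>2 | i j L a\<^sub>1 a\<^sub>2 Q b\<^sub>1 b\<^sub>2.
    \<exists>l r x y. (l, r) \<in> R \<and> l \<in> homset (free_prop S) i j \<and> r \<in> homset (free_prop S) i j \<and>
      Cospan 0 (i + j) L x (copair i a\<^sub>1 a\<^sub>2) \<in> Phi S (bend S (free_inj S l)) \<and>
      Cospan 0 (i + j) Q y (copair i b\<^sub>1 b\<^sub>2) \<in> Phi S (bend S (free_inj S r))}"

definition convex_dpo_step :: "'g signature \<Rightarrow> 'g dpo_rule set \<Rightarrow> nat \<Rightarrow> nat \<Rightarrow>
    'g hgraph \<Rightarrow> hmap \<Rightarrow> hmap \<Rightarrow> 'g hgraph \<Rightarrow> hmap \<Rightarrow> hmap \<Rightarrow> bool" where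
  "convex_dpo_step S \<R> n m D q\<^sub>1 q\<^sub>2 E p\<^sub>1 p\<^sub>2 \<longleftrightarrow>
    (\<exists>i j L a\<^sub>1 a\<^sub>2 Q b\<^sub>1 b\<^sub>2 C c\<^sub>1 c\<^sub>2 d\<^sub>1 d\<^sub>2 f g g' f'.
      DPO_Rule i j L a\<^sub>1 a\<^sub>2 Q b\<^sub>1 b\<^sub>2 \<in> \<R> \<and>
      is_pushout S (discrete (i + j)) L C D (copair i a\<^sub>1 a\<^sub>2) (copair i c\<^sub>1 c\<^sub>2) f g \<and>
      is_pushout S (discrete (i + j)) Q C E (copair i b\<^sub>1 b\<^sub>2) (copair i c\<^sub>1 c\<^sub>2) f' g' \<and>
      hyp_hom S (discrete (n + m)) C (copair n d\<^sub>1 d\<^sub>2) \<and>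
      heq (discrete (n + m) :: 'g hgraph) (copair n d\<^sub>1 d\<^sub>2 \<then> g) (copair n q\<^sub>1 q\<^sub>2) \<and>
      heq (discrete (n + m) :: 'g hgraph) (copair n d\<^sub>1 d\<^sub>2 \<then> g') (copair n p\<^sub>1 p\<^sub>2) \<and>
      convex_matching S L D f \<and>
      boundary_complement S i j L a\<^sub>1 a\<^sub>2 n m D q\<^sub>1 q\<^sub>2 f C c\<^sub>1 c\<^sub>2 g d\<^sub>1 d\<^sub>2)"

text \<open>The step on arrows \<open>0 \<rightarrow> n + m\<close> of the cospan PROP, that is on isomorphism classes.\<close>

definition convex_dpo :: "'g signature \<Rightarrow> 'g dpo_rule set \<Rightarrow> nat \<Rightarrow> nat \<Rightarrow>
    'g cospan set \<Rightarrow> 'g cospan set \<Rightarrow> bool" where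
  "convex_dpo S \<R> n m A B \<longleftrightarrow>
    (\<exists>D x q\<^sub>1 q\<^sub>2 E y p\<^sub>1 p\<^sub>2.
      Cospan 0 (n + m) D x (copair n q\<^sub>1 q\<^sub>2) \<in> A \<and>
      Cospan 0 (n + m) E y (copair n p\<^sub>1 p\<^sub>2) \<in> B \<and>
      convex_dpo_step S \<R> n m D q\<^sub>1 q\<^sub>2 E p\<^sub>1 p\<^sub>2)"

end

theory Submission
  imports Defs "HOL-Library.Multiset"
begin

text \<open>Interpreting a term \<open>t\<close> over the generators and the Frobenius structure in a hypergraph \<open>T\<close>, as a
  span of sets between tuples of nodes, gives a functor of \<open>T\<close> which is invariant under all the laws
  and which is represented by the cospan assigned to \<open>t\<close>. By Yoneda, \<open>Phi\<close> sends the class of \<open>t\<close> to the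
  cospans representing it, and bending merely moves the inputs to the outputs.

  For terms without Frobenius generators these cospans are string diagrams: monogamous and acyclic.
  They determine the term up to the laws (each term is a normal form along a topological order of
  the edges, and independent edges commute), and every monogamous acyclic cospan arises in this way.

  A context \<open>c\<^sub>1; (id\<^sub>k \<oplus> _); c\<^sub>2\<close> is the same as a boundary complement split into a past and a future
  that share the wires \<open>k\<close>. Given a convex match, no path leads from its outputs to its inputs, so
  the edges from which its inputs can be reached form such a past.\<close>

section \<open>Permutations in a PROP\<close>

text \<open>\<open>Phi\<close> interprets an arbitrarily chosen representative term, and composition
  of cospans is fixed only up to isomorphism, so a direct proof of invariance would juggle iterated
  pushouts. In a test hypergraph each PROP law becomes a rebracketing of tuples, and each Frobenius
  law says that two connected terms force all their boundary wires onto one node. Faithfulness has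
  the opposite difficulty: a term has to be recovered from a hypergraph. Placing all parts of a term
  inside one ambient hypergraph turns wires into named nodes. Permutations are then described by
  lists of names, and the terms to be compared live in the same cospan rather than in isomorphic
  copies. The delicate case of the rewriting step is a left side with identity wires: inputs and
  outputs of the match overlap in the rewritten hypergraph, while the boundary complement must keep
  them apart. The complement is then no sub-hypergraph and has to contain two copies of such
  wires.\<close>

context prop_cat
begin

abbreviation sq :: "'a \<Rightarrow> 'a \<Rightarrow> 'a" (infixl "\<cdot>" 65) where "f \<cdot> g \<equiv> cmp X f g"
abbreviation pr :: "'a \<Rightarrow> 'a \<Rightarrow> 'a" (infixl "\<oplus>" 70) where "f \<oplus> g \<equiv> tens X f g"
abbreviation I :: "nat \<Rightarrow> 'a" where "I \<equiv> idt X"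
abbreviation \<sigma> :: "nat \<Rightarrow> nat \<Rightarrow> 'a" where "\<sigma> \<equiv> symm X"

lemma arr_simps [simp]:
  "I n \<in> arrs X" "src X (I n) = n" "trg X (I n) = n"
  "\<sigma> n m \<in> arrs X" "src X (\<sigma> n m) = n + m" "trg X (\<sigma> n m) = m + n"
  "f \<in> arrs X \<Longrightarrow> g \<in> arrs X \<Longrightarrow> trg X f = src X g \<Longrightarrow> f \<cdot> g \<in> arrs X"
  "f \<in> arrs X \<Longrightarrow> g \<in> arrs X \<Longrightarrow> trg X f = src X g \<Longrightarrow> src X (f \<cdot> g) = src X f"
  "f \<in> arrs X \<Longrightarrow> g \<in> arrs X \<Longrightarrow> trg X f = src X g \<Longrightarrow> trg X (f \<cdot> g) = trg X g"
  "f \<in> arrs X \<Longrightarrow> g \<in> arrs X \<Longrightarrow> f \<oplus> g \<in> arrs X"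
  "f \<in> arrs X \<Longrightarrow> g \<in> arrs X \<Longrightarrow> src X (f \<oplus> g) = src X f + src X g"
  "f \<in> arrs X \<Longrightarrow> g \<in> arrs X \<Longrightarrow> trg X (f \<oplus> g) = trg X f + trg X g"
  using idt_hom[of n] symm_hom[of n m] cmp_hom[of f "src X f" "trg X f" g "trg X g"]
    tens_hom[of f "src X f" "trg X f" g "src X g" "trg X g"]
  by (auto simp: homset_def)

lemma comp_simps:
  "f \<in> arrs X \<Longrightarrow> src X f = n \<Longrightarrow> I n \<cdot> f = f"
  "f \<in> arrs X \<Longrightarrow> trg X f = n \<Longrightarrow> f \<cdot> I n = f"
  "f \<in> arrs X \<Longrightarrow> g \<in> arrs X \<Longrightarrow> h \<in> arrs X \<Longrightarrow> trg X f = src X g \<Longrightarrow> trg X g = src X h \<Longrightarrow>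
    f \<cdot> g \<cdot> h = f \<cdot> (g \<cdot> h)"
  using cmp_idt_left cmp_idt_right cmp_assoc by (auto simp: homset_def)

lemma tens_simps:
  "f \<in> arrs X \<Longrightarrow> I 0 \<oplus> f = f"
  "f \<in> arrs X \<Longrightarrow> f \<oplus> I 0 = f"
  "I n \<oplus> I m = I (n + m)"
  "f \<in> arrs X \<Longrightarrow> g \<in> arrs X \<Longrightarrow> h \<in> arrs X \<Longrightarrow> f \<oplus> g \<oplus> h = f \<oplus> (g \<oplus> h)"
  using tens_unit_left tens_unit_right tens_idt tens_assoc by (auto simp: homset_def)

lemma inter:
  assumes "f \<in> arrs X" "g \<in> arrs X" "f' \<in> arrs X" "g' \<in> arrs X"
    "trg X f = src X g" "trg X f' = src X g'"
  shows "(f \<oplus> f') \<cdot> (g \<oplus> g') = (f \<cdot> g) \<oplus> (f' \<cdot> g')"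
  using interchange[of f "src X f" "trg X f" g "trg X g" f' "src X f'" "trg X f'" g' "trg X g'"] assms
  by (simp add: homset_def)

lemma nat_sym:
  assumes "f \<in> arrs X" "g \<in> arrs X" "trg X f = m" "trg X g = m'" "src X f = n" "src X g = n'"
  shows "(f \<oplus> g) \<cdot> \<sigma> m m' = \<sigma> n n' \<cdot> (g \<oplus> f)"
  using symm_natural[of f n m g n' m'] assms by (simp add: homset_def)

lemma whisk_left:
  "f \<in> arrs X \<Longrightarrow> g \<in> arrs X \<Longrightarrow> trg X f = src X g \<Longrightarrow> I n \<oplus> (f \<cdot> g) = (I n \<oplus> f) \<cdot> (I n \<oplus> g)"
  by (simp add: inter comp_simps)

lemma whisk_right:
  "f \<in> arrs X \<Longrightarrow> g \<in> arrs X \<Longrightarrow> trg X f = src X g \<Longrightarrow> (f \<cdot> g) \<oplus> I n = (f \<oplus> I n) \<cdot> (g \<oplus> I n)"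
  by (simp add: inter comp_simps)

lemma whisk_add: "f \<in> arrs X \<Longrightarrow> I n \<oplus> (I m \<oplus> f) = I (n + m) \<oplus> f"
  by (simp add: tens_simps(4)[symmetric] tens_simps(3))

lemma slide:
  assumes "f \<in> arrs X" "g \<in> arrs X" "src X f = n" "trg X f = m" "src X g = n'" "trg X g = m'"
  shows "(f \<oplus> I n') \<cdot> (I m \<oplus> g) = f \<oplus> g" "(I n \<oplus> g) \<cdot> (f \<oplus> I m') = f \<oplus> g"
  using assms by (simp_all add: inter comp_simps)

lemma sym_inv: "\<sigma> n m \<cdot> \<sigma> m n = I (n + m)"
  by (rule symm_inverse)

text \<open>The hexagon with two zeros makes \<open>\<sigma> n 0\<close> idempotent, and an
  invertible idempotent is an identity.\<close>

lemma sym_zero_right: "\<sigma> n 0 = I n"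
proof -
  have "\<sigma> n 0 = \<sigma> n 0 \<cdot> \<sigma> n 0"
    using symm_hexagon[of n 0 0] by (simp add: tens_simps)
  then have "\<sigma> n 0 \<cdot> \<sigma> 0 n = \<sigma> n 0 \<cdot> (\<sigma> n 0 \<cdot> \<sigma> 0 n)"
    by (simp add: comp_simps(3)[symmetric])
  then show ?thesis by (simp add: sym_inv comp_simps)
qed

lemma sym_zero_left: "\<sigma> 0 n = I n"
  using sym_inv[of n 0] by (simp add: sym_zero_right comp_simps)

lemma inverse_unique:
  assumes "f \<in> arrs X" "g \<in> arrs X" "h \<in> arrs X" "trg X f = src X g" "trg X g = src X h"
    "f \<cdot> g = I (src X f)" "g \<cdot> h = I (src X g)"
  shows "f = h"
proof -
  have "f = f \<cdot> (g \<cdot> h)" using assms by (simp add: comp_simps)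
  also have "\<dots> = f \<cdot> g \<cdot> h" by (rule comp_simps(3)[OF assms(1-5), symmetric])
  also have "\<dots> = h"
  proof -
    have "trg X g = src X f" using arr_simps(9)[OF assms(1,2,4)] assms(6) by simp
    then show ?thesis using assms by (simp add: comp_simps)
  qed
  finally show ?thesis .
qed

text \<open>Both sides are inverse to \<open>\<sigma> k (n + m)\<close>, which the given hexagon
  expands.\<close>

lemma sym_hexagon_rev: "\<sigma> (n + m) k = (I n \<oplus> \<sigma> m k) \<cdot> (\<sigma> n k \<oplus> I m)"
proof (rule inverse_unique[of _ "\<sigma> k (n + m)"])
  have h: "\<sigma> k (n + m) = (\<sigma> k n \<oplus> I m) \<cdot> (I n \<oplus> \<sigma> k m)" by (rule symm_hexagon)
  have "\<sigma> k (n + m) \<cdot> ((I n \<oplus> \<sigma> m k) \<cdot> (\<sigma> n k \<oplus> I m)) =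
     (\<sigma> k n \<oplus> I m) \<cdot> ((I n \<oplus> \<sigma> k m) \<cdot> (I n \<oplus> \<sigma> m k) \<cdot> (\<sigma> n k \<oplus> I m))"
    unfolding h by (simp add: comp_simps add_ac)
  also have "(I n \<oplus> \<sigma> k m) \<cdot> (I n \<oplus> \<sigma> m k) = I (n + k + m)"
    by (simp add: inter sym_inv tens_simps comp_simps add_ac)
  also have "(\<sigma> k n \<oplus> I m) \<cdot> (I (n + k + m) \<cdot> (\<sigma> n k \<oplus> I m)) = I (k + n + m)"
    by (simp add: comp_simps inter sym_inv tens_simps)
  finally show "\<sigma> k (n + m) \<cdot> ((I n \<oplus> \<sigma> m k) \<cdot> (\<sigma> n k \<oplus> I m)) = I (src X (\<sigma> k (n + m)))"
    by (simp add: add_ac)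
qed (simp_all add: sym_inv add_ac)

text \<open>This is naturality of \<open>\<sigma> 1 2\<close> with respect to the swap
  \<open>\<sigma> 1 1\<close>, with \<open>\<sigma> 1 2\<close> expanded by the hexagon.\<close>

lemma yang_baxter:
  "(\<sigma> 1 1 \<oplus> I 1) \<cdot> (I 1 \<oplus> \<sigma> 1 1) \<cdot> (\<sigma> 1 1 \<oplus> I 1) =
    (I 1 \<oplus> \<sigma> 1 1) \<cdot> (\<sigma> 1 1 \<oplus> I 1) \<cdot> (I 1 \<oplus> \<sigma> 1 1)"
proof -
  have h: "\<sigma> 1 (1 + 1) = (\<sigma> 1 1 \<oplus> I 1) \<cdot> (I 1 \<oplus> \<sigma> 1 1)" by (rule symm_hexagon)
  have "(I 1 \<oplus> \<sigma> 1 1) \<cdot> \<sigma> 1 (1 + 1) = \<sigma> 1 (1 + 1) \<cdot> (\<sigma> 1 1 \<oplus> I 1)"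
    by (rule nat_sym) simp_all
  then show ?thesis unfolding h by (simp add: comp_simps)
qed

text \<open>Lists name the wires. The arrow pulls the first wire named \<open>y\<close> to the front
  by adjacent transpositions; it is well typed only if \<open>y\<close> occurs in the list, which
  also makes \<open>length xs - 1\<close> harmless.\<close>

primrec front :: "nat \<Rightarrow> nat list \<Rightarrow> 'a" where
  "front y [] = I 0"
| "front y (x # xs) = (if x = y then I (Suc (length xs))
     else (I 1 \<oplus> front y xs) \<cdot> (\<sigma> 1 1 \<oplus> I (length xs - 1)))"

text \<open>The permutation from the order \<open>xs\<close> to the order \<open>ys\<close>, written
  as a selection sort. Fixing one word in transpositions per permutation reduces coherence of
  symmetries to the composition law \<open>perm_trans\<close>.\<close>

primrec perm :: "nat list \<Rightarrow> nat list \<Rightarrow> 'a" where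
  "perm xs [] = I 0"
| "perm xs (y # ys) = front y xs \<cdot> (I 1 \<oplus> perm (remove1 y xs) ys)"

lemma front_arr [simp]:
  "y \<in> set xs \<Longrightarrow> front y xs \<in> arrs X"
  "y \<in> set xs \<Longrightarrow> src X (front y xs) = length xs"
  "y \<in> set xs \<Longrightarrow> trg X (front y xs) = length xs"
proof (induction xs)
  case (Cons x xs)
  { case 1 then show ?case using Cons by (cases xs) auto }
  { case 2 then show ?case using Cons by (cases xs) auto }
  { case 3 then show ?case using Cons by (cases xs) auto }
qed auto

lemma perm_arr:
  "mset xs = mset ys \<Longrightarrow> perm xs ys \<in> arrs X \<and> src X (perm xs ys) = length xs \<and> trg X (perm xs ys) = length ys"
proof (induction ys arbitrary: xs)
  case (Cons y ys)
  then have "y \<in> set xs" "mset (remove1 y xs) = mset ys" by (metis list.set_intros(1) set_mset_mset, simp)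
  moreover have "length xs = Suc (length ys)" using Cons.prems by (metis length_Cons size_mset)
  moreover have "length (remove1 y xs) = length ys" using calculation(2) by (metis size_mset)
  ultimately show ?case using Cons.IH[of "remove1 y xs"] by simp
qed auto

lemma perm_arrs [simp]:
  assumes "mset xs = mset ys"
  shows "perm xs ys \<in> arrs X" "src X (perm xs ys) = length xs" "trg X (perm xs ys) = length ys"
  using perm_arr[OF assms] by auto

lemma perm_refl: "perm xs xs = I (length xs)"
  by (induction xs) (simp_all add: tens_simps comp_simps)

lemma length_pos_if_two: "y \<in> set xs \<Longrightarrow> z \<in> set xs \<Longrightarrow> y \<noteq> z \<Longrightarrow> \<exists>n. length xs = Suc (Suc n)"
  by (metis length_0_conv length_Suc_conv list.distinct(1) set_ConsD empty_iff list.set(1) not0_implies_Suc)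

text \<open>Pulling out \<open>y\<close> and then \<open>z\<close> differs from the opposite order
  by one swap of the two front wires. In the induction a head equal to \<open>y\<close> or
  \<open>z\<close> needs at most that a swap is an involution; any other head needs the braid
  relation.\<close>

lemma front_comm:
  assumes "y \<in> set xs" "z \<in> set xs" "y \<noteq> z"
  shows "front y xs \<cdot> (I 1 \<oplus> front z (remove1 y xs)) \<cdot> (\<sigma> 1 1 \<oplus> I (length xs - 2)) =
    front z xs \<cdot> (I 1 \<oplus> front y (remove1 z xs))"
  using assms
proof (induction xs)
  case (Cons x xs)
  show ?case
  proof (cases "x = y")
    case True
    then obtain n where n: "length xs = Suc n" using Cons.prems by (cases xs) auto
    then show ?thesis using True Cons.prems by (simp add: comp_simps tens_simps length_remove1)
  next
    case xy: False
    show ?thesis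
    proof (cases "x = z")
      case True
      then obtain n where n: "length xs = Suc n" using Cons.prems by (cases xs) auto
      then have "front y (x # xs) \<cdot> (I 1 \<oplus> front z (remove1 y (x # xs))) \<cdot> (\<sigma> 1 1 \<oplus> I (length (x # xs) - 2))
        = (I 1 \<oplus> front y xs) \<cdot> ((\<sigma> 1 1 \<oplus> I n) \<cdot> (\<sigma> 1 1 \<oplus> I n))"
        using True Cons.prems by (simp add: comp_simps tens_simps length_remove1)
      also have "(\<sigma> 1 1 \<oplus> I n) \<cdot> (\<sigma> 1 1 \<oplus> I n) = I (Suc (Suc n))"
        by (simp add: inter sym_inv comp_simps tens_simps)
      finally show ?thesis using True Cons.prems n by (simp add: comp_simps)
    next
      case False
      then have yz: "y \<in> set xs" "z \<in> set xs" using xy Cons.prems by auto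
      obtain n where n: "length xs = Suc (Suc n)" using length_pos_if_two[OF yz Cons.prems(3)] by blast
      have m: "z \<in> set (remove1 y xs)" "y \<in> set (remove1 z xs)" using yz Cons.prems(3) by auto
      have l: "length (remove1 y xs) = Suc n" "length (remove1 z xs) = Suc n"
        using n yz by (simp_all add: length_remove1)
      let ?Y = "front y xs" and ?Z = "front z xs" and ?y = "front y (remove1 z xs)" and ?z = "front z (remove1 y xs)"
      have IH: "?Y \<cdot> (I 1 \<oplus> ?z) \<cdot> (\<sigma> 1 1 \<oplus> I n) = ?Z \<cdot> (I 1 \<oplus> ?y)"
        using Cons.IH[OF yz Cons.prems(3)] n by simp
      have [simp]: "?Y \<in> arrs X" "?Z \<in> arrs X" "?y \<in> arrs X" "?z \<in> arrs X"
        "src X ?Y = Suc (Suc n)" "src X ?Z = Suc (Suc n)" "src X ?y = Suc n" "src X ?z = Suc n"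
        "trg X ?Y = Suc (Suc n)" "trg X ?Z = Suc (Suc n)" "trg X ?y = Suc n" "trg X ?z = Suc n"
        using yz m n l by simp_all
      let ?s1 = "\<sigma> 1 1 \<oplus> I (Suc n)" and ?s2 = "I 1 \<oplus> (\<sigma> 1 1 \<oplus> I n)"
      \<comment> \<open>The braid relation with \<open>n\<close> idle wires on the right.\<close>
      have yb: "?s1 \<cdot> (?s2 \<cdot> ?s1) = ?s2 \<cdot> (?s1 \<cdot> ?s2)"
      proof -
        have e: "?s1 = \<sigma> 1 1 \<oplus> I 1 \<oplus> I n" "?s2 = I 1 \<oplus> \<sigma> 1 1 \<oplus> I n"
          by (simp_all add: tens_simps)
        show ?thesis unfolding e
          using arg_cong[OF yang_baxter, of "\<lambda>f. f \<oplus> I n"] by (simp add: whisk_right comp_simps)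
      qed
      \<comment> \<open>An arrow on the wires beyond the first two passes through a swap of the
        first two.\<close>
      have sl: "?s1 \<cdot> (I 1 \<oplus> (I 1 \<oplus> f)) = (I 1 \<oplus> (I 1 \<oplus> f)) \<cdot> ?s1"
        if "f \<in> arrs X" "src X f = Suc n" "trg X f = Suc n" for f
        using that by (simp add: whisk_add inter comp_simps)
      have "front y (x # xs) \<cdot> (I 1 \<oplus> front z (remove1 y (x # xs))) \<cdot> (\<sigma> 1 1 \<oplus> I (length (x # xs) - 2))
        = (I 1 \<oplus> ?Y) \<cdot> (?s1 \<cdot> (I 1 \<oplus> (I 1 \<oplus> ?z))) \<cdot> (?s2 \<cdot> ?s1)"
        using xy False Cons.prems n l by (simp add: whisk_left comp_simps)
      also have "\<dots> = (I 1 \<oplus> ?Y) \<cdot> (I 1 \<oplus> (I 1 \<oplus> ?z)) \<cdot> (?s1 \<cdot> (?s2 \<cdot> ?s1))"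
        by (subst sl) (simp_all add: comp_simps)
      also have "\<dots> = (I 1 \<oplus> (?Y \<cdot> (I 1 \<oplus> ?z) \<cdot> (\<sigma> 1 1 \<oplus> I n))) \<cdot> (?s1 \<cdot> ?s2)"
        unfolding yb by (simp add: whisk_left comp_simps)
      also have "\<dots> = (I 1 \<oplus> ?Z) \<cdot> ((I 1 \<oplus> (I 1 \<oplus> ?y)) \<cdot> ?s1) \<cdot> ?s2"
        unfolding IH by (simp add: whisk_left comp_simps)
      also have "\<dots> = (I 1 \<oplus> ?Z) \<cdot> (?s1 \<cdot> (I 1 \<oplus> (I 1 \<oplus> ?y))) \<cdot> ?s2"
        by (subst sl) simp_all
      also have "\<dots> = front z (x # xs) \<cdot> (I 1 \<oplus> front y (remove1 z (x # xs)))"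
        using xy False Cons.prems n l by (simp add: whisk_left comp_simps)
      finally show ?thesis .
    qed
  qed
qed simp

text \<open>Selecting \<open>z\<close> after permuting is the same as selecting it at once and
  permuting the others. Each step of the sort is moved across by \<open>front_comm\<close>.\<close>

lemma perm_front:
  assumes "mset xs = mset ys" "z \<in> set ys"
  shows "perm xs ys \<cdot> front z ys = front z xs \<cdot> (I 1 \<oplus> perm (remove1 z xs) (remove1 z ys))"
  using assms
proof (induction ys arbitrary: xs)
  case (Cons y ys)
  have y: "y \<in> set xs" "mset (remove1 y xs) = mset ys" "z \<in> set xs"
    using Cons.prems by (metis list.set_intros(1) set_mset_mset, simp, metis set_mset_mset)
  have lxs: "length xs = Suc (length ys)" using Cons.prems by (metis length_Cons size_mset)
  show ?case
  proof (cases "y = z")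
    case True
    then show ?thesis using y lxs by (simp add: comp_simps length_remove1)
  next
    case False
    then have z: "z \<in> set ys" using Cons.prems by simp
    then obtain n where n: "length ys = Suc n" by (cases ys) auto
    have r: "remove1 z (remove1 y xs) = remove1 y (remove1 z xs)" by (rule remove1_commute)
    have m: "mset (remove1 y (remove1 z xs)) = mset (remove1 z ys)"
      using y(2) by (metis r mset_remove1)
    have mem: "z \<in> set (remove1 y xs)" "y \<in> set (remove1 z xs)" using False y by auto
    have l: "length (remove1 y xs) = Suc n" "length (remove1 z xs) = Suc n" "length (remove1 z ys) = n"
      "length (remove1 y (remove1 z xs)) = n"
      using n lxs y z mem by (simp_all add: length_remove1)
    let ?p = "perm (remove1 y xs) ys" and ?q = "perm (remove1 y (remove1 z xs)) (remove1 z ys)"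
    have [simp]: "?p \<in> arrs X" "src X ?p = Suc n" "trg X ?p = Suc n" "?q \<in> arrs X" "src X ?q = n" "trg X ?q = n"
      using y m l n by simp_all
    have [simp]: "front z ys \<in> arrs X" "src X (front z ys) = Suc n" "trg X (front z ys) = Suc n"
      using z n by simp_all
    have [simp]: "front y xs \<in> arrs X" "src X (front y xs) = Suc (Suc n)" "trg X (front y xs) = Suc (Suc n)"
      using y n lxs by simp_all
    have [simp]: "front z (remove1 y xs) \<in> arrs X" "src X (front z (remove1 y xs)) = Suc n" "trg X (front z (remove1 y xs)) = Suc n"
      using mem l by simp_all
    have [simp]: "front z xs \<in> arrs X" "src X (front z xs) = Suc (Suc n)" "trg X (front z xs) = Suc (Suc n)"
      using y lxs n by simp_all
    have [simp]: "front y (remove1 z xs) \<in> arrs X" "src X (front y (remove1 z xs)) = Suc n" "trg X (front y (remove1 z xs)) = Suc n"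
      using mem l by simp_all
    have IH: "?p \<cdot> front z ys = front z (remove1 y xs) \<cdot> (I 1 \<oplus> ?q)"
      using Cons.IH[OF y(2) z] r by simp
    have "perm xs (y # ys) \<cdot> front z (y # ys)
      = front y xs \<cdot> (I 1 \<oplus> (?p \<cdot> front z ys)) \<cdot> (\<sigma> 1 1 \<oplus> I n)"
      using False n by (simp add: whisk_left comp_simps)
    also have "\<dots> = front y xs \<cdot> (I 1 \<oplus> front z (remove1 y xs)) \<cdot> ((I 2 \<oplus> ?q) \<cdot> (\<sigma> 1 1 \<oplus> I n))"
      unfolding IH by (simp add: whisk_left comp_simps whisk_add numeral_2_eq_2)
    also have "(I 2 \<oplus> ?q) \<cdot> (\<sigma> 1 1 \<oplus> I n) = (\<sigma> 1 1 \<oplus> I n) \<cdot> (I 2 \<oplus> ?q)"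
      by (simp add: inter comp_simps numeral_2_eq_2)
    also have "front y xs \<cdot> (I 1 \<oplus> front z (remove1 y xs)) \<cdot> ((\<sigma> 1 1 \<oplus> I n) \<cdot> (I 2 \<oplus> ?q)) =
      (front y xs \<cdot> (I 1 \<oplus> front z (remove1 y xs)) \<cdot> (\<sigma> 1 1 \<oplus> I n)) \<cdot> (I 2 \<oplus> ?q)"
      by (simp add: comp_simps numeral_2_eq_2)
    also have "front y xs \<cdot> (I 1 \<oplus> front z (remove1 y xs)) \<cdot> (\<sigma> 1 1 \<oplus> I n) =
      front z xs \<cdot> (I 1 \<oplus> front y (remove1 z xs))"
      using front_comm[OF y(1,3) False] lxs n by simp
    also have "front z xs \<cdot> (I 1 \<oplus> front y (remove1 z xs)) \<cdot> (I 2 \<oplus> ?q) =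
      front z xs \<cdot> (I 1 \<oplus> perm (remove1 z xs) (remove1 z (y # ys)))"
      using False by (simp add: whisk_left comp_simps whisk_add numeral_2_eq_2)
    finally show ?thesis .
  qed
qed simp

text \<open>The coherence statement used for all later reorderings. The first wire wanted by
  \<open>zs\<close> is pulled through \<open>perm xs ys\<close> by \<open>perm_front\<close>, and
  the remaining wires follow by induction.\<close>

lemma perm_trans:
  assumes "mset xs = mset ys" "mset ys = mset zs"
  shows "perm xs ys \<cdot> perm ys zs = perm xs zs"
  using assms
proof (induction zs arbitrary: xs ys)
  case Nil
  then show ?case by (simp add: comp_simps)
next
  case (Cons z zs)
  have z: "z \<in> set ys" "z \<in> set xs" using Cons.prems by (metis list.set_intros(1) set_mset_mset)+
  have m: "mset (remove1 z xs) = mset (remove1 z ys)" "mset (remove1 z ys) = mset zs"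
    "mset (remove1 z xs) = mset zs"
    using Cons.prems by auto
  have l: "length xs = length ys" "length ys = Suc (length zs)" "length (remove1 z ys) = length zs"
     "length (remove1 z xs) = length zs"
    using Cons.prems m by (metis size_mset length_Cons)+
  have "perm xs ys \<cdot> perm ys (z # zs) = perm xs ys \<cdot> front z ys \<cdot> (I 1 \<oplus> perm (remove1 z ys) zs)"
    using z m l Cons.prems(1) by (simp add: comp_simps)
  also have "\<dots> = front z xs \<cdot> (I 1 \<oplus> (perm (remove1 z xs) (remove1 z ys) \<cdot> perm (remove1 z ys) zs))"
    using perm_front[OF Cons.prems(1) z(1)] z m l by (simp add: comp_simps whisk_left)
  also have "\<dots> = perm xs (z # zs)" using Cons.IH[OF m(1,2)] by simp
  finally show ?case .
qed

lemma front_append: "y \<in> set xs \<Longrightarrow> front y (xs @ zs) = front y xs \<oplus> I (length zs)"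
proof (induction xs)
  case (Cons x xs)
  show ?case
  proof (cases "x = y")
    case False
    then have y: "y \<in> set xs" using Cons.prems by simp
    then obtain n where n: "length xs = Suc n" by (cases xs) auto
    show ?thesis using False n y Cons.IH[OF y] by (simp add: whisk_right tens_simps)
  qed (simp add: tens_simps)
qed simp

lemma perm_append_right:
  "mset xs = mset ys \<Longrightarrow> perm (xs @ zs) (ys @ zs) = perm xs ys \<oplus> I (length zs)"
proof (induction ys arbitrary: xs)
  case Nil
  then show ?case by (simp add: perm_refl tens_simps)
next
  case (Cons y ys)
  have y: "y \<in> set xs" "mset (remove1 y xs) = mset ys"
    using Cons.prems by (metis list.set_intros(1) set_mset_mset, simp)
  have l: "length xs = Suc (length ys)" "length (remove1 y xs) = length ys"
    using Cons.prems y by (metis size_mset length_Cons)+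
  show ?case using y l Cons.IH[OF y(2)]
    by (simp add: front_append remove1_append whisk_right tens_simps)
qed

lemma perm_append_left:
  "mset xs = mset ys \<Longrightarrow> perm (zs @ xs) (zs @ ys) = I (length zs) \<oplus> perm xs ys"
proof (induction zs)
  case (Cons z zs)
  have "length xs = length ys" using Cons.prems by (metis size_mset)
  then show ?case using Cons by (simp add: comp_simps whisk_add)
qed (simp add: tens_simps)

lemma front_snoc: "y \<notin> set xs \<Longrightarrow> front y (xs @ [y]) = \<sigma> (length xs) 1"
proof (induction xs)
  case (Cons x xs)
  then show ?case using sym_hexagon_rev[of 1 "length xs" 1] by simp
qed (simp add: sym_zero_left)

text \<open>Links the sorting words with the given block symmetries. Disjointness ensures that the
  name looked up by \<open>front\<close> is found in the second block and not earlier.\<close>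

lemma perm_swap: "set xs \<inter> set ys = {} \<Longrightarrow> perm (xs @ ys) (ys @ xs) = \<sigma> (length xs) (length ys)"
proof (induction ys)
  case (Cons y ys)
  have r: "remove1 y (xs @ y # ys) = xs @ ys" using Cons.prems by (simp add: remove1_append)
  have f: "front y (xs @ y # ys) = \<sigma> (length xs) 1 \<oplus> I (length ys)"
    using front_append[of y "xs @ [y]" ys] front_snoc[of y xs] Cons.prems by simp
  show ?case using Cons r f symm_hexagon[of "length xs" 1 "length ys"] by simp
qed (simp add: perm_refl sym_zero_right)

end

section \<open>Normal forms along topological orders of edges\<close>

definition rest :: "'g hgraph \<Rightarrow> nat \<Rightarrow> nat list \<Rightarrow> nat list" where
  "rest A h ins = filter (\<lambda>v. v \<notin> set (sources A h)) ins"

text \<open>The edges \<open>hs\<close> are executed in turn on a frontier, initially \<open>ins\<close>. The targets of the remaining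
  edges must avoid the frontier at every stage, so that a consumed node never reappears.\<close>

primrec run :: "'g hgraph \<Rightarrow> nat list \<Rightarrow> nat list \<Rightarrow> nat list \<Rightarrow> bool" where
  "run A [] ins outs \<longleftrightarrow> distinct ins \<and> mset ins = mset outs"
| "run A (h # hs) ins outs \<longleftrightarrow> distinct ins \<and> distinct (sources A h) \<and> set (sources A h) \<subseteq> set ins \<and>
    distinct (targets A h) \<and> (\<forall>h' \<in> set (h # hs). set (targets A h') \<inter> set ins = {}) \<and>
    run A hs (rest A h ins @ targets A h) outs"

lemma run_distinct: "run A hs ins outs \<Longrightarrow> distinct ins"
  by (cases hs) auto

lemma mset_rest:
  assumes "distinct ins" "distinct (sources A h)" "set (sources A h) \<subseteq> set ins"
  shows "mset ins = mset (rest A h ins @ sources A h)"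
proof -
  have "distinct (rest A h ins @ sources A h)" "set ins = set (rest A h ins @ sources A h)"
    using assms by (auto simp: rest_def)
  then show ?thesis using assms(1) by (metis set_eq_iff_mset_eq_distinct)
qed

lemma mset_rest_cong: "mset xs = mset ins \<Longrightarrow> mset (rest A h xs) = mset (rest A h ins)"
  by (simp add: rest_def)

lemma run_mset:
  assumes "run A hs ins outs" "mset xs = mset ins"
  shows "run A hs xs outs"
  using assms
proof (induction hs arbitrary: ins xs)
  case Nil
  then show ?case by simp (metis mset_eq_imp_distinct_iff)
next
  case (Cons h hs)
  have "run A hs (rest A h xs @ targets A h) outs"
  proof (rule Cons.IH)
    show "run A hs (rest A h ins @ targets A h) outs" using Cons.prems(1) by simp
    show "mset (rest A h xs @ targets A h) = mset (rest A h ins @ targets A h)"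
      using mset_rest_cong[OF Cons.prems(2)] by simp
  qed
  moreover have "distinct xs" "set xs = set ins"
    using Cons.prems by (auto dest: mset_eq_imp_distinct_iff mset_eq_setD)
  ultimately show ?case using Cons.prems by simp
qed

lemma run_mset_out:
  "run A hs ins outs \<Longrightarrow> mset outs = mset ys \<Longrightarrow> run A hs ins ys"
  by (induction hs arbitrary: ins) auto

lemma run_sources:
  "run A hs ins outs \<Longrightarrow> h \<in> set hs \<Longrightarrow>
    set (sources A h) \<subseteq> set ins \<union> (\<Union>h \<in> set hs. set (targets A h))"
proof (induction hs arbitrary: ins)
  case (Cons k hs)
  have r: "set (rest A k ins) \<subseteq> set ins" by (auto simp: rest_def)
  show ?case
  proof (cases "h = k")
    case False
    then have "set (sources A h) \<subseteq> set (rest A k ins @ targets A k) \<union> (\<Union>h \<in> set hs. set (targets A h))"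
      using Cons.prems by (intro Cons.IH) auto
    then show ?thesis using r by auto
  qed (use Cons.prems in auto)
qed simp

text \<open>\<open>run\<close> demands freshness of all later targets at every stage, so the targets
  of the second part must avoid the initial frontier and everything that the first part
  produces.\<close>

lemma run_append:
  assumes "run A hs ins mid" "run A hs' mid outs"
    "\<And>h. h \<in> set hs' \<Longrightarrow> set (targets A h) \<inter> (set ins \<union> (\<Union>h \<in> set hs. set (targets A h))) = {}"
  shows "run A (hs @ hs') ins outs"
  using assms
proof (induction hs arbitrary: ins)
  case Nil
  then show ?case by (auto intro: run_mset)
next
  case (Cons h hs)
  have "set (rest A h ins) \<subseteq> set ins" by (auto simp: rest_def)
  then have "set (targets A k) \<inter> (set (rest A h ins @ targets A h) \<union> (\<Union>h \<in> set hs. set (targets A h))) = {}"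
    if "k \<in> set hs'" for k
    using Cons.prems(3)[OF that] by auto
  then have "run A (hs @ hs') (rest A h ins @ targets A h) outs"
    using Cons.prems(1,2) by (intro Cons.IH) simp_all
  then show ?case using Cons.prems by auto
qed

lemma rest_append: "rest A h (xs @ ys) = rest A h xs @ rest A h ys"
  by (simp add: rest_def)

lemma rest_disjoint: "set zs \<inter> set (sources A h) = {} \<Longrightarrow> rest A h zs = zs"
  unfolding rest_def by (intro filter_True) auto

lemma rest_self: "rest A h (sources A h) = []"
  unfolding rest_def by (intro filter_False) auto

lemma run_prepend:
  assumes "run A hs ins outs" "distinct zs"
    "set zs \<inter> (set ins \<union> (\<Union>h \<in> set hs. set (targets A h))) = {}"
  shows "run A hs (zs @ ins) (zs @ outs)"
  using assms
proof (induction hs arbitrary: ins)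
  case (Cons h hs)
  have r: "set (rest A h ins) \<subseteq> set ins" by (auto simp: rest_def)
  have "rest A h zs = zs" using Cons.prems by (intro rest_disjoint) auto
  moreover have "run A hs (zs @ rest A h ins @ targets A h) (zs @ outs)"
    using Cons.prems r by (intro Cons.IH) auto
  ultimately show ?case using Cons.prems by (auto simp: rest_append)
qed auto

lemma run_postpend:
  assumes "run A hs ins outs" "distinct zs"
    "set zs \<inter> (set ins \<union> (\<Union>h \<in> set hs. set (targets A h))) = {}"
  shows "run A hs (ins @ zs) (outs @ zs)"
  using run_mset_out[OF run_mset[OF run_prepend[OF assms], of "ins @ zs"]] by simp

text \<open>Ambient hypergraphs are arbitrary outside the denoted part, so typing of the arrows
  \<open>gam h\<close> is demanded only on the set \<open>E\<close>.\<close>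

locale wiring = prop_cat X for X :: "'a prop_data" +
  fixes A :: "'g hgraph" and gam :: "nat \<Rightarrow> 'a" and E :: "nat set"
  assumes gam_hom: "h \<in> E \<Longrightarrow> gam h \<in> homset X (length (sources A h)) (length (targets A h))"
begin

lemma gam_arr [simp]:
  "h \<in> E \<Longrightarrow> gam h \<in> arrs X" "h \<in> E \<Longrightarrow> src X (gam h) = length (sources A h)"
  "h \<in> E \<Longrightarrow> trg X (gam h) = length (targets A h)"
  using gam_hom by (auto simp: homset_def)

text \<open>Each step sorts the sources of \<open>h\<close> to the right end of the frontier,
  applies \<open>gam h\<close> there and appends its targets. The order of the idle wires is a
  choice that \<open>nf_perm\<close> shows to be immaterial.\<close>

primrec nf :: "nat list \<Rightarrow> nat list \<Rightarrow> nat list \<Rightarrow> 'a" where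
  "nf [] ins outs = perm ins outs"
| "nf (h # hs) ins outs = perm ins (rest A h ins @ sources A h) \<cdot>
     (I (length (rest A h ins)) \<oplus> gam h) \<cdot> nf hs (rest A h ins @ targets A h) outs"

lemma nf_arr:
  "run A hs ins outs \<Longrightarrow> set hs \<subseteq> E \<Longrightarrow>
    nf hs ins outs \<in> arrs X \<and> src X (nf hs ins outs) = length ins \<and> trg X (nf hs ins outs) = length outs"
proof (induction hs arbitrary: ins)
  case (Cons h hs)
  then have "mset ins = mset (rest A h ins @ sources A h)" by (intro mset_rest) auto
  then show ?case using Cons by simp
qed simp

lemma nf_arrs [simp]:
  assumes "run A hs ins outs" "set hs \<subseteq> E"
  shows "nf hs ins outs \<in> arrs X" "src X (nf hs ins outs) = length ins" "trg X (nf hs ins outs) = length outs"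
  using nf_arr[OF assms] by auto

text \<open>A reordering of the frontier splits into one of the idle wires and one absorbed by the
  sorting step. The former slides past \<open>gam h\<close> and is passed on to the rest of the
  run.\<close>

lemma nf_perm:
  assumes "run A hs ins outs" "set hs \<subseteq> E" "mset xs = mset ins"
  shows "nf hs xs outs = perm xs ins \<cdot> nf hs ins outs"
  using assms
proof (induction hs arbitrary: ins xs)
  case Nil
  then show ?case by (simp add: perm_trans)
next
  case (Cons h hs)
  let ?ri = "rest A h ins" and ?rx = "rest A h xs" and ?s = "sources A h" and ?t = "targets A h"
  have m: "mset ins = mset (?ri @ ?s)" using Cons.prems by (intro mset_rest) auto
  have r: "mset ?rx = mset ?ri" by (rule mset_rest_cong[OF Cons.prems(3)])
  have l: "length ?rx = length ?ri" using r by (metis size_mset)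
  have R: "run A hs (?ri @ ?t) outs" and E: "set hs \<subseteq> E" "h \<in> E" using Cons.prems by auto
  have l2: "length ins = length ?ri + length ?s" using m by (metis size_mset length_append)
  have l3: "length xs = length ?ri + length ?s" using l2 Cons.prems(3) by (metis size_mset)
  have IH: "nf hs (?rx @ ?t) outs = (perm ?rx ?ri \<oplus> I (length ?t)) \<cdot> nf hs (?ri @ ?t) outs"
    using Cons.IH[OF R E(1), of "?rx @ ?t"] r by (simp add: perm_append_right)
  have [simp]: "nf hs (?ri @ ?t) outs \<in> arrs X" "src X (nf hs (?ri @ ?t) outs) = length ?ri + length ?t"
    using R E by simp_all
  have pp: "perm xs (?rx @ ?s) \<cdot> (perm ?rx ?ri \<oplus> I (length ?s)) = perm xs ins \<cdot> perm ins (?ri @ ?s)"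
    using m r Cons.prems(3) by (simp add: perm_append_right[symmetric] perm_trans)
  have sl: "(I (length ?rx) \<oplus> gam h) \<cdot> (perm ?rx ?ri \<oplus> I (length ?t)) =
      (perm ?rx ?ri \<oplus> I (length ?s)) \<cdot> (I (length ?ri) \<oplus> gam h)"
    using r l E by (simp add: slide)
  have "nf (h # hs) xs outs = perm xs (?rx @ ?s) \<cdot>
     ((I (length ?rx) \<oplus> gam h) \<cdot> (perm ?rx ?ri \<oplus> I (length ?t))) \<cdot> nf hs (?ri @ ?t) outs"
    using m r l E l2 l3 Cons.prems(3) IH by (simp add: comp_simps)
  also have "\<dots> = perm xs (?rx @ ?s) \<cdot> (perm ?rx ?ri \<oplus> I (length ?s)) \<cdot> (I (length ?ri) \<oplus> gam h) \<cdot> nf hs (?ri @ ?t) outs"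
    unfolding sl using m r l E l2 l3 Cons.prems(3) by (simp add: comp_simps)
  also have "\<dots> = perm xs ins \<cdot> nf (h # hs) ins outs"
    unfolding pp using m r l E l2 l3 Cons.prems(3) by (simp add: comp_simps)
  finally show ?case .
qed

lemma nf_perm_out:
  assumes "run A hs ins outs" "set hs \<subseteq> E" "mset outs = mset ys"
  shows "nf hs ins ys = nf hs ins outs \<cdot> perm outs ys"
  using assms
proof (induction hs arbitrary: ins)
  case Nil
  then show ?case by (simp add: perm_trans)
next
  case (Cons h hs)
  let ?ri = "rest A h ins" and ?s = "sources A h" and ?t = "targets A h"
  have m: "mset ins = mset (?ri @ ?s)" using Cons.prems by (intro mset_rest) auto
  have R: "run A hs (?ri @ ?t) outs" and E: "set hs \<subseteq> E" "h \<in> E" using Cons.prems by auto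
  have IH: "nf hs (?ri @ ?t) ys = nf hs (?ri @ ?t) outs \<cdot> perm outs ys"
    by (rule Cons.IH[OF R E(1) Cons.prems(3)])
  have [simp]: "nf hs (?ri @ ?t) outs \<in> arrs X" "src X (nf hs (?ri @ ?t) outs) = length ?ri + length ?t"
    "trg X (nf hs (?ri @ ?t) outs) = length outs"
    using R E by simp_all
  show ?case using IH m Cons.prems(3) E by (simp add: comp_simps)
qed

lemma nf_append:
  assumes "run A hs ins mid" "run A hs' mid outs" "set hs \<subseteq> E" "set hs' \<subseteq> E"
  shows "nf (hs @ hs') ins outs = nf hs ins mid \<cdot> nf hs' mid outs"
  using assms
proof (induction hs arbitrary: ins)
  case Nil
  then show ?case using nf_perm[of hs' mid outs ins] by simp
next
  case (Cons h hs)
  let ?ri = "rest A h ins" and ?s = "sources A h" and ?t = "targets A h"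
  have m: "mset ins = mset (?ri @ ?s)" using Cons.prems by (intro mset_rest) auto
  have R: "run A hs (?ri @ ?t) mid" and E: "set hs \<subseteq> E" "h \<in> E" using Cons.prems by auto
  have IH: "nf (hs @ hs') (?ri @ ?t) outs = nf hs (?ri @ ?t) mid \<cdot> nf hs' mid outs"
    by (rule Cons.IH[OF R Cons.prems(2) E(1) Cons.prems(4)])
  have [simp]: "nf hs (?ri @ ?t) mid \<in> arrs X" "src X (nf hs (?ri @ ?t) mid) = length ?ri + length ?t"
    "trg X (nf hs (?ri @ ?t) mid) = length mid" "nf hs' mid outs \<in> arrs X" "src X (nf hs' mid outs) = length mid"
    using R E Cons.prems by simp_all
  show ?case using IH m E by (simp add: comp_simps)
qed

text \<open>Wires on the left are never sources here, so they stay in front of every intermediate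
  frontier and every sorting step fixes them.\<close>

lemma nf_prepend:
  assumes "run A hs ins outs" "set hs \<subseteq> E"
    "set zs \<inter> (set ins \<union> (\<Union>h \<in> set hs. set (targets A h))) = {}"
  shows "nf hs (zs @ ins) (zs @ outs) = I (length zs) \<oplus> nf hs ins outs"
  using assms
proof (induction hs arbitrary: ins)
  case Nil
  then show ?case by (simp add: perm_append_left)
next
  case (Cons h hs)
  let ?ri = "rest A h ins" and ?s = "sources A h" and ?t = "targets A h"
  have r: "set ?ri \<subseteq> set ins" by (auto simp: rest_def)
  have z: "rest A h zs = zs" using Cons.prems by (intro rest_disjoint) auto
  have m: "mset ins = mset (?ri @ ?s)" using Cons.prems by (intro mset_rest) auto
  have R: "run A hs (?ri @ ?t) outs" and E: "set hs \<subseteq> E" "h \<in> E" using Cons.prems by auto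
  have IH: "nf hs (zs @ ?ri @ ?t) (zs @ outs) = I (length zs) \<oplus> nf hs (?ri @ ?t) outs"
    using Cons.prems r by (intro Cons.IH[OF R E(1)]) auto
  have [simp]: "nf hs (?ri @ ?t) outs \<in> arrs X" "src X (nf hs (?ri @ ?t) outs) = length ?ri + length ?t"
    using R E by simp_all
  show ?case using IH m E z perm_append_left[OF m, of zs]
    by (simp add: rest_append whisk_left whisk_add)
qed

text \<open>Targets are appended on the right, so idle wires on that side do not stay in place. The
  statement is \<open>nf_prepend\<close> conjugated by block symmetries, which cancel by
  naturality.\<close>

lemma nf_postpend:
  assumes "run A hs ins outs" "set hs \<subseteq> E" "distinct zs"
    "set zs \<inter> (set ins \<union> (\<Union>h \<in> set hs. set (targets A h))) = {}" "set zs \<inter> set outs = {}"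
  shows "nf hs (ins @ zs) (outs @ zs) = nf hs ins outs \<oplus> I (length zs)"
proof -
  let ?N = "nf hs ins outs" and ?z = "length zs"
  have R: "run A hs (zs @ ins) (zs @ outs)" by (rule run_prepend[OF assms(1,3,4)])
  have R': "run A hs (ins @ zs) (zs @ outs)" by (rule run_mset[OF R]) simp
  have 1: "nf hs (ins @ zs) (outs @ zs) = nf hs (ins @ zs) (zs @ outs) \<cdot> perm (zs @ outs) (outs @ zs)"
    by (rule nf_perm_out[OF R' assms(2)]) simp
  have 2: "nf hs (ins @ zs) (zs @ outs) = perm (ins @ zs) (zs @ ins) \<cdot> nf hs (zs @ ins) (zs @ outs)"
    by (rule nf_perm[OF R assms(2)]) simp
  have 3: "nf hs (zs @ ins) (zs @ outs) = I ?z \<oplus> ?N"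
    by (rule nf_prepend[OF assms(1,2,4)])
  have 4: "perm (ins @ zs) (zs @ ins) = \<sigma> (length ins) ?z"
    by (rule perm_swap) (use assms(4) in blast)
  have 5: "perm (zs @ outs) (outs @ zs) = \<sigma> ?z (length outs)"
    by (rule perm_swap[OF assms(5)])
  have N: "?N \<in> arrs X" "src X ?N = length ins" "trg X ?N = length outs"
    using nf_arrs[OF assms(1,2)] by auto
  have 6: "\<sigma> (length ins) ?z \<cdot> (I ?z \<oplus> ?N) = (?N \<oplus> I ?z) \<cdot> \<sigma> (length outs) ?z"
    by (rule nat_sym[symmetric]) (use N in simp_all)
  have "nf hs (ins @ zs) (outs @ zs) = (?N \<oplus> I ?z) \<cdot> \<sigma> (length outs) ?z \<cdot> \<sigma> ?z (length outs)"
    unfolding 1 2 3 4 5 6 ..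
  also have "\<dots> = (?N \<oplus> I ?z) \<cdot> (\<sigma> (length outs) ?z \<cdot> \<sigma> ?z (length outs))"
    by (rule comp_simps(3)) (use N in simp_all)
  also have "\<dots> = ?N \<oplus> I ?z"
    unfolding sym_inv by (rule comp_simps(2)) (use N in simp_all)
  finally show ?thesis .
qed

end

section \<open>Exchange of independent edges\<close>

lemma run_fresh:
  "run A hs ins outs \<Longrightarrow> h \<in> set hs \<Longrightarrow> set (targets A h) \<inter> set ins = {}"
  by (cases hs) auto

lemma run_outs:
  "run A hs ins outs \<Longrightarrow> set outs \<subseteq> set ins \<union> (\<Union>h \<in> set hs. set (targets A h))"
proof (induction hs arbitrary: ins)
  case Nil
  then show ?case by (auto dest: mset_eq_setD)
next
  case (Cons k hs)
  have r: "set (rest A k ins) \<subseteq> set ins" by (auto simp: rest_def)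
  have "set outs \<subseteq> set (rest A k ins @ targets A k) \<union> (\<Union>h \<in> set hs. set (targets A h))"
    using Cons.prems by (intro Cons.IH) auto
  then show ?case using r by auto
qed

lemma run_distinct_outs: "run A hs ins outs \<Longrightarrow> distinct outs"
  by (induction hs arbitrary: ins) (auto dest: mset_eq_imp_distinct_iff)

context wiring
begin

text \<open>The symmetries are those that \<open>nf\<close> creates when it executes two boxes on
  adjacent blocks, one order per equation. Both orders reduce to the parallel product by naturality
  and the interchange law.\<close>

lemma swap_calc:
  assumes "f \<in> arrs X" "g \<in> arrs X" "src X f = s" "trg X f = t" "src X g = s'" "trg X g = t'"
  shows "\<sigma> s s' \<cdot> (I s' \<oplus> f) \<cdot> \<sigma> s' t \<cdot> (I t \<oplus> g) = f \<oplus> g"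
    and "(I s \<oplus> g) \<cdot> \<sigma> s t' \<cdot> (I t' \<oplus> f) \<cdot> \<sigma> t' t = f \<oplus> g"
proof -
  have 1: "\<sigma> s s' \<cdot> (I s' \<oplus> f) = (f \<oplus> I s') \<cdot> \<sigma> t s'"
    by (rule nat_sym[symmetric]) (use assms in simp_all)
  have "\<sigma> s s' \<cdot> (I s' \<oplus> f) \<cdot> \<sigma> s' t = (f \<oplus> I s') \<cdot> (\<sigma> t s' \<cdot> \<sigma> s' t)"
    unfolding 1 using assms by (simp add: comp_simps)
  also have "\<dots> = f \<oplus> I s'"
    unfolding sym_inv by (rule comp_simps(2)) (use assms in simp_all)
  finally have 2: "\<sigma> s s' \<cdot> (I s' \<oplus> f) \<cdot> \<sigma> s' t = f \<oplus> I s'" .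
  show "\<sigma> s s' \<cdot> (I s' \<oplus> f) \<cdot> \<sigma> s' t \<cdot> (I t \<oplus> g) = f \<oplus> g"
    unfolding 2 by (rule slide(1)[OF assms])
  have 3: "\<sigma> s t' \<cdot> (I t' \<oplus> f) = (f \<oplus> I t') \<cdot> \<sigma> t t'"
    by (rule nat_sym[symmetric]) (use assms in simp_all)
  have "(I s \<oplus> g) \<cdot> \<sigma> s t' \<cdot> (I t' \<oplus> f) \<cdot> \<sigma> t' t = (I s \<oplus> g) \<cdot> (\<sigma> s t' \<cdot> (I t' \<oplus> f)) \<cdot> \<sigma> t' t"
    using assms by (simp add: comp_simps)
  also have "\<dots> = (I s \<oplus> g) \<cdot> (f \<oplus> I t') \<cdot> (\<sigma> t t' \<cdot> \<sigma> t' t)"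
    unfolding 3 using assms by (simp add: comp_simps)
  also have "\<dots> = (f \<oplus> g) \<cdot> I (t + t')"
    unfolding sym_inv slide(2)[OF assms] ..
  also have "\<dots> = f \<oplus> g" by (rule comp_simps(2)) (use assms in simp_all)
  finally show "(I s \<oplus> g) \<cdot> \<sigma> s t' \<cdot> (I t' \<oplus> f) \<cdot> \<sigma> t' t = f \<oplus> g" .
qed

text \<open>Both edges can start from the present frontier and share no source, so they act in
  parallel, and the two orders are the two sides of \<open>swap_calc\<close>. That the swapped order
  is again a run is part of the claim, because the bubbling argument iterates it.\<close>

lemma nf_swap:
  assumes R: "run A (h # k # hs) ins outs" and E: "set (h # k # hs) \<subseteq> E"
    and k: "set (sources A k) \<subseteq> set ins" "set (sources A h) \<inter> set (sources A k) = {}"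
  shows "run A (k # h # hs) ins outs \<and> nf (h # k # hs) ins outs = nf (k # h # hs) ins outs"
proof -
  let ?s = "sources A h" and ?t = "targets A h" and ?s' = "sources A k" and ?t' = "targets A k"
  \<comment> \<open>\<open>Q\<close> holds the wires used by neither edge. In the arrangement
    \<open>?st\<close> the sorting step before \<open>k\<close> is an identity and the one before
    \<open>h\<close> is a single block symmetry.\<close>
  define Q where "Q = rest A k (rest A h ins)"
  let ?st = "Q @ ?s @ ?s'"
  have d: "distinct ins" "distinct ?s" "set ?s \<subseteq> set ins" "distinct ?s'" "distinct ?t" "distinct ?t'"
    and fr: "\<And>h'. h' \<in> set (h # k # hs) \<Longrightarrow> set (targets A h') \<inter> set ins = {}"
    using R by auto
  have st: "distinct ?st" "set ?st = set ins"
    using d k by (auto simp: Q_def rest_def)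
  then have m: "mset ?st = mset ins" using d(1) by (metis set_eq_iff_mset_eq_distinct)
  have Qd: "set Q \<inter> set ?s = {}" "set Q \<inter> set ?s' = {}" "set Q \<subseteq> set ins"
    by (auto simp: Q_def rest_def)
  have td: "set ?t \<inter> set ins = {}" "set ?t' \<inter> set ins = {}" using fr by auto
  have "rest A h Q = Q" "rest A k Q = Q" "rest A h ?s' = ?s'" "rest A k ?s = ?s"
    "rest A k ?t = ?t" "rest A h ?t' = ?t'"
    by (rule rest_disjoint; use Qd k td d(3) in blast)+
  then have r1: "rest A h ?st = Q @ ?s'" and r2: "rest A k (Q @ ?s' @ ?t) = Q @ ?t"
    and r3: "rest A k ?st = Q @ ?s" and r4: "rest A h (Q @ ?s @ ?t') = Q @ ?t'"
    by (simp_all add: rest_append rest_self)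
  have R': "run A (h # k # hs) ?st outs" by (rule run_mset[OF R m])
  have R1: "run A (k # hs) (Q @ ?s' @ ?t) outs" using R' r1 by simp
  then have R2: "run A hs (Q @ ?t @ ?t') outs" using r2 by simp
  then have R3: "run A hs (Q @ ?t' @ ?t) outs" by (rule run_mset) simp
  have tt: "set ?t \<inter> set ?t' = {}" using R1 by auto
  have fr2: "set (targets A h') \<inter> set ?t = {}" "set (targets A h') \<inter> set ?t' = {}" if "h' \<in> set hs" for h'
    using run_fresh[OF R2 that] by auto
  have Rk: "run A (h # hs) (Q @ ?s @ ?t') outs"
  proof -
    have "distinct (Q @ ?s @ ?t')" using st td d by (auto simp: Q_def rest_def)
    moreover have "\<forall>h' \<in> set (h # hs). set (targets A h') \<inter> set (Q @ ?s @ ?t') = {}"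
    proof
      fix h' assume "h' \<in> set (h # hs)"
      then show "set (targets A h') \<inter> set (Q @ ?s @ ?t') = {}"
        using fr[of h'] fr2[of h'] tt Qd(3) d(3) by (cases "h' = h") auto
    qed
    ultimately show ?thesis using R3 r4 d by auto
  qed
  have "\<forall>h' \<in> set (k # h # hs). set (targets A h') \<inter> set ?st = {}"
    unfolding st(2) using fr by auto
  then have R'': "run A (k # h # hs) ?st outs" using Rk r3 d st by auto
  have E': "h \<in> E" "k \<in> E" "set hs \<subseteq> E" using E by auto
  let ?N = "nf hs (Q @ ?t @ ?t') outs" and ?q = "length Q"
  have N: "?N \<in> arrs X" "src X ?N = ?q + length ?t + length ?t'" "trg X ?N = length outs"
    using nf_arrs[OF R2 E'(3)] by auto
  have "nf (h # k # hs) ?st outs = (I ?q \<oplus> \<sigma> (length ?s) (length ?s')) \<cdot> (I (?q + length ?s') \<oplus> gam h) \<cdot>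
      ((I ?q \<oplus> \<sigma> (length ?s') (length ?t)) \<cdot> (I (?q + length ?t) \<oplus> gam k) \<cdot> ?N)"
  proof -
    have "perm ?st (Q @ ?s' @ ?s) = I ?q \<oplus> \<sigma> (length ?s) (length ?s')"
      using perm_append_left[of "?s @ ?s'" "?s' @ ?s" Q] perm_swap[OF k(2)] by simp
    moreover have "perm (Q @ ?s' @ ?t) (Q @ ?t @ ?s') = I ?q \<oplus> \<sigma> (length ?s') (length ?t)"
    proof -
      have "set ?s' \<inter> set ?t = {}" using td k by blast
      then show ?thesis using perm_append_left[of "?s' @ ?t" "?t @ ?s'" Q] perm_swap[of ?s' ?t] by simp
    qed
    ultimately show ?thesis by (simp add: r1 r2)
  qed
  also have "\<dots> = (I ?q \<oplus> (\<sigma> (length ?s) (length ?s') \<cdot> (I (length ?s') \<oplus> gam h) \<cdot> \<sigma> (length ?s') (length ?t) \<cdot>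
      (I (length ?t) \<oplus> gam k))) \<cdot> ?N"
    using E' N by (simp add: whisk_left whisk_add comp_simps)
  also have "\<dots> = (I ?q \<oplus> (gam h \<oplus> gam k)) \<cdot> ?N"
    using E' by (subst swap_calc(1)) simp_all
  also have "\<dots> = (I ?q \<oplus> ((I (length ?s) \<oplus> gam k) \<cdot> \<sigma> (length ?s) (length ?t') \<cdot>
      (I (length ?t') \<oplus> gam h) \<cdot> \<sigma> (length ?t') (length ?t))) \<cdot> ?N"
    using E' by (subst swap_calc(2)) simp_all
  also have "\<dots> = (I (?q + length ?s) \<oplus> gam k) \<cdot> ((I ?q \<oplus> \<sigma> (length ?s) (length ?t')) \<cdot>
      (I (?q + length ?t') \<oplus> gam h) \<cdot> ((I ?q \<oplus> \<sigma> (length ?t') (length ?t)) \<cdot> ?N))"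
    using E' N by (simp add: whisk_left whisk_add comp_simps)
  also have "\<dots> = nf (k # h # hs) ?st outs"
  proof -
    have "perm ?st (Q @ ?s @ ?s') = I (?q + length ?s + length ?s')"
      by (simp add: perm_refl add.assoc)
    moreover have "perm (Q @ ?s @ ?t') (Q @ ?t' @ ?s) = I ?q \<oplus> \<sigma> (length ?s) (length ?t')"
    proof -
      have "set ?s \<inter> set ?t' = {}" using td d by blast
      then show ?thesis using perm_append_left[of "?s @ ?t'" "?t' @ ?s" Q] perm_swap[of ?s ?t'] by simp
    qed
    moreover have "nf hs (Q @ ?t' @ ?t) outs = (I ?q \<oplus> \<sigma> (length ?t') (length ?t)) \<cdot> ?N"
    proof -
      have "nf hs (Q @ ?t' @ ?t) outs = perm (Q @ ?t' @ ?t) (Q @ ?t @ ?t') \<cdot> ?N"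
        by (rule nf_perm[OF R2 E'(3)]) simp
      then show ?thesis
        using perm_append_left[of "?t' @ ?t" "?t @ ?t'" Q] perm_swap[of ?t' ?t] tt by (simp add: Int_commute)
    qed
    ultimately show ?thesis using E' N by (simp add: r3 r4 comp_simps)
  qed
  finally have "nf (h # k # hs) ?st outs = nf (k # h # hs) ?st outs" .
  moreover have "nf (h # k # hs) ins outs = perm ins ?st \<cdot> nf (h # k # hs) ?st outs"
    by (rule nf_perm[OF R' E m[symmetric]])
  moreover have "nf (k # h # hs) ins outs = perm ins ?st \<cdot> nf (k # h # hs) ?st outs"
    by (rule nf_perm[OF R'' _ m[symmetric]]) (use E in auto)
  moreover have "run A (k # h # hs) ins outs" by (rule run_mset[OF R'' m[symmetric]])
  ultimately show ?thesis by simp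
qed

text \<open>An edge that is already enabled bubbles past every earlier edge \<open>k\<close>. A
  source \<open>v\<close> shared with \<open>k\<close> would be consumed by \<open>k\<close> and
  would have to be some edge's target to be available again, but all targets avoid the initial
  frontier.\<close>

lemma nf_front:
  assumes "run A (a @ h # b) ins outs" "set (a @ h # b) \<subseteq> E" "set (sources A h) \<subseteq> set ins"
  shows "run A (h # a @ b) ins outs \<and> nf (a @ h # b) ins outs = nf (h # a @ b) ins outs"
  using assms
proof (induction a arbitrary: ins)
  case (Cons k a)
  let ?i = "rest A k ins @ targets A k"
  have R: "run A (a @ h # b) ?i outs" using Cons.prems by simp
  have "v \<notin> set (sources A k)" if v: "v \<in> set (sources A h)" for v
  proof
    assume vk: "v \<in> set (sources A k)"
    have "set (sources A h) \<subseteq> set ?i \<union> (\<Union>h \<in> set (a @ h # b). set (targets A h))"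
      by (rule run_sources[OF R]) simp
    then have "v \<in> (\<Union>h \<in> set (k # a @ h # b). set (targets A h))"
      using v vk by (auto simp: rest_def)
    moreover have "set (targets A h') \<inter> set ins = {}" if "h' \<in> set (k # a @ h # b)" for h'
      using run_fresh[OF Cons.prems(1), of h'] that by simp
    ultimately show False using v Cons.prems(3) by blast
  qed
  then have dis: "set (sources A k) \<inter> set (sources A h) = {}" by auto
  then have s: "set (sources A h) \<subseteq> set ?i" using Cons.prems(3) by (auto simp: rest_def)
  have IH: "run A (h # a @ b) ?i outs" "nf (a @ h # b) ?i outs = nf (h # a @ b) ?i outs"
    using Cons.IH[OF R _ s] Cons.prems(2) by auto
  have R2: "run A (k # h # a @ b) ins outs" using IH(1) Cons.prems(1) by auto
  have "nf ((k # a) @ h # b) ins outs = nf (k # h # a @ b) ins outs" using IH(2) by simp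
  moreover have "run A (h # k # a @ b) ins outs \<and> nf (k # h # a @ b) ins outs = nf (h # k # a @ b) ins outs"
    by (rule nf_swap[OF R2 _ Cons.prems(3) dis]) (use Cons.prems(2) in auto)
  ultimately show ?case by simp
qed simp

text \<open>The first edge of one order is enabled at once, hence bubbles to the front of the other
  order; the tails are compared by induction.\<close>

lemma nf_unique:
  assumes "run A hs ins outs" "run A hs' ins outs" "set hs = set hs'" "distinct hs" "distinct hs'" "set hs \<subseteq> E"
  shows "nf hs ins outs = nf hs' ins outs"
  using assms
proof (induction hs arbitrary: ins hs')
  case (Cons h hs)
  then have "h \<in> set hs'" by auto
  then obtain a b where ab: "hs' = a @ h # b" by (meson split_list)
  have s: "set (sources A h) \<subseteq> set ins" using Cons.prems(1) by simp
  have F: "run A (h # a @ b) ins outs" "nf hs' ins outs = nf (h # a @ b) ins outs"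
    using nf_front[OF Cons.prems(2)[unfolded ab] _ s] Cons.prems(3,6) ab by auto
  have "nf hs (rest A h ins @ targets A h) outs = nf (a @ b) (rest A h ins @ targets A h) outs"
    by (rule Cons.IH) (use Cons.prems F ab in auto)
  then show ?case using F by simp
qed simp

end

section \<open>String diagrams\<close>

text \<open>A term of the free PROP denotes the nodes \<open>V\<close> and edges \<open>E\<close> of an ambient hypergraph \<open>A\<close>, with
  inputs \<open>i\<close> and outputs \<open>u\<close>. No quotient is involved: composition is a union in which the two parts
  share exactly the wires \<open>w\<close>.\<close>

primrec den :: "'g signature \<Rightarrow> 'g hgraph \<Rightarrow> 'g tm \<Rightarrow> nat set \<Rightarrow> nat set \<Rightarrow> nat list \<Rightarrow> nat list \<Rightarrow> bool" where
  "den S A (TId n) V E i u \<longleftrightarrow> i = u \<and> length i = n \<and> distinct i \<and> V = set i \<and> E = {}"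
| "den S A (TSym n m) V E i u \<longleftrightarrow> length i = n + m \<and> u = drop n i @ take n i \<and> distinct i \<and> V = set i \<and> E = {}"
| "den S A (TGen g) V E i u \<longleftrightarrow> (\<exists>h. E = {h} \<and> label A h = g \<and> sources A h = i \<and> targets A h = u \<and>
     distinct (i @ u) \<and> V = set (i @ u) \<and> g \<in> gens S \<and> length i = arity S g \<and> length u = coarity S g)"
| "den S A (TSeq s t) V E i u \<longleftrightarrow> (\<exists>V\<^sub>1 E\<^sub>1 V\<^sub>2 E\<^sub>2 w. den S A s V\<^sub>1 E\<^sub>1 i w \<and> den S A t V\<^sub>2 E\<^sub>2 w u \<and>
     V = V\<^sub>1 \<union> V\<^sub>2 \<and> V\<^sub>1 \<inter> V\<^sub>2 = set w \<and> E = E\<^sub>1 \<union> E\<^sub>2 \<and> E\<^sub>1 \<inter> E\<^sub>2 = {})"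
| "den S A (TPar s t) V E i u \<longleftrightarrow> (\<exists>V\<^sub>1 E\<^sub>1 V\<^sub>2 E\<^sub>2 i\<^sub>1 i\<^sub>2 u\<^sub>1 u\<^sub>2. den S A s V\<^sub>1 E\<^sub>1 i\<^sub>1 u\<^sub>1 \<and> den S A t V\<^sub>2 E\<^sub>2 i\<^sub>2 u\<^sub>2 \<and>
     i = i\<^sub>1 @ i\<^sub>2 \<and> u = u\<^sub>1 @ u\<^sub>2 \<and> V = V\<^sub>1 \<union> V\<^sub>2 \<and> V\<^sub>1 \<inter> V\<^sub>2 = {} \<and> E = E\<^sub>1 \<union> E\<^sub>2 \<and> E\<^sub>1 \<inter> E\<^sub>2 = {})"

lemma den_typing: "den S A t V E i u \<Longrightarrow> wt S t \<and> length i = tdom S t \<and> length u = tcod S t"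
proof (induction t arbitrary: V E i u)
  case (TSeq s t)
  then show ?case by (auto; metis)
next
  case (TPar s t)
  from TPar.prems show ?case by (auto dest!: TPar.IH)
qed auto

text \<open>Membership in \<open>edges A\<close> is not demanded: \<open>den\<close> takes sources,
  targets and labels from \<open>A\<close> but keeps its own set of edges.\<close>

definition typed_edges :: "'g signature \<Rightarrow> 'g hgraph \<Rightarrow> nat set" where
  "typed_edges S A = {h. label A h \<in> gens S \<and> length (sources A h) = arity S (label A h) \<and>
     length (targets A h) = coarity S (label A h)}"

text \<open>The term itself supplies a topological order: edges of a first factor precede those of a
  second. Covering \<open>V\<close> by inputs and targets is carried along because it yields the
  freshness conditions for concatenation.\<close>

lemma den_nf:
  assumes "prop_cat X" and \<gamma>: "\<And>g. g \<in> gens S \<Longrightarrow> \<gamma> g \<in> homset X (arity S g) (coarity S g)"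
    and "den S A t V E i u"
  shows "\<exists>hs. distinct hs \<and> set hs = E \<and> E \<subseteq> typed_edges S A \<and> run A hs i u \<and>
    V = set i \<union> (\<Union>h \<in> E. set (targets A h)) \<and>
    interp X \<gamma> t = wiring.nf X A (\<lambda>h. \<gamma> (label A h)) hs i u"
proof -
  interpret W: wiring X A "\<lambda>h. \<gamma> (label A h)" "typed_edges S A"
  proof -
    interpret prop_cat X by fact
    show "wiring X A (\<lambda>h. \<gamma> (label A h)) (typed_edges S A)"
    proof
      fix h assume "h \<in> typed_edges S A"
      then show "\<gamma> (label A h) \<in> homset X (length (sources A h)) (length (targets A h))"
        using \<gamma>[of "label A h"] by (auto simp: typed_edges_def)
    qed
  qed
  show ?thesis using assms(3)
  proof (induction t arbitrary: V E i u)
    case (TId n)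
    then show ?case by (intro exI[of _ "[]"]) (auto simp: W.perm_refl)
  next
    case (TSym n m)
    have "set (take n i) \<inter> set (drop n i) = {}"
      using TSym by (metis append_take_drop_id den.simps(2) distinct_append)
    then have "W.perm (take n i @ drop n i) (drop n i @ take n i) = symm X n m"
      using W.perm_swap[of "take n i" "drop n i"] TSym by simp
    moreover have "mset i = mset (drop n i) + mset (take n i)"
      by (metis append_take_drop_id mset_append union_commute)
    ultimately show ?case using TSym by (intro exI[of _ "[]"]) auto
  next
    case (TGen g)
    then obtain h where h: "E = {h}" "label A h = g" "sources A h = i" "targets A h = u"
      "distinct (i @ u)" "V = set (i @ u)" "g \<in> gens S" "length i = arity S g" "length u = coarity S g"
      by auto
    have r: "rest A h i = []" using h(3) rest_self by metis
    have E: "h \<in> typed_edges S A" using h by (simp add: typed_edges_def)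
    have "\<gamma> g \<in> arrs X" "src X (\<gamma> g) = length i" "trg X (\<gamma> g) = length u"
      using \<gamma>[OF h(7)] h by (auto simp: homset_def)
    then have "W.nf [h] i u = \<gamma> g" using h r by (simp add: W.perm_refl W.comp_simps W.tens_simps)
    then show ?case using h r E by (intro exI[of _ "[h]"]) auto
  next
    case (TSeq s t)
    then obtain V1 E1 V2 E2 w where d: "den S A s V1 E1 i w" "den S A t V2 E2 w u"
      "V = V1 \<union> V2" "V1 \<inter> V2 = set w" "E = E1 \<union> E2" "E1 \<inter> E2 = {}" by auto
    obtain hs where hs: "distinct hs" "set hs = E1" "E1 \<subseteq> typed_edges S A" "run A hs i w"
      "V1 = set i \<union> (\<Union>h \<in> E1. set (targets A h))" "interp X \<gamma> s = W.nf hs i w"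
      using TSeq.IH(1)[OF d(1)] by auto
    obtain ks where ks: "distinct ks" "set ks = E2" "E2 \<subseteq> typed_edges S A" "run A ks w u"
      "V2 = set w \<union> (\<Union>h \<in> E2. set (targets A h))" "interp X \<gamma> t = W.nf ks w u"
      using TSeq.IH(2)[OF d(2)] by auto
    have w: "set w \<subseteq> V1" using d(4) by blast
    have "run A (hs @ ks) i u"
    proof (rule run_append[OF hs(4) ks(4)])
      fix h assume h: "h \<in> set ks"
      then have "set (targets A h) \<subseteq> V2" using ks by auto
      then show "set (targets A h) \<inter> (set i \<union> (\<Union>h \<in> set hs. set (targets A h))) = {}"
        using run_fresh[OF ks(4) h] hs(2,5) d(4) by blast
    qed
    moreover have "W.nf (hs @ ks) i u = interp X \<gamma> (TSeq s t)"
      using W.nf_append[OF hs(4) ks(4)] hs ks by simp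
    ultimately show ?case using hs ks d w
      by (intro exI[of _ "hs @ ks"]) auto
  next
    case (TPar s t)
    then obtain V1 E1 V2 E2 i1 i2 u1 u2 where d: "den S A s V1 E1 i1 u1" "den S A t V2 E2 i2 u2"
      "i = i1 @ i2" "u = u1 @ u2" "V = V1 \<union> V2" "V1 \<inter> V2 = {}" "E = E1 \<union> E2" "E1 \<inter> E2 = {}" by auto
    obtain hs where hs: "distinct hs" "set hs = E1" "E1 \<subseteq> typed_edges S A" "run A hs i1 u1"
      "V1 = set i1 \<union> (\<Union>h \<in> E1. set (targets A h))" "interp X \<gamma> s = W.nf hs i1 u1"
      using TPar.IH(1)[OF d(1)] by auto
    obtain ks where ks: "distinct ks" "set ks = E2" "E2 \<subseteq> typed_edges S A" "run A ks i2 u2"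
      "V2 = set i2 \<union> (\<Union>h \<in> E2. set (targets A h))" "interp X \<gamma> t = W.nf ks i2 u2"
      using TPar.IH(2)[OF d(2)] by auto
    have o: "set u1 \<subseteq> V1" "set u2 \<subseteq> V2" using run_outs[OF hs(4)] run_outs[OF ks(4)] hs ks by auto
    have du1: "distinct u1" by (rule run_distinct_outs[OF hs(4)])
    have f1: "set i2 \<inter> (set i1 \<union> (\<Union>h \<in> set hs. set (targets A h))) = {}" "set i2 \<inter> set u1 = {}"
      using d(6) hs(2,5) ks(5) o by auto
    have f2: "set u1 \<inter> (set i2 \<union> (\<Union>h \<in> set ks. set (targets A h))) = {}"
      using d(6) ks(2,5) o by auto
    \<comment> \<open>Parallel factors are executed in turn: \<open>hs\<close> while
      \<open>i2\<close> is idle, then \<open>ks\<close> while the outputs \<open>u1\<close> are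
      idle.\<close>
    have R1: "run A hs (i1 @ i2) (u1 @ i2)"
      by (rule run_postpend[OF hs(4) run_distinct[OF ks(4)] f1(1)])
    have R2: "run A ks (u1 @ i2) (u1 @ u2)"
      by (rule run_prepend[OF ks(4) du1 f2])
    have "run A (hs @ ks) (i1 @ i2) (u1 @ u2)"
    proof (rule run_append[OF R1 R2])
      fix h assume h: "h \<in> set ks"
      then have "set (targets A h) \<subseteq> V2" using ks by auto
      then show "set (targets A h) \<inter> (set (i1 @ i2) \<union> (\<Union>h \<in> set hs. set (targets A h))) = {}"
        using run_fresh[OF ks(4) h] hs(2,5) d(6) by auto
    qed
    moreover have "W.nf (hs @ ks) (i1 @ i2) (u1 @ u2) = interp X \<gamma> (TPar s t)"
    proof -
      have 1: "W.nf hs (i1 @ i2) (u1 @ i2) = tens X (W.nf hs i1 u1) (idt X (length i2))"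
        by (rule W.nf_postpend[OF hs(4) _ run_distinct[OF ks(4)] f1]) (use hs in auto)
      have 2: "W.nf ks (u1 @ i2) (u1 @ u2) = tens X (idt X (length u1)) (W.nf ks i2 u2)"
        by (rule W.nf_prepend[OF ks(4) _ f2]) (use ks in auto)
      have "W.nf (hs @ ks) (i1 @ i2) (u1 @ u2) =
          cmp X (W.nf hs (i1 @ i2) (u1 @ i2)) (W.nf ks (u1 @ i2) (u1 @ u2))"
        using W.nf_append[OF R1 R2] hs ks by simp
      also have "\<dots> = tens X (W.nf hs i1 u1) (W.nf ks i2 u2)"
        unfolding 1 2 using W.nf_arrs[OF hs(4)] W.nf_arrs[OF ks(4)] hs ks by (intro W.slide(1)) auto
      finally show ?thesis using hs ks by simp
    qed
    ultimately show ?case using hs ks d by (intro exI[of _ "hs @ ks"]) auto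
  qed
qed

text \<open>Both terms are equal to normal forms for topological orders of the same set of edges, and any two
  such orders are connected by exchanges of adjacent independent edges.\<close>

lemma den_faithful:
  assumes "den S A s V E i u" "den S A t V E i u"
  shows "tm_class S {} s = tm_class S {} t"
proof -
  \<comment> \<open>In this generic interpretation a well-typed term is interpreted by its own
    class, so equality of normal forms becomes equality in the free PROP.\<close>
  let ?X = "presented S {}" and ?\<gamma> = "\<lambda>g. tm_class S {} (TGen g)"
  have X: "prop_cat ?X" by (rule prop_cat_presented)
  have \<gamma>: "?\<gamma> g \<in> homset ?X (arity S g) (coarity S g)" if "g \<in> gens S" for g
    unfolding homset_presented using that by (intro exI[of _ "TGen g"]) auto
  have int: "interp ?X ?\<gamma> t = tm_class S {} t" if "wt S t" for t
    using interp_presented[of S S "\<lambda>g. g" t "{}"] that by (simp add: tm.map_ident)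
  interpret W: wiring ?X A "\<lambda>h. ?\<gamma> (label A h)" "typed_edges S A"
  proof -
    interpret prop_cat ?X by fact
    show "wiring ?X A (\<lambda>h. ?\<gamma> (label A h)) (typed_edges S A)"
    proof
      fix h assume "h \<in> typed_edges S A"
      then show "?\<gamma> (label A h) \<in> homset ?X (length (sources A h)) (length (targets A h))"
        using \<gamma>[of "label A h"] by (auto simp: typed_edges_def)
    qed
  qed
  obtain hs where hs: "distinct hs" "set hs = E" "E \<subseteq> typed_edges S A" "run A hs i u"
    "interp ?X ?\<gamma> s = W.nf hs i u"
    using den_nf[OF X \<gamma> assms(1)] by blast
  obtain ks where ks: "distinct ks" "set ks = E" "run A ks i u" "interp ?X ?\<gamma> t = W.nf ks i u"
    using den_nf[OF X \<gamma> assms(2)] by blast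
  have "W.nf hs i u = W.nf ks i u"
    by (rule W.nf_unique) (use hs ks in auto)
  then show ?thesis using hs ks int den_typing[OF assms(1)] den_typing[OF assms(2)] by simp
qed

section \<open>Homomorphisms out of discrete hypergraphs as lists\<close>

text \<open>The relevant values of such a homomorphism, as a list. Equality up to
  \<open>heq\<close>, membership of the image and injectivity then become statements about lists,
  and copairing becomes concatenation.\<close>

definition leg :: "nat \<Rightarrow> hmap \<Rightarrow> nat list" where
  "leg n f = map (nmap f) [0..<n]"

definition lmap :: "nat list \<Rightarrow> hmap" where
  "lmap xs = node_map (\<lambda>k. xs ! k)"

lemma length_leg [simp]: "length (leg n f) = n"
  by (simp add: leg_def)

lemma leg_lmap [simp]: "leg (length xs) (lmap xs) = xs"
  by (simp add: leg_def lmap_def node_map_def map_nth)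

lemma leg_copair [simp]: "leg (i + j) (copair i f g) = leg i f @ leg j g"
proof -
  have "[0..<i + j] = [0..<i] @ [i..<i + j]" by (rule upt_add_eq_append) simp
  also have "[i..<i + j] = map (\<lambda>k. k + i) [0..<j]" by (simp add: map_add_upt add.commute)
  finally have "[0..<i + j] = [0..<i] @ map (\<lambda>k. k + i) [0..<j]" .
  then show ?thesis by (simp add: leg_def copair_def node_map_def)
qed

lemma hcomp_simps [simp]:
  "nmap (f \<then> g) = nmap g \<circ> nmap f" "emap (f \<then> g) = emap g \<circ> emap f"
  by (simp_all add: hcomp_def fun_eq_iff)

lemma hid_simps [simp]: "nmap hid = id" "emap hid = id"
  by (simp_all add: hid_def fun_eq_iff)

lemma leg_comp [simp]: "leg n (f \<then> g) = map (nmap g) (leg n f)"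
  by (simp add: leg_def)

lemma leg_hid [simp]: "leg n hid = [0..<n]"
  by (simp add: leg_def)

lemma leg_node_map [simp]: "leg n (node_map f) = map f [0..<n]"
  by (simp add: leg_def node_map_def)

lemma discrete_simps [simp]: "nodes (discrete n) = {..<n}" "edges (discrete n) = {}"
  by (simp_all add: discrete_def)

lemma hyp_discrete [simp]: "hyp S (discrete n)"
  by (simp add: hyp_def)

lemma heq_discrete: "heq (discrete n) f g \<longleftrightarrow> leg n f = leg n g"
  by (auto simp: heq_def leg_def)

lemma hom_discrete: "hyp_hom S (discrete n) G f \<longleftrightarrow> hyp S G \<and> set (leg n f) \<subseteq> nodes G"
  by (auto simp: hyp_hom_def leg_def)

lemma hom_comp: "hyp_hom S G H f \<Longrightarrow> hyp_hom S H K g \<Longrightarrow> hyp_hom S G K (f \<then> g)"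
  by (auto simp: hyp_hom_def)

lemma hom_hid: "hyp S G \<Longrightarrow> hyp_hom S G G hid"
  by (auto simp: hyp_hom_def)

lemma hom_hyp: "hyp_hom S G H f \<Longrightarrow> hyp S G \<and> hyp S H"
  by (simp add: hyp_hom_def)

lemma hom_map_nodes: "hyp_hom S G H f \<Longrightarrow> set xs \<subseteq> nodes G \<Longrightarrow> set (map (nmap f) xs) \<subseteq> nodes H"
  by (auto simp: hyp_hom_def)

lemma heq_map: "heq G f g \<Longrightarrow> set xs \<subseteq> nodes G \<Longrightarrow> map (nmap f) xs = map (nmap g) xs"
  by (auto simp: heq_def)

section \<open>Elements of terms in a hypergraph\<close>

text \<open>A term is interpreted in a hypergraph \<open>T\<close> as a span of sets between tuples of nodes of
  \<open>T\<close>; \<open>TSeq\<close> becomes a pullback of spans. By the universal properties of pushouts and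
  coproducts, the cospan denoted by the term represents this functor of \<open>T\<close>.\<close>

datatype val = U | VE nat | VSeq val "nat list" val | VPar val val

primrec vmap :: "hmap \<Rightarrow> val \<Rightarrow> val" where
  "vmap w U = U"
| "vmap w (VE h) = VE (emap w h)"
| "vmap w (VSeq a m b) = VSeq (vmap w a) (map (nmap w) m) (vmap w b)"
| "vmap w (VPar a b) = VPar (vmap w a) (vmap w b)"

abbreviation fsig :: "'g signature \<Rightarrow> ('g + frob_gen) signature" where
  "fsig S \<equiv> sig_sum S frob_sig"

primrec elem :: "'g signature \<Rightarrow> 'g hgraph \<Rightarrow> ('g + frob_gen) tm \<Rightarrow> val \<Rightarrow> nat list \<Rightarrow> nat list \<Rightarrow> bool" where
  "elem S T (TId n) x i u \<longleftrightarrow> x = U \<and> u = i \<and> length i = n \<and> set i \<subseteq> nodes T"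
| "elem S T (TSym n m) x i u \<longleftrightarrow> x = U \<and> u = drop n i @ take n i \<and> length i = n + m \<and> set i \<subseteq> nodes T"
| "elem S T (TGen g) x i u \<longleftrightarrow> (case g of
      Inl a \<Rightarrow> \<exists>h \<in> edges T. x = VE h \<and> label T h = a \<and> i = sources T h \<and> u = targets T h
    | Inr a \<Rightarrow> x = U \<and> (\<exists>v \<in> nodes T. i = replicate (arity frob_sig a) v \<and> u = replicate (coarity frob_sig a) v))"
| "elem S T (TSeq s t) x i u \<longleftrightarrow> (\<exists>a m b. x = VSeq a m b \<and> elem S T s a i m \<and> elem S T t b m u)"
| "elem S T (TPar s t) x i u \<longleftrightarrow> (\<exists>a b. x = VPar a b \<and>
      elem S T s a (take (tdom (fsig S) s) i) (take (tcod (fsig S) s) u) \<and>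
      elem S T t b (drop (tdom (fsig S) s) i) (drop (tcod (fsig S) s) u))"

lemma elem_bounds:
  assumes "hyp S T"
  shows "elem S T t x i u \<Longrightarrow> wt (fsig S) t \<Longrightarrow>
    length i = tdom (fsig S) t \<and> length u = tcod (fsig S) t \<and> set i \<subseteq> nodes T \<and> set u \<subseteq> nodes T"
proof (induction t arbitrary: x i u)
  case (TSym n m)
  then show ?case by (auto dest: in_set_takeD in_set_dropD)
next
  case (TGen g)
  then show ?case using assms
    by (auto simp: hyp_def sig_sum_def split: sum.splits)
next
  case (TSeq s t)
  then show ?case by fastforce
next
  case (TPar s t)
  then obtain a b where e: "elem S T s a (take (tdom (fsig S) s) i) (take (tcod (fsig S) s) u)"
      "elem S T t b (drop (tdom (fsig S) s) i) (drop (tcod (fsig S) s) u)" by auto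
  have 1: "length (take (tdom (fsig S) s) i) = tdom (fsig S) s \<and> length (take (tcod (fsig S) s) u) = tcod (fsig S) s
     \<and> set (take (tdom (fsig S) s) i) \<subseteq> nodes T \<and> set (take (tcod (fsig S) s) u) \<subseteq> nodes T"
    using TPar.IH(1)[OF e(1)] TPar.prems by simp
  have 2: "length (drop (tdom (fsig S) s) i) = tdom (fsig S) t \<and> length (drop (tcod (fsig S) s) u) = tcod (fsig S) t
     \<and> set (drop (tdom (fsig S) s) i) \<subseteq> nodes T \<and> set (drop (tcod (fsig S) s) u) \<subseteq> nodes T"
    using TPar.IH(2)[OF e(2)] TPar.prems by simp
  have "set i = set (take (tdom (fsig S) s) i) \<union> set (drop (tdom (fsig S) s) i)"
    "set u = set (take (tcod (fsig S) s) u) \<union> set (drop (tcod (fsig S) s) u)"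
    by (metis append_take_drop_id set_append)+
  moreover have "length i = tdom (fsig S) s + tdom (fsig S) t" "length u = tcod (fsig S) s + tcod (fsig S) t"
    using 1 2 by (auto simp: min_def split: if_splits)
  ultimately show ?case using 1 2 by auto
qed auto

lemma elem_hom:
  assumes "hyp_hom S T T' w"
  shows "elem S T t x i u \<Longrightarrow> elem S T' t (vmap w x) (map (nmap w) i) (map (nmap w) u)"
proof (induction t arbitrary: x i u)
  case (TId n)
  then show ?case using hom_map_nodes[OF assms] by simp
next
  case (TSym n m)
  then show ?case using hom_map_nodes[OF assms] by (simp add: take_map drop_map)
next
  case (TGen g)
  then show ?case using assms
    by (auto simp: hyp_hom_def split: sum.splits)
next
  case (TSeq s t)
  then show ?case by fastforce
next
  case (TPar s t)
  then show ?case by (auto simp: take_map drop_map)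
qed

section \<open>Representing cospans\<close>

text \<open>The triple \<open>(x, i, u)\<close> is a universal element: every element over every
  \<open>T\<close> is its image under exactly one homomorphism up to \<open>heq\<close>. Thus
  \<open>G\<close> represents the functor of elements of \<open>t\<close>.\<close>

definition univ :: "'g signature \<Rightarrow> ('g + frob_gen) tm \<Rightarrow> 'g hgraph \<Rightarrow> val \<Rightarrow> nat list \<Rightarrow> nat list \<Rightarrow> bool" where
  "univ S t G x i u \<longleftrightarrow> hyp S G \<and> elem S G t x i u \<and>
    (\<forall>T y j v. hyp S T \<longrightarrow> elem S T t y j v \<longrightarrow>
      (\<exists>w. hyp_hom S G T w \<and> vmap w x = y \<and> map (nmap w) i = j \<and> map (nmap w) u = v)) \<and>
    (\<forall>T w w'. hyp_hom S G T w \<longrightarrow> hyp_hom S G T w' \<longrightarrow> vmap w x = vmap w' x \<longrightarrow>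
      map (nmap w) i = map (nmap w') i \<longrightarrow> map (nmap w) u = map (nmap w') u \<longrightarrow> heq G w w')"

lemma vmap_comp: "vmap (f \<then> g) x = vmap g (vmap f x)"
  by (induction x) auto

lemma vmap_hid [simp]: "vmap hid x = x"
  by (induction x) simp_all

lemma map_hid: "map (nmap hid) xs = xs"
  by simp

lemma map_comp_hcomp: "map (nmap (f \<then> g)) xs = map (nmap g) (map (nmap f) xs)"
  by simp

text \<open>Uniqueness of representing objects: each universal element induces a map to the other,
  and both composites fix a universal element.\<close>

lemma univ_iso:
  assumes "univ S t G x i u" "univ S t H y j v"
  obtains f where "hyp_iso S G H f" "vmap f x = y" "map (nmap f) i = j" "map (nmap f) u = v"
proof -
  have G: "hyp S G" "elem S G t x i u" and H: "hyp S H" "elem S H t y j v"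
    using assms by (auto simp: univ_def)
  obtain f where f: "hyp_hom S G H f" "vmap f x = y" "map (nmap f) i = j" "map (nmap f) u = v"
    using assms(1) H unfolding univ_def by blast
  obtain g where g: "hyp_hom S H G g" "vmap g y = x" "map (nmap g) j = i" "map (nmap g) v = u"
    using assms(2) G unfolding univ_def by blast
  have "heq G (f \<then> g) hid"
  proof -
    have "\<forall>T w w'. hyp_hom S G T w \<longrightarrow> hyp_hom S G T w' \<longrightarrow> vmap w x = vmap w' x \<longrightarrow>
      map (nmap w) i = map (nmap w') i \<longrightarrow> map (nmap w) u = map (nmap w') u \<longrightarrow> heq G w w'"
      using assms(1) by (simp add: univ_def)
    then show ?thesis
      using hom_comp[OF f(1) g(1)] hom_hid[OF G(1)] f g
      by (metis vmap_comp map_comp_hcomp vmap_hid map_hid)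
  qed
  moreover have "heq H (g \<then> f) hid"
  proof -
    have "\<forall>T w w'. hyp_hom S H T w \<longrightarrow> hyp_hom S H T w' \<longrightarrow> vmap w y = vmap w' y \<longrightarrow>
      map (nmap w) j = map (nmap w') j \<longrightarrow> map (nmap w) v = map (nmap w') v \<longrightarrow> heq H w w'"
      using assms(2) by (simp add: univ_def)
    then show ?thesis
      using hom_comp[OF g(1) f(1)] hom_hid[OF H(1)] f g
      by (metis vmap_comp map_comp_hcomp vmap_hid map_hid)
  qed
  ultimately have "hyp_iso S G H f" using f g unfolding hyp_iso_def by blast
  then show ?thesis using that f by blast
qed

text \<open>\<open>heq\<close> says nothing outside \<open>T\<close>, but an element mentions only
  nodes and edges of \<open>T\<close>. Well-typedness bounds the middle tuples stored by
  \<open>VSeq\<close>.\<close>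

lemma vmap_elem_cong:
  assumes "hyp S T" "heq T w w'" "elem S T t x i u" "wt (fsig S) t"
  shows "vmap w x = vmap w' x"
  using assms(3,4)
proof (induction t arbitrary: x i u)
  case (TGen g)
  then show ?case using assms(2) by (auto simp: heq_def split: sum.splits)
next
  case (TSeq s t)
  then obtain a m b where e: "x = VSeq a m b" "elem S T s a i m" "elem S T t b m u" by auto
  have "set m \<subseteq> nodes T" using elem_bounds[OF assms(1) e(2)] TSeq.prems by simp
  then show ?case using TSeq e heq_map[OF assms(2), of m] by auto
qed auto

lemma univ_transport:
  assumes U: "univ S t G x i u" and t: "wt (fsig S) t" and f: "hyp_iso S G H f"
  shows "univ S t H (vmap f x) (map (nmap f) i) (map (nmap f) u)"
proof -
  obtain g where g: "hyp_hom S H G g" "heq G (f \<then> g) hid" "heq H (g \<then> f) hid" and f': "hyp_hom S G H f"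
    using f by (auto simp: hyp_iso_def)
  have G: "hyp S G" "elem S G t x i u" using U by (auto simp: univ_def)
  have b: "set i \<subseteq> nodes G" "set u \<subseteq> nodes G" using elem_bounds[OF G t] by auto
  have gf: "vmap g (vmap f x) = x" "map (nmap g) (map (nmap f) i) = i" "map (nmap g) (map (nmap f) u) = u"
    using vmap_elem_cong[OF G(1) g(2) G(2) t] heq_map[OF g(2) b(1)] heq_map[OF g(2) b(2)]
    by (simp_all add: vmap_comp)
  show ?thesis unfolding univ_def
  proof (intro conjI allI impI)
    show "hyp S H" using hom_hyp[OF f'] by simp
    show "elem S H t (vmap f x) (map (nmap f) i) (map (nmap f) u)" by (rule elem_hom[OF f' G(2)])
  next
    fix T y j v assume T: "hyp S T" "elem S T t y j v"
    then obtain w where w: "hyp_hom S G T w" "vmap w x = y" "map (nmap w) i = j" "map (nmap w) u = v"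
      using U unfolding univ_def by blast
    show "\<exists>w. hyp_hom S H T w \<and> vmap w (vmap f x) = y \<and> map (nmap w) (map (nmap f) i) = j \<and>
        map (nmap w) (map (nmap f) u) = v"
      using hom_comp[OF g(1) w(1)] gf w
      by (intro exI[of _ "g \<then> w"]) (metis vmap_comp map_comp_hcomp)
  next
    fix T w w' assume w: "hyp_hom S H T w" "hyp_hom S H T w'" "vmap w (vmap f x) = vmap w' (vmap f x)"
      "map (nmap w) (map (nmap f) i) = map (nmap w') (map (nmap f) i)"
      "map (nmap w) (map (nmap f) u) = map (nmap w') (map (nmap f) u)"
    then have "heq G (f \<then> w) (f \<then> w')"
      using U hom_comp[OF f' w(1)] hom_comp[OF f' w(2)] unfolding univ_def
      by (metis vmap_comp map_comp_hcomp)
    then have e: "heq H (g \<then> (f \<then> w)) (g \<then> (f \<then> w'))"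
      using g(1) by (auto simp: heq_def hyp_hom_def)
    show "heq H w w'"
      using e g(3) by (auto simp: heq_def)
  qed
qed

text \<open>The relation \<open>B\<close> is between elements together with their boundaries, because bending
  an arrow moves its inputs to the outputs.\<close>

definition nat_iso :: "'g signature \<Rightarrow> ('g + frob_gen) tm \<Rightarrow> ('g + frob_gen) tm \<Rightarrow>
    (val \<Rightarrow> nat list \<Rightarrow> nat list \<Rightarrow> val \<Rightarrow> nat list \<Rightarrow> nat list \<Rightarrow> bool) \<Rightarrow> bool" where
  "nat_iso S s t B \<longleftrightarrow>
    (\<forall>T x i u. hyp S T \<longrightarrow> elem S T s x i u \<longrightarrow> (\<exists>y j v. B x i u y j v \<and> elem S T t y j v)) \<and>
    (\<forall>T y j v. hyp S T \<longrightarrow> elem S T t y j v \<longrightarrow> (\<exists>x i u. B x i u y j v \<and> elem S T s x i u)) \<and>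
    (\<forall>x i u y j v y' j' v'. B x i u y j v \<longrightarrow> B x i u y' j' v' \<longrightarrow> y = y' \<and> j = j' \<and> v = v') \<and>
    (\<forall>x i u y j v x' i' u'. B x i u y j v \<longrightarrow> B x' i' u' y j v \<longrightarrow> x = x' \<and> i = i' \<and> u = u') \<and>
    (\<forall>w x i u y j v. B x i u y j v \<longrightarrow>
      B (vmap w x) (map (nmap w) i) (map (nmap w) u) (vmap w y) (map (nmap w) j) (map (nmap w) v))"

lemma nat_isoD:
  assumes "nat_iso S s t B"
  shows "hyp S T \<Longrightarrow> elem S T s x i u \<Longrightarrow> (\<exists>y j v. B x i u y j v \<and> elem S T t y j v)"
    and "hyp S T \<Longrightarrow> elem S T t y j v \<Longrightarrow> (\<exists>x i u. B x i u y j v \<and> elem S T s x i u)"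
    and "B x i u y j v \<Longrightarrow> B x i u y' j' v' \<Longrightarrow> y = y' \<and> j = j' \<and> v = v'"
    and "B x i u y j v \<Longrightarrow> B x' i' u' y j v \<Longrightarrow> x = x' \<and> i = i' \<and> u = u'"
    and "B x i u y j v \<Longrightarrow>
      B (vmap w x) (map (nmap w) i) (map (nmap w) u) (vmap w y) (map (nmap w) j) (map (nmap w) v)"
proof -
  note n = assms[unfolded nat_iso_def]
  show "hyp S T \<Longrightarrow> elem S T s x i u \<Longrightarrow> (\<exists>y j v. B x i u y j v \<and> elem S T t y j v)"
    using n[THEN conjunct1] by blast
  show "hyp S T \<Longrightarrow> elem S T t y j v \<Longrightarrow> (\<exists>x i u. B x i u y j v \<and> elem S T s x i u)"
    using n[THEN conjunct2, THEN conjunct1] by blast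
  show "B x i u y j v \<Longrightarrow> B x i u y' j' v' \<Longrightarrow> y = y' \<and> j = j' \<and> v = v'"
    using n[THEN conjunct2, THEN conjunct2, THEN conjunct1] by blast
  show "B x i u y j v \<Longrightarrow> B x' i' u' y j v \<Longrightarrow> x = x' \<and> i = i' \<and> u = u'"
    using n[THEN conjunct2, THEN conjunct2, THEN conjunct2, THEN conjunct1] by blast
  show "B x i u y j v \<Longrightarrow>
      B (vmap w x) (map (nmap w) i) (map (nmap w) u) (vmap w y) (map (nmap w) j) (map (nmap w) v)"
    using n[THEN conjunct2, THEN conjunct2, THEN conjunct2, THEN conjunct2] by blast
qed

text \<open>A natural bijection of elements carries universal elements to universal elements over
  the same hypergraph. Hence equal terms, and a term and its bent version, have the same
  apex.\<close>

lemma univ_nat_iso: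
  assumes U: "univ S s G x i u" and N: "nat_iso S s t B" and B: "B x i u y j v"
  shows "univ S t G y j v"
  unfolding univ_def
proof (intro conjI allI impI)
  show G: "hyp S G" using U by (simp add: univ_def)
  have e: "elem S G s x i u" using U by (simp add: univ_def)
  note N1 = nat_isoD(1)[OF N] and N2 = nat_isoD(2)[OF N] and N3 = nat_isoD(3)[OF N] and N4 = nat_isoD(4)[OF N]
    and N5 = nat_isoD(5)[OF N]
  show "elem S G t y j v" using N1[OF G e] N3[OF B] by metis
  fix T
  show "\<exists>w. hyp_hom S G T w \<and> vmap w y = y' \<and> map (nmap w) j = j' \<and> map (nmap w) v = v'"
    if T: "hyp S T" "elem S T t y' j' v'" for y' j' v'
  proof -
    obtain x' i' u' where x': "B x' i' u' y' j' v'" "elem S T s x' i' u'" using N2[OF T] by blast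
    then obtain w where w: "hyp_hom S G T w" "vmap w x = x'" "map (nmap w) i = i'" "map (nmap w) u = u'"
      using U T(1) unfolding univ_def by blast
    have "vmap w y = y' \<and> map (nmap w) j = j' \<and> map (nmap w) v = v'"
      using N3[OF N5[OF B, of w], unfolded w, OF x'(1)] .
    then show ?thesis using w(1) by blast
  qed
  show "heq G w w'" if w: "hyp_hom S G T w" "hyp_hom S G T w'" "vmap w y = vmap w' y"
      "map (nmap w) j = map (nmap w') j" "map (nmap w) v = map (nmap w') v" for w w'
  proof -
    have "vmap w x = vmap w' x \<and> map (nmap w) i = map (nmap w') i \<and> map (nmap w) u = map (nmap w') u"
      using N4[OF N5[OF B, of w]] N5[OF B, of w'] w(3-5) by simp
    then show ?thesis using U w(1,2) unfolding univ_def by blast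
  qed
qed

section \<open>Invariance of elements under the PROP and Frobenius laws\<close>

text \<open>An isomorphism of spans: a bijection of values that fixes both boundary tuples. Fixing
  them is what allows such bijections to be composed along a middle tuple.\<close>

definition bd_iso :: "'g signature \<Rightarrow> ('g + frob_gen) tm \<Rightarrow> ('g + frob_gen) tm \<Rightarrow>
    (val \<Rightarrow> val \<Rightarrow> nat list \<Rightarrow> nat list \<Rightarrow> bool) \<Rightarrow> bool" where
  "bd_iso S s t B \<longleftrightarrow>
    (\<forall>T x i u. hyp S T \<longrightarrow> elem S T s x i u \<longrightarrow> (\<exists>y. B x y i u \<and> elem S T t y i u)) \<and>
    (\<forall>T y i u. hyp S T \<longrightarrow> elem S T t y i u \<longrightarrow> (\<exists>x. B x y i u \<and> elem S T s x i u)) \<and>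
    (\<forall>x y y' i u. B x y i u \<longrightarrow> B x y' i u \<longrightarrow> y = y') \<and>
    (\<forall>x x' y i u. B x y i u \<longrightarrow> B x' y i u \<longrightarrow> x = x') \<and>
    (\<forall>w x y i u. B x y i u \<longrightarrow> B (vmap w x) (vmap w y) (map (nmap w) i) (map (nmap w) u))"

lemma bd_isoI:
  assumes "\<And>T x i u. hyp S T \<Longrightarrow> elem S T s x i u \<Longrightarrow> (\<exists>y. B x y i u \<and> elem S T t y i u)"
    and "\<And>T y i u. hyp S T \<Longrightarrow> elem S T t y i u \<Longrightarrow> (\<exists>x. B x y i u \<and> elem S T s x i u)"
    and "\<And>x y y' i u. B x y i u \<Longrightarrow> B x y' i u \<Longrightarrow> y = y'"
    and "\<And>x x' y i u. B x y i u \<Longrightarrow> B x' y i u \<Longrightarrow> x = x'"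
    and "\<And>w x y i u. B x y i u \<Longrightarrow> B (vmap w x) (vmap w y) (map (nmap w) i) (map (nmap w) u)"
  shows "\<exists>B. bd_iso S s t B"
  unfolding bd_iso_def by (intro exI[of _ B] conjI allI impI) (fact assms)+

lemma bd_isoD:
  assumes "bd_iso S s t B"
  shows "hyp S T \<Longrightarrow> elem S T s x i u \<Longrightarrow> (\<exists>y. B x y i u \<and> elem S T t y i u)"
    and "hyp S T \<Longrightarrow> elem S T t y i u \<Longrightarrow> (\<exists>x. B x y i u \<and> elem S T s x i u)"
    and "B x y i u \<Longrightarrow> B x y' i u \<Longrightarrow> y = y'"
    and "B x y i u \<Longrightarrow> B x' y i u \<Longrightarrow> x = x'"
    and "B x y i u \<Longrightarrow> B (vmap w x) (vmap w y) (map (nmap w) i) (map (nmap w) u)"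
proof -
  note n = assms[unfolded bd_iso_def]
  show "hyp S T \<Longrightarrow> elem S T s x i u \<Longrightarrow> (\<exists>y. B x y i u \<and> elem S T t y i u)"
    using n[THEN conjunct1] by blast
  show "hyp S T \<Longrightarrow> elem S T t y i u \<Longrightarrow> (\<exists>x. B x y i u \<and> elem S T s x i u)"
    using n[THEN conjunct2, THEN conjunct1] by blast
  show "B x y i u \<Longrightarrow> B x y' i u \<Longrightarrow> y = y'"
    using n[THEN conjunct2, THEN conjunct2, THEN conjunct1] by blast
  show "B x y i u \<Longrightarrow> B x' y i u \<Longrightarrow> x = x'"
    using n[THEN conjunct2, THEN conjunct2, THEN conjunct2, THEN conjunct1] by blast
  show "B x y i u \<Longrightarrow> B (vmap w x) (vmap w y) (map (nmap w) i) (map (nmap w) u)"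
    using n[THEN conjunct2, THEN conjunct2, THEN conjunct2, THEN conjunct2] by blast
qed

text \<open>Replaces \<open>take\<close> and \<open>drop\<close> by an arbitrary splitting:
  well-typedness of \<open>s\<close> fixes the lengths of its boundary, so there is only one
  splitting into elements.\<close>

lemma elem_par:
  assumes "hyp S T" "wt (fsig S) s"
  shows "elem S T (TPar s t) x i u \<longleftrightarrow> (\<exists>a b i\<^sub>1 i\<^sub>2 u\<^sub>1 u\<^sub>2. x = VPar a b \<and> i = i\<^sub>1 @ i\<^sub>2 \<and> u = u\<^sub>1 @ u\<^sub>2 \<and>
    elem S T s a i\<^sub>1 u\<^sub>1 \<and> elem S T t b i\<^sub>2 u\<^sub>2)"
proof
  assume "elem S T (TPar s t) x i u"
  then show "\<exists>a b i\<^sub>1 i\<^sub>2 u\<^sub>1 u\<^sub>2. x = VPar a b \<and> i = i\<^sub>1 @ i\<^sub>2 \<and> u = u\<^sub>1 @ u\<^sub>2 \<and>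
    elem S T s a i\<^sub>1 u\<^sub>1 \<and> elem S T t b i\<^sub>2 u\<^sub>2"
    by (metis append_take_drop_id elem.simps(5))
next
  assume "\<exists>a b i\<^sub>1 i\<^sub>2 u\<^sub>1 u\<^sub>2. x = VPar a b \<and> i = i\<^sub>1 @ i\<^sub>2 \<and> u = u\<^sub>1 @ u\<^sub>2 \<and>
    elem S T s a i\<^sub>1 u\<^sub>1 \<and> elem S T t b i\<^sub>2 u\<^sub>2"
  then obtain a b i1 i2 u1 u2 where h: "x = VPar a b" "i = i1 @ i2" "u = u1 @ u2"
    "elem S T s a i1 u1" "elem S T t b i2 u2" by blast
  then show "elem S T (TPar s t) x i u" using elem_bounds[OF assms(1) h(4) assms(2)] by simp
qed

text \<open>The same middle tuple \<open>m\<close> serves on both sides, because the two given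
  bijections leave boundaries unchanged.\<close>

lemma bd_iso_seq:
  assumes "bd_iso S s s' B" "bd_iso S t t' B'"
  shows "\<exists>B. bd_iso S (TSeq s t) (TSeq s' t') B"
proof (rule bd_isoI[where B = "\<lambda>x y i u. \<exists>a m b a' b'. x = VSeq a m b \<and> y = VSeq a' m b' \<and> B a a' i m \<and> B' b b' m u"],
    goal_cases)
  case (1 T x i u)
  then show ?case using bd_isoD(1)[OF assms(1) 1(1)] bd_isoD(1)[OF assms(2) 1(1)] by simp metis
next
  case (2 T x i u)
  then show ?case using bd_isoD(2)[OF assms(1) 2(1)] bd_isoD(2)[OF assms(2) 2(1)] by simp metis
next
  case 3
  then show ?case using bd_isoD(3)[OF assms(1)] bd_isoD(3)[OF assms(2)] by auto
next
  case 4
  then show ?case using bd_isoD(4)[OF assms(1)] bd_isoD(4)[OF assms(2)] by auto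
next
  case 5
  then show ?case using bd_isoD(5)[OF assms(1)] bd_isoD(5)[OF assms(2)] by auto
qed

lemma bd_iso_par:
  assumes "bd_iso S s s' B" "bd_iso S t t' B'"
    and "tdom (fsig S) s = tdom (fsig S) s'" "tcod (fsig S) s = tcod (fsig S) s'"
  shows "\<exists>B. bd_iso S (TPar s t) (TPar s' t') B"
proof (rule bd_isoI[where B = "\<lambda>x y i u. \<exists>a b a' b'. x = VPar a b \<and> y = VPar a' b' \<and>
      B a a' (take (tdom (fsig S) s) i) (take (tcod (fsig S) s) u) \<and>
      B' b b' (drop (tdom (fsig S) s) i) (drop (tcod (fsig S) s) u)"], goal_cases)
  case (1 T x i u)
  then show ?case using bd_isoD(1)[OF assms(1) 1(1)] bd_isoD(1)[OF assms(2) 1(1)] assms(3,4) by simp metis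
next
  case (2 T x i u)
  then show ?case using bd_isoD(2)[OF assms(1) 2(1)] bd_isoD(2)[OF assms(2) 2(1)] assms(3,4) by simp metis
next
  case 3
  then show ?case using bd_isoD(3)[OF assms(1)] bd_isoD(3)[OF assms(2)] by auto
next
  case 4
  then show ?case using bd_isoD(4)[OF assms(1)] bd_isoD(4)[OF assms(2)] by auto
next
  case 5
  then show ?case using bd_isoD(5)[OF assms(1)] bd_isoD(5)[OF assms(2)]
    by (fastforce simp: take_map drop_map)
qed

text \<open>A connected edge-free term: its elements amount to a choice of one node, which appears
  on all \<open>n + m\<close> boundary wires. The function \<open>Y\<close> records the value, as
  middle tuples depend on the bracketing of the term.\<close>

definition spider :: "'g signature \<Rightarrow> ('g + frob_gen) tm \<Rightarrow> (nat \<Rightarrow> val) \<Rightarrow> nat \<Rightarrow> nat \<Rightarrow> bool" where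
  "spider S t Y n m \<longleftrightarrow> (\<forall>T x i u. hyp S T \<longrightarrow> elem S T t x i u \<longleftrightarrow>
    (\<exists>v \<in> nodes T. x = Y v \<and> i = replicate n v \<and> u = replicate m v)) \<and>
    (\<forall>w v. vmap w (Y v) = Y (nmap w v))"

text \<open>A boundary wire is needed to read the chosen node off the boundary, which makes the
  correspondence of values functional in both directions.\<close>

lemma spider_bd_iso:
  assumes "spider S s Y n m" "spider S t Z n m" "n > 0 \<or> m > 0"
  shows "\<exists>B. bd_iso S s t B"
proof (rule bd_isoI[where B = "\<lambda>x y i u. \<exists>v. x = Y v \<and> y = Z v \<and> i = replicate n v \<and> u = replicate m v"],
    goal_cases)
  case (1 T x i u)
  then show ?case using assms unfolding spider_def by metis
next
  case (2 T x i u)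
  then show ?case using assms unfolding spider_def by metis
next
  case 3
  then show ?case using assms(3) by (auto simp: replicate_eq_replicate)
next
  case 4
  then show ?case using assms(3) by (auto simp: replicate_eq_replicate)
next
  case 5
  then show ?case using assms(1,2) unfolding spider_def by (metis map_replicate)
qed

lemma elem_frob:
  "elem S T (TGen (Inr Mu)) x i u \<longleftrightarrow> x = U \<and> (\<exists>v \<in> nodes T. i = [v, v] \<and> u = [v])"
  "elem S T (TGen (Inr Eta)) x i u \<longleftrightarrow> x = U \<and> (\<exists>v \<in> nodes T. i = [] \<and> u = [v])"
  "elem S T (TGen (Inr Delta)) x i u \<longleftrightarrow> x = U \<and> (\<exists>v \<in> nodes T. i = [v] \<and> u = [v, v])"
  "elem S T (TGen (Inr Eps)) x i u \<longleftrightarrow> x = U \<and> (\<exists>v \<in> nodes T. i = [v] \<and> u = [])"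
  "elem S T (TId (Suc 0)) x i u \<longleftrightarrow> x = U \<and> (\<exists>v \<in> nodes T. i = [v] \<and> u = [v])"
  "elem S T (TSym (Suc 0) (Suc 0)) x i u \<longleftrightarrow> x = U \<and> (\<exists>v \<in> nodes T. \<exists>v' \<in> nodes T. i = [v, v'] \<and> u = [v', v])"
  by (auto simp: frob_sig_def numeral_2_eq_2 length_Suc_conv)

lemma wt_frob:
  "wt (fsig S) (TGen (Inr g))" "tdom (fsig S) (TGen (Inr g)) = arity frob_sig g"
  "tcod (fsig S) (TGen (Inr g)) = coarity frob_sig g"
  by (auto simp: sig_sum_def frob_sig_def)

lemma spider_par:
  assumes "spider S s Y n m" "spider S t Z n' m'" "wt (fsig S) s" "hyp S T"
  shows "elem S T (TPar s t) x i u \<longleftrightarrow> (\<exists>v \<in> nodes T. \<exists>v' \<in> nodes T. x = VPar (Y v) (Z v') \<and>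
    i = replicate n v @ replicate n' v' \<and> u = replicate m v @ replicate m' v')"
proof -
  have 1: "elem S T s x i u \<longleftrightarrow> (\<exists>v \<in> nodes T. x = Y v \<and> i = replicate n v \<and> u = replicate m v)"
    "elem S T t x i u \<longleftrightarrow> (\<exists>v \<in> nodes T. x = Z v \<and> i = replicate n' v \<and> u = replicate m' v)" for x i u
    using assms(1)[unfolded spider_def, THEN conjunct1] assms(2)[unfolded spider_def, THEN conjunct1]
      assms(4) by simp_all
  show ?thesis unfolding elem_par[OF assms(4,3)] 1 by blast
qed

text \<open>Both sides of every Frobenius equation are spiders of the same type. Specialness fits as
  well: the middle tuple of \<open>\<delta>; \<mu>\<close> is forced to repeat the boundary
  node.\<close>

lemma frob_bd_iso:
  assumes "(s, t) \<in> frob_eqs"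
  shows "\<exists>B. bd_iso S (map_tm Inr s) (map_tm Inr t) B"
proof -
  let ?\<mu> = "TGen (Inr Mu)" and ?\<eta> = "TGen (Inr Eta)" and ?\<delta> = "TGen (Inr Delta)" and ?\<epsilon> = "TGen (Inr Eps)"
    and ?i = "TId (Suc 0)"
  have g: "spider S ?\<mu> (\<lambda>v. U) 2 1" "spider S ?\<eta> (\<lambda>v. U) 0 1" "spider S ?\<delta> (\<lambda>v. U) 1 2"
    "spider S ?\<epsilon> (\<lambda>v. U) 1 0" "spider S ?i (\<lambda>v. U) 1 1"
    unfolding spider_def by (auto simp: elem_frob numeral_2_eq_2 simp del: elem.simps)
  have i: "wt (fsig S) ?i" by simp
  note par = spider_par[OF g(1) g(5) wt_frob(1)] spider_par[OF g(5) g(1) i]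
    spider_par[OF g(2) g(5) wt_frob(1)] spider_par[OF g(5) g(2) i]
    spider_par[OF g(3) g(5) wt_frob(1)] spider_par[OF g(5) g(3) i]
    spider_par[OF g(4) g(5) wt_frob(1)] spider_par[OF g(5) g(4) i]
  have 1: "spider S (TSeq (TPar ?\<mu> ?i) ?\<mu>) (\<lambda>v. VSeq (VPar U U) [v, v] U) 3 1"
    "spider S (TSeq (TPar ?i ?\<mu>) ?\<mu>) (\<lambda>v. VSeq (VPar U U) [v, v] U) 3 1"
    "spider S (TSeq (TPar ?\<eta> ?i) ?\<mu>) (\<lambda>v. VSeq (VPar U U) [v, v] U) 1 1"
    "spider S (TSeq (TPar ?i ?\<eta>) ?\<mu>) (\<lambda>v. VSeq (VPar U U) [v, v] U) 1 1"
    unfolding spider_def elem.simps(4)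
    by (auto simp: par elem_frob numeral_2_eq_2 numeral_3_eq_3 simp del: elem.simps)
  have 2: "spider S (TSeq ?\<delta> (TPar ?\<delta> ?i)) (\<lambda>v. VSeq U [v, v] (VPar U U)) 1 3"
    "spider S (TSeq ?\<delta> (TPar ?i ?\<delta>)) (\<lambda>v. VSeq U [v, v] (VPar U U)) 1 3"
    "spider S (TSeq ?\<delta> (TPar ?\<epsilon> ?i)) (\<lambda>v. VSeq U [v, v] (VPar U U)) 1 1"
    "spider S (TSeq ?\<delta> (TPar ?i ?\<epsilon>)) (\<lambda>v. VSeq U [v, v] (VPar U U)) 1 1"
    unfolding spider_def elem.simps(4)
    by (auto simp: par elem_frob numeral_2_eq_2 numeral_3_eq_3 simp del: elem.simps)
  have 3: "spider S (TSeq (TSym (Suc 0) (Suc 0)) ?\<mu>) (\<lambda>v. VSeq U [v, v] U) 2 1"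
    "spider S (TSeq ?\<delta> (TSym (Suc 0) (Suc 0))) (\<lambda>v. VSeq U [v, v] U) 1 2"
    "spider S (TSeq ?\<delta> ?\<mu>) (\<lambda>v. VSeq U [v, v] U) 1 1"
    "spider S (TSeq ?\<mu> ?\<delta>) (\<lambda>v. VSeq U [v] U) 2 2"
    unfolding spider_def elem.simps(4)
    by (auto simp: elem_frob numeral_2_eq_2 simp del: elem.simps)
  have 4: "spider S (TSeq (TPar ?\<delta> ?i) (TPar ?i ?\<mu>)) (\<lambda>v. VSeq (VPar U U) [v, v, v] (VPar U U)) 2 2"
    "spider S (TSeq (TPar ?i ?\<delta>) (TPar ?\<mu> ?i)) (\<lambda>v. VSeq (VPar U U) [v, v, v] (VPar U U)) 2 2"
    unfolding spider_def elem.simps(4)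
    by (auto simp: par elem_frob numeral_2_eq_2 simp del: elem.simps)
  have p: "3 > (0::nat)" "2 > (0::nat)" "1 > (0::nat)" by simp_all
  note pairs = spider_bd_iso[OF 1(1) 1(2) disjI1[OF p(1)]] spider_bd_iso[OF 1(3) g(5) disjI1[OF p(3)]]
    spider_bd_iso[OF 1(4) g(5) disjI1[OF p(3)]] spider_bd_iso[OF 3(1) g(1) disjI1[OF p(2)]]
    spider_bd_iso[OF 2(1) 2(2) disjI1[OF p(3)]] spider_bd_iso[OF 2(3) g(5) disjI1[OF p(3)]]
    spider_bd_iso[OF 2(4) g(5) disjI1[OF p(3)]] spider_bd_iso[OF 3(2) g(3) disjI1[OF p(3)]]
    spider_bd_iso[OF 4(1) 3(4) disjI1[OF p(2)]] spider_bd_iso[OF 3(4) 4(2) disjI1[OF p(2)]]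
    spider_bd_iso[OF 3(3) g(5) disjI1[OF p(3)]]
  from assms show ?thesis
    unfolding frob_eqs_def Let_def insert_iff prod.inject empty_iff
    by (elim disjE conjE FalseE) (simp_all add: pairs)
qed

lemma take_drop_eq: "take k i = take k u \<Longrightarrow> drop k i = drop k u \<Longrightarrow> i = u"
  by (metis append_take_drop_id)

text \<open>Every law is an explicit rebracketing of nested tuples. The relations have to be
  functional both ways, so middle tuples present on one side only must be expressed through the
  boundary or through the other value.\<close>

lemma tm_eq_bd_iso:
  assumes "tm_eq (fsig S) (eqs_sum {} frob_eqs) s t"
  shows "\<exists>B. bd_iso S s t B"
  using assms
proof (induction)
  case (refl s)
  show ?case by (rule bd_isoI[where B = "\<lambda>x y i u. x = y"]) auto
next
  case (sym s t)
  then obtain B where B: "bd_iso S s t B" by blast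
  show ?case
    by (rule bd_isoI[where B = "\<lambda>x y i u. B y x i u"];
      erule bd_isoD(1)[OF B] bd_isoD(2)[OF B] bd_isoD(3)[OF B] bd_isoD(4)[OF B] bd_isoD(5)[OF B]; assumption?)
next
  case (trans s t r)
  then obtain B B' where B: "bd_iso S s t B" "bd_iso S t r B'" by blast
  show ?case
  proof (rule bd_isoI[where B = "\<lambda>x z i u. \<exists>y. B x y i u \<and> B' y z i u"], goal_cases)
    case 1
    then show ?case using bd_isoD(1)[OF B(1) 1(1)] bd_isoD(1)[OF B(2) 1(1)] by metis
  next
    case 2
    then show ?case using bd_isoD(2)[OF B(1) 2(1)] bd_isoD(2)[OF B(2) 2(1)] by metis
  next
    case 3
    then show ?case using bd_isoD(3)[OF B(1)] bd_isoD(3)[OF B(2)] by metis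
  next
    case 4
    then show ?case using bd_isoD(4)[OF B(1)] bd_isoD(4)[OF B(2)] by metis
  next
    case 5
    then show ?case using bd_isoD(5)[OF B(1)] bd_isoD(5)[OF B(2)] by metis
  qed
next
  case (seq_cong s s' t t')
  then show ?case using bd_iso_seq by metis
next
  case (par_cong s s' t t')
  then show ?case using bd_iso_par tm_eq_wt by metis
next
  case (equation s t)
  then obtain s' t' where "(s', t') \<in> frob_eqs" "s = map_tm Inr s'" "t = map_tm Inr t'"
    by (auto simp: eqs_sum_def)
  then show ?case using frob_bd_iso by blast
next
  case (seq_id_left s)
  show ?case
  proof (rule bd_isoI[where B = "\<lambda>x y i u. x = VSeq U i y"], goal_cases)
    case (2 T x i u)
    then show ?case using elem_bounds[OF 2 seq_id_left] by auto
  qed auto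
next
  case (seq_id_right s)
  show ?case
  proof (rule bd_isoI[where B = "\<lambda>x y i u. x = VSeq y u U"], goal_cases)
    case (2 T x i u)
    then show ?case using elem_bounds[OF 2 seq_id_right] by auto
  qed auto
next
  case (seq_assoc s t u)
  show ?case
    by (rule bd_isoI[where B = "\<lambda>x y i u. \<exists>a m b m' c. x = VSeq (VSeq a m b) m' c \<and> y = VSeq a m (VSeq b m' c)"];
      auto; blast)
next
  case (par_id n m)
  show ?case
  proof (rule bd_isoI[where B = "\<lambda>x y i u. x = VPar U U \<and> y = U"], goal_cases)
    case (1 T x i u)
    then have h: "elem S T (TPar (TId n) (TId m)) x i u" by simp
    then have "u = i" by (simp, metis take_drop_eq)
    moreover have "length i = n + m" "set i \<subseteq> nodes T" using elem_bounds[OF 1(1) h] by auto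
    ultimately show ?case using h by simp
  next
    case (2 T x i u)
    then show ?case by (auto dest: in_set_takeD in_set_dropD)
  qed auto
next
  case (interchange s t s' t')
  then have w: "wt (fsig S) s" "wt (fsig S) t" "wt (fsig S) s'" "wt (fsig S) t'"
    "tcod (fsig S) s = tdom (fsig S) t" "tcod (fsig S) s' = tdom (fsig S) t'" by auto
  show ?case
  \<comment> \<open>Recording the length of \<open>m\<close> makes the decomposition of
    \<open>m @ m'\<close> unique; without it the relation would not be injective.\<close>
  proof (rule bd_isoI[where B = "\<lambda>x y i u. \<exists>a m b a' m' b'. x = VPar (VSeq a m b) (VSeq a' m' b') \<and>
      y = VSeq (VPar a a') (m @ m') (VPar b b') \<and> length m = tcod (fsig S) s"], goal_cases)
    case (1 T x i u)
    then have "elem S T (TPar (TSeq s t) (TSeq s' t')) x i u" by simp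
    then obtain a b i1 i2 u1 u2 where h: "x = VPar a b" "i = i1 @ i2" "u = u1 @ u2"
      "elem S T (TSeq s t) a i1 u1" "elem S T (TSeq s' t') b i2 u2"
      using elem_par[OF 1(1) interchange(1)] by blast
    from h(4) obtain a1 m a2 where m: "a = VSeq a1 m a2" "elem S T s a1 i1 m" "elem S T t a2 m u1" by auto
    from h(5) obtain b1 m' b2 where m': "b = VSeq b1 m' b2" "elem S T s' b1 i2 m'" "elem S T t' b2 m' u2" by auto
    have "elem S T (TPar s s') (VPar a1 b1) i (m @ m')"
      unfolding elem_par[OF 1(1) w(1)] using h m m' by blast
    moreover have "elem S T (TPar t t') (VPar a2 b2) (m @ m') u"
      unfolding elem_par[OF 1(1) w(2)] using h m m' by blast
    moreover have "length m = tcod (fsig S) s" using elem_bounds[OF 1(1) m(2) w(1)] by simp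
    ultimately show ?case using h m m'
      by (intro exI[of _ "VSeq (VPar a1 b1) (m @ m') (VPar a2 b2)"]) (auto simp del: elem.simps(5))
  next
    case (2 T y i u)
    then obtain c m d where y: "y = VSeq c m d" and
      c: "elem S T (TPar s s') c i m" and d: "elem S T (TPar t t') d m u" by (auto simp del: elem.simps(5))
    from c obtain a1 b1 i1 i2 m1 m2 where c': "c = VPar a1 b1" "i = i1 @ i2" "m = m1 @ m2"
      "elem S T s a1 i1 m1" "elem S T s' b1 i2 m2" using elem_par[OF 2(1) w(1)] by blast
    from d obtain a2 b2 m1' m2' u1 u2 where d': "d = VPar a2 b2" "m = m1' @ m2'" "u = u1 @ u2"
      "elem S T t a2 m1' u1" "elem S T t' b2 m2' u2" using elem_par[OF 2(1) w(2)] by blast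
    have l: "length m1 = tcod (fsig S) s" "length m1' = tcod (fsig S) s"
      using elem_bounds[OF 2(1) c'(4) w(1)] elem_bounds[OF 2(1) d'(4) w(2)] w(5) by auto
    then have e: "m1 = m1'" "m2 = m2'" using c'(3) d'(2) by auto
    have "elem S T (TPar (TSeq s t) (TSeq s' t')) (VPar (VSeq a1 m1 a2) (VSeq b1 m2 b2)) i u"
      unfolding elem_par[OF 2(1) interchange(1)] using c' d' e by (simp del: elem.simps(5)) blast
    then show ?case using y c' d' e l
      by (intro exI[of _ "VPar (VSeq a1 m1 a2) (VSeq b1 m2 b2)"]) (auto simp del: elem.simps(5))
  qed auto
next
  case (par_unit_left s)
  show ?case
  proof (rule bd_isoI[where B = "\<lambda>x y i u. x = VPar U y"], goal_cases)
  qed auto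
next
  case (par_unit_right s)
  show ?case
  proof (rule bd_isoI[where B = "\<lambda>x y i u. x = VPar y U"], goal_cases)
    case (1 T x i u)
    then have "elem S T (TPar s (TId 0)) x i u" by simp
    then show ?case unfolding elem_par[OF 1(1) par_unit_right] by auto
  next
    case (2 T x i u)
    have "elem S T (TPar s (TId 0)) (VPar x U) i u"
      unfolding elem_par[OF 2(1) par_unit_right]
      by (rule exI[of _ x], rule exI[of _ U], rule exI[of _ i], rule exI[of _ "[]"], rule exI[of _ u],
        rule exI[of _ "[]"]) (use 2 in simp)
    then show ?case by blast
  qed auto
next
  case (par_assoc s t r)
  then have w: "wt (fsig S) s" "wt (fsig S) t" "wt (fsig S) r" "wt (fsig S) (TPar s t)" by auto
  show ?case
  proof (rule bd_isoI[where B = "\<lambda>x y i u. \<exists>a b c. x = VPar (VPar a b) c \<and> y = VPar a (VPar b c)"], goal_cases)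
    case (1 T x i u)
    then have "elem S T (TPar (TPar s t) r) x i u" by simp
    then obtain a b c where "x = VPar (VPar a b) c" "elem S T (TPar s (TPar t r)) (VPar a (VPar b c)) i u"
      unfolding elem_par[OF 1(1) w(1)] elem_par[OF 1(1) w(2)] elem_par[OF 1(1) w(4)]
      by (metis append_assoc)
    then show ?case by blast
  next
    case (2 T x i u)
    then have "elem S T (TPar s (TPar t r)) x i u" by simp
    then obtain a b c where "x = VPar a (VPar b c)" "elem S T (TPar (TPar s t) r) (VPar (VPar a b) c) i u"
      unfolding elem_par[OF 2(1) w(1)] elem_par[OF 2(1) w(2)] elem_par[OF 2(1) w(4)]
      by (metis append_assoc)
    then show ?case by blast
  qed auto
next
  case (sym_natural s t)
  let ?n = "tdom (fsig S) s" and ?m = "tcod (fsig S) s" and ?n' = "tdom (fsig S) t" and ?m' = "tcod (fsig S) t"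
  show ?case
  \<comment> \<open>Each side has its own middle tuple. One is the output \<open>u\<close> with its
    two blocks exchanged back, the other the input \<open>i\<close> with its blocks
    exchanged.\<close>
  proof (rule bd_isoI[where B = "\<lambda>x y i u. \<exists>a b. x = VSeq (VPar a b) (drop ?m' u @ take ?m' u) U \<and>
      y = VSeq U (drop ?n i @ take ?n i) (VPar b a)"], goal_cases)
    case (1 T x i u)
    then obtain c m where x: "x = VSeq c m U" "elem S T (TPar s t) c i m" "u = drop ?m m @ take ?m m" "length m = ?m + ?m'"
      by (auto simp del: elem.simps(5))
    from x(2) obtain a b i1 i2 m1 m2 where c: "c = VPar a b" "i = i1 @ i2" "m = m1 @ m2"
      "elem S T s a i1 m1" "elem S T t b i2 m2" using elem_par[OF 1(1) sym_natural(1)] by blast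
    have b: "length i1 = ?n" "length m1 = ?m" "length i2 = ?n'" "length m2 = ?m'" "set i1 \<subseteq> nodes T" "set i2 \<subseteq> nodes T"
      using elem_bounds[OF 1(1) c(4) sym_natural(1)] elem_bounds[OF 1(1) c(5) sym_natural(2)] by auto
    have "elem S T (TPar t s) (VPar b a) (i2 @ i1) u"
      unfolding elem_par[OF 1(1) sym_natural(2)] using c x b by auto
    then have "elem S T (TSeq (TSym ?n ?n') (TPar t s)) (VSeq U (i2 @ i1) (VPar b a)) i u"
      using b c by (auto simp del: elem.simps(5))
    then show ?case using x c b by (intro exI[of _ "VSeq U (i2 @ i1) (VPar b a)"]) auto
  next
    case (2 T y i u)
    then obtain c m where x: "y = VSeq U m c" "elem S T (TPar t s) c m u" "m = drop ?n i @ take ?n i" "length i = ?n + ?n'"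
      by (auto simp del: elem.simps(5))
    from x(2) obtain b a m1 m2 u1 u2 where c: "c = VPar b a" "m = m1 @ m2" "u = u1 @ u2"
      "elem S T t b m1 u1" "elem S T s a m2 u2" using elem_par[OF 2(1) sym_natural(2)] by blast
    have b: "length m1 = ?n'" "length u1 = ?m'" "length m2 = ?n" "length u2 = ?m" "set u1 \<subseteq> nodes T" "set u2 \<subseteq> nodes T"
      using elem_bounds[OF 2(1) c(5) sym_natural(1)] elem_bounds[OF 2(1) c(4) sym_natural(2)] by auto
    have "m1 = drop ?n i" "m2 = take ?n i" using x(3,4) c(2) b by auto
    then have i: "i = m2 @ m1" by simp
    have "elem S T (TPar s t) (VPar a b) i (u2 @ u1)"
      unfolding elem_par[OF 2(1) sym_natural(1)] using c i b by auto
    then have "elem S T (TSeq (TPar s t) (TSym ?m ?m')) (VSeq (VPar a b) (u2 @ u1) U) i u"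
      using b c by (auto simp del: elem.simps(5))
    then show ?case using x c b by (intro exI[of _ "VSeq (VPar a b) (u2 @ u1) U"]) auto
  qed (auto simp: take_map drop_map)
next
  case (sym_inverse n m)
  show ?case
  proof (rule bd_isoI[where B = "\<lambda>x y i u. x = VSeq U (drop n i @ take n i) U \<and> y = U"], goal_cases)
    case (2 T x i u)
    then show ?case by (auto dest: in_set_takeD in_set_dropD)
  qed (auto simp: take_map drop_map)
next
  case (sym_hexagon n m k)
  show ?case
  proof (rule bd_isoI[where B = "\<lambda>x y i u. x = U \<and>
      y = VSeq (VPar U U) (take m (drop n i) @ take n i @ drop (n + m) i) (VPar U U)"], goal_cases)
    case (1 T x i u)
    define a b c where "a = take n i" and "b = take m (drop n i)" and "c = drop (n + m) i"
    have l: "length i = n + (m + k)" "set i \<subseteq> nodes T" "u = drop n i @ take n i" "x = U" using 1 by auto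
    have i: "i = a @ b @ c" unfolding a_def b_def c_def
      by (metis add.commute append_take_drop_id drop_drop)
    have len: "length a = n" "length b = m" "length c = k"
      using l by (auto simp: a_def b_def c_def)
    have "u = b @ c @ a" using l(3) i len by simp
    then show ?case using l i len by (auto simp: add.commute)
  next
    case (2 T y i u)
    then obtain c w d where y: "y = VSeq c w d" "elem S T (TPar (TSym n m) (TId k)) c i w"
      "elem S T (TPar (TId m) (TSym n k)) d w u" by (auto simp del: elem.simps(5))
    from y(2) obtain i1 i2 where 1: "c = VPar U U" "i = i1 @ i2" "length i1 = n + m" "length i2 = k"
      "w = (drop n i1 @ take n i1) @ i2" "set i \<subseteq> nodes T"
      using elem_par[OF 2(1), of "TSym n m" "TId k" c i w] by auto
    from y(3) obtain w1 w2 where 3: "d = VPar U U" "w = w1 @ w2" "length w1 = m" "length w2 = n + k"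
      "u = w1 @ drop n w2 @ take n w2"
      using elem_par[OF 2(1), of "TId m" "TSym n k" d w u] by auto
    have "w1 = drop n i1" "w2 = take n i1 @ i2" using 1 3 by auto
    then show ?case using 1 3 y by simp
  qed (auto simp: take_map drop_map)
qed

section \<open>Coproducts and pushouts of hypergraphs\<close>

lemma hmap_eqI: "nmap f = nmap g \<Longrightarrow> emap f = emap g \<Longrightarrow> f = (g :: hmap)"
  by simp

definition hinl :: hmap where "hinl = \<lparr> nmap = node_inl, emap = node_inl \<rparr>"
definition hinr :: hmap where "hinr = \<lparr> nmap = node_inr, emap = node_inr \<rparr>"

definition hcase :: "hmap \<Rightarrow> hmap \<Rightarrow> hmap" where
  "hcase f g = \<lparr> nmap = (\<lambda>x. case sum_decode x of Inl a \<Rightarrow> nmap f a | Inr b \<Rightarrow> nmap g b),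
     emap = (\<lambda>x. case sum_decode x of Inl a \<Rightarrow> emap f a | Inr b \<Rightarrow> emap g b) \<rparr>"

lemma hcase_hinl [simp]: "hinl \<then> hcase f g = f"
  by (rule hmap_eqI) (simp_all add: hinl_def hcase_def node_inl_def fun_eq_iff)

lemma hcase_hinr [simp]: "hinr \<then> hcase f g = g"
  by (rule hmap_eqI) (simp_all add: hinr_def hcase_def node_inr_def fun_eq_iff)

lemma hyp_sum_simps:
  "nodes (hyp_sum G H) = node_inl ` nodes G \<union> node_inr ` nodes H"
  "edges (hyp_sum G H) = node_inl ` edges G \<union> node_inr ` edges H"
  "sources (hyp_sum G H) (node_inl h) = map node_inl (sources G h)"
  "sources (hyp_sum G H) (node_inr h) = map node_inr (sources H h)"
  "targets (hyp_sum G H) (node_inl h) = map node_inl (targets G h)"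
  "targets (hyp_sum G H) (node_inr h) = map node_inr (targets H h)"
  "label (hyp_sum G H) (node_inl h) = label G h"
  "label (hyp_sum G H) (node_inr h) = label H h"
  by (auto simp: hyp_sum_def node_inl_def node_inr_def image_iff)

lemma hyp_hyp_sum: "hyp S G \<Longrightarrow> hyp S H \<Longrightarrow> hyp S (hyp_sum G H)"
  unfolding hyp_def by (auto simp: hyp_sum_simps; blast)

lemma hom_hinl: "hyp S G \<Longrightarrow> hyp S H \<Longrightarrow> hyp_hom S G (hyp_sum G H) hinl"
  by (simp add: hyp_hom_def hyp_hyp_sum hinl_def hyp_sum_simps)

lemma hom_hinr: "hyp S G \<Longrightarrow> hyp S H \<Longrightarrow> hyp_hom S H (hyp_sum G H) hinr"
  by (simp add: hyp_hom_def hyp_hyp_sum hinr_def hyp_sum_simps)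

lemma hcase_apply:
  "nmap (hcase f g) (node_inl v) = nmap f v" "nmap (hcase f g) (node_inr v) = nmap g v"
  "emap (hcase f g) (node_inl v) = emap f v" "emap (hcase f g) (node_inr v) = emap g v"
  by (simp_all add: hcase_def node_inl_def node_inr_def)

lemma hom_hcase: "hyp_hom S G T f \<Longrightarrow> hyp_hom S H T g \<Longrightarrow> hyp_hom S (hyp_sum G H) T (hcase f g)"
  by (auto simp: hyp_hom_def hyp_hyp_sum hyp_sum_simps hcase_apply)

lemma heq_hyp_sum:
  "heq (hyp_sum G H) w w' \<longleftrightarrow> heq G (hinl \<then> w) (hinl \<then> w') \<and> heq H (hinr \<then> w) (hinr \<then> w')"
  by (auto simp: heq_def hyp_sum_simps hinl_def hinr_def)

lemma heq_trans: "heq G f g \<Longrightarrow> heq G g h \<Longrightarrow> heq G f h"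
  by (simp add: heq_def)

lemma heq_sym: "heq G f g \<Longrightarrow> heq G g f"
  by (simp add: heq_def)

lemma heq_refl [simp]: "heq G f f"
  by (simp add: heq_def)

text \<open>The pushout over a discrete hypergraph: the coproduct with nodes identified along the
  generated equivalence, each class being represented by its least element.\<close>

lemma pushout_exists:
  fixes B C :: "'g hgraph"
  assumes f: "hyp_hom S (discrete k) B f" and g: "hyp_hom S (discrete k) C g"
  shows "\<exists>P p q. is_pushout S (discrete k) B C P f g p q"
proof -
  let ?H = "hyp_sum B C"
  define R where "R = (\<lambda>a b. \<exists>l < k. a = node_inl (nmap f l) \<and> b = node_inr (nmap g l))"
  define q where "q = (\<lambda>v. LEAST u. equivclp R v u)"
  have B: "hyp S B" and C: "hyp S C" using f g by (auto simp: hyp_hom_def)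
  have qv: "equivclp R v (q v)" for v
    unfolding q_def by (rule LeastI[of _ v]) simp
  have qR: "q a = q b" if "equivclp R a b" for a b
  proof -
    have "equivclp R a = equivclp R b"
      using that by (intro ext iffI) (meson equivclp_sym equivclp_trans)+
    then show ?thesis by (simp add: q_def)
  qed
  define P where "P = ?H\<lparr> nodes := q ` nodes ?H, sources := \<lambda>h. map q (sources ?H h),
     targets := \<lambda>h. map q (targets ?H h) \<rparr>"
  define Q where "Q = \<lparr> nmap = q, emap = (\<lambda>h. h) \<rparr>"
  have H: "hyp S ?H" by (rule hyp_hyp_sum[OF B C])
  have P: "hyp S P" using H by (auto simp: hyp_def P_def)
  have Q: "hyp_hom S ?H P Q" using H P by (auto simp: hyp_hom_def P_def Q_def)
  have eq: "heq (discrete k :: 'g hgraph) (f \<then> (hinl \<then> Q)) (g \<then> (hinr \<then> Q))"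
  proof -
    have "q (node_inl (nmap f l)) = q (node_inr (nmap g l))" if "l < k" for l
      by (rule qR) (use that in \<open>auto simp: R_def intro!: r_into_equivclp\<close>)
    then show ?thesis by (auto simp: heq_def Q_def hinl_def hinr_def)
  qed
  have "is_pushout S (discrete k) B C P f g (hinl \<then> Q) (hinr \<then> Q)"
    unfolding is_pushout_def
  proof (intro conjI allI impI)
    show "hyp_hom S B P (hinl \<then> Q)" by (rule hom_comp[OF hom_hinl[OF B C] Q])
    show "hyp_hom S C P (hinr \<then> Q)" by (rule hom_comp[OF hom_hinr[OF B C] Q])
    fix T u v assume u: "hyp_hom S B T u" and v: "hyp_hom S C T v" and
      uv: "heq (discrete k :: 'g hgraph) (f \<then> u) (g \<then> v)"
    let ?w = "hcase u v"
    have w: "hyp_hom S ?H T ?w" by (rule hom_hcase[OF u v])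
    have "nmap ?w a = nmap ?w b" if "equivclp R a b" for a b
      using that
    proof (induction rule: equivclp_induct)
      case (step y z)
      then show ?case using uv by (auto simp: R_def heq_def hcase_apply)
    qed simp
    \<comment> \<open>The copairing is constant on classes, so it takes the same value at the least
      representative. Hence the function \<open>?w\<close> itself serves as the mediating map out of
      the quotient.\<close>
    then have wq: "nmap ?w (q a) = nmap ?w a" for a using qv by metis
    have hom: "hyp_hom S P T ?w"
      using w P wq by (auto simp: hyp_hom_def P_def)
    have e: "heq B (hinl \<then> Q \<then> ?w) u" "heq C (hinr \<then> Q \<then> ?w) v"
      using wq by (auto simp: heq_def Q_def hinl_def hinr_def hcase_apply)
    show "\<exists>w. hyp_hom S P T w \<and> heq B (hinl \<then> Q \<then> w) u \<and> heq C (hinr \<then> Q \<then> w) v \<and>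
        (\<forall>w'. hyp_hom S P T w' \<and> heq B (hinl \<then> Q \<then> w') u \<and> heq C (hinr \<then> Q \<then> w') v \<longrightarrow> heq P w' w)"
    proof (intro exI[of _ ?w] conjI allI impI hom e)
      fix w' assume "hyp_hom S P T w' \<and> heq B (hinl \<then> Q \<then> w') u \<and> heq C (hinr \<then> Q \<then> w') v"
      then have "heq ?H (Q \<then> w') ?w"
        unfolding heq_hyp_sum using e by (auto simp: heq_def hcase_apply hinl_def hinr_def)
      then show "heq P w' ?w" using wq by (auto simp: heq_def P_def Q_def)
    qed
  qed (use f g eq in \<open>auto simp: hcomp_def\<close>)
  then show ?thesis by blast
qed

lemma univ_hyp: "univ S t G x i u \<Longrightarrow> hyp S G"
  by (simp add: univ_def)

lemma univ_elem: "univ S t G x i u \<Longrightarrow> elem S G t x i u"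
  by (simp add: univ_def)

lemma univ_exist:
  assumes "univ S t G x i u" "hyp S T" "elem S T t y j v"
  obtains w where "hyp_hom S G T w" "vmap w x = y" "map (nmap w) i = j" "map (nmap w) u = v"
  using assms unfolding univ_def by blast

lemma univ_unique:
  assumes "univ S t G x i u" "hyp_hom S G T w" "hyp_hom S G T w'" "vmap w x = vmap w' x"
    "map (nmap w) i = map (nmap w') i" "map (nmap w) u = map (nmap w') u"
  shows "heq G w w'"
proof -
  have "\<forall>T w w'. hyp_hom S G T w \<longrightarrow> hyp_hom S G T w' \<longrightarrow> vmap w x = vmap w' x \<longrightarrow>
      map (nmap w) i = map (nmap w') i \<longrightarrow> map (nmap w) u = map (nmap w') u \<longrightarrow> heq G w w'"
    using assms(1) unfolding univ_def by (elim conjE)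
  then show ?thesis using assms(2-) by blast
qed

lemma univI:
  assumes "hyp S G" "elem S G t x i u"
    and "\<And>T y j v. hyp S T \<Longrightarrow> elem S T t y j v \<Longrightarrow>
      \<exists>w. hyp_hom S G T w \<and> vmap w x = y \<and> map (nmap w) i = j \<and> map (nmap w) u = v"
    and "\<And>T w w'. hyp_hom S G T w \<Longrightarrow> hyp_hom S G T w' \<Longrightarrow> vmap w x = vmap w' x \<Longrightarrow>
      map (nmap w) i = map (nmap w') i \<Longrightarrow> map (nmap w) u = map (nmap w') u \<Longrightarrow> heq G w w'"
  shows "univ S t G x i u"
  unfolding univ_def using assms(1,2) by (intro conjI allI impI) (simp_all add: assms(3,4))

text \<open>The two coprojections are jointly epic: both maps mediate the cocone induced by
  \<open>w\<close>.\<close>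

lemma pushout_unique:
  assumes po: "is_pushout S A B C P f g p q" and w: "hyp_hom S P T w" "hyp_hom S P T w'"
    and e: "heq B (p \<then> w) (p \<then> w')" "heq C (q \<then> w) (q \<then> w')"
  shows "heq P w w'"
proof -
  have h: "hyp_hom S B P p" "hyp_hom S C P q" "hyp_hom S A B f" "hyp_hom S A C g" "heq A (f \<then> p) (g \<then> q)"
    using po by (auto simp: is_pushout_def)
  have "heq A (f \<then> (p \<then> w)) (g \<then> (q \<then> w))" using h(5) by (simp add: heq_def)
  then obtain w0 where "\<forall>w'. hyp_hom S P T w' \<and> heq B (p \<then> w') (p \<then> w) \<and> heq C (q \<then> w') (q \<then> w) \<longrightarrow> heq P w' w0"
    using po hom_comp[OF h(1) w(1)] hom_comp[OF h(2) w(1)] unfolding is_pushout_def by blast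
  then have "heq P w w0" "heq P w' w0" using w e by (auto intro: heq_sym)
  then show ?thesis by (meson heq_trans heq_sym)
qed

text \<open>A map out of a coproduct is a pair of maps, and an element of a parallel composite is a
  pair of elements. Coproducts appear as pushouts over the empty hypergraph, so that both tagged
  sums and disjoint unions of parts are covered.\<close>

lemma univ_par_pushout:
  fixes S :: "'g signature"
  assumes U: "univ S s G x i u" "univ S t H y j v" and s: "wt (fsig S) s" and t: "wt (fsig S) t"
    and po: "is_pushout S (discrete 0) G H P f g p q"
  shows "univ S (TPar s t) P (VPar (vmap p x) (vmap q y))
    (map (nmap p) i @ map (nmap q) j) (map (nmap p) u @ map (nmap q) v)"
proof (rule univI)
  have h: "hyp_hom S G P p" "hyp_hom S H P q" using po by (auto simp: is_pushout_def)
  show P: "hyp S P" using hom_hyp[OF h(1)] by simp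
  show "elem S P (TPar s t) (VPar (vmap p x) (vmap q y))
      (map (nmap p) i @ map (nmap q) j) (map (nmap p) u @ map (nmap q) v)"
    unfolding elem_par[OF P s]
    using elem_hom[OF h(1) univ_elem[OF U(1)]] elem_hom[OF h(2) univ_elem[OF U(2)]] by blast
  fix T
  show "\<exists>w. hyp_hom S P T w \<and> vmap w (VPar (vmap p x) (vmap q y)) = z \<and>
      map (nmap w) (map (nmap p) i @ map (nmap q) j) = i' \<and> map (nmap w) (map (nmap p) u @ map (nmap q) v) = u'"
    if T: "hyp S T" "elem S T (TPar s t) z i' u'" for z i' u'
  proof -
    obtain a b i1 i2 u1 u2 where e: "z = VPar a b" "i' = i1 @ i2" "u' = u1 @ u2"
      "elem S T s a i1 u1" "elem S T t b i2 u2" using T(2) unfolding elem_par[OF T(1) s] by blast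
    obtain w1 where w1: "hyp_hom S G T w1" "vmap w1 x = a" "map (nmap w1) i = i1" "map (nmap w1) u = u1"
      by (rule univ_exist[OF U(1) T(1) e(4)])
    obtain w2 where w2: "hyp_hom S H T w2" "vmap w2 y = b" "map (nmap w2) j = i2" "map (nmap w2) v = u2"
      by (rule univ_exist[OF U(2) T(1) e(5)])
    have "heq (discrete 0 :: 'g hgraph) (f \<then> w1) (g \<then> w2)" by (simp add: heq_def)
    then obtain w where w: "hyp_hom S P T w" "heq G (p \<then> w) w1" "heq H (q \<then> w) w2"
      using po w1(1) w2(1) unfolding is_pushout_def by blast
    have bG: "set i \<subseteq> nodes G" "set u \<subseteq> nodes G" using elem_bounds[OF univ_hyp[OF U(1)] univ_elem[OF U(1)] s] by auto
    have bH: "set j \<subseteq> nodes H" "set v \<subseteq> nodes H" using elem_bounds[OF univ_hyp[OF U(2)] univ_elem[OF U(2)] t] by auto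
    have "vmap w (vmap p x) = a" "vmap w (vmap q y) = b"
      using vmap_elem_cong[OF univ_hyp[OF U(1)] w(2) univ_elem[OF U(1)] s]
        vmap_elem_cong[OF univ_hyp[OF U(2)] w(3) univ_elem[OF U(2)] t] w1 w2 by (simp_all add: vmap_comp)
    moreover have "map (nmap w) (map (nmap p) i) = i1" "map (nmap w) (map (nmap p) u) = u1"
      "map (nmap w) (map (nmap q) j) = i2" "map (nmap w) (map (nmap q) v) = u2"
      using heq_map[OF w(2) bG(1)] heq_map[OF w(2) bG(2)] heq_map[OF w(3) bH(1)] heq_map[OF w(3) bH(2)]
        w1 w2 by simp_all
    ultimately show ?thesis using w(1) e by (intro exI[of _ w]) simp
  qed
  show "heq P w w'" if w: "hyp_hom S P T w" "hyp_hom S P T w'"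
     "vmap w (VPar (vmap p x) (vmap q y)) = vmap w' (VPar (vmap p x) (vmap q y))"
     "map (nmap w) (map (nmap p) i @ map (nmap q) j) = map (nmap w') (map (nmap p) i @ map (nmap q) j)"
     "map (nmap w) (map (nmap p) u @ map (nmap q) v) = map (nmap w') (map (nmap p) u @ map (nmap q) v)" for w w'
  proof (rule pushout_unique[OF po w(1,2)])
    show "heq H (q \<then> w) (q \<then> w')"
      by (rule univ_unique[OF U(2) hom_comp[OF h(2) w(1)] hom_comp[OF h(2) w(2)]])
        (use w in \<open>simp_all add: vmap_comp\<close>)
    show "heq G (p \<then> w) (p \<then> w')"
      by (rule univ_unique[OF U(1) hom_comp[OF h(1) w(1)] hom_comp[OF h(1) w(2)]])
        (use w in \<open>simp_all add: vmap_comp\<close>)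
  qed
qed

lemma pushout_hyp_sum:
  assumes "hyp S G" "hyp S H"
  shows "is_pushout S (discrete 0) G H (hyp_sum G H) hid hid hinl hinr"
  unfolding is_pushout_def
proof (intro conjI allI impI)
  fix T u v assume u: "hyp_hom S G T u" "hyp_hom S H T v"
  show "\<exists>w. hyp_hom S (hyp_sum G H) T w \<and> heq G (hinl \<then> w) u \<and> heq H (hinr \<then> w) v \<and>
        (\<forall>w'. hyp_hom S (hyp_sum G H) T w' \<and> heq G (hinl \<then> w') u \<and> heq H (hinr \<then> w') v \<longrightarrow>
          heq (hyp_sum G H) w' w)"
    by (rule exI[of _ "hcase u v"]) (simp add: hom_hcase[OF u] heq_hyp_sum)
qed (use assms in \<open>auto simp: hom_discrete hom_hinl hom_hinr heq_def\<close>)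

lemma univ_par:
  assumes U: "univ S s G x i u" "univ S t H y j v" and s: "wt (fsig S) s" and t: "wt (fsig S) t"
  shows "univ S (TPar s t) (hyp_sum G H) (VPar (vmap hinl x) (vmap hinr y))
    (map node_inl i @ map node_inr j) (map node_inl u @ map node_inr v)"
  using univ_par_pushout[OF U s t pushout_hyp_sum[OF univ_hyp[OF U(1)] univ_hyp[OF U(2)]]]
  by (simp add: hinl_def hinr_def)

text \<open>A map out of the pushout is a pair of maps agreeing on the interface, that is, a pair of
  elements with the same middle tuple. This is exactly an element of the sequential
  composite.\<close>

lemma univ_seq:
  fixes S :: "'g signature"
  assumes U: "univ S s G x i m" "univ S t H y m' v" and s: "wt (fsig S) s" and t: "wt (fsig S) t"
    and po: "is_pushout S (discrete k) G H P f g p q" and fg: "leg k f = m" "leg k g = m'"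
  shows "univ S (TSeq s t) P (VSeq (vmap p x) (map (nmap p) m) (vmap q y)) (map (nmap p) i) (map (nmap q) v)"
proof (rule univI)
  have h: "hyp_hom S G P p" "hyp_hom S H P q" "heq (discrete k :: 'g hgraph) (f \<then> p) (g \<then> q)"
    using po by (auto simp: is_pushout_def)
  have m: "map (nmap p) m = map (nmap q) m'" using h(3) fg by (simp add: heq_discrete)
  show "hyp S P" using hom_hyp[OF h(1)] by simp
  show "elem S P (TSeq s t) (VSeq (vmap p x) (map (nmap p) m) (vmap q y)) (map (nmap p) i) (map (nmap q) v)"
    using elem_hom[OF h(1) univ_elem[OF U(1)]] elem_hom[OF h(2) univ_elem[OF U(2)]] m by simp
  fix T
  show "\<exists>w. hyp_hom S P T w \<and> vmap w (VSeq (vmap p x) (map (nmap p) m) (vmap q y)) = z \<and>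
      map (nmap w) (map (nmap p) i) = i' \<and> map (nmap w) (map (nmap q) v) = v'"
    if T: "hyp S T" "elem S T (TSeq s t) z i' v'" for z i' v'
  proof -
    obtain a n b where e: "z = VSeq a n b" "elem S T s a i' n" "elem S T t b n v'" using T(2) by auto
    obtain w1 where w1: "hyp_hom S G T w1" "vmap w1 x = a" "map (nmap w1) i = i'" "map (nmap w1) m = n"
      by (rule univ_exist[OF U(1) T(1) e(2)])
    obtain w2 where w2: "hyp_hom S H T w2" "vmap w2 y = b" "map (nmap w2) m' = n" "map (nmap w2) v = v'"
      by (rule univ_exist[OF U(2) T(1) e(3)])
    have "heq (discrete k :: 'g hgraph) (f \<then> w1) (g \<then> w2)" using fg w1 w2 by (simp add: heq_discrete)
    then obtain w where w: "hyp_hom S P T w" "heq G (p \<then> w) w1" "heq H (q \<then> w) w2"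
      using po w1(1) w2(1) unfolding is_pushout_def by blast
    have bG: "set i \<subseteq> nodes G" "set m \<subseteq> nodes G" using elem_bounds[OF univ_hyp[OF U(1)] univ_elem[OF U(1)] s] by auto
    have bH: "set v \<subseteq> nodes H" using elem_bounds[OF univ_hyp[OF U(2)] univ_elem[OF U(2)] t] by auto
    have "vmap w (vmap p x) = a" "vmap w (vmap q y) = b"
      using vmap_elem_cong[OF univ_hyp[OF U(1)] w(2) univ_elem[OF U(1)] s]
        vmap_elem_cong[OF univ_hyp[OF U(2)] w(3) univ_elem[OF U(2)] t] w1 w2 by (simp_all add: vmap_comp)
    moreover have "map (nmap w) (map (nmap p) i) = i'" "map (nmap w) (map (nmap p) m) = n"
      "map (nmap w) (map (nmap q) v) = v'"
      using heq_map[OF w(2) bG(1)] heq_map[OF w(2) bG(2)] heq_map[OF w(3) bH] w1 w2 by simp_all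
    ultimately show ?thesis using w(1) e by (intro exI[of _ w]) simp
  qed
  show "heq P w w'" if w: "hyp_hom S P T w" "hyp_hom S P T w'"
     "vmap w (VSeq (vmap p x) (map (nmap p) m) (vmap q y)) = vmap w' (VSeq (vmap p x) (map (nmap p) m) (vmap q y))"
     "map (nmap w) (map (nmap p) i) = map (nmap w') (map (nmap p) i)"
     "map (nmap w) (map (nmap q) v) = map (nmap w') (map (nmap q) v)" for w w'
  proof (rule pushout_unique[OF po w(1,2)])
    have "map (nmap w) (map (nmap q) m') = map (nmap w') (map (nmap q) m')"
      using w(3) m by simp
    then show "heq H (q \<then> w) (q \<then> w')"
      by (intro univ_unique[OF U(2) hom_comp[OF h(2) w(1)] hom_comp[OF h(2) w(2)]])
        (use w in \<open>simp_all add: vmap_comp\<close>)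
    show "heq G (p \<then> w) (p \<then> w')"
      by (rule univ_unique[OF U(1) hom_comp[OF h(1) w(1)] hom_comp[OF h(1) w(2)]])
        (use w in \<open>simp_all add: vmap_comp\<close>)
  qed
qed

text \<open>For edge-free terms an element is a free choice of an \<open>n\<close>-tuple
  \<open>j\<close> of nodes, whose positions are displayed on the boundary according to
  \<open>I\<close> and \<open>J\<close>. Covering all positions makes a map determined by its
  boundary.\<close>

lemma univ_discrete:
  fixes S :: "'g signature"
  assumes el: "\<And>T x i u. hyp S T \<Longrightarrow> elem S T t x i u \<longleftrightarrow> x = U \<and>
      (\<exists>j. length j = n \<and> set j \<subseteq> nodes T \<and> i = map ((!) j) I \<and> u = map ((!) j) J)"
    and cov: "set I \<union> set J = {..<n}"
  shows "univ S t (discrete n) U I J"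
proof (rule univI)
  have "v < n" if "v \<in> set I \<union> set J" for v using cov that by blast
  then have "map ((!) [0..<n]) I = I" "map ((!) [0..<n]) J = J"
    by (simp_all add: map_idI)
  then show "elem S (discrete n) t U I J"
    unfolding el[OF hyp_discrete] by (intro conjI exI[of _ "[0..<n]"]) auto
  fix T
  show "\<exists>w. hyp_hom S (discrete n) T w \<and> vmap w U = y \<and> map (nmap w) I = i \<and> map (nmap w) J = u"
    if T: "hyp S T" "elem S T t y i u" for y i u
  proof -
    obtain j where j: "y = U" "length j = n" "set j \<subseteq> nodes T" "i = map ((!) j) I" "u = map ((!) j) J"
      using T(2) unfolding el[OF T(1)] by blast
    have "leg n (lmap j) = j" using leg_lmap[of j] j(2) by simp
    then have "hyp_hom S (discrete n) T (lmap j)" using T(1) j(3) by (simp add: hom_discrete)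
    then show ?thesis using j by (intro exI[of _ "lmap j"]) (simp add: lmap_def node_map_def)
  qed
  show "heq (discrete n :: 'g hgraph) w w'" if "map (nmap w) I = map (nmap w') I" "map (nmap w) J = map (nmap w') J" for w w'
  proof -
    have "nmap w k = nmap w' k" if "k < n" for k
      using that cov \<open>map (nmap w) I = _\<close> \<open>map (nmap w) J = _\<close> by (auto simp: map_eq_conv)
    then show ?thesis by (simp add: heq_def)
  qed
qed simp

section \<open>Cospans representing terms and the values of \<open>Phi\<close>\<close>

definition represents :: "'g signature \<Rightarrow> ('g + frob_gen) tm \<Rightarrow> 'g cospan \<Rightarrow> bool" where
  "represents S t c \<longleftrightarrow> cospan S c \<and> cdom c = tdom (fsig S) t \<and> ccod c = tcod (fsig S) t \<and>
    (\<exists>x. univ S t (apex c) x (leg (cdom c) (lleg c)) (leg (ccod c) (rleg c)))"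

lemma represents_iso:
  assumes "represents S t c" "represents S t d"
  shows "cospan_iso S c d"
proof -
  obtain x y where u: "univ S t (apex c) x (leg (cdom c) (lleg c)) (leg (ccod c) (rleg c))"
    "univ S t (apex d) y (leg (cdom d) (lleg d)) (leg (ccod d) (rleg d))"
    using assms by (auto simp: represents_def)
  then obtain f where "hyp_iso S (apex c) (apex d) f" "map (nmap f) (leg (cdom c) (lleg c)) = leg (cdom d) (lleg d)"
    "map (nmap f) (leg (ccod c) (rleg c)) = leg (ccod d) (rleg d)" by (rule univ_iso)
  then show ?thesis using assms by (auto simp: cospan_iso_def represents_def heq_discrete simp flip: map_map)
qed

lemma represents_transport:
  assumes "represents S t c" "cospan_iso S c d" "wt (fsig S) t"
  shows "represents S t d"
proof -
  obtain x where u: "univ S t (apex c) x (leg (cdom c) (lleg c)) (leg (ccod c) (rleg c))"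
    using assms by (auto simp: represents_def)
  obtain f where f: "hyp_iso S (apex c) (apex d) f" "map (nmap f) (leg (cdom c) (lleg c)) = leg (cdom d) (lleg d)"
    "map (nmap f) (leg (ccod c) (rleg c)) = leg (ccod d) (rleg d)"
    using assms(2) by (auto simp: cospan_iso_def heq_discrete)
  show ?thesis using univ_transport[OF u assms(3) f(1)] f(2,3) assms by (auto simp: represents_def cospan_iso_def)
qed

text \<open>Representing cospans are isomorphic to one another, and isomorphic copies of one
  represent too. So the class of one is the set of all of them, with no trace of the choice.\<close>

lemma represents_class:
  assumes "represents S t c" "wt (fsig S) t"
  shows "cospan_class S c = Collect (represents S t)"
  using represents_iso[OF assms(1)] represents_transport[OF assms(1) _ assms(2)] by (auto simp: cospan_class_def)

definition phi_gen :: "'g signature \<Rightarrow> 'g + frob_gen \<Rightarrow> 'g cospan set" where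
  "phi_gen S = case_sum (\<lambda>g. cospan_class S (gen_cospan S g)) (\<lambda>g. cospan_class S (frob_cospan g))"

lemma represents_id: "represents S (TId n) (Cospan n n (discrete n) hid hid)"
proof -
  have "univ S (TId n) (discrete n) U [0..<n] [0..<n]"
  proof (rule univ_discrete[where n = n])
    show "elem S T (TId n) x i u \<longleftrightarrow> x = U \<and>
      (\<exists>j. length j = n \<and> set j \<subseteq> nodes T \<and> i = map ((!) j) [0..<n] \<and> u = map ((!) j) [0..<n])" for T x i u
      by (auto simp: map_nth)
  qed auto
  then show ?thesis by (auto simp: represents_def cospan_def hom_discrete)
qed

lemma represents_sym: "represents S (TSym n m) (Cospan (n + m) (m + n) (discrete (n + m)) hid
         (node_map (\<lambda>k. if k < m then n + k else k - m)))"
proof -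
  let ?J = "drop n [0..<n + m] @ take n [0..<n + m]"
  have "univ S (TSym n m) (discrete (n + m)) U [0..<n + m] ?J"
  proof (rule univ_discrete[where n = "n + m"])
    show "elem S T (TSym n m) x i u \<longleftrightarrow> x = U \<and>
      (\<exists>j. length j = n + m \<and> set j \<subseteq> nodes T \<and> i = map ((!) j) [0..<n + m] \<and> u = map ((!) j) ?J)" for T x i u
    proof -
      have "map ((!) j) ?J = drop n j @ take n j" if "length j = n + m" for j :: "nat list"
        using that by (metis drop_map map_append map_nth take_map)
      moreover have "map ((!) j) [0..<n + m] = j" if "length j = n + m" for j :: "nat list"
        using that by (metis map_nth)
      ultimately show ?thesis by (auto simp del: map_append)
    qed
  qed auto
  moreover have "map (\<lambda>k. if k < m then n + k else k - m) [0..<m + n] = ?J"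
    by (rule nth_equalityI) (auto simp: nth_append)
  ultimately show ?thesis by (auto simp: represents_def cospan_def hom_discrete)
qed

lemma represents_frob: "represents S (TGen (Inr g)) (frob_cospan g)"
proof -
  have "univ S (TGen (Inr g)) (discrete 1) U (replicate (arity frob_sig g) 0) (replicate (coarity frob_sig g) 0)"
  proof (rule univ_discrete[where n = 1])
    show "elem S T (TGen (Inr g)) x i u \<longleftrightarrow> x = U \<and> (\<exists>j. length j = 1 \<and> set j \<subseteq> nodes T \<and>
      i = map ((!) j) (replicate (arity frob_sig g) 0) \<and> u = map ((!) j) (replicate (coarity frob_sig g) 0))" for T x i u
      by (auto simp: length_Suc_conv)
    show "set (replicate (arity frob_sig g) (0 :: nat)) \<union> set (replicate (coarity frob_sig g) 0) = {..<1}"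
      by (cases g) (auto simp: frob_sig_def)
  qed
  then show ?thesis
    by (auto simp: represents_def cospan_def hom_discrete frob_cospan_def wt_frob map_replicate_const simp del: tdom.simps tcod.simps)
qed

lemma represents_gen:
  assumes g: "g \<in> gens S"
  shows "represents S (TGen (Inl g)) (gen_cospan S g)"
proof -
  let ?G = "gen_hyp S g" and ?n = "arity S g" and ?m = "coarity S g"
  have G: "hyp S ?G" using g by (auto simp: hyp_def gen_hyp_def)
  have "univ S (TGen (Inl g)) ?G (VE 0) [0..<?n] [?n..<?n + ?m]"
  proof (rule univI[OF G])
    show "elem S ?G (TGen (Inl g)) (VE 0) [0..<?n] [?n..<?n + ?m]" by (simp add: gen_hyp_def)
    fix T
    show "\<exists>w. hyp_hom S ?G T w \<and> vmap w (VE 0) = y \<and> map (nmap w) [0..<?n] = i \<and> map (nmap w) [?n..<?n + ?m] = u"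
      if T: "hyp S T" "elem S T (TGen (Inl g)) y i u" for y i u
    proof -
      obtain h where h: "h \<in> edges T" "y = VE h" "label T h = g" "i = sources T h" "u = targets T h" using T(2) by auto
      define w where "w = \<lparr> nmap = (!) (i @ u), emap = \<lambda>_. h \<rparr>"
      have l: "length i = ?n" "length u = ?m" "set (i @ u) \<subseteq> nodes T" using T(1) h by (auto simp: hyp_def)
      have 1: "map (nmap w) [0..<?n] = i" "map (nmap w) [?n..<?n + ?m] = u"
        using l by (auto simp: w_def nth_append intro!: nth_equalityI)
      have "(i @ u) ! k \<in> nodes T" if "k < ?n + ?m" for k
        using that l by (metis length_append nth_mem subsetD)
      then have "hyp_hom S ?G T w" using G T(1) h 1
        by (auto simp: hyp_hom_def gen_hyp_def w_def)
      then show ?thesis using 1 h by (intro exI[of _ w]) (simp add: w_def)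
    qed
    show "heq ?G w w'" if "vmap w (VE 0) = vmap w' (VE 0)" "map (nmap w) [0..<?n] = map (nmap w') [0..<?n]"
       "map (nmap w) [?n..<?n + ?m] = map (nmap w') [?n..<?n + ?m]" for w w'
    proof -
      have "nmap w v = nmap w' v" if "v < ?n + ?m" for v
        using that \<open>map (nmap w) [0..<?n] = _\<close> \<open>map (nmap w) [?n..<?n + ?m] = _\<close>
        by (cases "v < ?n") (auto simp: map_eq_conv)
      then show ?thesis using \<open>vmap w (VE 0) = _\<close> by (auto simp: heq_def gen_hyp_def)
    qed
  qed
  moreover have "map (\<lambda>k. ?n + k) [0..<?m] = [?n..<?n + ?m]"
    using map_add_upt[of ?n ?m] by (simp add: add.commute)
  ultimately show ?thesis using G
    by (auto simp: represents_def cospan_def hom_discrete gen_cospan_def sig_sum_def; auto simp: gen_hyp_def)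
qed

text \<open>Composition in \<open>fterm\<close> is a union over all choices of representatives and
  pushouts. By the universal property all these choices give the same class; one existing choice,
  carried along as nonemptiness, rules out the empty union.\<close>

lemma interp_fterm:
  "wt (fsig S) t \<Longrightarrow> interp (fterm S) (phi_gen S) t = Collect (represents S t) \<and> Collect (represents S t) \<noteq> {}"
proof (induction t)
  case (TId n)
  then show ?case using represents_class[OF represents_id, of S n] represents_id[of S n] by (auto simp: fterm_def)
next
  case (TSym n m)
  then show ?case using represents_class[OF represents_sym, of S n m] represents_sym[of S n m] by (auto simp: fterm_def)
next
  case (TGen g)
  show ?case
  proof (cases g)
    case (Inl a)
    then have "a \<in> gens S" using TGen by (auto simp: sig_sum_def)
    from represents_gen[OF this] represents_class[OF represents_gen[OF this]] show ?thesis using Inl TGen by (auto simp: phi_gen_def)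
  next
    case (Inr a)
    from represents_frob[of S a] represents_class[OF represents_frob, of S a] show ?thesis using Inr TGen by (auto simp: phi_gen_def)
  qed
next
  case (TSeq s t)
  have w: "wt (fsig S) s" "wt (fsig S) t" "tcod (fsig S) s = tdom (fsig S) t" using TSeq.prems by auto
  have IH: "interp (fterm S) (phi_gen S) s = Collect (represents S s)" "interp (fterm S) (phi_gen S) t = Collect (represents S t)"
    using TSeq w by auto
  obtain c0 d0 where cd: "represents S s c0" "represents S t d0" using TSeq.IH w by auto
  have comp: "represents S (TSeq s t) (Cospan (cdom c) (ccod d) P (lleg c \<then> p) (rleg d \<then> q))"
    if c: "represents S s c" and d: "represents S t d" and po: "is_pushout S (discrete (ccod c)) (apex c) (apex d) P (rleg c) (lleg d) p q"
    for c d P p q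
  proof -
    have k: "cdom d = ccod c" using c d w(3) by (simp add: represents_def)
    obtain x y where u: "univ S s (apex c) x (leg (cdom c) (lleg c)) (leg (ccod c) (rleg c))"
      "univ S t (apex d) y (leg (ccod c) (lleg d)) (leg (ccod d) (rleg d))"
      using c d k by (auto simp: represents_def)
    have h: "hyp_hom S (apex c) P p" "hyp_hom S (apex d) P q" using po by (auto simp: is_pushout_def)
    have "cospan S (Cospan (cdom c) (ccod d) P (lleg c \<then> p) (rleg d \<then> q))"
      using c d h hom_comp by (auto simp: represents_def cospan_def)
    then show ?thesis using univ_seq[OF u w(1,2) po HOL.refl HOL.refl] c d by (auto simp: represents_def)
  qed
  have eq: "cospan_class S (Cospan (cdom c) (ccod d) P (lleg c \<then> p) (rleg d \<then> q)) = Collect (represents S (TSeq s t))"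
    if "represents S s c" "represents S t d" "is_pushout S (discrete (ccod c)) (apex c) (apex d) P (rleg c) (lleg d) p q"
    for c d P p q
    by (rule represents_class[OF comp[OF that] TSeq.prems])
  have k0: "cdom d0 = ccod c0" using cd w(3) by (simp add: represents_def)
  obtain P p q where po: "is_pushout S (discrete (ccod c0)) (apex c0) (apex d0) P (rleg c0) (lleg d0) p q"
    using pushout_exists[of S "ccod c0" "apex c0" "rleg c0" "apex d0" "lleg d0"] cd k0
    by (auto simp: represents_def cospan_def)
  have "cmp (fterm S) (Collect (represents S s)) (Collect (represents S t)) = Collect (represents S (TSeq s t))"
  proof
    show "cmp (fterm S) (Collect (represents S s)) (Collect (represents S t)) \<subseteq> Collect (represents S (TSeq s t))"
      using eq by (auto simp: fterm_def)
    have "cospan_class S (Cospan (cdom c0) (ccod d0) P (lleg c0 \<then> p) (rleg d0 \<then> q)) \<subseteq>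
        cmp (fterm S) (Collect (represents S s)) (Collect (represents S t))"
      unfolding fterm_def prop_data.simps
      by (rule Union_upper, rule CollectI, rule exI[of _ c0], rule exI[of _ d0], rule exI[of _ P],
        rule exI[of _ p], rule exI[of _ q]) (use cd k0 po in simp)
    then show "Collect (represents S (TSeq s t)) \<subseteq> cmp (fterm S) (Collect (represents S s)) (Collect (represents S t))"
      using eq[OF cd po] by simp
  qed
  then show ?case using IH comp[OF cd po] by auto
next
  case (TPar s t)
  have w: "wt (fsig S) s" "wt (fsig S) t" using TPar.prems by auto
  have IH: "interp (fterm S) (phi_gen S) s = Collect (represents S s)" "interp (fterm S) (phi_gen S) t = Collect (represents S t)"
    using TPar w by auto
  obtain c0 d0 where cd: "represents S s c0" "represents S t d0" using TPar.IH w by auto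
  have comp: "represents S (TPar s t) (cospan_sum c d)" if c: "represents S s c" and d: "represents S t d" for c d
  proof -
    obtain x y where u: "univ S s (apex c) x (leg (cdom c) (lleg c)) (leg (ccod c) (rleg c))"
      "univ S t (apex d) y (leg (cdom d) (lleg d)) (leg (ccod d) (rleg d))"
      using c d by (auto simp: represents_def)
    have l: "nmap (node_map f) = f" for f by (simp add: node_map_def)
    note U = univ_par[OF u w]
    have b: "set (map node_inl (leg (cdom c) (lleg c)) @ map node_inr (leg (cdom d) (lleg d))) \<subseteq> nodes (hyp_sum (apex c) (apex d)) \<and>
      set (map node_inl (leg (ccod c) (rleg c)) @ map node_inr (leg (ccod d) (rleg d))) \<subseteq> nodes (hyp_sum (apex c) (apex d))"
      using elem_bounds[OF univ_hyp[OF U] univ_elem[OF U] TPar.prems] by blast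
    then have "cospan S (cospan_sum c d)"
      using univ_hyp[OF U] by (auto simp: cospan_def cospan_sum_def hom_discrete l simp flip: map_map)
    then show ?thesis using U c d by (auto simp: represents_def cospan_sum_def l simp flip: map_map)
  qed
  have eq: "cospan_class S (cospan_sum c d) = Collect (represents S (TPar s t))" if "represents S s c" "represents S t d" for c d
    by (rule represents_class[OF comp[OF that] TPar.prems])
  have "tens (fterm S) (Collect (represents S s)) (Collect (represents S t)) = Collect (represents S (TPar s t))"
    using eq cd by (auto simp: fterm_def)
  then show ?case using IH comp[OF cd] by auto
qed

abbreviation feqs :: "(('g + frob_gen) tm \<times> ('g + frob_gen) tm) set" where
  "feqs \<equiv> eqs_sum {} frob_eqs"

text \<open>A bijection of values over a fixed boundary is a special case of the natural bijections
  handled by \<open>univ_nat_iso\<close>; the cospan, legs included, does not change.\<close>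

lemma represents_tm_eq:
  assumes "tm_eq (fsig S) feqs s t" "represents S s c"
  shows "represents S t c"
proof -
  obtain B where B: "bd_iso S s t B" using tm_eq_bd_iso[OF assms(1)] by blast
  have N: "nat_iso S s t (\<lambda>x i u y j v. B x y i u \<and> j = i \<and> v = u)"
    unfolding nat_iso_def
  proof (intro conjI allI impI, goal_cases)
    case (1 T x i u)
    then show ?case using bd_isoD(1)[OF B] by blast
  next
    case (2 T x i u)
    then show ?case using bd_isoD(2)[OF B] by blast
  qed (auto dest: bd_isoD(3)[OF B] bd_isoD(4)[OF B] intro: bd_isoD(5)[OF B])
  obtain x where u: "univ S s (apex c) x (leg (cdom c) (lleg c)) (leg (ccod c) (rleg c))"
    using assms(2) by (auto simp: represents_def)
  obtain y where "B x y (leg (cdom c) (lleg c)) (leg (ccod c) (rleg c))"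
    using bd_isoD(1)[OF B univ_hyp[OF u] univ_elem[OF u]] by blast
  then have "univ S t (apex c) y (leg (cdom c) (lleg c)) (leg (ccod c) (rleg c))"
    by (intro univ_nat_iso[OF u N]) simp
  then show ?thesis using assms(2) tm_eq_wt[OF assms(1)] by (auto simp: represents_def)
qed

text \<open>\<open>Phi\<close> evaluates the term picked by \<open>rep\<close>. Invariance of
  \<open>represents\<close> under the laws allows any other member of the class in its
  place.\<close>

lemma Phi_class:
  assumes "wt (fsig S) t"
  shows "Phi S (tm_class (fsig S) feqs t) = Collect (represents S t)" "Collect (represents S t) \<noteq> {}"
proof -
  have e: "tm_eq (fsig S) feqs t (rep (tm_class (fsig S) feqs t))" by (rule tm_eq_rep[OF assms])
  then have "interp (fterm S) (phi_gen S) (rep (tm_class (fsig S) feqs t)) =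
      Collect (represents S (rep (tm_class (fsig S) feqs t)))"
    using interp_fterm tm_eq_wt by blast
  also have "\<dots> = Collect (represents S t)"
    using represents_tm_eq[OF e] represents_tm_eq[OF tm_eq.sym[OF e]] by blast
  finally show "Phi S (tm_class (fsig S) feqs t) = Collect (represents S t)"
    by (simp add: Phi_def induced_def phi_gen_def)
  show "Collect (represents S t) \<noteq> {}" using interp_fterm[OF assms] by blast
qed

lemma free_inj_class:
  assumes "wt S t"
  shows "free_inj S (tm_class S {} t) = tm_class (fsig S) feqs (map_tm Inl t)"
proof -
  let ?\<gamma> = "\<lambda>g. tm_class (fsig S) feqs (TGen (Inl g))"
  have gl: "g \<in> gens S \<Longrightarrow> wt (fsig S) (TGen (Inl g)) \<and> arity (fsig S) (Inl g) = arity S g \<and>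
      coarity (fsig S) (Inl g) = coarity S g" for g
    by (auto simp: sig_sum_def)
  have hl: "g \<in> gens S \<Longrightarrow> ?\<gamma> g \<in> homset (presented (fsig S) feqs) (arity S g) (coarity S g)" for g
    unfolding homset_presented using gl[of g] by (intro exI[of _ "TGen (Inl g)"]) auto
  show ?thesis
    unfolding free_inj_def coprod_inl_def coprod_presented_def
    using induced_class[of "presented (fsig S) feqs" S ?\<gamma> "{}" t, OF prop_cat_presented hl _ assms]
      interp_presented[of S "fsig S" Inl t feqs, OF gl assms] by simp
qed

section \<open>Caps and bending\<close>

fun cap_tm :: "nat \<Rightarrow> ('g + frob_gen) tm" where
  "cap_tm 0 = TId 0"
| "cap_tm (Suc 0) = TSeq (TGen (Inr Eta)) (TGen (Inr Delta))"
| "cap_tm (Suc (Suc n)) = TSeq (TPar (cap_tm (Suc 0)) (cap_tm (Suc n)))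
     (TPar (TPar (TId 1) (TSym 1 (Suc n))) (TId (Suc n)))"

lemma cap_tm_typing:
  "wt (fsig S) (cap_tm n :: ('g + frob_gen) tm) \<and> tdom (fsig S) (cap_tm n :: ('g + frob_gen) tm) = 0 \<and>
   tcod (fsig S) (cap_tm n :: ('g + frob_gen) tm) = n + n"
  by (induction n rule: cap_tm.induct) (auto simp: sig_sum_def frob_sig_def)

lemma cap_class:
  fixes S :: "'g signature"
  shows "cap S n = tm_class (fsig S) feqs (cap_tm n)"
proof (induction n rule: cap_tm.induct)
  case 1
  then show ?case by (simp add: free_plus_frob_def coprod_presented_def presented_simps)
next
  case 2
  then show ?case
    unfolding cap.simps(2) cap_tm.simps(2) free_plus_frob_def coprod_presented_def frob_arr_def
    by (rule presented_simps(6)) (auto simp: frob_sig_def sig_sum_def)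
next
  case (3 n)
  let ?X = "presented (fsig S) feqs"
  have t: "wt (fsig S) (cap_tm (Suc 0) :: ('g + frob_gen) tm)" "wt (fsig S) (cap_tm (Suc n) :: ('g + frob_gen) tm)"
    "tcod (fsig S) (cap_tm (Suc 0) :: ('g + frob_gen) tm) = 2"
    "tcod (fsig S) (cap_tm (Suc n) :: ('g + frob_gen) tm) = Suc n + Suc n"
    using cap_tm_typing[of S "Suc 0"] cap_tm_typing[of S "Suc n"] by auto
  show ?case
    unfolding cap.simps(3) cap_tm.simps(3) 3 Let_def free_plus_frob_def coprod_presented_def
    using t by (simp add: presented_simps del: cap_tm.simps)
qed

definition bend_tm :: "nat \<Rightarrow> 'g tm \<Rightarrow> ('g + frob_gen) tm" where
  "bend_tm n t = TSeq (cap_tm n) (TPar (TId n) (map_tm Inl t))"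

lemma bend_tm_typing:
  assumes "wt S t" "tdom S t = n"
  shows "wt (fsig S) (bend_tm n t) \<and> tdom (fsig S) (bend_tm n t) = 0 \<and> tcod (fsig S) (bend_tm n t) = n + tcod S t"
  using assms cap_tm_typing[of S n] by (simp add: bend_tm_def map_tm_typing)

lemma bend_class:
  assumes "wt S t" "tdom S t = n"
  shows "bend S (free_inj S (tm_class S {} t)) = tm_class (fsig S) feqs (bend_tm n t)"
  unfolding bend_def Let_def free_inj_class[OF assms(1)] free_plus_frob_def coprod_presented_def cap_class
  using assms cap_tm_typing[of S] by (simp add: presented_simps map_tm_typing bend_tm_def)

text \<open>A cap contains no edges, so its value is determined by the tuple of nodes on its wires.
  The clauses follow those of \<open>cap_tm\<close> and spell out the middle tuples.\<close>

fun cap_val :: "nat list \<Rightarrow> val" where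
  "cap_val [] = U"
| "cap_val [v] = VSeq U [v] U"
| "cap_val (v # v' # vs) = VSeq (VPar (VSeq U [v] U) (cap_val (v' # vs))) ([v, v] @ (v' # vs) @ (v' # vs)) (VPar (VPar U U) U)"

lemma cap_val_map: "vmap w (cap_val vs) = cap_val (map (nmap w) vs)"
  by (induction vs rule: cap_val.induct) auto

lemma elem_parI:
  assumes "hyp S T" "wt (fsig S) s" "elem S T s a i\<^sub>1 u\<^sub>1" "elem S T t b i\<^sub>2 u\<^sub>2"
  shows "elem S T (TPar s t) (VPar a b) (i\<^sub>1 @ i\<^sub>2) (u\<^sub>1 @ u\<^sub>2)"
  unfolding elem_par[OF assms(1,2)] using assms(3,4) by blast

text \<open>An element of a cap is one tuple of nodes displayed twice. In the recursion the middle
  tuple is \<open>[v, v] @ vs @ vs\<close>, and the symmetry moves the second \<open>v\<close> past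
  the first copy of \<open>vs\<close>.\<close>

lemma elem_cap:
  fixes S :: "'g signature"
  assumes "hyp S T"
  shows "elem S T (cap_tm n) x i u \<longleftrightarrow> (\<exists>vs. length vs = n \<and> set vs \<subseteq> nodes T \<and> x = cap_val vs \<and> i = [] \<and> u = vs @ vs)"
proof (induction n arbitrary: x i u rule: cap_tm.induct)
  case 1
  then show ?case by auto
next
  case 2
  show ?case by (auto simp: elem_frob length_Suc_conv simp del: elem.simps(3))
next
  case (3 n)
  have w1: "wt (fsig S) (cap_tm (Suc 0) :: ('g + frob_gen) tm)"
    using cap_tm_typing by blast
  have w2: "wt (fsig S) (TPar (TId 1) (TSym 1 (Suc n)))" "wt (fsig S) (TId 1)" by simp_all
  \<comment> \<open>Elements of the shuffle in the recursive clause: the wire \<open>a\<close> is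
    carried past the block \<open>b\<close>, while \<open>v\<close> and \<open>c\<close> stay in
    place.\<close>
  have p: "elem S T (TPar (TPar (TId 1) (TSym 1 (Suc n))) (TId (Suc n))) y m u \<longleftrightarrow>
    (\<exists>v a b c. y = VPar (VPar U U) U \<and> m = [v] @ ([a] @ b) @ c \<and> u = [v] @ (b @ [a]) @ c \<and>
      length b = Suc n \<and> length c = Suc n \<and> insert v (insert a (set b \<union> set c)) \<subseteq> nodes T)" for y m u
  proof (rule iffI, goal_cases)
    case 1
    then obtain i1 i2 v k where h: "y = VPar (VPar U U) U" "m = ([v] @ k) @ i2" "u = ([v] @ drop 1 k @ take 1 k) @ i2"
      "length k = Suc (Suc n)" "length i2 = Suc n" "insert v (set k \<union> set i2) \<subseteq> nodes T"
      unfolding elem_par[OF assms w2(1)] elem_par[OF assms w2(2)]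
      by (auto simp: length_Suc_conv[of _ 0])
    then obtain a b where "k = a # b" by (cases k) auto
    then show ?case using h by auto
  next
    case 2
    then obtain v a b c where h: "y = VPar (VPar U U) U" "m = [v] @ ([a] @ b) @ c" "u = [v] @ (b @ [a]) @ c"
      "length b = Suc n" "length c = Suc n" "insert v (insert a (set b \<union> set c)) \<subseteq> nodes T" by blast
    have "elem S T (TPar (TId 1) (TSym 1 (Suc n))) (VPar U U) (v # a # b) (v # b @ [a])"
      using h by simp
    moreover have "elem S T (TId (Suc n)) U c c" using h by simp
    ultimately have "elem S T (TPar (TPar (TId 1) (TSym 1 (Suc n))) (TId (Suc n))) (VPar (VPar U U) U)
        ((v # a # b) @ c) ((v # b @ [a]) @ c)"
      by (rule elem_parI[OF assms w2(1)])
    then show ?case using h(1,2,3) by (simp del: elem.simps)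
  qed
  show ?case
  proof
    assume "elem S T (cap_tm (Suc (Suc n))) x i u"
    then obtain c m d where e: "x = VSeq c m d" "elem S T (TPar (cap_tm (Suc 0)) (cap_tm (Suc n))) c i m"
      "elem S T (TPar (TPar (TId 1) (TSym 1 (Suc n))) (TId (Suc n))) d m u"
      unfolding cap_tm.simps(3) elem.simps(4) by blast
    from e(2) obtain v vs where c: "c = VPar (cap_val [v]) (cap_val vs)" "i = []" "m = ([v] @ [v]) @ (vs @ vs)"
      "length vs = Suc n" "insert v (set vs) \<subseteq> nodes T"
    proof -
      obtain a b u1 u2 vs0 vs where h: "c = VPar a b" "m = u1 @ u2" "length vs0 = Suc 0" "length vs = Suc n"
        "set vs0 \<subseteq> nodes T" "set vs \<subseteq> nodes T" "a = cap_val vs0" "b = cap_val vs" "i = []"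
        "u1 = vs0 @ vs0" "u2 = vs @ vs"
        using e(2) unfolding elem_par[OF assms w1] 3 by blast
      obtain v where "vs0 = [v]" using h(3) by (auto simp: length_Suc_conv)
      then show ?thesis using that[of v vs] h by simp
    qed
    have d: "d = VPar (VPar U U) U" "u = [v] @ (vs @ [v]) @ vs"
    proof -
      obtain v' a b c' where h: "d = VPar (VPar U U) U" "m = [v'] @ ([a] @ b) @ c'" "u = [v'] @ (b @ [a]) @ c'"
        "length b = Suc n" using e(3) unfolding p by blast
      have "v' = v" "a = v" "b @ c' = vs @ vs" using h(2) c(3) by simp_all
      moreover from this have "b = vs" "c' = vs" using h(4) c(4) by (simp_all add: append_eq_append_conv)
      ultimately show "d = VPar (VPar U U) U" "u = [v] @ (vs @ [v]) @ vs" using h by simp_all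
    qed
    obtain v' vs' where vs: "vs = v' # vs'" using c(4) by (cases vs) auto
    show "\<exists>vs. length vs = Suc (Suc n) \<and> set vs \<subseteq> nodes T \<and> x = cap_val vs \<and> i = [] \<and> u = vs @ vs"
    proof (intro exI conjI)
      show "length (v # vs) = Suc (Suc n)" "set (v # vs) \<subseteq> nodes T" using c(4,5) by simp_all
      show "x = cap_val (v # vs)" unfolding e(1) c(1,3) d(1) vs by simp
      show "u = (v # vs) @ (v # vs)" unfolding d(2) by simp
    qed (rule c(2))
  next
    assume "\<exists>vs. length vs = Suc (Suc n) \<and> set vs \<subseteq> nodes T \<and> x = cap_val vs \<and> i = [] \<and> u = vs @ vs"
    then obtain v v' vs' where vs: "length (v' # vs') = Suc n" "insert v (set (v' # vs')) \<subseteq> nodes T"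
      "x = cap_val (v # v' # vs')" "i = []" "u = (v # v' # vs') @ (v # v' # vs')"
    proof -
      obtain ws where ws: "length ws = Suc (Suc n)" "set ws \<subseteq> nodes T" "x = cap_val ws" "i = []" "u = ws @ ws"
        using \<open>\<exists>vs. _\<close> by blast
      obtain v v' vs' where "ws = v # v' # vs'" using ws(1) by (auto simp: length_Suc_conv)
      then show ?thesis using that[of v' vs' v] ws by simp
    qed
    let ?vs = "v' # vs'"
    have "elem S T (TPar (cap_tm (Suc 0)) (cap_tm (Suc n))) (VPar (VSeq U [v] U) (cap_val ?vs)) [] ([v, v] @ ?vs @ ?vs)"
    proof -
      have 1: "elem S T (cap_tm (Suc 0)) (VSeq U [v] U) [] [v, v]"
        unfolding 3(1) by (rule exI[of _ "[v]"]) (use vs in simp)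
      have 2: "elem S T (cap_tm (Suc n)) (cap_val ?vs) [] (?vs @ ?vs)"
        unfolding 3(2) by (rule exI[of _ ?vs]) (use vs in simp)
      show ?thesis using elem_parI[OF assms w1 1 2] by (simp del: elem.simps)
    qed
    moreover have "elem S T (TPar (TPar (TId 1) (TSym 1 (Suc n))) (TId (Suc n))) (VPar (VPar U U) U) ([v, v] @ ?vs @ ?vs) u"
      unfolding p by (rule exI[of _ v], rule exI[of _ v], rule exI[of _ ?vs], rule exI[of _ ?vs]) (use vs in auto)
    ultimately show "elem S T (cap_tm (Suc (Suc n))) x i u"
      unfolding cap_tm.simps(3) elem.simps(4) using vs by auto
  qed
qed

text \<open>The cap produces two equal tuples: one is displayed as output and the other is fed to
  \<open>t\<close>. So a bent element is an element of \<open>t\<close> with its inputs written in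
  front of its outputs.\<close>

lemma bend_nat_iso:
  assumes t: "wt S t" "tdom S t = n"
  shows "nat_iso S (map_tm Inl t) (bend_tm n t) (\<lambda>x i u y j v. length i = n \<and>
     y = VSeq (cap_val i) (i @ i) (VPar U x) \<and> j = [] \<and> v = i @ u)"
  unfolding nat_iso_def
proof (intro conjI allI impI, goal_cases)
  case (1 T x i u)
  have b: "length i = n" "set i \<subseteq> nodes T" using elem_bounds[OF 1] t by (auto simp: map_tm_typing)
  have "elem S T (cap_tm n) (cap_val i) [] (i @ i)" unfolding elem_cap[OF 1(1)] using b by blast
  then have "elem S T (bend_tm n t) (VSeq (cap_val i) (i @ i) (VPar U x)) [] (i @ u)"
    unfolding bend_tm_def using b 1 by simp
  then show ?case using b by blast
next
  case (2 T y j v)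
  then obtain a m b where e: "y = VSeq a m b" "elem S T (cap_tm n) a j m" "elem S T (TPar (TId n) (map_tm Inl t)) b m v"
    unfolding bend_tm_def by auto
  obtain vs where vs: "length vs = n" "a = cap_val vs" "j = []" "m = vs @ vs"
    using e(2) unfolding elem_cap[OF 2(1)] by blast
  obtain x where x: "b = VPar U x" "take n v = vs" "elem S T (map_tm Inl t) x vs (drop n v)"
    using e(3) vs by auto
  have v: "v = vs @ drop n v" using append_take_drop_id[of n v] unfolding x(2) by (rule HOL.sym)
  show ?case
    by (rule exI[of _ x], rule exI[of _ vs], rule exI[of _ "drop n v"])
      (intro conjI vs(1,3) v x(3), simp add: e vs x(1))
qed (elim conjE, simp add: cap_val_map)+

text \<open>Transporting universal elements both ways along bending describes the bent cospan by the
  term itself: cutting its right leg at position \<open>n\<close> recovers inputs and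
  outputs.\<close>

lemma Phi_bend:
  fixes S :: "'g signature"
  assumes t: "wt S t" "tdom S t = n" "tcod S t = m"
  shows "Phi S (bend S (free_inj S (tm_class S {} t))) = {c. cospan S c \<and> cdom c = 0 \<and> ccod c = n + m \<and>
    (\<exists>x. univ S (map_tm Inl t) (apex c) x (take n (leg (n + m) (rleg c))) (drop n (leg (n + m) (rleg c))))}"
proof -
  note N = bend_nat_iso[OF t(1,2)]
  have w: "wt (fsig S) (bend_tm n t)" "tdom (fsig S) (bend_tm n t) = 0" "tcod (fsig S) (bend_tm n t) = n + m"
    using bend_tm_typing[OF t(1,2)] t(3) by auto
  have w': "wt (fsig S) (map_tm Inl t)" "tdom (fsig S) (map_tm Inl t) = n"
    using t by (simp_all add: map_tm_typing)
  have N': "nat_iso S (bend_tm n t) (map_tm Inl t) (\<lambda>y j v x i u. length i = n \<and>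
     y = VSeq (cap_val i) (i @ i) (VPar U x) \<and> j = [] \<and> v = i @ u)"
    unfolding nat_iso_def
  proof (intro conjI allI impI, goal_cases)
    case (1 T y j v)
    then show ?case using nat_isoD(2)[OF N 1] by blast
  next
    case (2 T x i u)
    then show ?case using nat_isoD(1)[OF N 2] by blast
  qed (elim conjE, simp add: cap_val_map)+
  have eq: "(\<exists>y. univ S (bend_tm n t) G y [] v) \<longleftrightarrow> (\<exists>x. univ S (map_tm Inl t) G x (take n v) (drop n v))"
    if "length v = n + m" for G v
  proof
    assume "\<exists>y. univ S (bend_tm n t) G y [] v"
    then obtain y where y: "univ S (bend_tm n t) G y [] v" by blast
    then obtain x i u where x: "length i = n" "y = VSeq (cap_val i) (i @ i) (VPar U x)" "v = i @ u"
      using nat_isoD(2)[OF N univ_hyp[OF y] univ_elem[OF y]] by blast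
    have "univ S (map_tm Inl t) G x i u"
      by (rule univ_nat_iso[OF y N']) (use x in simp)
    then show "\<exists>x. univ S (map_tm Inl t) G x (take n v) (drop n v)" using x by auto
  next
    assume "\<exists>x. univ S (map_tm Inl t) G x (take n v) (drop n v)"
    then obtain x where x: "univ S (map_tm Inl t) G x (take n v) (drop n v)" by blast
    have "univ S (bend_tm n t) G (VSeq (cap_val (take n v)) (take n v @ take n v) (VPar U x)) [] v"
      by (rule univ_nat_iso[OF x N]) (use that in simp)
    then show "\<exists>y. univ S (bend_tm n t) G y [] v" by blast
  qed
  have l: "leg 0 f = []" for f by (simp add: leg_def)
  show ?thesis
    unfolding bend_class[OF t(1,2)] Phi_class(1)[OF w(1)]
  proof (rule Collect_cong)
    show "represents S (bend_tm n t) c \<longleftrightarrow> cospan S c \<and> cdom c = 0 \<and> ccod c = n + m \<and>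
      (\<exists>x. univ S (map_tm Inl t) (apex c) x (take n (leg (n + m) (rleg c))) (drop n (leg (n + m) (rleg c))))" for c
      unfolding represents_def w using eq[of "leg (n + m) (rleg c)" "apex c"] l by (metis length_leg)
  qed
qed

section \<open>Denotations as parts of an ambient hypergraph\<close>

text \<open>Only the node and edge sets change, so the inclusion between two parts of
  \<open>A\<close> is the identity map \<open>hid\<close> and no renaming appears in
  compositions.\<close>

definition subhyp :: "'g hgraph \<Rightarrow> nat set \<Rightarrow> nat set \<Rightarrow> 'g hgraph" where
  "subhyp A V E = A\<lparr> nodes := V, edges := E \<rparr>"

lemma subhyp_simps [simp]:
  "nodes (subhyp A V E) = V" "edges (subhyp A V E) = E" "sources (subhyp A V E) = sources A"
  "targets (subhyp A V E) = targets A" "label (subhyp A V E) = label A" "subhyp A (nodes A) (edges A) = A"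
  by (simp_all add: subhyp_def)

lemma hom_sub: "hyp S (subhyp A V E) \<Longrightarrow> hyp S (subhyp A V' E') \<Longrightarrow> V \<subseteq> V' \<Longrightarrow> E \<subseteq> E' \<Longrightarrow>
    hyp_hom S (subhyp A V E) (subhyp A V' E') hid"
  by (auto simp: hyp_hom_def)

lemma hyp_sub_Un: "hyp S (subhyp A V E) \<Longrightarrow> hyp S (subhyp A V' E') \<Longrightarrow> hyp S (subhyp A (V \<union> V') (E \<union> E'))"
  by (auto simp: hyp_def)

definition glue :: "nat set \<Rightarrow> nat set \<Rightarrow> hmap \<Rightarrow> hmap \<Rightarrow> hmap" where
  "glue V E f g = \<lparr> nmap = (\<lambda>v. if v \<in> V then nmap f v else nmap g v), emap = (\<lambda>h. if h \<in> E then emap f h else emap g h) \<rparr>"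

lemma glue_heq:
  assumes "\<And>v. v \<in> V \<inter> V' \<Longrightarrow> nmap f v = nmap g v" "E \<inter> E' = {}"
  shows "heq (subhyp A V E) (glue V E f g) f" "heq (subhyp A V' E') (glue V E f g) g"
  using assms by (auto simp: heq_def glue_def)

lemma hom_glue:
  assumes f: "hyp_hom S (subhyp A V E) T f" and g: "hyp_hom S (subhyp A V' E') T g"
    and ag: "\<And>v. v \<in> V \<inter> V' \<Longrightarrow> nmap f v = nmap g v" and E: "E \<inter> E' = {}"
  shows "hyp_hom S (subhyp A (V \<union> V') (E \<union> E')) T (glue V E f g)"
proof -
  let ?w = "glue V E f g"
  have h: "hyp S (subhyp A V E)" "hyp S (subhyp A V' E')" "hyp S T" using f g by (auto simp: hyp_hom_def)
  have n: "nmap ?w v = nmap f v" if "v \<in> V" for v using that by (simp add: glue_def)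
  have n': "nmap ?w v = nmap g v" if "v \<in> V'" for v using that ag by (simp add: glue_def)
  have 1: "emap ?w h = emap f h" "map (nmap ?w) (sources A h) = map (nmap f) (sources A h)"
     "map (nmap ?w) (targets A h) = map (nmap f) (targets A h)" if "h \<in> E" for h
  proof -
    have "set (sources A h) \<subseteq> V" "set (targets A h) \<subseteq> V" using h(1) that by (auto simp: hyp_def)
    then show "map (nmap ?w) (sources A h) = map (nmap f) (sources A h)"
     "map (nmap ?w) (targets A h) = map (nmap f) (targets A h)" using n by auto
  qed (use that in \<open>simp add: glue_def\<close>)
  have 2: "emap ?w h = emap g h" "map (nmap ?w) (sources A h) = map (nmap g) (sources A h)"
     "map (nmap ?w) (targets A h) = map (nmap g) (targets A h)" if "h \<in> E'" for h
  proof -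
    have "set (sources A h) \<subseteq> V'" "set (targets A h) \<subseteq> V'" using h(2) that by (auto simp: hyp_def)
    then show "map (nmap ?w) (sources A h) = map (nmap g) (sources A h)"
     "map (nmap ?w) (targets A h) = map (nmap g) (targets A h)" using n' by auto
  qed (use that E in \<open>auto simp: glue_def\<close>)
  show ?thesis
    unfolding hyp_hom_def
  proof (intro conjI ballI)
    show "hyp S (subhyp A (V \<union> V') (E \<union> E'))" by (rule hyp_sub_Un[OF h(1,2)])
    show "hyp S T" by (rule h(3))
    show "nmap ?w v \<in> nodes T" if "v \<in> nodes (subhyp A (V \<union> V') (E \<union> E'))" for v
      using that n[of v] n'[of v] f g by (auto simp: hyp_hom_def)
    fix k assume "k \<in> edges (subhyp A (V \<union> V') (E \<union> E'))"
    then consider "k \<in> E" | "k \<in> E'" by auto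
    then have "emap ?w k \<in> edges T \<and> sources T (emap ?w k) = map (nmap ?w) (sources A k) \<and>
      targets T (emap ?w k) = map (nmap ?w) (targets A k) \<and> label T (emap ?w k) = label A k"
    proof cases
      assume k: "k \<in> E"
      show ?thesis unfolding 1[OF k] using f k by (simp add: hyp_hom_def)
    next
      assume k: "k \<in> E'"
      show ?thesis unfolding 2[OF k] using g k by (simp add: hyp_hom_def)
    qed
    then show "emap ?w k \<in> edges T"
      "sources T (emap ?w k) = map (nmap ?w) (sources (subhyp A (V \<union> V') (E \<union> E')) k)"
      "targets T (emap ?w k) = map (nmap ?w) (targets (subhyp A (V \<union> V') (E \<union> E')) k)"
      "label T (emap ?w k) = label (subhyp A (V \<union> V') (E \<union> E')) k" by simp_all
  qed
qed

text \<open>A union is the pushout of its parts over their intersection. Disjoint edge sets and a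
  list \<open>w\<close> enumerating the common nodes put the intersection in the form of a discrete
  interface.\<close>

lemma pushout_sub:
  assumes h: "hyp S (subhyp A V E)" "hyp S (subhyp A V' E')" and w: "V \<inter> V' = set w" "E \<inter> E' = {}"
  shows "is_pushout S (discrete (length w)) (subhyp A V E) (subhyp A V' E') (subhyp A (V \<union> V') (E \<union> E'))
    (lmap w) (lmap w) hid hid"
  unfolding is_pushout_def
proof (intro conjI allI impI)
  let ?P = "subhyp A (V \<union> V') (E \<union> E')"
  have P: "hyp S ?P" by (rule hyp_sub_Un[OF h])
  show "hyp_hom S (discrete (length w)) (subhyp A V E) (lmap w)" "hyp_hom S (discrete (length w)) (subhyp A V' E') (lmap w)"
    using h w by (auto simp: hom_discrete)
  show "hyp_hom S (subhyp A V E) ?P hid" by (rule hom_sub[OF h(1) P]) auto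
  show "hyp_hom S (subhyp A V' E') ?P hid" by (rule hom_sub[OF h(2) P]) auto
  fix T f g assume fg: "hyp_hom S (subhyp A V E) T f" "hyp_hom S (subhyp A V' E') T g"
    "heq (discrete (length w) :: 'a hgraph) (lmap w \<then> f) (lmap w \<then> g)"
  have m: "map (nmap f) w = map (nmap g) w" using fg(3) by (simp add: heq_discrete)
  have ag: "nmap f v = nmap g v" if "v \<in> V \<inter> V'" for v using that m w(1) by (auto simp: map_eq_conv)
  note he = glue_heq[of V V' f g E E' A, OF ag w(2)]
  show "\<exists>u. hyp_hom S ?P T u \<and> heq (subhyp A V E) (hid \<then> u) f \<and> heq (subhyp A V' E') (hid \<then> u) g \<and>
     (\<forall>w'. hyp_hom S ?P T w' \<and> heq (subhyp A V E) (hid \<then> w') f \<and> heq (subhyp A V' E') (hid \<then> w') g \<longrightarrow> heq ?P w' u)"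
    by (rule exI[of _ "glue V E f g"]) (use he hom_glue[OF fg(1,2) ag w(2)] in \<open>auto simp: heq_def\<close>)
qed (simp add: heq_def)

lemma den_wf:
  "den S A t V E i u \<Longrightarrow> hyp S (subhyp A V E) \<and> set i \<subseteq> V \<and> set u \<subseteq> V \<and> distinct i \<and> distinct u"
proof (induction t arbitrary: V E i u)
  case (TSym n m)
  then show ?case by (auto simp: hyp_def dest: in_set_takeD in_set_dropD)
      (metis Int_commute append_take_drop_id distinct_append disjoint_iff)
next
  case (TSeq s t)
  then obtain V1 E1 V2 E2 w where d: "den S A s V1 E1 i w" "den S A t V2 E2 w u"
      "V = V1 \<union> V2" "E = E1 \<union> E2" by auto
  then show ?case using TSeq.IH(1)[OF d(1)] TSeq.IH(2)[OF d(2)] hyp_sub_Un by auto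
next
  case (TPar s t)
  then obtain V1 E1 V2 E2 i1 i2 u1 u2 where d: "den S A s V1 E1 i1 u1" "den S A t V2 E2 i2 u2"
      "i = i1 @ i2" "u = u1 @ u2" "V = V1 \<union> V2" "V1 \<inter> V2 = {}" "E = E1 \<union> E2" by auto
  then show ?case using TPar.IH(1)[OF d(1)] TPar.IH(2)[OF d(2)] hyp_sub_Un by auto
qed (auto simp: hyp_def)

lemma den_seqI:
  assumes "den S A s V\<^sub>1 E\<^sub>1 i w" "den S A t V\<^sub>2 E\<^sub>2 w u" "V\<^sub>1 \<inter> V\<^sub>2 = set w" "E\<^sub>1 \<inter> E\<^sub>2 = {}"
  shows "den S A (TSeq s t) (V\<^sub>1 \<union> V\<^sub>2) (E\<^sub>1 \<union> E\<^sub>2) i u"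
  unfolding den.simps using assms by blast

lemma den_parI:
  assumes "den S A s V\<^sub>1 E\<^sub>1 i\<^sub>1 u\<^sub>1" "den S A t V\<^sub>2 E\<^sub>2 i\<^sub>2 u\<^sub>2" "V\<^sub>1 \<inter> V\<^sub>2 = {}" "E\<^sub>1 \<inter> E\<^sub>2 = {}"
  shows "den S A (TPar s t) (V\<^sub>1 \<union> V\<^sub>2) (E\<^sub>1 \<union> E\<^sub>2) (i\<^sub>1 @ i\<^sub>2) (u\<^sub>1 @ u\<^sub>2)"
  unfolding den.simps using assms by blast

lemma ex_map: "length i = length j \<Longrightarrow> distinct i \<Longrightarrow> \<exists>f. map f i = j"
proof (induction i j rule: list_induct2)
  case (Cons x xs y ys)
  then obtain f where "map f xs = ys" by auto
  then have "map (f(x := y)) (x # xs) = y # ys" using Cons.prems by auto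
  then show ?case by (rule exI[of _ "f(x := y)"])
qed simp

text \<open>For a term without edges the output is a rearrangement \<open>F\<close> of the input. As
  \<open>F\<close> commutes with renaming, an assignment of nodes to the distinct input names
  settles the outputs too.\<close>

lemma univ_wires:
  fixes A :: "'g hgraph"
  assumes el: "\<And>T x i' u'. hyp S T \<Longrightarrow> elem S T t x i' u' \<longleftrightarrow> x = U \<and>
      length i' = length i \<and> set i' \<subseteq> nodes T \<and> u' = F i'"
    and F: "\<And>f. map f (F i) = F (map f i)" and d: "distinct i"
  shows "univ S t (subhyp A (set i) {}) U i (F i)"
proof (rule univI)
  show G: "hyp S (subhyp A (set i) {})" by (simp add: hyp_def)
  show "elem S (subhyp A (set i) {}) t U i (F i)" unfolding el[OF G] by simp
  fix T
  show "\<exists>w. hyp_hom S (subhyp A (set i) {}) T w \<and> vmap w U = y \<and> map (nmap w) i = j \<and> map (nmap w) (F i) = v"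
    if T: "hyp S T" "elem S T t y j v" for y j v
  proof -
    have j: "y = U" "length i = length j" "set j \<subseteq> nodes T" "v = F j" using T(2) unfolding el[OF T(1)] by auto
    obtain f where f: "map f i = j" using ex_map[OF j(2) d] by blast
    have "hyp_hom S (subhyp A (set i) {}) T (node_map f)"
      using T(1) G f j(3) by (auto simp: hyp_hom_def node_map_def)
    then show ?thesis using f F j by (intro exI[of _ "node_map f"]) (simp add: node_map_def)
  qed
  show "heq (subhyp A (set i) {}) w w'" if "map (nmap w) i = map (nmap w') i" for w w'
    using that by (simp add: heq_def map_eq_conv)
qed

text \<open>Links the two semantics: the overlaps required by \<open>den\<close> are precisely those
  that turn unions into the pushouts needed for universality.\<close>

lemma den_univ:
  fixes S :: "'g signature"
  shows "den S A t V E i u \<Longrightarrow> \<exists>x. univ S (map_tm Inl t) (subhyp A V E) x i u"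
proof (induction t arbitrary: V E i u)
  case (TId n)
  have "univ S (TId n) (subhyp A (set i) {}) U i (id i)"
    by (rule univ_wires) (use TId in auto)
  then show ?case using TId by auto
next
  case (TSym n m)
  have "univ S (TSym n m) (subhyp A (set i) {}) U i ((\<lambda>i. drop n i @ take n i) i)"
    by (rule univ_wires) (use TSym in \<open>auto simp: take_map drop_map\<close>)
  then show ?case using TSym by auto
next
  case (TGen g)
  then obtain h where h: "E = {h}" "label A h = g" "sources A h = i" "targets A h = u"
      "distinct (i @ u)" "V = set (i @ u)" "g \<in> gens S" "length i = arity S g" "length u = coarity S g"
    by auto
  have G: "hyp S (subhyp A V E)" using den_wf[OF TGen] by simp
  have "univ S (TGen (Inl g)) (subhyp A V E) (VE h) i u"
  proof (rule univI[OF G])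
    show "elem S (subhyp A V E) (TGen (Inl g)) (VE h) i u" using h by simp
    fix T
    show "\<exists>w. hyp_hom S (subhyp A V E) T w \<and> vmap w (VE h) = y \<and> map (nmap w) i = j \<and> map (nmap w) u = v"
      if T: "hyp S T" "elem S T (TGen (Inl g)) y j v" for y j v
    proof -
      obtain k where k: "k \<in> edges T" "y = VE k" "label T k = g" "j = sources T k" "v = targets T k" using T(2) by auto
      have l: "length j = arity S g" "length v = coarity S g" "set (j @ v) \<subseteq> nodes T" using T(1) k by (auto simp: hyp_def)
      obtain f where f: "map f (i @ u) = j @ v" using ex_map[of "i @ u" "j @ v"] h l by auto
      then have ij: "map f i = j" "map f u = v" using h l by (auto simp: append_eq_append_conv)
      let ?w = "\<lparr> nmap = f, emap = \<lambda>_. k \<rparr>"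
      have "f x \<in> nodes T" if "x \<in> V" for x
        using that f l(3) h(6) by (metis image_eqI image_set subsetD)
      then have "hyp_hom S (subhyp A V E) T ?w"
        using T(1) G h k ij by (auto simp: hyp_hom_def)
      then show ?thesis using ij k by (intro exI[of _ ?w]) simp
    qed
    show "heq (subhyp A V E) w w'" if "vmap w (VE h) = vmap w' (VE h)" "map (nmap w) i = map (nmap w') i"
      "map (nmap w) u = map (nmap w') u" for w w'
      using that h by (auto simp: heq_def map_eq_conv)
  qed
  then show ?case by auto
next
  case (TSeq s t)
  then obtain V1 E1 V2 E2 w where d: "den S A s V1 E1 i w" "den S A t V2 E2 w u"
      "V = V1 \<union> V2" "V1 \<inter> V2 = set w" "E = E1 \<union> E2" "E1 \<inter> E2 = {}" by auto
  obtain x y where xy: "univ S (map_tm Inl s) (subhyp A V1 E1) x i w" "univ S (map_tm Inl t) (subhyp A V2 E2) y w u"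
    using TSeq.IH(1)[OF d(1)] TSeq.IH(2)[OF d(2)] by blast
  have w: "wt (fsig S) (map_tm Inl s)" "wt (fsig S) (map_tm Inl t)"
    using den_typing[OF d(1)] den_typing[OF d(2)] by (simp_all add: map_tm_typing)
  have "univ S (TSeq (map_tm Inl s) (map_tm Inl t)) (subhyp A V E) (VSeq (vmap hid x) (map (nmap hid) w) (vmap hid y))
      (map (nmap hid) i) (map (nmap hid) u)"
    unfolding d(3,5)
    by (rule univ_seq[OF xy w pushout_sub[OF univ_hyp[OF xy(1)] univ_hyp[OF xy(2)] d(4,6)] leg_lmap leg_lmap])
  then show ?case by auto
next
  case (TPar s t)
  then obtain V1 E1 V2 E2 i1 i2 u1 u2 where d: "den S A s V1 E1 i1 u1" "den S A t V2 E2 i2 u2"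
      "i = i1 @ i2" "u = u1 @ u2" "V = V1 \<union> V2" "V1 \<inter> V2 = {}" "E = E1 \<union> E2" "E1 \<inter> E2 = {}" by auto
  obtain x y where xy: "univ S (map_tm Inl s) (subhyp A V1 E1) x i1 u1" "univ S (map_tm Inl t) (subhyp A V2 E2) y i2 u2"
    using TPar.IH(1)[OF d(1)] TPar.IH(2)[OF d(2)] by blast
  have w: "wt (fsig S) (map_tm Inl s)" "wt (fsig S) (map_tm Inl t)"
    using den_typing[OF d(1)] den_typing[OF d(2)] by (simp_all add: map_tm_typing)
  have v: "V1 \<inter> V2 = set []" using d(6) by simp
  have "univ S (TPar (map_tm Inl s) (map_tm Inl t)) (subhyp A V E) (VPar (vmap hid x) (vmap hid y))
      (map (nmap hid) i1 @ map (nmap hid) i2) (map (nmap hid) u1 @ map (nmap hid) u2)"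
    unfolding d(5,7)
    by (rule univ_par_pushout[OF xy w pushout_sub[OF univ_hyp[OF xy(1)] univ_hyp[OF xy(2)] v d(8), unfolded list.size(3)]])
  then show ?case using d by auto
qed

section \<open>Renaming and existence of denotations\<close>

lemma den_cong:
  assumes "\<And>h. h \<in> E \<Longrightarrow> sources A h = sources A' h \<and> targets A h = targets A' h \<and> label A h = label A' h"
  shows "den S A t V E i u \<Longrightarrow> den S A' t V E i u"
  using assms
proof (induction t arbitrary: V E i u)
  case (TSeq s t)
  then obtain V1 E1 V2 E2 w where d: "den S A s V1 E1 i w" "den S A t V2 E2 w u"
      "V = V1 \<union> V2" "V1 \<inter> V2 = set w" "E = E1 \<union> E2" "E1 \<inter> E2 = {}" by auto
  have "den S A' s V1 E1 i w" "den S A' t V2 E2 w u"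
    using TSeq.IH(1)[OF d(1)] TSeq.IH(2)[OF d(2)] TSeq.prems(2) d(5) by auto
  then show ?case unfolding d(3,5) by (rule den_seqI[OF _ _ d(4,6)])
next
  case (TPar s t)
  then obtain V1 E1 V2 E2 i1 i2 u1 u2 where d: "den S A s V1 E1 i1 u1" "den S A t V2 E2 i2 u2"
      "i = i1 @ i2" "u = u1 @ u2" "V = V1 \<union> V2" "V1 \<inter> V2 = {}" "E = E1 \<union> E2" "E1 \<inter> E2 = {}" by auto
  have "den S A' s V1 E1 i1 u1" "den S A' t V2 E2 i2 u2"
    using TPar.IH(1)[OF d(1)] TPar.IH(2)[OF d(2)] TPar.prems(2) d(7) by auto
  then show ?case unfolding d(3,4,5,7) by (rule den_parI[OF _ _ d(6,8)])
qed auto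

text \<open>Injectivity keeps intersections, so the prescribed overlaps of parts survive renaming.
  Nodes and edges are renamed independently.\<close>

lemma den_map:
  assumes "\<And>h. h \<in> E \<Longrightarrow> sources A' (e h) = map f (sources A h) \<and> targets A' (e h) = map f (targets A h) \<and>
      label A' (e h) = label A h"
    and "inj_on f V" "inj_on e E" "den S A t V E i u"
  shows "den S A' t (f ` V) (e ` E) (map f i) (map f u)"
  using assms
proof (induction t arbitrary: V E i u)
  case (TId n)
  then show ?case by (auto simp: distinct_map)
next
  case (TSym n m)
  then show ?case by (auto simp: distinct_map take_map drop_map)
next
  case (TGen g)
  then obtain h where h: "E = {h}" "label A h = g" "sources A h = i" "targets A h = u"
      "distinct (i @ u)" "V = set (i @ u)" "g \<in> gens S" "length i = arity S g" "length u = coarity S g"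
    by auto
  have "distinct (map f (i @ u))" using h(5,6) TGen.prems(2) by (simp only: distinct_map)
  then show ?case using h TGen.prems(1)[of h] by (auto simp: image_Un)
next
  case (TSeq s t)
  then obtain V1 E1 V2 E2 w where d: "den S A s V1 E1 i w" "den S A t V2 E2 w u"
      "V = V1 \<union> V2" "V1 \<inter> V2 = set w" "E = E1 \<union> E2" "E1 \<inter> E2 = {}" by auto
  have "den S A' s (f ` V1) (e ` E1) (map f i) (map f w)" "den S A' t (f ` V2) (e ` E2) (map f w) (map f u)"
    using TSeq.prems d by (auto intro!: TSeq.IH intro: inj_on_subset)
  moreover have "f ` V1 \<inter> f ` V2 = set (map f w)"
    using inj_on_image_Int[OF TSeq.prems(2), of V1 V2] d by auto
  moreover have "e ` E1 \<inter> e ` E2 = {}"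
    using inj_on_image_Int[OF TSeq.prems(3), of E1 E2] d by auto
  ultimately show ?case unfolding den.simps d(3,5) image_Un by blast
next
  case (TPar s t)
  then obtain V1 E1 V2 E2 i1 i2 u1 u2 where d: "den S A s V1 E1 i1 u1" "den S A t V2 E2 i2 u2"
      "i = i1 @ i2" "u = u1 @ u2" "V = V1 \<union> V2" "V1 \<inter> V2 = {}" "E = E1 \<union> E2" "E1 \<inter> E2 = {}" by auto
  have "den S A' s (f ` V1) (e ` E1) (map f i1) (map f u1)" "den S A' t (f ` V2) (e ` E2) (map f i2) (map f u2)"
    using TPar.prems d by (auto intro!: TPar.IH intro: inj_on_subset)
  moreover have "f ` V1 \<inter> f ` V2 = {}"
    using inj_on_image_Int[OF TPar.prems(2), of V1 V2] d by auto
  moreover have "e ` E1 \<inter> e ` E2 = {}"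
    using inj_on_image_Int[OF TPar.prems(3), of E1 E2] d by auto
  ultimately show ?case unfolding den.simps d(3,4,5,7) image_Un map_append by blast
qed

text \<open>Inputs are prescribed because a second factor has to continue from the outputs of the
  first. New nodes start at \<open>N\<close> and new edges at \<open>K\<close>, and each subterm
  begins where the previous one ended, so parts meet in the shared wires only.\<close>

lemma den_exists_fresh:
  fixes S :: "'g signature"
  assumes "wt S t" "distinct i" "length i = tdom S t" "set i \<subseteq> {..<N}"
  shows "\<exists>A V E u N' K'. den S A t V E i u \<and> V \<subseteq> set i \<union> {N..<N'} \<and> E \<subseteq> {K..<K'} \<and> N \<le> N' \<and> K \<le> K'"
  using assms
proof (induction t arbitrary: i N K)
  case (TId n)
  then show ?case by auto
next
  case (TSym n m)
  then show ?case by auto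
next
  case (TGen g)
  let ?u = "[N..<N + coarity S g]"
  define A :: "'g hgraph" where "A = \<lparr> nodes = {}, edges = {}, sources = \<lambda>_. i, targets = \<lambda>_. ?u, label = \<lambda>_. g \<rparr>"
  have "den S A (TGen g) (set (i @ ?u)) {K} i ?u"
    using TGen by (auto simp: A_def)
  moreover have "set (i @ ?u) \<subseteq> set i \<union> {N..<N + coarity S g}" by auto
  moreover have "{K} \<subseteq> {K..<Suc K}" by auto
  ultimately show ?case by (meson le_add1 le_SucI order_refl)
next
  case (TSeq s t)
  obtain A1 V1 E1 w N1 K1 where 1: "den S A1 s V1 E1 i w" "V1 \<subseteq> set i \<union> {N..<N1}" "E1 \<subseteq> {K..<K1}" "N \<le> N1" "K \<le> K1"
  proof -
    have "\<exists>A V E u N' K'. den S A s V E i u \<and> V \<subseteq> set i \<union> {N..<N'} \<and> E \<subseteq> {K..<K'} \<and> N \<le> N' \<and> K \<le> K'"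
      by (rule TSeq.IH(1)) (use TSeq.prems in auto)
    then show ?thesis using that by blast
  qed
  have w: "distinct w" "length w = tdom S t" "set w \<subseteq> V1" "set i \<subseteq> V1"
    using den_wf[OF 1(1)] den_typing[OF 1(1)] TSeq.prems by auto
  have V1: "V1 \<subseteq> {..<N1}" using 1(2,4) TSeq.prems(4) by fastforce
  obtain A2 V2 E2 u N2 K2 where 2: "den S A2 t V2 E2 w u" "V2 \<subseteq> set w \<union> {N1..<N2}" "E2 \<subseteq> {K1..<K2}" "N1 \<le> N2" "K1 \<le> K2"
  proof -
    have "\<exists>A V E u N' K'. den S A t V E w u \<and> V \<subseteq> set w \<union> {N1..<N'} \<and> E \<subseteq> {K1..<K'} \<and> N1 \<le> N' \<and> K1 \<le> K'"
      by (rule TSeq.IH(2)) (use TSeq.prems w V1 in auto)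
    then show ?thesis using that by blast
  qed
  \<comment> \<open>Edges below \<open>K1\<close> belong to the first factor and the others to the
    second, so the two ambient hypergraphs merge without renaming.\<close>
  define A where "A = \<lparr> nodes = {}, edges = {}, sources = \<lambda>h. if h < K1 then sources A1 h else sources A2 h,
     targets = \<lambda>h. if h < K1 then targets A1 h else targets A2 h,
     label = \<lambda>h. if h < K1 then label A1 h else label A2 h \<rparr>"
  have d1: "den S A s V1 E1 i w" by (rule den_cong[OF _ 1(1)]) (use 1(3) in \<open>auto simp: A_def\<close>)
  have d2: "den S A t V2 E2 w u" by (rule den_cong[OF _ 2(1)]) (use 2(3) in \<open>auto simp: A_def\<close>)
  have "V1 \<inter> V2 = set w" using V1 2(2) w(3) den_wf[OF 2(1)] by fastforce
  moreover have "E1 \<inter> E2 = {}" using 1(3) 2(3) by fastforce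
  ultimately have "den S A (TSeq s t) (V1 \<union> V2) (E1 \<union> E2) i u" by (rule den_seqI[OF d1 d2])
  moreover have "V1 \<union> V2 \<subseteq> set i \<union> {N..<N2}" using 1(2,4) 2(2,4) w(3) V1 by fastforce
  moreover have "E1 \<union> E2 \<subseteq> {K..<K2}" using 1(3,5) 2(3,5) by fastforce
  ultimately show ?case using 1(4,5) 2(4,5) by (meson order_trans)
next
  case (TPar s t)
  let ?i1 = "take (tdom S s) i" and ?i2 = "drop (tdom S s) i"
  have i: "i = ?i1 @ ?i2" "distinct ?i1" "distinct ?i2" "set ?i1 \<inter> set ?i2 = {}"
    using TPar.prems(2) by (simp, metis append_take_drop_id distinct_append)+
  have li: "length ?i1 = tdom S s" "length ?i2 = tdom S t" using TPar.prems(3) by auto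
  have si: "set ?i1 \<subseteq> {..<N}" "set ?i2 \<subseteq> {..<N}"
    using TPar.prems(4) by (auto dest: in_set_takeD in_set_dropD)
  obtain A1 V1 E1 u1 N1 K1 where 1: "den S A1 s V1 E1 ?i1 u1" "V1 \<subseteq> set ?i1 \<union> {N..<N1}" "E1 \<subseteq> {K..<K1}" "N \<le> N1" "K \<le> K1"
  proof -
    have "\<exists>A V E u N' K'. den S A s V E ?i1 u \<and> V \<subseteq> set ?i1 \<union> {N..<N'} \<and> E \<subseteq> {K..<K'} \<and> N \<le> N' \<and> K \<le> K'"
      by (rule TPar.IH(1)) (use TPar.prems i(2) li(1) si(1) in simp_all)
    then show ?thesis using that by blast
  qed
  have si2: "set ?i2 \<subseteq> {..<N1}" using si(2) 1(4) by auto
  obtain A2 V2 E2 u2 N2 K2 where 2: "den S A2 t V2 E2 ?i2 u2" "V2 \<subseteq> set ?i2 \<union> {N1..<N2}" "E2 \<subseteq> {K1..<K2}" "N1 \<le> N2" "K1 \<le> K2"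
  proof -
    have "\<exists>A V E u N' K'. den S A t V E ?i2 u \<and> V \<subseteq> set ?i2 \<union> {N1..<N'} \<and> E \<subseteq> {K1..<K'} \<and> N1 \<le> N' \<and> K1 \<le> K'"
      by (rule TPar.IH(2)) (use TPar.prems i(3) li(2) si2 in simp_all)
    then show ?thesis using that by blast
  qed
  define A where "A = \<lparr> nodes = {}, edges = {}, sources = \<lambda>h. if h < K1 then sources A1 h else sources A2 h,
     targets = \<lambda>h. if h < K1 then targets A1 h else targets A2 h,
     label = \<lambda>h. if h < K1 then label A1 h else label A2 h \<rparr>"
  have d1: "den S A s V1 E1 ?i1 u1" by (rule den_cong[OF _ 1(1)]) (use 1(3) in \<open>auto simp: A_def\<close>)
  have d2: "den S A t V2 E2 ?i2 u2" by (rule den_cong[OF _ 2(1)]) (use 2(3) in \<open>auto simp: A_def\<close>)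
  have "V1 \<inter> V2 = {}" using 1(2) 2(2) si i(4) 1(4) by fastforce
  moreover have "E1 \<inter> E2 = {}" using 1(3) 2(3) by fastforce
  ultimately have "den S A (TPar s t) (V1 \<union> V2) (E1 \<union> E2) i (u1 @ u2)"
    unfolding den.simps using d1 d2 i(1) by blast
  moreover have "V1 \<union> V2 \<subseteq> set i \<union> {N..<N2}"
    using 1(2,4) 2(2,4) by (fastforce dest: in_set_takeD in_set_dropD)
  moreover have "E1 \<union> E2 \<subseteq> {K..<K2}" using 1(3,5) 2(3,5) by fastforce
  ultimately show ?case using 1(4,5) 2(4,5) by (meson order_trans)
qed

lemma den_exists:
  assumes "wt S t"
  obtains A V E i u where "den S A t V E i u"
  using den_exists_fresh[OF assms, of "[0..<tdom S t]" "tdom S t" 0] by (auto simp: atLeast0LessThan)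

text \<open>Converse of \<open>den_univ\<close>: some denotation exists, it represents the same
  functor, and the resulting isomorphism transports it onto all of \<open>G\<close>.\<close>

lemma univ_den:
  assumes t: "wt S t" and U: "univ S (map_tm Inl t) G x i u"
  shows "den S G t (nodes G) (edges G) i u"
proof -
  obtain A V E j v where d: "den S A t V E j v" by (rule den_exists[OF t])
  obtain y where y: "univ S (map_tm Inl t) (subhyp A V E) y j v" using den_univ[OF d] by blast
  obtain f where f: "hyp_iso S (subhyp A V E) G f" "map (nmap f) j = i" "map (nmap f) v = u"
    using univ_iso[OF y U] by metis
  then obtain g where g: "hyp_hom S (subhyp A V E) G f" "hyp_hom S G (subhyp A V E) g"
    "heq (subhyp A V E) (f \<then> g) hid" "heq G (g \<then> f) hid" by (auto simp: hyp_iso_def)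
  have n: "bij_betw (nmap f) V (nodes G)"
    by (rule bij_betw_byWitness[where f' = "nmap g"]) (use g in \<open>auto simp: heq_def hyp_hom_def\<close>)
  have e: "bij_betw (emap f) E (edges G)"
    by (rule bij_betw_byWitness[where f' = "emap g"]) (use g in \<open>auto simp: heq_def hyp_hom_def\<close>)
  have "den S G t (nmap f ` V) (emap f ` E) (map (nmap f) j) (map (nmap f) v)"
    by (rule den_map[OF _ _ _ d]) (use g(1) n e in \<open>auto simp: hyp_hom_def bij_betw_def\<close>)
  then show ?thesis using f(2,3) n e by (simp add: bij_betw_def)
qed

section \<open>Monogamous acyclic hypergraphs\<close>

definition tgt_mset :: "'g hgraph \<Rightarrow> nat set \<Rightarrow> nat multiset" where
  "tgt_mset A E = (\<Sum>h \<in> E. mset (targets A h))"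

definition src_mset :: "'g hgraph \<Rightarrow> nat set \<Rightarrow> nat multiset" where
  "src_mset A E = (\<Sum>h \<in> E. mset (sources A h))"

text \<open>Monogamicity as two equations of multisets: each node is an input or the target of exactly
  one edge, exactly once, and dually. In this form it is immediately compatible with gluing.\<close>

definition mono_eqs :: "'g hgraph \<Rightarrow> nat set \<Rightarrow> nat set \<Rightarrow> nat list \<Rightarrow> nat list \<Rightarrow> bool" where
  "mono_eqs A V E i u \<longleftrightarrow> mset i + tgt_mset A E = mset_set V \<and> mset u + src_mset A E = mset_set V"

text \<open>Acyclicity as the existence of a topological numbering of the edges. In this form it
  restricts to subsets and pulls back along homomorphisms, without any handling of paths.\<close>

definition ranked :: "'g hgraph \<Rightarrow> nat set \<Rightarrow> bool" where
  "ranked A E \<longleftrightarrow> (\<exists>rk :: nat \<Rightarrow> nat. \<forall>h \<in> E. \<forall>h' \<in> E.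
     set (targets A h) \<inter> set (sources A h') \<noteq> {} \<longrightarrow> rk h < rk h')"

lemma mset_set_Un_Int:
  assumes "finite V" "finite W"
  shows "mset_set (V \<union> W) + mset_set (V \<inter> W) = mset_set V + mset_set W"
  using assms by (intro multiset_eqI) (auto simp: count_mset_set')

lemma tgt_mset_Un: "finite E \<Longrightarrow> finite E' \<Longrightarrow> E \<inter> E' = {} \<Longrightarrow> tgt_mset A (E \<union> E') = tgt_mset A E + tgt_mset A E'"
  by (simp add: tgt_mset_def sum.union_disjoint)

lemma src_mset_Un: "finite E \<Longrightarrow> finite E' \<Longrightarrow> E \<inter> E' = {} \<Longrightarrow> src_mset A (E \<union> E') = src_mset A E + src_mset A E'"
  by (simp add: src_mset_def sum.union_disjoint)

lemma tgt_mset_empty [simp]: "tgt_mset A {} = {#}" "src_mset A {} = {#}"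
  by (simp_all add: tgt_mset_def src_mset_def)

lemma tgt_mset_single [simp]: "tgt_mset A {h} = mset (targets A h)" "src_mset A {h} = mset (sources A h)"
  by (simp_all add: tgt_mset_def src_mset_def)

text \<open>Adding the equations of the two parts leaves one copy of the shared wires on each side:
  as a boundary list on the left and, by inclusion and exclusion, as the intersection on the right.
  These copies cancel.\<close>

lemma mono_eqs_glue:
  assumes fin: "finite V" "finite W" "finite E" "finite E'" and d: "distinct w" "V \<inter> W = set w" "E \<inter> E' = {}"
    and "mono_eqs A V E i w" "mono_eqs A W E' w u"
  shows "mono_eqs A (V \<union> W) (E \<union> E') i u"
proof -
  have w: "mset_set (V \<inter> W) = mset w" using d by (simp add: mset_set_set)
  note g = mset_set_Un_Int[OF fin(1,2), unfolded w]
  have "(mset i + tgt_mset A (E \<union> E')) + mset w = mset_set (V \<union> W) + mset w"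
    unfolding g tgt_mset_Un[OF fin(3,4) d(3)] using assms(8,9) by (simp add: mono_eqs_def add_ac) (metis add.assoc add.commute)
  moreover have "(mset u + src_mset A (E \<union> E')) + mset w = mset_set (V \<union> W) + mset w"
    unfolding g src_mset_Un[OF fin(3,4) d(3)] using assms(8,9) by (simp add: mono_eqs_def add_ac) (metis add.assoc add.commute)
  ultimately show ?thesis by (simp add: mono_eqs_def)
qed

lemma hyp_sub_finite: "hyp S (subhyp A V E) \<Longrightarrow> finite V \<and> finite E"
  by (simp add: hyp_def)

lemma den_mono_eqs: "den S A t V E i u \<Longrightarrow> mono_eqs A V E i u"
proof (induction t arbitrary: V E i u)
  case (TId n)
  then show ?case by (auto simp: mono_eqs_def mset_set_set)
next
  case (TSym n m)
  then have "mset u = mset i" by simp (metis append_take_drop_id mset_append union_commute)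
  then show ?case using TSym by (simp add: mono_eqs_def mset_set_set)
next
  case (TGen g)
  then show ?case by (auto simp: mono_eqs_def mset_set_set[symmetric] mset_set_Union)
next
  case (TSeq s t)
  then obtain V1 E1 V2 E2 w where d: "den S A s V1 E1 i w" "den S A t V2 E2 w u"
      "V = V1 \<union> V2" "V1 \<inter> V2 = set w" "E = E1 \<union> E2" "E1 \<inter> E2 = {}" by auto
  have f: "finite V1" "finite V2" "finite E1" "finite E2" "distinct w"
    using den_wf[OF d(1)] den_wf[OF d(2)] hyp_sub_finite by blast+
  show ?case unfolding d(3,5)
    by (rule mono_eqs_glue[OF f d(4,6) TSeq.IH(1)[OF d(1)] TSeq.IH(2)[OF d(2)]])
next
  case (TPar s t)
  then obtain V1 E1 V2 E2 i1 i2 u1 u2 where d: "den S A s V1 E1 i1 u1" "den S A t V2 E2 i2 u2"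
      "i = i1 @ i2" "u = u1 @ u2" "V = V1 \<union> V2" "V1 \<inter> V2 = {}" "E = E1 \<union> E2" "E1 \<inter> E2 = {}" by auto
  have f: "finite V1" "finite V2" "finite E1" "finite E2"
    using den_wf[OF d(1)] den_wf[OF d(2)] hyp_sub_finite by blast+
  show ?case unfolding d(3,4,5,7) using TPar.IH(1)[OF d(1)] TPar.IH(2)[OF d(2)]
    by (simp add: mono_eqs_def tgt_mset_Un src_mset_Un f d(6,8) mset_set_Union) (metis add.assoc add.left_commute)
qed

text \<open>The right-hand sides are multisets of sets, so all contributions at one node add up to
  at most one. Two occurrences anywhere would add up to two, and a node without any occurrence would
  contradict the count one.\<close>

lemma mono_eqsD:
  assumes "mono_eqs A V E i u" "finite V" "finite E"
  shows "distinct i" "distinct u" "set i \<subseteq> V" "set u \<subseteq> V"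
    and "h \<in> E \<Longrightarrow> distinct (sources A h) \<and> distinct (targets A h) \<and> set (targets A h) \<subseteq> V - set i \<and>
      set (sources A h) \<subseteq> V - set u"
    and "v \<in> V \<Longrightarrow> v \<in> set i \<or> (\<exists>h \<in> E. v \<in> set (targets A h))"
    and "v \<in> V \<Longrightarrow> v \<in> set u \<or> (\<exists>h \<in> E. v \<in> set (sources A h))"
    and "h \<in> E \<Longrightarrow> h' \<in> E \<Longrightarrow> h \<noteq> h' \<Longrightarrow> set (targets A h) \<inter> set (targets A h') = {} \<and>
      set (sources A h) \<inter> set (sources A h') = {}"
proof -
  have t: "count (mset i) v + count (tgt_mset A E) v = (if v \<in> V then 1 else 0)" for v
    using assms(1,2) by (metis count_mset_set' count_union mono_eqs_def)
  have s: "count (mset u) v + count (src_mset A E) v = (if v \<in> V then 1 else 0)" for v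
    using assms(1,2) by (metis count_mset_set' count_union mono_eqs_def)
  have ct: "count (tgt_mset A E) v = (\<Sum>h \<in> E. count (mset (targets A h)) v)" for v
    by (simp add: tgt_mset_def count_sum)
  have cs: "count (src_mset A E) v = (\<Sum>h \<in> E. count (mset (sources A h)) v)" for v
    by (simp add: src_mset_def count_sum)
  have mt: "count (mset (targets A h)) v \<le> count (tgt_mset A E) v" if "h \<in> E" for h v
    unfolding ct using that assms(3) by (intro member_le_sum) auto
  have ms: "count (mset (sources A h)) v \<le> count (src_mset A E) v" if "h \<in> E" for h v
    unfolding cs using that assms(3) by (intro member_le_sum) auto
  have pos: "v \<in> set xs \<longleftrightarrow> count (mset xs) v > 0" for v and xs :: "nat list" by simp
  have dist: "distinct xs" if "\<And>v. count (mset xs) v \<le> 1" for xs :: "nat list"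
    unfolding distinct_count_atmost_1
  proof
    fix v
    show "count (mset xs) v = (if v \<in> set xs then 1 else 0)"
    proof (cases "v \<in> set xs")
      case True
      then have "count (mset xs) v > 0" by (simp only: pos)
      then have "count (mset xs) v = 1" using that[of v] by linarith
      then show ?thesis using True by simp
    qed simp
  qed
  have ge: "1 \<le> count (mset xs) v" if "v \<in> set xs" for v and xs :: "nat list"
    using that unfolding pos by linarith
  have t1: "count (mset i) v + count (tgt_mset A E) v \<le> 1" and s1: "count (mset u) v + count (src_mset A E) v \<le> 1" for v
    unfolding t s by simp_all
  have t0: "v \<in> V" if "1 \<le> count (mset i) v + count (tgt_mset A E) v" for v
    using that unfolding t by (simp split: if_splits)
  have s0: "v \<in> V" if "1 \<le> count (mset u) v + count (src_mset A E) v" for v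
    using that unfolding s by (simp split: if_splits)
  have ti: "1 \<le> count (mset i) v + count (tgt_mset A E) v" if "v \<in> V" for v
    unfolding t using that by simp
  have si: "1 \<le> count (mset u) v + count (src_mset A E) v" if "v \<in> V" for v
    unfolding s using that by simp
  show "distinct i" by (rule dist) (use t1 in \<open>meson add_leD1\<close>)
  show "distinct u" by (rule dist) (use s1 in \<open>meson add_leD1\<close>)
  show "set i \<subseteq> V" by (rule subsetI, rule t0, drule ge, linarith)
  show "set u \<subseteq> V" by (rule subsetI, rule s0, drule ge, linarith)
  show "distinct (sources A h) \<and> distinct (targets A h) \<and> set (targets A h) \<subseteq> V - set i \<and>
      set (sources A h) \<subseteq> V - set u" if h: "h \<in> E"
  proof (intro conjI subsetI DiffI notI)
    show "distinct (sources A h)" by (rule dist) (use s1 ms[OF h] in \<open>meson add_leD2 le_trans\<close>)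
    show "distinct (targets A h)" by (rule dist) (use t1 mt[OF h] in \<open>meson add_leD2 le_trans\<close>)
    fix v
    show "v \<in> V" if "v \<in> set (targets A h)"
      by (rule t0) (use ge[OF that] mt[OF h, of v] in linarith)
    show False if "v \<in> set (targets A h)" "v \<in> set i"
      using ge[OF that(1)] ge[OF that(2)] mt[OF h, of v] t1[of v] by linarith
    show "v \<in> V" if "v \<in> set (sources A h)"
      by (rule s0) (use ge[OF that] ms[OF h, of v] in linarith)
    show False if "v \<in> set (sources A h)" "v \<in> set u"
      using ge[OF that(1)] ge[OF that(2)] ms[OF h, of v] s1[of v] by linarith
  qed
  have z: "count (mset xs) v = 0" if "v \<notin> set xs" for v and xs :: "nat list"
    using that unfolding pos by linarith
  show "v \<in> set i \<or> (\<exists>h \<in> E. v \<in> set (targets A h))" if "v \<in> V"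
  proof (rule ccontr)
    assume n: "\<not> ?thesis"
    have "count (mset i) v = 0" by (rule z) (use n in blast)
    moreover have "count (tgt_mset A E) v = 0" unfolding ct by (rule sum.neutral) (use n z in blast)
    ultimately show False using ti[OF that] by linarith
  qed
  show "v \<in> set u \<or> (\<exists>h \<in> E. v \<in> set (sources A h))" if "v \<in> V"
  proof (rule ccontr)
    assume n: "\<not> ?thesis"
    have "count (mset u) v = 0" by (rule z) (use n in blast)
    moreover have "count (src_mset A E) v = 0" unfolding cs by (rule sum.neutral) (use n z in blast)
    ultimately show False using si[OF that] by linarith
  qed
  assume hh: "h \<in> E" "h' \<in> E" "h \<noteq> h'"
  have two: "f h + f h' \<le> sum f E" for f :: "nat \<Rightarrow> nat"
  proof -
    have "sum f {h, h'} \<le> sum f E" using hh assms(3) by (intro sum_mono2) auto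
    then show ?thesis using hh(3) by simp
  qed
  show "set (targets A h) \<inter> set (targets A h') = {} \<and> set (sources A h) \<inter> set (sources A h') = {}"
  proof (intro conjI equals0I)
    fix v assume "v \<in> set (targets A h) \<inter> set (targets A h')"
    then have m: "v \<in> set (targets A h)" "v \<in> set (targets A h')" by auto
    show False using two[of "\<lambda>h. count (mset (targets A h)) v"] t1[of v] ct[of v] ge[OF m(1)] ge[OF m(2)]
      by linarith
  next
    fix v assume "v \<in> set (sources A h) \<inter> set (sources A h')"
    then have m: "v \<in> set (sources A h)" "v \<in> set (sources A h')" by auto
    show False using two[of "\<lambda>h. count (mset (sources A h)) v"] s1[of v] cs[of v] ge[OF m(1)] ge[OF m(2)]
      by linarith
  qed
qed

text \<open>The ranks of the second part are shifted above a bound for those of the first, which is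
  consistent as nothing leads from the second part back.\<close>

lemma ranked_Un:
  assumes "ranked A E" "ranked A E'" "finite E" "E \<inter> E' = {}"
    and bk: "\<And>h h'. h \<in> E' \<Longrightarrow> h' \<in> E \<Longrightarrow> set (targets A h) \<inter> set (sources A h') = {}"
  shows "ranked A (E \<union> E')"
proof -
  obtain r r' :: "nat \<Rightarrow> nat" where r: "\<forall>h \<in> E. \<forall>h' \<in> E. set (targets A h) \<inter> set (sources A h') \<noteq> {} \<longrightarrow> r h < r h'"
    "\<forall>h \<in> E'. \<forall>h' \<in> E'. set (targets A h) \<inter> set (sources A h') \<noteq> {} \<longrightarrow> r' h < r' h'"
    using assms(1,2) unfolding ranked_def by blast
  obtain N where N: "\<And>h. h \<in> E \<Longrightarrow> r h < N"
    using assms(3) by (metis finite_imageI finite_nat_set_iff_bounded imageI)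
  let ?r = "\<lambda>h. if h \<in> E then r h else N + r' h"
  have "?r h < ?r h'" if "h \<in> E \<union> E'" "h' \<in> E \<union> E'" "set (targets A h) \<inter> set (sources A h') \<noteq> {}" for h h'
  proof (cases "h \<in> E")
    case True
    then show ?thesis using r(1) that N[OF True] by auto
  next
    case False
    then have h: "h \<in> E'" using that by simp
    have "h' \<notin> E" using bk[OF h, of h'] that(3) by blast
    then show ?thesis using r(2) h that False by auto
  qed
  then show ?thesis unfolding ranked_def by (intro exI[of _ ?r]) blast
qed

text \<open>In a composite the targets of the second factor avoid its inputs \<open>w\<close>, the
  only nodes shared with the first factor, so no edge points backwards.\<close>

lemma den_ranked: "den S A t V E i u \<Longrightarrow> ranked A E"
proof (induction t arbitrary: V E i u)
  case (TGen g)
  then show ?case by (auto simp: ranked_def)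
next
  case (TSeq s t)
  then obtain V1 E1 V2 E2 w where d: "den S A s V1 E1 i w" "den S A t V2 E2 w u"
      "V = V1 \<union> V2" "V1 \<inter> V2 = set w" "E = E1 \<union> E2" "E1 \<inter> E2 = {}" by auto
  have f: "finite V1" "finite V2" "finite E1" "finite E2"
    using den_wf[OF d(1)] den_wf[OF d(2)] hyp_sub_finite by blast+
  show ?case unfolding d(5)
  proof (rule ranked_Un[OF TSeq.IH(1)[OF d(1)] TSeq.IH(2)[OF d(2)] f(3) d(6)])
    fix h h' assume "h \<in> E2" "h' \<in> E1"
    then have "set (targets A h) \<subseteq> V2 - set w" "set (sources A h') \<subseteq> V1"
      using mono_eqsD(5)[OF den_mono_eqs[OF d(2)] f(2,4)] mono_eqsD(5)[OF den_mono_eqs[OF d(1)] f(1,3)] by blast+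
    then show "set (targets A h) \<inter> set (sources A h') = {}" using d(4) by blast
  qed
next
  case (TPar s t)
  then obtain V1 E1 V2 E2 i1 i2 u1 u2 where d: "den S A s V1 E1 i1 u1" "den S A t V2 E2 i2 u2"
      "i = i1 @ i2" "u = u1 @ u2" "V = V1 \<union> V2" "V1 \<inter> V2 = {}" "E = E1 \<union> E2" "E1 \<inter> E2 = {}" by auto
  have f: "finite V1" "finite V2" "finite E1" "finite E2"
    using den_wf[OF d(1)] den_wf[OF d(2)] hyp_sub_finite by blast+
  show ?case unfolding d(7)
  proof (rule ranked_Un[OF TPar.IH(1)[OF d(1)] TPar.IH(2)[OF d(2)] f(3) d(8)])
    fix h h' assume "h \<in> E2" "h' \<in> E1"
    then have "set (targets A h) \<subseteq> V2" "set (sources A h') \<subseteq> V1"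
      using mono_eqsD(5)[OF den_mono_eqs[OF d(2)] f(2,4)] mono_eqsD(5)[OF den_mono_eqs[OF d(1)] f(1,3)] by blast+
    then show "set (targets A h) \<inter> set (sources A h') = {}" using d(6) by blast
  qed
qed (auto simp: ranked_def)

lemma den_perm:
  "distinct i \<Longrightarrow> mset i = mset u \<Longrightarrow> \<exists>t. den S A t (set i) {} i u"
proof (induction u arbitrary: i)
  case Nil
  then show ?case by (intro exI[of _ "TId 0"]) simp
next
  case (Cons y u)
  then have "y \<in> set i" by (metis list.set_intros(1) set_mset_mset)
  then obtain a b where i: "i = a @ y # b" by (meson split_list)
  have ab: "distinct (a @ b)" "mset (a @ b) = mset u" using Cons.prems i by auto
  obtain t where t: "den S A t (set (a @ b)) {} (a @ b) u" using Cons.IH[OF ab] by blast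
  have 1: "den S A (TPar (TSym (length a) 1) (TId (length b))) (set (a @ [y]) \<union> set b) ({} \<union> {}) ((a @ [y]) @ b) ((y # a) @ b)"
    by (rule den_parI) (use Cons.prems i in auto)
  have 2: "den S A (TPar (TId 1) t) ({y} \<union> set (a @ b)) ({} \<union> {}) ([y] @ (a @ b)) ([y] @ u)"
    by (rule den_parI[OF _ t]) (use Cons.prems i in auto)
  have "den S A (TSeq (TPar (TSym (length a) 1) (TId (length b))) (TPar (TId 1) t))
     ((set (a @ [y]) \<union> set b) \<union> ({y} \<union> set (a @ b))) (({} \<union> {}) \<union> ({} \<union> {})) ((a @ [y]) @ b) ([y] @ u)"
    by (rule den_seqI[OF 1]) (use 2 in auto)
  moreover have "(set (a @ [y]) \<union> set b) \<union> ({y} \<union> set (a @ b)) = set i" using i by auto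
  ultimately have "den S A (TSeq (TPar (TSym (length a) 1) (TId (length b))) (TPar (TId 1) t)) (set i) {} i (y # u)"
    using i by (simp del: den.simps)
  then show ?case by blast
qed

text \<open>Induction on the number of edges peels off one of minimal rank. The term sorts its
  sources to the right, applies the generator beside idle wires and continues with the remaining
  hypergraph.\<close>

lemma den_full:
  assumes "hyp S (subhyp A V E)" "mono_eqs A V E i u" "ranked A E"
  shows "\<exists>t. den S A t V E i u"
  using assms
proof (induction "card E" arbitrary: V E i)
  case 0
  then have E: "E = {}" using hyp_sub_finite by fastforce
  have f: "finite V" using 0 hyp_sub_finite by blast
  have m: "mset i = mset u" "mset i = mset_set V" using 0 E by (auto simp: mono_eqs_def)
  have "distinct i" using mono_eqsD(1)[OF 0(3) f] E by simp
  moreover have "V = set i" using m(2) f by (metis finite_set_mset_mset_set set_mset_mset)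
  ultimately show ?case using den_perm[OF _ m(1)] E by blast
next
  case (Suc k)
  have f: "finite V" "finite E" using Suc hyp_sub_finite by blast+
  obtain rk :: "nat \<Rightarrow> nat" where rk: "\<forall>h \<in> E. \<forall>h' \<in> E. set (targets A h) \<inter> set (sources A h') \<noteq> {} \<longrightarrow> rk h < rk h'"
    using Suc.prems(3) unfolding ranked_def by blast
  have "E \<noteq> {}" using Suc(2) by auto
  then obtain h where h: "h \<in> E" "\<And>h'. h' \<in> E \<Longrightarrow> rk h \<le> rk h'"
    using ex_min_if_finite[of "rk ` E"] f(2) by (metis arg_min_least arg_min_if_finite(1))
  note M = mono_eqsD[OF Suc.prems(2) f]
  \<comment> \<open>An edge producing a source of \<open>h\<close> would have smaller rank than the
    minimal \<open>h\<close>, so every source is an input.\<close>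
  have src: "set (sources A h) \<subseteq> set i"
  proof
    fix v assume v: "v \<in> set (sources A h)"
    then have "v \<in> V" using M(5)[OF h(1)] by blast
    moreover have "v \<notin> set (targets A h')" if "h' \<in> E" for h'
      using rk h(1) h(2)[OF that] v that by (metis disjoint_iff leD)
    ultimately show "v \<in> set i" using M(6) by blast
  qed
  have st: "set (targets A h) \<inter> set (sources A h) = {}" using rk h(1) by blast
  let ?r = "rest A h i" and ?s = "sources A h" and ?t = "targets A h"
  have d: "distinct ?s" "distinct ?t" "set ?t \<subseteq> V - set i" "set ?s \<subseteq> V - set u" using M(5)[OF h(1)] by auto
  have mi: "mset i = mset (?r @ ?s)" by (rule mset_rest[OF M(1) d(1) src])
  \<comment> \<open>The consumed nodes leave together with \<open>h\<close>. Its targets become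
    inputs, so the remainder satisfies the equations again after cancelling
    \<open>?s\<close>.\<close>
  let ?V = "V - set ?s" and ?E = "E - {h}"
  have Eh: "tgt_mset A E = mset ?t + tgt_mset A ?E" "src_mset A E = mset ?s + src_mset A ?E"
    using f(2) h(1) by (simp_all add: tgt_mset_def src_mset_def sum.remove)
  have mV: "mset_set V = mset_set ?V + mset ?s"
  proof -
    have "set ?s \<subseteq> V" using d(4) by blast
    then have "mset_set V = mset_set ?V + mset_set (set ?s)"
      using f(1) by (metis Diff_disjoint Un_Diff_cancel2 finite_Diff List.finite_set inf.commute mset_set_Union sup.absorb1)
    then show ?thesis using d(1) by (simp add: mset_set_set)
  qed
  have mg: "mono_eqs A ?V ?E (?r @ ?t) u"
  proof -
    have "(mset (?r @ ?t) + tgt_mset A ?E) + mset ?s = mset_set ?V + mset ?s"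
      using Suc.prems(2) unfolding mV[symmetric] mono_eqs_def Eh mi by (simp add: add_ac)
    moreover have "(mset u + src_mset A ?E) + mset ?s = mset_set ?V + mset ?s"
      using Suc.prems(2) unfolding mV[symmetric] mono_eqs_def Eh by (simp add: add_ac)
    ultimately show ?thesis by (simp add: mono_eqs_def)
  qed
  have hy: "hyp S (subhyp A ?V ?E)"
    unfolding hyp_def
  proof (intro conjI ballI)
    fix k assume k: "k \<in> edges (subhyp A ?V ?E)"
    then have "set (sources A k) \<inter> set ?s = {}" using M(8)[of k h] h(1) by auto
    then show "set (sources (subhyp A ?V ?E) k) \<subseteq> nodes (subhyp A ?V ?E)"
      using k Suc.prems(1) by (auto simp: hyp_def)
    have "set (targets A k) \<inter> set i = {}" using M(5)[of k] k by auto
    then show "set (targets (subhyp A ?V ?E) k) \<subseteq> nodes (subhyp A ?V ?E)"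
      using k Suc.prems(1) src by (auto simp: hyp_def)
  qed (use f Suc.prems(1) in \<open>auto simp: hyp_def\<close>)
  have "ranked A ?E" using rk unfolding ranked_def by blast
  moreover have "k = card ?E" using Suc(2) h(1) f(2) by simp
  ultimately obtain t where t: "den S A t ?V ?E (?r @ ?t) u" using Suc(1)[OF _ hy mg] by blast
  obtain p where p: "den S A p (set i) {} i (?r @ ?s)" using den_perm[OF M(1) mi] by blast
  have g: "den S A (TGen (label A h)) (set (?s @ ?t)) {h} ?s ?t"
    using d(1,2) st h(1) Suc.prems(1) by (auto simp: hyp_def)
  have r: "set ?r \<subseteq> set i" "distinct ?r" "set ?r \<inter> set ?s = {}" using M(1) by (auto simp: rest_def)
  have pg: "den S A (TPar (TId (length ?r)) (TGen (label A h))) (set ?r \<union> set (?s @ ?t)) ({} \<union> {h}) (?r @ ?s) (?r @ ?t)"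
    by (rule den_parI[OF _ g]) (use r d(3) in auto)
  have si: "set i = set ?r \<union> set ?s" using mi by (metis mset_eq_setD set_append)
  have "den S A (TSeq (TPar (TId (length ?r)) (TGen (label A h))) t) ((set ?r \<union> set (?s @ ?t)) \<union> ?V) (({} \<union> {h}) \<union> ?E) (?r @ ?s) u"
    by (rule den_seqI[OF pg t]) (use r d(3) M(3) st in auto)
  then have "den S A (TSeq p (TSeq (TPar (TId (length ?r)) (TGen (label A h))) t))
     (set i \<union> ((set ?r \<union> set (?s @ ?t)) \<union> ?V)) ({} \<union> (({} \<union> {h}) \<union> ?E)) i u"
    by (rule den_seqI[OF p]) (use si in auto)
  moreover have "set i \<union> ((set ?r \<union> set (?s @ ?t)) \<union> ?V) = V"
    using M(3) d(3) d(4) si by auto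
  moreover have "{} \<union> (({} \<union> {h}) \<union> ?E) = E" using h(1) by auto
  ultimately show ?case by metis
qed

section \<open>From degrees to multiset equations\<close>

text \<open>Maps from a one-node hypergraph pick single nodes, so left cancellation tested on them
  is injectivity. Conversely, anything mapping into a discrete hypergraph has no edges, so
  injectivity on nodes suffices.\<close>

lemma mono_discrete: "hyp_mono S (discrete n) G f \<longleftrightarrow> hyp S G \<and> set (leg n f) \<subseteq> nodes G \<and> distinct (leg n f)"
proof (intro iffI conjI)
  assume m: "hyp_mono S (discrete n) G f"
  then have h: "hyp_hom S (discrete n) G f" by (simp add: hyp_mono_def)
  then show "hyp S G" "set (leg n f) \<subseteq> nodes G" by (simp_all add: hom_discrete)
  show "distinct (leg n f)"
  proof -
    have "inj_on (nmap f) {..<n}"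
    proof (rule inj_onI)
      fix a b assume ab: "a \<in> {..<n}" "b \<in> {..<n}" "nmap f a = nmap f b"
      have "hyp_hom S (discrete 1) (discrete n) (node_map (\<lambda>_. c))" if "c < n" for c
        using that by (simp add: hom_discrete)
      moreover have "heq (discrete 1 :: 'a hgraph) (node_map (\<lambda>_. a) \<then> f) (node_map (\<lambda>_. b) \<then> f)"
        using ab(3) by (simp add: heq_def node_map_def)
      ultimately have "heq (discrete 1 :: 'a hgraph) (node_map (\<lambda>_. a)) (node_map (\<lambda>_. b))"
        using m ab unfolding hyp_mono_def by blast
      then show "a = b" by (simp add: heq_def node_map_def)
    qed
    then show ?thesis by (simp add: leg_def distinct_map atLeast0LessThan)
  qed
next
  assume a: "hyp S G \<and> set (leg n f) \<subseteq> nodes G \<and> distinct (leg n f)"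
  then have i: "inj_on (nmap f) {..<n}" by (simp add: leg_def distinct_map atLeast0LessThan)
  show "hyp_mono S (discrete n) G f"
    unfolding hyp_mono_def
  proof (intro conjI allI impI)
    show "hyp_hom S (discrete n) G f" using a by (simp add: hom_discrete)
    fix T u v assume uv: "hyp_hom S T (discrete n) u" "hyp_hom S T (discrete n) v" "heq T (u \<then> f) (v \<then> f)"
    then have "edges T = {}" by (auto simp: hyp_hom_def)
    moreover have "nmap u x = nmap v x" if "x \<in> nodes T" for x
      using that uv i by (auto simp: hyp_hom_def heq_def inj_on_def)
    ultimately show "heq T u v" by (simp add: heq_def)
  qed
qed

lemma indegree_count:
  assumes "finite (edges G)"
  shows "indegree G v = count (tgt_mset G (edges G)) v" "outdegree G v = count (src_mset G (edges G)) v"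
proof -
  have c: "card {i. i < length xs \<and> xs ! i = v} = count (mset xs) v" for xs :: "nat list"
    unfolding count_mset count_list_eq_length_filter length_filter_conv_card
    by (rule arg_cong[where f = card]) auto
  have "{(h, i). h \<in> edges G \<and> i < length (targets G h) \<and> targets G h ! i = v} =
      Sigma (edges G) (\<lambda>h. {i. i < length (targets G h) \<and> targets G h ! i = v})" by auto
  then show "indegree G v = count (tgt_mset G (edges G)) v"
    using assms by (simp add: indegree_def tgt_mset_def count_sum c card_SigmaI)
  have "{(h, i). h \<in> edges G \<and> i < length (sources G h) \<and> sources G h ! i = v} =
      Sigma (edges G) (\<lambda>h. {i. i < length (sources G h) \<and> sources G h ! i = v})" by auto
  then show "outdegree G v = count (src_mset G (edges G)) v"
    using assms by (simp add: outdegree_def src_mset_def count_sum c card_SigmaI)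
qed

lemma mset_set_count_iff:
  assumes "finite V" "set i \<subseteq> V" "distinct i" "set_mset M \<subseteq> V"
  shows "mset i + M = mset_set V \<longleftrightarrow> (\<forall>v \<in> V. count M v = (if v \<in> set i then 0 else 1))"
proof -
  have c: "count (mset i) v = (if v \<in> set i then 1 else 0)" for v
    using assms(3) by (simp add: distinct_count_atmost_1)
  have "mset i + M = mset_set V \<longleftrightarrow> (\<forall>v. count (mset i) v + count M v = (if v \<in> V then 1 else 0))"
    using assms(1) by (simp add: multiset_eq_iff count_mset_set')
  also have "\<dots> \<longleftrightarrow> (\<forall>v \<in> V. count M v = (if v \<in> set i then 0 else 1))"
  proof (intro iffI ballI allI)
    fix v assume "\<forall>v \<in> V. count M v = (if v \<in> set i then 0 else 1)"
    then show "count (mset i) v + count M v = (if v \<in> V then 1 else 0)"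
      using assms(2,4) c[of v] by (cases "v \<in> V") (auto simp: count_eq_zero_iff)
  next
    fix v assume "\<forall>v. count (mset i) v + count M v = (if v \<in> V then 1 else 0)" "v \<in> V"
    then have "count (mset i) v + count M v = 1" by simp
    then show "count M v = (if v \<in> set i then 0 else 1)" using c[of v] by (auto split: if_splits)
  qed
  finally show ?thesis .
qed

text \<open>Degrees are multiplicities in the multisets of targets and sources. The degree condition
  at every node is the equation of multisets read pointwise.\<close>

lemma monogamous_iff:
  "monogamous S m n G f g \<longleftrightarrow> hyp S G \<and> mono_eqs G (nodes G) (edges G) (leg m f) (leg n g)"
proof -
  have l: "nmap f ` {..<k} = set (leg k f)" for f k by (auto simp: leg_def)
  have t: "set_mset (tgt_mset G (edges G)) \<subseteq> nodes G" "set_mset (src_mset G (edges G)) \<subseteq> nodes G" if "hyp S G"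
    using that unfolding tgt_mset_def src_mset_def hyp_def by (auto simp: set_mset_sum)
  show ?thesis
  proof
    assume m: "monogamous S m n G f g"
    then have h: "hyp S G" "set (leg m f) \<subseteq> nodes G" "distinct (leg m f)" "set (leg n g) \<subseteq> nodes G" "distinct (leg n g)"
      by (auto simp: monogamous_def mono_discrete)
    have f: "finite (nodes G)" "finite (edges G)" using h(1) by (auto simp: hyp_def)
    show "hyp S G \<and> mono_eqs G (nodes G) (edges G) (leg m f) (leg n g)"
      using m h unfolding mono_eqs_def mset_set_count_iff[OF f(1) h(2,3) t(1)[OF h(1)]]
        mset_set_count_iff[OF f(1) h(4,5) t(2)[OF h(1)]]
      by (simp add: monogamous_def indegree_count[OF f(2)] l)
  next
    assume m: "hyp S G \<and> mono_eqs G (nodes G) (edges G) (leg m f) (leg n g)"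
    then have h: "hyp S G" and f: "finite (nodes G)" "finite (edges G)" by (auto simp: hyp_def)
    have M: "mono_eqs G (nodes G) (edges G) (leg m f) (leg n g)" using m by simp
    note D = mono_eqsD[OF M f]
    show "monogamous S m n G f g"
      unfolding monogamous_def mono_discrete
      using h D(1-4) M unfolding mono_eqs_def mset_set_count_iff[OF f(1) D(3,1) t(1)[OF h]]
        mset_set_count_iff[OF f(1) D(4,2) t(2)[OF h]]
      by (simp add: indegree_count[OF f(2)] l)
  qed
qed

section \<open>Contexts and pushouts\<close>

lemma hid_hcomp [simp]: "hid \<then> f = f"
  by (rule hmap_eqI) simp_all

text \<open>A pushout along the two boundary interfaces \<open>is\<close> and \<open>js\<close> of a context \<open>C\<close>, made of \<open>c\<^sub>1\<close> and \<open>c\<^sub>2\<close>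
  sharing only the wires \<open>ks\<close>, denotes the sequential composite.\<close>

lemma context_univ:
  fixes S :: "'g signature"
  assumes c1: "den S C c\<^sub>1 V\<^sub>1 E\<^sub>1 ins (ks @ is)" and c2: "den S C c\<^sub>2 V\<^sub>2 E\<^sub>2 (ks @ js) outs"
    and V: "V\<^sub>1 \<inter> V\<^sub>2 = set ks" "nodes C = V\<^sub>1 \<union> V\<^sub>2" and E: "E\<^sub>1 \<inter> E\<^sub>2 = {}" "edges C = E\<^sub>1 \<union> E\<^sub>2"
    and r: "wt S r" and Q: "univ S (map_tm Inl r) Q z is' js'"
    and po: "is_pushout S (discrete k) Q C P f g p q"
    and fg: "leg k f = is' @ js'" "leg k g = is @ js" and len: "length is' = length is"
  shows "\<exists>x. univ S (map_tm Inl (TSeq (TSeq c\<^sub>1 (TPar (TId (length ks)) r)) c\<^sub>2)) P x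
    (map (nmap q) ins) (map (nmap q) outs)"
proof -
  let ?S1 = "subhyp C V\<^sub>1 E\<^sub>1" and ?S2 = "subhyp C V\<^sub>2 E\<^sub>2"
  have C: "subhyp C (V\<^sub>1 \<union> V\<^sub>2) (E\<^sub>1 \<union> E\<^sub>2) = C" using V(2) E(2) by (simp add: subhyp_def)
  obtain x1 x2 where x: "univ S (map_tm Inl c\<^sub>1) ?S1 x1 ins (ks @ is)" "univ S (map_tm Inl c\<^sub>2) ?S2 x2 (ks @ js) outs"
    using den_univ[OF c1] den_univ[OF c2] by blast
  have h: "hyp S ?S1" "hyp S ?S2" using x by (auto dest: univ_hyp)
  have hC: "hyp S C" using hyp_sub_Un[OF h] C by simp
  have i1: "hyp_hom S ?S1 C hid" using hom_sub[OF h(1), of "V\<^sub>1 \<union> V\<^sub>2" "E\<^sub>1 \<union> E\<^sub>2"] C hC by simp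
  have i2: "hyp_hom S ?S2 C hid" using hom_sub[OF h(2), of "V\<^sub>1 \<union> V\<^sub>2" "E\<^sub>1 \<union> E\<^sub>2"] C hC by simp
  have pq: "hyp_hom S Q P p" "hyp_hom S C P q" "heq (discrete k :: 'g hgraph) (f \<then> p) (g \<then> q)"
    using po by (auto simp: is_pushout_def)
  have "map (nmap p) is' @ map (nmap p) js' = map (nmap q) is @ map (nmap q) js"
    using pq(3) fg by (simp add: heq_discrete)
  then have ij: "map (nmap p) is' = map (nmap q) is" "map (nmap p) js' = map (nmap q) js"
    using len by (simp_all add: append_eq_append_conv)
  have P: "hyp S P" using hom_hyp[OF pq(2)] by simp
  have q1: "hyp_hom S ?S1 P q" using hom_comp[OF i1 pq(2)] by simp
  have q2: "hyp_hom S ?S2 P q" using hom_comp[OF i2 pq(2)] by simp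
  have w1: "wt (fsig S) (map_tm Inl c\<^sub>1)" and w2: "wt (fsig S) (map_tm Inl c\<^sub>2)" and wr: "wt (fsig S) (map_tm Inl r)"
    using den_typing[OF c1] den_typing[OF c2] r by (simp_all add: map_tm_typing)
  have wi: "wt (fsig S) (TId (length ks))" by simp
  have b1: "set ins \<subseteq> V\<^sub>1" "set ks \<subseteq> V\<^sub>1" "set is \<subseteq> V\<^sub>1" using den_wf[OF c1] by auto
  have b2: "set outs \<subseteq> V\<^sub>2" "set ks \<subseteq> V\<^sub>2" "set js \<subseteq> V\<^sub>2" using den_wf[OF c2] by auto
  let ?t = "TSeq (TSeq (map_tm Inl c\<^sub>1) (TPar (TId (length ks)) (map_tm Inl r))) (map_tm Inl c\<^sub>2)"
  \<comment> \<open>The universal element of the composite: its middle tuples are the images of the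
    interfaces of the context, and its inner part comes from \<open>Q\<close>.\<close>
  let ?x = "VSeq (VSeq (vmap q x1) (map (nmap q) (ks @ is)) (VPar U (vmap p z))) (map (nmap q) (ks @ js)) (vmap q x2)"
  have "univ S ?t P ?x (map (nmap q) ins) (map (nmap q) outs)"
  proof (rule univI[OF P])
    have "elem S P (TId (length ks)) U (map (nmap q) ks) (map (nmap q) ks)"
      using hom_map_nodes[OF pq(2), of ks] b1 V(2) by auto
    moreover have "elem S P (map_tm Inl r) (vmap p z) (map (nmap q) is) (map (nmap q) js)"
      using elem_hom[OF pq(1) univ_elem[OF Q]] ij by simp
    ultimately have "elem S P (TPar (TId (length ks)) (map_tm Inl r)) (VPar U (vmap p z))
        (map (nmap q) ks @ map (nmap q) is) (map (nmap q) ks @ map (nmap q) js)"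
      by (rule elem_parI[OF P wi])
    then show "elem S P ?t ?x (map (nmap q) ins) (map (nmap q) outs)"
      using elem_hom[OF q1 univ_elem[OF x(1)]] elem_hom[OF q2 univ_elem[OF x(2)]]
      unfolding elem.simps(4) map_append by blast
  next
    fix T
    show "\<exists>w. hyp_hom S P T w \<and> vmap w ?x = y \<and> map (nmap w) (map (nmap q) ins) = i \<and> map (nmap w) (map (nmap q) outs) = u"
      if T: "hyp S T" "elem S T ?t y i u" for y i u
    proof -
      obtain a m b m' c where e: "y = VSeq (VSeq a m b) m' c" "elem S T (map_tm Inl c\<^sub>1) a i m"
        "elem S T (TPar (TId (length ks)) (map_tm Inl r)) b m m'" "elem S T (map_tm Inl c\<^sub>2) c m' u"
        using T(2) unfolding elem.simps(4) by blast
      obtain m1 m2 m2' b' where b: "b = VPar U b'" "m = m1 @ m2" "m' = m1 @ m2'" "length m1 = length ks"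
        "elem S T (map_tm Inl r) b' m2 m2'"
        using e(3) unfolding elem_par[OF T(1) wi] by auto
      obtain w1 where w1': "hyp_hom S ?S1 T w1" "vmap w1 x1 = a" "map (nmap w1) ins = i" "map (nmap w1) (ks @ is) = m"
        by (rule univ_exist[OF x(1) T(1) e(2)])
      obtain w2 where w2': "hyp_hom S ?S2 T w2" "vmap w2 x2 = c" "map (nmap w2) (ks @ js) = m'" "map (nmap w2) outs = u"
        by (rule univ_exist[OF x(2) T(1) e(4)])
      obtain w0 where w0: "hyp_hom S Q T w0" "vmap w0 z = b'" "map (nmap w0) is' = m2" "map (nmap w0) js' = m2'"
        by (rule univ_exist[OF Q T(1) b(5)])
      have k1: "map (nmap w1) ks = m1" "map (nmap w1) is = m2" using w1'(4) b by (simp_all add: append_eq_append_conv)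
      have k2: "map (nmap w2) ks = m1" "map (nmap w2) js = m2'" using w2'(3) b by (simp_all add: append_eq_append_conv)
      have ag: "nmap w1 v = nmap w2 v" if "v \<in> V\<^sub>1 \<inter> V\<^sub>2" for v
      proof -
        have "map (nmap w1) ks = map (nmap w2) ks" using k1(1) k2(1) by simp
        then show ?thesis using that V(1) by (auto simp: map_eq_conv)
      qed
      \<comment> \<open>The maps on the two halves agree on the shared wires \<open>ks\<close>,
        hence glue to a map on \<open>C\<close>; together with \<open>w0\<close> it is a cocone for
        the pushout.\<close>
      let ?v = "glue V\<^sub>1 E\<^sub>1 w1 w2"
      have v: "hyp_hom S C T ?v" using hom_glue[OF w1'(1) w2'(1) ag E(1)] C by simp
      have v1: "heq ?S1 ?v w1" and v2: "heq ?S2 ?v w2" by (rule glue_heq[OF ag E(1)]; simp)+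
      have "map (nmap ?v) is = m2" using heq_map[OF v1, of "is"] b1 k1 by simp
      moreover have "map (nmap ?v) js = m2'" using heq_map[OF v2, of "js"] b2 k2 by simp
      ultimately have "heq (discrete k :: 'g hgraph) (f \<then> w0) (g \<then> ?v)" using fg w0 by (simp add: heq_discrete)
      then obtain w where w: "hyp_hom S P T w" "heq Q (p \<then> w) w0" "heq C (q \<then> w) ?v"
        using po w0(1) v unfolding is_pushout_def by blast
      have s1: "heq ?S1 (q \<then> w) w1" using w(3) v1 V(2) E(2) by (auto simp: heq_def)
      have s2: "heq ?S2 (q \<then> w) w2" using w(3) v2 V(2) E(2) by (auto simp: heq_def)
      have vm: "vmap w (vmap q x1) = a" "vmap w (vmap q x2) = c" "vmap w (vmap p z) = b'"
        using vmap_elem_cong[OF h(1) s1 univ_elem[OF x(1)] w1] vmap_elem_cong[OF h(2) s2 univ_elem[OF x(2)] w2]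
          vmap_elem_cong[OF univ_hyp[OF Q] w(2) univ_elem[OF Q] wr] w1' w2' w0 by (simp_all add: vmap_comp)
      have m1: "map (nmap w) (map (nmap q) l) = map (nmap w1) l" if "set l \<subseteq> V\<^sub>1" for l
        using heq_map[OF s1, of l] that by simp
      have m2: "map (nmap w) (map (nmap q) l) = map (nmap w2) l" if "set l \<subseteq> V\<^sub>2" for l
        using heq_map[OF s2, of l] that by simp
      have "map (nmap w) (map (nmap q) ins) = i" using m1[OF b1(1)] w1'(3) by (rule HOL.trans)
      moreover have "map (nmap w) (map (nmap q) (ks @ is)) = m"
        by (rule HOL.trans[OF m1 w1'(4)]) (use b1 in simp)
      moreover have "map (nmap w) (map (nmap q) (ks @ js)) = m'"
        by (rule HOL.trans[OF m2 w2'(3)]) (use b2 in simp)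
      moreover have "map (nmap w) (map (nmap q) outs) = u" using m2[OF b2(1)] w2'(4) by (rule HOL.trans)
      ultimately have "vmap w ?x = y" unfolding e(1) b(1) by (simp only: vmap.simps vm)
      then show ?thesis using w(1) \<open>map (nmap w) (map (nmap q) ins) = i\<close> \<open>map (nmap w) (map (nmap q) outs) = u\<close> by blast
    qed
    show "heq P w w'" if w: "hyp_hom S P T w" "hyp_hom S P T w'" "vmap w ?x = vmap w' ?x"
      "map (nmap w) (map (nmap q) ins) = map (nmap w') (map (nmap q) ins)"
      "map (nmap w) (map (nmap q) outs) = map (nmap w') (map (nmap q) outs)" for w w'
    proof (rule pushout_unique[OF po w(1,2)])
      have e: "vmap w (vmap q x1) = vmap w' (vmap q x1)" "vmap w (vmap q x2) = vmap w' (vmap q x2)"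
        "vmap w (vmap p z) = vmap w' (vmap p z)"
        "map (nmap w) (map (nmap q) (ks @ is)) = map (nmap w') (map (nmap q) (ks @ is))"
        "map (nmap w) (map (nmap q) (ks @ js)) = map (nmap w') (map (nmap q) (ks @ js))"
        using w(3) by simp_all
      have "map (nmap w) (map (nmap p) is') = map (nmap w') (map (nmap p) is')"
        "map (nmap w) (map (nmap p) js') = map (nmap w') (map (nmap p) js')"
        unfolding ij using e(4,5) by simp_all
      then show "heq Q (p \<then> w) (p \<then> w')"
        using e(3) by (intro univ_unique[OF Q hom_comp[OF pq(1) w(1)] hom_comp[OF pq(1) w(2)]]) (simp_all add: vmap_comp)
      have "heq ?S1 (q \<then> w) (q \<then> w')"
        by (rule univ_unique[OF x(1) hom_comp[OF q1 w(1)] hom_comp[OF q1 w(2)]])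
          (use e w(4) in \<open>simp_all add: vmap_comp\<close>)
      moreover have "heq ?S2 (q \<then> w) (q \<then> w')"
        by (rule univ_unique[OF x(2) hom_comp[OF q2 w(1)] hom_comp[OF q2 w(2)]])
          (use e w(5) in \<open>simp_all add: vmap_comp\<close>)
      ultimately show "heq C (q \<then> w) (q \<then> w')" using V(2) E(2) by (auto simp: heq_def)
    qed
  qed
  then show ?thesis by (auto simp del: elem.simps)
qed

section \<open>Directed paths and the split of a complement\<close>

text \<open>A test hypergraph with a single node imposes no condition on nodes, so its edges may be
  tagged by their origin in \<open>L\<close> or \<open>C\<close>. The mediating map then separates
  the images of the two edge sets.\<close>

lemma pushout_edges_disjoint:
  fixes S :: "'g signature"
  assumes po: "is_pushout S (discrete k) L C D f\<^sub>0 g\<^sub>0 f g"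
  shows "emap f ` edges L \<inter> emap g ` edges C = {}"
proof -
  have h: "hyp S L" "hyp S C" using po by (auto simp: is_pushout_def hyp_hom_def)
  let ?H = "hyp_sum L C"
  have H: "hyp S ?H" by (rule hyp_hyp_sum[OF h])
  define T where "T = ?H\<lparr> nodes := {0}, sources := \<lambda>h. map (\<lambda>_. 0) (sources ?H h), targets := \<lambda>h. map (\<lambda>_. 0) (targets ?H h) \<rparr>"
  define \<kappa> where "\<kappa> = \<lparr> nmap = \<lambda>_. 0 :: nat, emap = \<lambda>h. h :: nat \<rparr>"
  have "hyp S T" using H by (auto simp: hyp_def T_def)
  then have \<kappa>: "hyp_hom S ?H T \<kappa>" using H by (auto simp: hyp_hom_def T_def \<kappa>_def)
  have e: "heq (discrete k :: 'g hgraph) (f\<^sub>0 \<then> (hinl \<then> \<kappa>)) (g\<^sub>0 \<then> (hinr \<then> \<kappa>))"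
    by (simp add: heq_def \<kappa>_def)
  obtain w where w: "heq L (f \<then> w) (hinl \<then> \<kappa>)" "heq C (g \<then> w) (hinr \<then> \<kappa>)"
    using po hom_comp[OF hom_hinl[OF h] \<kappa>] hom_comp[OF hom_hinr[OF h] \<kappa>] e unfolding is_pushout_def by blast
  have wa: "emap w (emap f a) = node_inl a" if "a \<in> edges L" for a
    using w(1) that by (simp add: heq_def \<kappa>_def hinl_def)
  have wb: "emap w (emap g b) = node_inr b" if "b \<in> edges C" for b
    using w(2) that by (simp add: heq_def \<kappa>_def hinr_def)
  have lr: "node_inl a \<noteq> node_inr b" for a b
    by (simp add: node_inl_def node_inr_def sum_encode_eq)
  show ?thesis
  proof (rule equals0I)
    fix x assume "x \<in> emap f ` edges L \<inter> emap g ` edges C"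
    then obtain a b where "a \<in> edges L" "b \<in> edges C" "x = emap f a" "x = emap g b" by blast
    then show False using wa[of a] wb[of b] lr[of a b] by simp
  qed
qed

lemma directed_path_Cons:
  assumes "h \<in> edges G" "v \<in> set (sources G h)" "u \<in> set (targets G h)" "directed_path G u hs v'"
  shows "directed_path G v (h # hs) v'"
proof -
  have hs: "hs \<noteq> []" "u \<in> set (sources G (hd hs))"
    "\<forall>i. Suc i < length hs \<longrightarrow> set (targets G (hs ! i)) \<inter> set (sources G (hs ! Suc i)) \<noteq> {}"
    using assms(4) by (auto simp: directed_path_def)
  have "set (targets G ((h # hs) ! i)) \<inter> set (sources G ((h # hs) ! Suc i)) \<noteq> {}" if "Suc i < length (h # hs)" for i
  proof (cases i)
    case 0
    then show ?thesis using assms(3) hs(1,2) by (auto simp: hd_conv_nth)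
  next
    case (Suc j)
    then show ?thesis using that hs(3) by simp
  qed
  then show ?thesis using assms hs(1) by (auto simp: directed_path_def)
qed

lemma directed_path_hom:
  assumes "hyp_hom S G H f" "directed_path G v hs v'"
  shows "directed_path H (nmap f v) (map (emap f) hs) (nmap f v')"
proof -
  have hs: "hs \<noteq> []" "set hs \<subseteq> edges G" "v \<in> set (sources G (hd hs))" "v' \<in> set (targets G (last hs))"
    "\<forall>i. Suc i < length hs \<longrightarrow> set (targets G (hs ! i)) \<inter> set (sources G (hs ! Suc i)) \<noteq> {}"
    using assms(2) by (auto simp: directed_path_def)
  have e: "emap f h \<in> edges H" "sources H (emap f h) = map (nmap f) (sources G h)"
    "targets H (emap f h) = map (nmap f) (targets G h)" if "h \<in> set hs" for h
    using assms(1) hs(2) that by (auto simp: hyp_hom_def)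
  have "set (targets H (map (emap f) hs ! i)) \<inter> set (sources H (map (emap f) hs ! Suc i)) \<noteq> {}"
    if i: "Suc i < length hs" for i
  proof -
    obtain x where "x \<in> set (targets G (hs ! i))" "x \<in> set (sources G (hs ! Suc i))" using hs(5) i by blast
    then have "nmap f x \<in> set (targets H (emap f (hs ! i)))" "nmap f x \<in> set (sources H (emap f (hs ! Suc i)))"
      using e i by simp_all
    then show ?thesis using i by auto
  qed
  then show ?thesis using hs(1-4) e by (auto simp: directed_path_def hd_map last_map)
qed

text \<open>The edges from which \<open>W\<close> can be reached. The backward inductive form makes
  closure under predecessors immediate, which is what cutting the complement needs; paths appear
  only when convexity is applied.\<close>

inductive_set upstream :: "'g hgraph \<Rightarrow> nat set \<Rightarrow> nat set" for G W where
  base: "h \<in> edges G \<Longrightarrow> v \<in> set (targets G h) \<Longrightarrow> v \<in> W \<Longrightarrow> h \<in> upstream G W"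
| step: "h \<in> edges G \<Longrightarrow> v \<in> set (targets G h) \<Longrightarrow> h' \<in> upstream G W \<Longrightarrow> v \<in> set (sources G h') \<Longrightarrow> h \<in> upstream G W"

lemma upstream_path:
  "h \<in> upstream G W \<Longrightarrow> v \<in> set (sources G h) \<Longrightarrow> \<exists>hs v'. directed_path G v hs v' \<and> v' \<in> W"
proof (induction arbitrary: v rule: upstream.induct)
  case (base h u)
  then have "directed_path G v [h] u" by (auto simp: directed_path_def)
  then show ?case using base by blast
next
  case (step h u h')
  then show ?case by (meson directed_path_Cons)
qed

lemma tgt_mset_distinct:
  assumes "finite E" "\<And>h. h \<in> E \<Longrightarrow> distinct (targets A h)"
    "\<And>h h'. h \<in> E \<Longrightarrow> h' \<in> E \<Longrightarrow> h \<noteq> h' \<Longrightarrow> set (targets A h) \<inter> set (targets A h') = {}"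
  shows "tgt_mset A E = mset_set (\<Union>h \<in> E. set (targets A h))"
  using assms
proof (induction E)
  case (insert h E)
  have "set (targets A h) \<inter> (\<Union>h \<in> E. set (targets A h)) = {}"
    using insert.prems(2)[of h] insert.hyps by fastforce
  then have "mset_set (\<Union>h \<in> insert h E. set (targets A h)) = mset (targets A h) + mset_set (\<Union>h \<in> E. set (targets A h))"
    using insert.hyps insert.prems(1)[of h] by (simp add: mset_set_Union mset_set_set)
  then show ?case using insert by (simp add: tgt_mset_def)
qed simp

lemma src_mset_distinct:
  assumes "finite E" "\<And>h. h \<in> E \<Longrightarrow> distinct (sources A h)"
    "\<And>h h'. h \<in> E \<Longrightarrow> h' \<in> E \<Longrightarrow> h \<noteq> h' \<Longrightarrow> set (sources A h) \<inter> set (sources A h') = {}"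
  shows "src_mset A E = mset_set (\<Union>h \<in> E. set (sources A h))"
  using tgt_mset_distinct[of E "A\<lparr> targets := sources A \<rparr>"] assms by (simp add: tgt_mset_def src_mset_def)

lemma mono_eqsI:
  assumes "finite E" "distinct i" "distinct u"
    "\<And>h. h \<in> E \<Longrightarrow> distinct (sources A h) \<and> distinct (targets A h) \<and> set (targets A h) \<inter> set i = {} \<and>
      set (sources A h) \<inter> set u = {}"
    "\<And>h h'. h \<in> E \<Longrightarrow> h' \<in> E \<Longrightarrow> h \<noteq> h' \<Longrightarrow> set (targets A h) \<inter> set (targets A h') = {} \<and>
      set (sources A h) \<inter> set (sources A h') = {}"
    "V = set i \<union> (\<Union>h \<in> E. set (targets A h))" "V = set u \<union> (\<Union>h \<in> E. set (sources A h))"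
  shows "mono_eqs A V E i u"
proof -
  have "tgt_mset A E = mset_set (\<Union>h \<in> E. set (targets A h))" by (rule tgt_mset_distinct) (use assms in auto)
  moreover have "mset_set V = mset_set (set i) + mset_set (\<Union>h \<in> E. set (targets A h))"
    unfolding assms(6) by (rule mset_set_Union) (use assms in auto)
  moreover have "src_mset A E = mset_set (\<Union>h \<in> E. set (sources A h))" by (rule src_mset_distinct) (use assms in auto)
  moreover have "mset_set V = mset_set (set u) + mset_set (\<Union>h \<in> E. set (sources A h))"
    unfolding assms(7) by (rule mset_set_Union) (use assms in auto)
  ultimately show ?thesis using assms(2,3) by (simp add: mono_eqs_def mset_set_set)
qed

text \<open>Convexity of the match enters through the last assumption: it says that no path leads from the
  outputs \<open>js\<close> of the match back to its inputs \<open>is\<close>. Hence everything upstream of \<open>is\<close> can be placed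
  before the match, and everything else after it.\<close>

lemma split_context:
  assumes hC: "hyp S C" and mg: "mono_eqs C (nodes C) (edges C) (js @ ins) (outs @ is)" and rk: "ranked C (edges C)"
    and ij: "set is \<inter> set js = {}"
    and cv: "\<And>h. h \<in> upstream C (set is) \<Longrightarrow> set (sources C h) \<inter> set js = {}"
  shows "\<exists>c\<^sub>1 c\<^sub>2 ks V\<^sub>1 E\<^sub>1 V\<^sub>2 E\<^sub>2. den S C c\<^sub>1 V\<^sub>1 E\<^sub>1 ins (ks @ is) \<and> den S C c\<^sub>2 V\<^sub>2 E\<^sub>2 (ks @ js) outs \<and>
    V\<^sub>1 \<inter> V\<^sub>2 = set ks \<and> nodes C = V\<^sub>1 \<union> V\<^sub>2 \<and> E\<^sub>1 \<inter> E\<^sub>2 = {} \<and> edges C = E\<^sub>1 \<union> E\<^sub>2"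
proof -
  let ?N = "nodes C" and ?E = "edges C"
  have f: "finite ?N" "finite ?E" using hC by (auto simp: hyp_def)
  note M = mono_eqsD[OF mg f]
  define E1 where "E1 = upstream C (set is)"
  define E2 where "E2 = ?E - E1"
  define T1 where "T1 = (\<Union>h \<in> E1. set (targets C h))"
  define S1 where "S1 = (\<Union>h \<in> E1. set (sources C h))"
  define T2 where "T2 = (\<Union>h \<in> E2. set (targets C h))"
  define S2 where "S2 = (\<Union>h \<in> E2. set (sources C h))"
  define V1 where "V1 = set ins \<union> T1"
  \<comment> \<open>What is available after \<open>E1\<close> but is neither consumed by
    \<open>E1\<close> nor an input of the match: the wires that bypass the match.\<close>
  define K where "K = V1 - S1 - set is"
  define V2 where "V2 = K \<union> set js \<union> T2"
  have E1: "E1 \<subseteq> ?E" unfolding E1_def by (auto elim: upstream.cases)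
  have EE: "E1 \<inter> E2 = {}" "?E = E1 \<union> E2" using E1 by (auto simp: E2_def)
  have fE: "finite E1" "finite E2" using f(2) EE(2) by auto
  have dio: "distinct js" "distinct ins" "set js \<inter> set ins = {}" "distinct outs" "distinct is" "set outs \<inter> set is = {}"
    using M(1,2) by auto
  have subhyp: "set js \<subseteq> ?N" "set ins \<subseteq> ?N" "set outs \<subseteq> ?N" "set is \<subseteq> ?N" using M(3,4) by auto
  have e: "distinct (sources C h)" "distinct (targets C h)" "set (targets C h) \<subseteq> ?N" "set (sources C h) \<subseteq> ?N"
    "set (targets C h) \<inter> set js = {}" "set (targets C h) \<inter> set ins = {}"
    "set (sources C h) \<inter> set outs = {}" "set (sources C h) \<inter> set is = {}" if "h \<in> ?E" for h
    using M(5)[OF that] by auto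
  have TS: "T1 \<subseteq> ?N" "T2 \<subseteq> ?N" "S1 \<subseteq> ?N" "S2 \<subseteq> ?N"
    "T1 \<inter> set js = {}" "T2 \<inter> set js = {}" "T1 \<inter> set ins = {}" "T2 \<inter> set ins = {}"
    "S1 \<inter> set outs = {}" "S2 \<inter> set outs = {}" "S1 \<inter> set is = {}" "S2 \<inter> set is = {}"
  proof -
    have mt: "v \<in> ?N \<and> v \<notin> set js \<and> v \<notin> set ins" if "h \<in> ?E" "v \<in> set (targets C h)" for h v
      using e(3,5,6)[OF that(1)] that(2) by auto
    have ms: "v \<in> ?N \<and> v \<notin> set outs \<and> v \<notin> set is" if "h \<in> ?E" "v \<in> set (sources C h)" for h v
      using e(4,7,8)[OF that(1)] that(2) by auto
    have "v \<in> ?N \<and> v \<notin> set js \<and> v \<notin> set ins" if "v \<in> T1 \<or> v \<in> T2" for v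
      using that mt EE(2) unfolding T1_def T2_def by auto
    moreover have "v \<in> ?N \<and> v \<notin> set outs \<and> v \<notin> set is" if "v \<in> S1 \<or> v \<in> S2" for v
      using that ms EE(2) unfolding S1_def S2_def by auto
    ultimately show "T1 \<subseteq> ?N" "T2 \<subseteq> ?N" "S1 \<subseteq> ?N" "S2 \<subseteq> ?N"
      "T1 \<inter> set js = {}" "T2 \<inter> set js = {}" "T1 \<inter> set ins = {}" "T2 \<inter> set ins = {}"
      "S1 \<inter> set outs = {}" "S2 \<inter> set outs = {}" "S1 \<inter> set is = {}" "S2 \<inter> set is = {}"
      by blast+
  qed
  have T12: "T1 \<inter> T2 = {}"
  proof (rule equals0I)
    fix v assume "v \<in> T1 \<inter> T2"
    then obtain h h' where h: "h \<in> E1" "h' \<in> E2" "v \<in> set (targets C h)" "v \<in> set (targets C h')"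
      unfolding T1_def T2_def by blast
    then have "h \<in> ?E" "h' \<in> ?E" "h \<noteq> h'" using EE by blast+
    from M(8)[OF this] show False using h by blast
  qed
  have S12: "S1 \<inter> S2 = {}"
  proof (rule equals0I)
    fix v assume "v \<in> S1 \<inter> S2"
    then obtain h h' where h: "h \<in> E1" "h' \<in> E2" "v \<in> set (sources C h)" "v \<in> set (sources C h')"
      unfolding S1_def S2_def by blast
    then have "h \<in> ?E" "h' \<in> ?E" "h \<noteq> h'" using EE by blast+
    from M(8)[OF this] show False using h by blast
  qed
  have in_cov: "?N = set js \<union> set ins \<union> T1 \<union> T2"
  proof
    show "?N \<subseteq> set js \<union> set ins \<union> T1 \<union> T2"
    proof
      fix v assume "v \<in> ?N"
      from M(6)[OF this] show "v \<in> set js \<union> set ins \<union> T1 \<union> T2"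
        using EE(2) unfolding T1_def T2_def by auto
    qed
  qed (use subhyp TS in blast)
  have out_cov: "?N = set outs \<union> set is \<union> S1 \<union> S2"
  proof
    show "?N \<subseteq> set outs \<union> set is \<union> S1 \<union> S2"
    proof
      fix v assume "v \<in> ?N"
      from M(7)[OF this] show "v \<in> set outs \<union> set is \<union> S1 \<union> S2"
        using EE(2) unfolding S1_def S2_def by auto
    qed
  qed (use subhyp TS in blast)
  \<comment> \<open>Here the path condition enters: an upstream edge fed by an output of the match
    could not be placed before the match.\<close>
  have S1js: "S1 \<inter> set js = {}" using cv unfolding S1_def E1_def by blast
  \<comment> \<open>An edge with an input of the match among its targets is upstream by definition,
    hence not in \<open>E2\<close>; the next fact uses closure under predecessors in the same
    way.\<close>
  have isT2: "set is \<inter> T2 = {}"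
    using EE unfolding T2_def E1_def E2_def by (auto intro: upstream.base)
  have S1T2: "S1 \<inter> T2 = {}"
    using EE unfolding S1_def T2_def E1_def E2_def by (auto intro: upstream.step)
  have S1V: "S1 \<subseteq> V1" using TS(3) S1js S1T2 in_cov unfolding V1_def by blast
  have isV: "set is \<subseteq> V1" using subhyp(4) ij isT2 in_cov unfolding V1_def by blast
  have V12: "V1 \<inter> set js = {}" "V1 \<inter> T2 = {}" using dio(3) TS(5,8) T12 unfolding V1_def by blast+
  have VV: "V1 \<inter> V2 = K" using V12 unfolding V2_def K_def by blast
  have NV: "?N = V1 \<union> V2" using in_cov subhyp TS unfolding V1_def V2_def K_def by blast
  have V1o: "V1 = K \<union> set is \<union> S1" using S1V isV unfolding K_def by blast
  have V2o: "V2 = set outs \<union> S2"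
  proof
    have "K \<subseteq> set outs \<union> S2" using out_cov NV unfolding K_def by blast
    moreover have "set js \<subseteq> set outs \<union> S2" using subhyp(1) out_cov ij S1js by blast
    moreover have "T2 \<subseteq> set outs \<union> S2" using TS(2) out_cov isT2 S1T2 by blast
    ultimately show "V2 \<subseteq> set outs \<union> S2" unfolding V2_def by blast
    have "set outs \<inter> set is = {}" "set outs \<inter> S1 = {}" using dio(6) TS(9) by blast+
    then have "set outs \<subseteq> V2" using subhyp(3) NV unfolding V2_def K_def by blast
    moreover have "S2 \<subseteq> V2" using TS(4,12) S12 NV unfolding V2_def K_def by blast
    ultimately show "set outs \<union> S2 \<subseteq> V2" by blast
  qed
  have "finite K" using f(1) NV by (metis VV finite_Int finite_Un)
  then obtain ks where ks: "set ks = K" "distinct ks" using finite_distinct_list by blast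
  have sin: "set (sources C h) \<subseteq> S1" "set (targets C h) \<subseteq> T1" if "h \<in> E1" for h
    using that unfolding S1_def T1_def by auto
  have sin2: "set (sources C h) \<subseteq> S2" "set (targets C h) \<subseteq> T2" if "h \<in> E2" for h
    using that unfolding S2_def T2_def by auto
  have K1: "K \<inter> S1 = {}" "K \<inter> set is = {}" "K \<inter> set js = {}" "K \<inter> T2 = {}"
    using V12 unfolding K_def by blast+
  have m1: "mono_eqs C V1 E1 ins (ks @ is)"
  proof (rule mono_eqsI[OF fE(1)])
    show "distinct ins" "distinct (ks @ is)" using dio ks K1 by auto
    show "V1 = set ins \<union> (\<Union>h \<in> E1. set (targets C h))" by (simp add: V1_def T1_def)
    show "V1 = set (ks @ is) \<union> (\<Union>h \<in> E1. set (sources C h))" using V1o ks by (simp add: S1_def)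
    show "distinct (sources C h) \<and> distinct (targets C h) \<and> set (targets C h) \<inter> set ins = {} \<and>
      set (sources C h) \<inter> set (ks @ is) = {}" if "h \<in> E1" for h
    proof -
      have "h \<in> ?E" using that E1 by blast
      from e[OF this] show ?thesis using sin[OF that] ks(1) K1(1) by auto
    qed
    show "set (targets C h) \<inter> set (targets C h') = {} \<and> set (sources C h) \<inter> set (sources C h') = {}"
      if "h \<in> E1" "h' \<in> E1" "h \<noteq> h'" for h h'
      by (rule M(8)) (use that E1 in auto)
  qed
  have m2: "mono_eqs C V2 E2 (ks @ js) outs"
  proof (rule mono_eqsI[OF fE(2)])
    show "distinct outs" "distinct (ks @ js)" using dio ks K1 by auto
    show "V2 = set (ks @ js) \<union> (\<Union>h \<in> E2. set (targets C h))" using ks by (simp add: V2_def T2_def)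
    show "V2 = set outs \<union> (\<Union>h \<in> E2. set (sources C h))" using V2o by (simp add: S2_def)
    show "distinct (sources C h) \<and> distinct (targets C h) \<and> set (targets C h) \<inter> set (ks @ js) = {} \<and>
      set (sources C h) \<inter> set outs = {}" if "h \<in> E2" for h
    proof -
      have "h \<in> ?E" using that EE by blast
      from e[OF this] show ?thesis using sin2[OF that] ks(1) K1(4) by auto
    qed
    show "set (targets C h) \<inter> set (targets C h') = {} \<and> set (sources C h) \<inter> set (sources C h') = {}"
      if "h \<in> E2" "h' \<in> E2" "h \<noteq> h'" for h h'
      by (rule M(8)) (use that EE in auto)
  qed
  have h1: "hyp S (subhyp C V1 E1)"
  proof -
    have "set (sources C h) \<subseteq> V1 \<and> set (targets C h) \<subseteq> V1" if "h \<in> E1" for h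
      using sin[OF that] S1V unfolding V1_def by blast
    then show ?thesis using hC E1 fE f NV by (auto simp: hyp_def)
  qed
  have h2: "hyp S (subhyp C V2 E2)"
  proof -
    have "set (sources C h) \<subseteq> V2 \<and> set (targets C h) \<subseteq> V2" if "h \<in> E2" for h
      using sin2[OF that] V2o unfolding V2_def by blast
    then show ?thesis using hC EE fE f NV by (auto simp: hyp_def)
  qed
  have r: "ranked C E1" "ranked C E2" using rk EE(2) unfolding ranked_def by blast+
  obtain c1 where c1: "den S C c1 V1 E1 ins (ks @ is)" using den_full[OF h1 m1 r(1)] by blast
  obtain c2 where c2: "den S C c2 V2 E2 (ks @ js) outs" using den_full[OF h2 m2 r(2)] by blast
  show ?thesis
    by (rule exI[of _ c1], rule exI[of _ c2], rule exI[of _ ks], rule exI[of _ V1], rule exI[of _ E1],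
      rule exI[of _ V2], rule exI[of _ E2]) (use c1 c2 VV ks(1) NV EE in simp)
qed

text \<open>A path starting in \<open>V\<close> cannot enter the past \<open>E\<^sub>1\<close>,
  whose sources avoid everything produced by the match and the future. Once it enters
  \<open>E\<^sub>2\<close> it stays there, and then its last target cannot lie in
  \<open>V\<close>.\<close>

lemma convex_middle:
  assumes E: "edges D = E\<^sub>1 \<union> E \<union> E\<^sub>2"
    and s: "\<And>h. h \<in> E\<^sub>1 \<Longrightarrow> set (sources D h) \<inter> (V \<union> W) = {}"
    and t: "\<And>h. h \<in> E \<Longrightarrow> set (targets D h) \<subseteq> V"
    and t2: "\<And>h. h \<in> E\<^sub>2 \<Longrightarrow> set (targets D h) \<subseteq> W - V"
    and s2: "\<And>h. h \<in> E \<Longrightarrow> set (sources D h) \<subseteq> V"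
    and p: "directed_path D v hs v'" "v \<in> V" "v' \<in> V"
  shows "set hs \<subseteq> E"
proof -
  have hs: "hs \<noteq> []" "set hs \<subseteq> edges D" "v \<in> set (sources D (hs ! 0))" "v' \<in> set (targets D (hs ! (length hs - 1)))"
    "\<And>i. Suc i < length hs \<Longrightarrow> set (targets D (hs ! i)) \<inter> set (sources D (hs ! Suc i)) \<noteq> {}"
    using p(1) by (auto simp: directed_path_def hd_conv_nth last_conv_nth)
  have mem: "hs ! i \<in> E\<^sub>1 \<union> E \<union> E\<^sub>2" if "i < length hs" for i
    using hs(2) that nth_mem unfolding E by blast
  have a: "hs ! i \<notin> E\<^sub>1" if "i < length hs" for i
    using that
  proof (induction i)
    case 0
    then show ?case using s hs(3) p(2) by blast
  next
    case (Suc i)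
    then have i: "i < length hs" "hs ! i \<notin> E\<^sub>1" by auto
    then have "hs ! i \<in> E \<union> E\<^sub>2" using mem[OF i(1)] by blast
    then have "set (targets D (hs ! i)) \<subseteq> V \<union> W" using t t2 by blast
    then show ?case using s hs(5)[OF Suc.prems] by blast
  qed
  have b: "hs ! Suc i \<in> E\<^sub>2" if i: "Suc i < length hs" "hs ! i \<in> E\<^sub>2" for i
  proof -
    have "hs ! Suc i \<notin> E" using t2[OF i(2)] s2 hs(5)[OF i(1)] by blast
    then show ?thesis using a[OF i(1)] mem[OF i(1)] by blast
  qed
  have c: "hs ! (i + k) \<in> E\<^sub>2" if "i + k < length hs" "hs ! i \<in> E\<^sub>2" for i k
    using that by (induction k) (auto intro: b)
  have "hs ! i \<in> E" if i: "i < length hs" for i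
  proof (rule ccontr)
    assume "hs ! i \<notin> E"
    then have "hs ! i \<in> E\<^sub>2" using a[OF i] mem[OF i] by blast
    then have "hs ! (length hs - 1) \<in> E\<^sub>2" using c[of i "length hs - 1 - i"] i by simp
    then show False using t2 hs(4) p(3) by blast
  qed
  then show ?thesis by (metis in_set_conv_nth subsetI)
qed

section \<open>The two directions of the equivalence\<close>

lemma homset_free:
  "f \<in> homset (free_prop S) n m \<longleftrightarrow> (\<exists>t. f = tm_class S {} t \<and> wt S t \<and> tdom S t = n \<and> tcod S t = m)"
  unfolding free_prop_def by (rule homset_presented)

lemma rewrite_class:
  assumes "wt S c\<^sub>1" "wt S l" "wt S c\<^sub>2" "tcod S c\<^sub>1 = k + tdom S l" "tdom S c\<^sub>2 = k + tcod S l"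
  shows "cmp (free_prop S) (cmp (free_prop S) (tm_class S {} c\<^sub>1) (tens (free_prop S) (idt (free_prop S) k) (tm_class S {} l)))
      (tm_class S {} c\<^sub>2) = tm_class S {} (TSeq (TSeq c\<^sub>1 (TPar (TId k) l)) c\<^sub>2)"
  using assms by (simp add: free_prop_def presented_simps)

text \<open>The map \<open>x\<close> starts from the empty hypergraph and is arbitrary; the right
  leg is a copairing, so the cut at \<open>n\<close> returns its two components.\<close>

lemma Phi_bend_iff:
  assumes "wt S t" "tdom S t = n" "tcod S t = m"
  shows "Cospan 0 (n + m) G x (copair n f g) \<in> Phi S (bend S (free_inj S (tm_class S {} t))) \<longleftrightarrow>
    (\<exists>y. univ S (map_tm Inl t) G y (leg n f) (leg m g))"
proof -
  have "cospan S (Cospan 0 (n + m) G x (copair n f g))" if "univ S (map_tm Inl t) G y (leg n f) (leg m g)" for y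
  proof -
    have "set (leg n f) \<subseteq> nodes G" "set (leg m g) \<subseteq> nodes G"
      using elem_bounds[OF univ_hyp[OF that] univ_elem[OF that]] assms(1) by (auto simp: map_tm_typing)
    moreover have "leg 0 x = []" by (simp add: leg_def)
    ultimately show ?thesis using univ_hyp[OF that] by (simp add: cospan_def hom_discrete)
  qed
  then show ?thesis unfolding Phi_bend[OF assms] by auto
qed

lemma image_hyp_simps:
  "nodes (image_hyp f L G) = nmap f ` nodes L" "edges (image_hyp f L G) = emap f ` edges L"
  by (simp_all add: image_hyp_def)

text \<open>The complement is split once into a context \<open>c1\<close>, \<open>c2\<close>.
  Filling it with \<open>L\<close> and with \<open>Q\<close> gives the two pushouts, so
  \<open>context_univ\<close> makes \<open>D\<close> and \<open>G\<close> represent the two sides of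
  a rewrite, which faithfulness identifies with \<open>d\<close> and \<open>e\<close>.\<close>

lemma dpo_imp_rewrites:
  fixes S :: "'g signature"
  assumes d: "wt S d" "tdom S d = n" "tcod S d = m" and e: "wt S e" "tdom S e = n" "tcod S e = m"
    and dpo: "convex_dpo S (dpo_rules S R) n m
      (Phi S (bend S (free_inj S (tm_class S {} d)))) (Phi S (bend S (free_inj S (tm_class S {} e))))"
  shows "rewrites_to (free_prop S) R (tm_class S {} d) (tm_class S {} e)"
proof -
  obtain D x q\<^sub>1 q\<^sub>2 G y p\<^sub>1 p\<^sub>2 where
    DG: "Cospan 0 (n + m) D x (copair n q\<^sub>1 q\<^sub>2) \<in> Phi S (bend S (free_inj S (tm_class S {} d)))"
      "Cospan 0 (n + m) G y (copair n p\<^sub>1 p\<^sub>2) \<in> Phi S (bend S (free_inj S (tm_class S {} e)))"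
    and step: "convex_dpo_step S (dpo_rules S R) n m D q\<^sub>1 q\<^sub>2 G p\<^sub>1 p\<^sub>2"
    using dpo unfolding convex_dpo_def by blast
  obtain i j L a\<^sub>1 a\<^sub>2 Q b\<^sub>1 b\<^sub>2 C c\<^sub>1 c\<^sub>2 d\<^sub>1 d\<^sub>2 f g g' f' where
    rule: "DPO_Rule i j L a\<^sub>1 a\<^sub>2 Q b\<^sub>1 b\<^sub>2 \<in> dpo_rules S R" and
    po: "is_pushout S (discrete (i + j)) L C D (copair i a\<^sub>1 a\<^sub>2) (copair i c\<^sub>1 c\<^sub>2) f g" and
    po': "is_pushout S (discrete (i + j)) Q C G (copair i b\<^sub>1 b\<^sub>2) (copair i c\<^sub>1 c\<^sub>2) f' g'" and
    q: "heq (discrete (n + m) :: 'g hgraph) (copair n d\<^sub>1 d\<^sub>2 \<then> g) (copair n q\<^sub>1 q\<^sub>2)" and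
    p: "heq (discrete (n + m) :: 'g hgraph) (copair n d\<^sub>1 d\<^sub>2 \<then> g') (copair n p\<^sub>1 p\<^sub>2)" and
    cm: "convex_matching S L D f" and
    bc: "boundary_complement S i j L a\<^sub>1 a\<^sub>2 n m D q\<^sub>1 q\<^sub>2 f C c\<^sub>1 c\<^sub>2 g d\<^sub>1 d\<^sub>2"
    using step unfolding convex_dpo_step_def by blast
  obtain l r z z' where lr: "(l, r) \<in> R" "l \<in> homset (free_prop S) i j" "r \<in> homset (free_prop S) i j"
    "Cospan 0 (i + j) L z (copair i a\<^sub>1 a\<^sub>2) \<in> Phi S (bend S (free_inj S l))"
    "Cospan 0 (i + j) Q z' (copair i b\<^sub>1 b\<^sub>2) \<in> Phi S (bend S (free_inj S r))"
    using rule unfolding dpo_rules_def by auto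
  obtain lt where lt: "l = tm_class S {} lt" "wt S lt" "tdom S lt = i" "tcod S lt = j"
    using lr(2) unfolding homset_free by blast
  obtain rt where rt: "r = tm_class S {} rt" "wt S rt" "tdom S rt = i" "tcod S rt = j"
    using lr(3) unfolding homset_free by blast
  obtain zl where L: "univ S (map_tm Inl lt) L zl (leg i a\<^sub>1) (leg j a\<^sub>2)"
    using lr(4) unfolding lt(1) Phi_bend_iff[OF lt(2-4)] by blast
  obtain zr where Q: "univ S (map_tm Inl rt) Q zr (leg i b\<^sub>1) (leg j b\<^sub>2)"
    using lr(5) unfolding rt(1) Phi_bend_iff[OF rt(2-4)] by blast
  obtain yd where D: "univ S (map_tm Inl d) D yd (leg n q\<^sub>1) (leg m q\<^sub>2)"
    using DG(1) unfolding Phi_bend_iff[OF d] by blast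
  obtain ye where G: "univ S (map_tm Inl e) G ye (leg n p\<^sub>1) (leg m p\<^sub>2)"
    using DG(2) unfolding Phi_bend_iff[OF e] by blast
  define js "is" ins outs where w: "js = leg j c\<^sub>2" "is = leg i c\<^sub>1" "ins = leg n d\<^sub>1" "outs = leg m d\<^sub>2"
  have g: "hyp_hom S C D g" and eq: "heq (discrete (i + j) :: 'g hgraph) (copair i a\<^sub>1 a\<^sub>2 \<then> f) (copair i c\<^sub>1 c\<^sub>2 \<then> g)"
    using po by (auto simp: is_pushout_def)
  have qe: "map (nmap g) ins = leg n q\<^sub>1" "map (nmap g) outs = leg m q\<^sub>2"
    using q by (simp_all add: heq_discrete w append_eq_append_conv)
  have pe: "map (nmap g') ins = leg n p\<^sub>1" "map (nmap g') outs = leg m p\<^sub>2"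
    using p by (simp_all add: heq_discrete w append_eq_append_conv)
  have ae: "map (nmap f) (leg i a\<^sub>1) = map (nmap g) is" "map (nmap f) (leg j a\<^sub>2) = map (nmap g) js"
    using eq by (simp_all add: heq_discrete w append_eq_append_conv)
  have mono: "monogamous S (j + n) (m + i) C (copair j c\<^sub>2 d\<^sub>1) (copair m d\<^sub>2 c\<^sub>1)"
    and cm1: "hyp_mono S (discrete (i + j)) C (copair i c\<^sub>1 c\<^sub>2)"
    using bc by (auto simp: boundary_complement_def)
  have hC: "hyp S C" and mg: "mono_eqs C (nodes C) (edges C) (js @ ins) (outs @ is)"
    using mono unfolding monogamous_iff by (simp_all add: w)
  have ij: "set is \<inter> set js = {}"
    using cm1 unfolding mono_discrete by (simp add: w)
  \<comment> \<open>\<open>D\<close> comes from a term and is therefore acyclic; a rank on its edges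
    is pulled back along \<open>g\<close>.\<close>
  have rk: "ranked C (edges C)"
  proof -
    obtain rk :: "nat \<Rightarrow> nat" where rk: "\<forall>h \<in> edges D. \<forall>h' \<in> edges D. set (targets D h) \<inter> set (sources D h') \<noteq> {} \<longrightarrow> rk h < rk h'"
      using den_ranked[OF univ_den[OF d(1) D]] unfolding ranked_def by blast
    have "rk (emap g h) < rk (emap g h')" if h: "h \<in> edges C" "h' \<in> edges C"
      "set (targets C h) \<inter> set (sources C h') \<noteq> {}" for h h'
    proof -
      obtain v where "v \<in> set (targets C h)" "v \<in> set (sources C h')" using h(3) by blast
      then have "nmap g v \<in> set (targets D (emap g h)) \<inter> set (sources D (emap g h'))"
        using g h(1,2) by (auto simp: hyp_hom_def)
      moreover have "emap g h \<in> edges D" "emap g h' \<in> edges D" using g h(1,2) by (auto simp: hyp_hom_def)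
      ultimately show ?thesis using rk by blast
    qed
    then show ?thesis unfolding ranked_def by (intro exI[of _ "\<lambda>h. rk (emap g h)"]) blast
  qed
  \<comment> \<open>A path in \<open>C\<close> from an output to an input of the match becomes a
    path in \<open>D\<close> between nodes of the image of \<open>L\<close>. Convexity would put its
    edges into that image, but edges coming from \<open>C\<close> never lie there.\<close>
  have cv: "set (sources C h) \<inter> set js = {}" if h: "h \<in> upstream C (set is)" for h
  proof (rule equals0I)
    fix v assume v: "v \<in> set (sources C h) \<inter> set js"
    then obtain hs v' where path: "directed_path C v hs v'" "v' \<in> set is" using upstream_path[OF h] by blast
    have "nmap g ` set js = nmap f ` set (leg j a\<^sub>2)" "nmap g ` set is = nmap f ` set (leg i a\<^sub>1)"
      using ae by (metis image_set)+
    moreover have "set (leg j a\<^sub>2) \<subseteq> nodes L" "set (leg i a\<^sub>1) \<subseteq> nodes L"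
      using elem_bounds[OF univ_hyp[OF L] univ_elem[OF L]] lt(2) by (auto simp: map_tm_typing)
    ultimately have "nmap g v \<in> nmap f ` nodes L" "nmap g v' \<in> nmap f ` nodes L"
      using v path(2) by blast+
    moreover have "convex_sub (image_hyp f L D) D" using cm by (simp add: convex_matching_def)
    moreover have path': "directed_path D (nmap g v) (map (emap g) hs) (nmap g v')"
      by (rule directed_path_hom[OF g path(1)])
    ultimately have "set (map (emap g) hs) \<subseteq> emap f ` edges L"
      unfolding convex_sub_def image_hyp_simps by blast
    moreover have "set hs \<subseteq> edges C" "hs \<noteq> []" using path(1) by (auto simp: directed_path_def)
    ultimately show False using pushout_edges_disjoint[OF po] by (cases hs) auto
  qed
  obtain c1 c2 ks V1 E1 V2 E2 where c: "den S C c1 V1 E1 ins (ks @ is)" "den S C c2 V2 E2 (ks @ js) outs"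
    "V1 \<inter> V2 = set ks" "nodes C = V1 \<union> V2" "E1 \<inter> E2 = {}" "edges C = E1 \<union> E2"
    using split_context[OF hC mg rk ij cv] by blast
  have t1: "wt S c1" "tdom S c1 = n" "tcod S c1 = length ks + i"
    using den_typing[OF c(1)] by (auto simp: w)
  have t2: "wt S c2" "tdom S c2 = length ks + j" "tcod S c2 = m"
    using den_typing[OF c(2)] by (auto simp: w)
  have cc: "leg (i + j) (copair i c\<^sub>1 c\<^sub>2) = is @ js" by (simp add: w)
  \<comment> \<open>Two terms represented by the same hypergraph with the same boundary both denote
    all of it, so that hypergraph itself serves as the ambient one in
    \<open>den_faithful\<close>.\<close>
  have faithful: "tm_class S {} (TSeq (TSeq c1 (TPar (TId (length ks)) l')) c2) = tm_class S {} d'"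
    if "univ S (map_tm Inl (TSeq (TSeq c1 (TPar (TId (length ks)) l')) c2)) G' x1 i' u'" "univ S (map_tm Inl d') G' x2 i' u'"
      "wt S l'" "tdom S l' = i" "tcod S l' = j" "wt S d'" for l' d' G' x1 x2 i' u'
  proof -
    have "wt S (TSeq (TSeq c1 (TPar (TId (length ks)) l')) c2)" using that t1 t2 by simp
    then show ?thesis using den_faithful univ_den that by blast
  qed
  obtain x1 where "univ S (map_tm Inl (TSeq (TSeq c1 (TPar (TId (length ks)) lt)) c2)) D x1 (leg n q\<^sub>1) (leg m q\<^sub>2)"
    using context_univ[OF c(1-6) lt(2) L po leg_copair cc] qe by (auto simp: w simp del: map_map)
  from faithful[OF this D lt(2-4) d(1)]
  have 1: "tm_class S {} d = tm_class S {} (TSeq (TSeq c1 (TPar (TId (length ks)) lt)) c2)" by simp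
  obtain x2 where "univ S (map_tm Inl (TSeq (TSeq c1 (TPar (TId (length ks)) rt)) c2)) G x2 (leg n p\<^sub>1) (leg m p\<^sub>2)"
    using context_univ[OF c(1-6) rt(2) Q po' leg_copair cc] pe by (auto simp: w simp del: map_map)
  from faithful[OF this G rt(2-4) e(1)]
  have 2: "tm_class S {} e = tm_class S {} (TSeq (TSeq c1 (TPar (TId (length ks)) rt)) c2)" by simp
  have 3: "tm_class S {} c1 \<in> homset (free_prop S) n (length ks + i)" "tm_class S {} c2 \<in> homset (free_prop S) (length ks + j) m"
    unfolding homset_free using t1 t2 by blast+
  have 4: "tm_class S {} d = cmp (free_prop S) (cmp (free_prop S) (tm_class S {} c1) (tens (free_prop S) (idt (free_prop S) (length ks)) l)) (tm_class S {} c2)"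
    "tm_class S {} e = cmp (free_prop S) (cmp (free_prop S) (tm_class S {} c1) (tens (free_prop S) (idt (free_prop S) (length ks)) r)) (tm_class S {} c2)"
    unfolding lt(1) rt(1) 1 2 using rewrite_class[of S c1 _ c2 "length ks"] t1 t2 lt(2-4) rt(2-4) by simp_all
  show ?thesis
    unfolding rewrites_to_def
    using lr(1-3) 3 4 by blast
qed

text \<open>Denoting the rewritten term exhibits the match as a part lying between the past
  \<open>c1\<close> and the future \<open>c2\<close>. Convexity and monogamicity follow from this
  layering, and the complement is assembled by hand.\<close>

lemma rewrites_imp_dpo:
  fixes S :: "'g signature"
  assumes c1: "wt S c1" "tdom S c1 = n" "tcod S c1 = k + i"
    and c2: "wt S c2" "tdom S c2 = k + j" "tcod S c2 = m"
    and l: "wt S l" "tdom S l = i" "tcod S l = j" and r: "wt S r" "tdom S r = i" "tcod S r = j"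
    and R: "(tm_class S {} l, tm_class S {} r) \<in> R"
  shows "convex_dpo S (dpo_rules S R) n m
    (Phi S (bend S (free_inj S (tm_class S {} (TSeq (TSeq c1 (TPar (TId k) l)) c2)))))
    (Phi S (bend S (free_inj S (tm_class S {} (TSeq (TSeq c1 (TPar (TId k) r)) c2)))))"
proof -
  let ?d = "TSeq (TSeq c1 (TPar (TId k) l)) c2" and ?e = "TSeq (TSeq c1 (TPar (TId k) r)) c2"
  have d: "wt S ?d" "tdom S ?d = n" "tcod S ?d = m" and e: "wt S ?e" "tdom S ?e = n" "tcod S ?e = m"
    using c1 c2 l r by simp_all
  \<comment> \<open>One denotation provides the match and both halves of the context inside the same
    hypergraph, with all overlaps known.\<close>
  obtain A V E ins outs where D: "den S A ?d V E ins outs" by (rule den_exists[OF d(1)])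
  then obtain V1 E1 V2 E2 Vl El ks "is" js where
    den: "den S A c1 V1 E1 ins (ks @ is)" "den S A l Vl El is js" "den S A c2 V2 E2 (ks @ js) outs"
    and ks: "length ks = k" "distinct ks" "set ks \<inter> Vl = {}"
    and V: "V = (V1 \<union> (set ks \<union> Vl)) \<union> V2" "V1 \<inter> (set ks \<union> Vl) = set ks \<union> set is"
      "(V1 \<union> (set ks \<union> Vl)) \<inter> V2 = set ks \<union> set js"
    and E: "E = (E1 \<union> El) \<union> E2" "E1 \<inter> El = {}" "(E1 \<union> El) \<inter> E2 = {}"
    by (auto simp: Un_assoc)
  have len: "length ins = n" "length outs = m" "length is = i" "length js = j"
    using den_typing[OF den(1)] den_typing[OF den(2)] den_typing[OF den(3)] c1 c2 ks by auto
  have wf1: "hyp S (subhyp A V1 E1)" "set ins \<subseteq> V1" "set ks \<subseteq> V1" "set is \<subseteq> V1"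
    using den_wf[OF den(1)] by auto
  have wf2: "hyp S (subhyp A V2 E2)" "set outs \<subseteq> V2" "set ks \<subseteq> V2" "set js \<subseteq> V2"
    using den_wf[OF den(3)] by auto
  have wfl: "hyp S (subhyp A Vl El)" "set is \<subseteq> Vl" "set js \<subseteq> Vl" "distinct is" "distinct js"
    using den_wf[OF den(2)] by auto
  let ?D = "subhyp A V E" and ?L = "subhyp A Vl El"
  have hD: "hyp S ?D" using den_wf[OF D] by simp
  have VV: "V1 \<inter> Vl = set is" "V1 \<inter> V2 \<subseteq> set ks \<union> set js" "Vl \<inter> V2 = set js"
    using V ks(3) wf1 wf2 wfl by blast+
  have VD: "V1 \<subseteq> V" "V2 \<subseteq> V" "Vl \<subseteq> V" and ED: "E1 \<subseteq> E" "E2 \<subseteq> E" "El \<subseteq> E"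
    unfolding V(1) E(1) by blast+
  have Vcov: "x \<in> Vl \<or> x \<in> V1 \<or> x \<in> V2" if "x \<in> V" for x
    using that wf1(3) unfolding V(1) by blast
  have Ecov: "h \<in> El \<or> h \<in> E1 \<or> h \<in> E2" if "h \<in> E" for h
    using that unfolding E(1) by blast
  have Edis: "h \<notin> El" if "h \<in> E1 \<or> h \<in> E2" for h
    using that E(2,3) by blast
  \<comment> \<open>In \<open>C\<close> the interfaces \<open>is\<close> and \<open>js\<close> must be disjoint, but in \<open>D\<close> they overlap when \<open>l\<close> contains
    identity wires. So \<open>C\<close> consists of even copies of the nodes of \<open>c1\<close> and odd copies of those of \<open>c2\<close>,
    except for the shared wires \<open>ks\<close>.\<close>
  define \<rho> where "\<rho> = (\<lambda>v::nat. if v \<in> set ks then 2 * v else Suc (2 * v))"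
  define \<tau> where "\<tau> = (\<lambda>v::nat. 2 * v)"
  have half: "\<tau> v div 2 = v" "\<rho> v div 2 = v" for v by (simp_all add: \<tau>_def \<rho>_def)
  have inj: "inj \<tau>" "inj \<rho>" by (metis half injI)+
  have odd: "v' \<in> set ks" if "\<tau> v = \<rho> v'" for v v'
  proof (rule ccontr)
    assume "v' \<notin> set ks"
    then have "even (Suc (2 * v'))" using that unfolding \<tau>_def \<rho>_def by (metis dvd_triv_left)
    then show False by simp
  qed
  have \<tau>\<rho>: "\<tau> v = \<rho> v' \<longleftrightarrow> v = v' \<and> v \<in> set ks" for v v'
  proof
    assume e: "\<tau> v = \<rho> v'"
    then have "v = v'" by (metis half)
    then show "v = v' \<and> v \<in> set ks" using odd[OF e] by simp
  qed (auto simp: \<tau>_def \<rho>_def)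
  have \<rho>ks: "map \<rho> ks = map \<tau> ks" by (simp add: \<tau>_def \<rho>_def)
  define C where "C = \<lparr> nodes = \<tau> ` V1 \<union> \<rho> ` V2, edges = E1 \<union> E2,
    sources = \<lambda>h. map (if h \<in> E1 then \<tau> else \<rho>) (sources A h),
    targets = \<lambda>h. map (if h \<in> E1 then \<tau> else \<rho>) (targets A h), label = label A \<rparr>"
  have E12: "E1 \<inter> E2 = {}" using E by blast
  have dC1: "den S C c1 (\<tau> ` V1) E1 (map \<tau> ins) (map \<tau> ks @ map \<tau> is)"
  proof -
    have "den S C c1 (\<tau> ` V1) (id ` E1) (map \<tau> ins) (map \<tau> (ks @ is))"
      by (rule den_map[OF _ _ _ den(1)]) (auto simp: C_def intro: inj_on_subset[OF inj(1)])
    then show ?thesis by simp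
  qed
  have dC2: "den S C c2 (\<rho> ` V2) E2 (map \<tau> ks @ map \<rho> js) (map \<rho> outs)"
  proof -
    have "den S C c2 (\<rho> ` V2) (id ` E2) (map \<rho> (ks @ js)) (map \<rho> outs)"
      by (rule den_map[OF _ _ _ den(3)]) (use E12 in \<open>auto simp: C_def intro: inj_on_subset[OF inj(2)]\<close>)
    then show ?thesis by (simp add: \<rho>ks)
  qed
  have VC: "\<tau> ` V1 \<inter> \<rho> ` V2 = set (map \<tau> ks)" "nodes C = \<tau> ` V1 \<union> \<rho> ` V2"
    using wf1(3) wf2(3) \<tau>\<rho> by (auto simp: C_def)
  have EC: "edges C = E1 \<union> E2" by (simp add: C_def)
  have hC: "hyp S C"
  proof -
    have "hyp S (subhyp C (\<tau> ` V1 \<union> \<rho> ` V2) (E1 \<union> E2))"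
      using den_wf[OF dC1] den_wf[OF dC2] hyp_sub_Un by blast
    then show ?thesis using VC(2) EC by (metis subhyp_simps(6))
  qed
  define c\<^sub>1 c\<^sub>2 d\<^sub>1 d\<^sub>2 a\<^sub>1 a\<^sub>2 q\<^sub>1 q\<^sub>2 where
    legs: "c\<^sub>1 = lmap (map \<tau> is)" "c\<^sub>2 = lmap (map \<rho> js)" "d\<^sub>1 = lmap (map \<tau> ins)" "d\<^sub>2 = lmap (map \<rho> outs)"
      "a\<^sub>1 = lmap is" "a\<^sub>2 = lmap js" "q\<^sub>1 = lmap ins" "q\<^sub>2 = lmap outs"
  have lg: "leg i c\<^sub>1 = map \<tau> is" "leg j c\<^sub>2 = map \<rho> js" "leg n d\<^sub>1 = map \<tau> ins" "leg m d\<^sub>2 = map \<rho> outs"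
    "leg i a\<^sub>1 = is" "leg j a\<^sub>2 = js" "leg n q\<^sub>1 = ins" "leg m q\<^sub>2 = outs"
    using leg_lmap[of "map \<tau> is"] leg_lmap[of "map \<rho> js"] leg_lmap[of "map \<tau> ins"] leg_lmap[of "map \<rho> outs"]
      leg_lmap[of "is"] leg_lmap[of js] leg_lmap[of ins] leg_lmap[of outs] len by (simp_all add: legs)
  \<comment> \<open>Halving undoes both renamings, so \<open>g\<close> forgets which copy a node is.
    It identifies the two copies of a wire that is at once an input and an output of the
    match.\<close>
  define g where "g = \<lparr> nmap = \<lambda>v. v div 2, emap = \<lambda>h. h \<rparr>"
  have gmap: "map (nmap g) (map \<tau> xs) = xs" "map (nmap g) (map \<rho> xs) = xs" for xs
    by (simp_all add: g_def half o_def)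
  have hL: "hyp_hom S ?L ?D hid" by (rule hom_sub[OF wfl(1) hD VD(3) ED(3)])
  have hg: "hyp_hom S C ?D g"
    unfolding hyp_hom_def
  proof (intro conjI ballI)
    show "nmap g v \<in> nodes ?D" if "v \<in> nodes C" for v
      using that VD by (auto simp: C_def g_def half)
    fix h assume "h \<in> edges C"
    then show "emap g h \<in> edges ?D" "sources ?D (emap g h) = map (nmap g) (sources C h)"
      "targets ?D (emap g h) = map (nmap g) (targets C h)" "label ?D (emap g h) = label C h"
      using ED by (auto simp: C_def g_def half o_def)
  qed (use hC hD in simp_all)
  have po: "is_pushout S (discrete (i + j)) ?L C ?D (copair i a\<^sub>1 a\<^sub>2) (copair i c\<^sub>1 c\<^sub>2) hid g"
    unfolding is_pushout_def
  proof (intro conjI allI impI)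
    show "hyp_hom S (discrete (i + j)) ?L (copair i a\<^sub>1 a\<^sub>2)"
      unfolding hom_discrete using wfl by (simp add: lg)
    show "hyp_hom S (discrete (i + j)) C (copair i c\<^sub>1 c\<^sub>2)"
      unfolding hom_discrete using hC wf1 wf2 by (auto simp: lg VC(2))
    show "hyp_hom S ?L ?D hid" "hyp_hom S C ?D g" by (rule hL, rule hg)
    show "heq (discrete (i + j) :: 'g hgraph) (copair i a\<^sub>1 a\<^sub>2 \<then> hid) (copair i c\<^sub>1 c\<^sub>2 \<then> g)"
      unfolding heq_discrete leg_comp leg_copair lg map_append gmap by simp
    fix T u v assume u: "hyp_hom S ?L T u" and v: "hyp_hom S C T v" and
      ag: "heq (discrete (i + j) :: 'g hgraph) (copair i a\<^sub>1 a\<^sub>2 \<then> u) (copair i c\<^sub>1 c\<^sub>2 \<then> v)"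
    have "map (nmap u) is @ map (nmap u) js = map (nmap v) (map \<tau> is) @ map (nmap v) (map \<rho> js)"
      using ag unfolding heq_discrete leg_comp leg_copair lg map_append .
    then have "map (nmap u) is = map (nmap v) (map \<tau> is)" "map (nmap u) js = map (nmap v) (map \<rho> js)"
      by (simp_all add: append_eq_append_conv)
    then have uv: "x \<in> set is \<Longrightarrow> nmap u x = nmap v (\<tau> x)" "x \<in> set js \<Longrightarrow> nmap u x = nmap v (\<rho> x)" for x
      by (simp_all add: map_eq_conv)
    \<comment> \<open>The parts overlap, so the choice of branch must not matter: \<open>is\<close>
      and \<open>js\<close> agree because the cocone commutes, and other nodes common to
      \<open>V1\<close> and \<open>V2\<close> lie in \<open>ks\<close>, where the two renamings
      coincide.\<close>
    define w where "w = \<lparr> nmap = \<lambda>x. if x \<in> Vl then nmap u x else if x \<in> V1 then nmap v (\<tau> x) else nmap v (\<rho> x),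
      emap = \<lambda>h. if h \<in> El then emap u h else emap v h \<rparr>"
    have wl: "nmap w x = nmap u x" if "x \<in> Vl" for x using that by (simp add: w_def)
    have w1: "nmap w x = nmap v (\<tau> x)" if "x \<in> V1" for x
      using that uv(1)[of x] VV(1) by (auto simp: w_def)
    have w2: "nmap w x = nmap v (\<rho> x)" if "x \<in> V2" for x
    proof (cases "x \<in> Vl")
      case True
      then show ?thesis using that uv(2)[of x] VV(3) wl[OF True] by auto
    next
      case False
      show ?thesis
      proof (cases "x \<in> V1")
        case True
        then have "x \<in> set ks" using that VV(2) False wfl(3) by blast
        then show ?thesis using w1[OF True] by (simp add: \<tau>_def \<rho>_def)
      qed (use False in \<open>simp add: w_def\<close>)
    qed
    have el: "emap w h = emap u h" if "h \<in> El" for h using that by (simp add: w_def)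
    have e12: "emap w h = emap v h" if "h \<in> E1 \<union> E2" for h using Edis that by (simp add: w_def)
    have hom: "hyp_hom S ?D T w"
      unfolding hyp_hom_def
    proof (intro conjI ballI)
      show "hyp S ?D" "hyp S T" using hD u by (auto simp: hyp_hom_def)
      show "nmap w x \<in> nodes T" if "x \<in> nodes ?D" for x
      proof -
        consider "x \<in> Vl" | "x \<in> V1" | "x \<in> V2" using Vcov \<open>x \<in> nodes ?D\<close> by auto
        then show ?thesis
        proof cases
          case 1
          then show ?thesis using u wl by (auto simp: hyp_hom_def)
        next
          case 2
          then show ?thesis using v w1 by (auto simp: hyp_hom_def VC(2))
        next
          case 3
          then show ?thesis using v w2 by (auto simp: hyp_hom_def VC(2))
        qed
      qed
      fix h assume "h \<in> edges ?D"
      then consider "h \<in> El" | "h \<in> E1" | "h \<in> E2" "h \<notin> E1" using Ecov[of h] E12 by auto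
      then have "emap w h \<in> edges T \<and> sources T (emap w h) = map (nmap w) (sources A h) \<and>
        targets T (emap w h) = map (nmap w) (targets A h) \<and> label T (emap w h) = label A h"
      proof cases
        case 1
        then have "set (sources A h) \<subseteq> Vl" "set (targets A h) \<subseteq> Vl" using wfl(1) by (auto simp: hyp_def)
        then have "map (nmap w) (sources A h) = map (nmap u) (sources A h)" "map (nmap w) (targets A h) = map (nmap u) (targets A h)"
          using wl by auto
        then show ?thesis using u 1 el by (simp add: hyp_hom_def)
      next
        case 2
        then have "set (sources A h) \<subseteq> V1" "set (targets A h) \<subseteq> V1" using wf1(1) by (auto simp: hyp_def)
        then have "map (nmap w) (sources A h) = map (nmap v) (sources C h)" "map (nmap w) (targets A h) = map (nmap v) (targets C h)"
          using w1 2 by (auto simp: C_def)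
        then show ?thesis using v 2 e12[of h] by (simp add: hyp_hom_def EC) (simp add: C_def)
      next
        case 3
        then have "set (sources A h) \<subseteq> V2" "set (targets A h) \<subseteq> V2" using wf2(1) by (auto simp: hyp_def)
        then have "map (nmap w) (sources A h) = map (nmap v) (sources C h)" "map (nmap w) (targets A h) = map (nmap v) (targets C h)"
          using w2 3 by (auto simp: C_def)
        then show ?thesis using v 3 e12[of h] by (simp add: hyp_hom_def EC) (simp add: C_def)
      qed
      then show "emap w h \<in> edges T" "sources T (emap w h) = map (nmap w) (sources ?D h)"
        "targets T (emap w h) = map (nmap w) (targets ?D h)" "label T (emap w h) = label ?D h" by simp_all
    qed
    have hl: "heq ?L (hid \<then> w) u" using wl el by (simp add: heq_def)
    have hc: "heq C (g \<then> w) v" using w1 w2 e12 by (auto simp: heq_def C_def g_def half)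
    show "\<exists>w. hyp_hom S ?D T w \<and> heq ?L (hid \<then> w) u \<and> heq C (g \<then> w) v \<and>
        (\<forall>w'. hyp_hom S ?D T w' \<and> heq ?L (hid \<then> w') u \<and> heq C (g \<then> w') v \<longrightarrow> heq ?D w' w)"
    proof (intro exI[of _ w] conjI allI impI hom hl hc)
      fix w' assume w': "hyp_hom S ?D T w' \<and> heq ?L (hid \<then> w') u \<and> heq C (g \<then> w') v"
      have n': "nmap w' (nmap g x) = nmap v x" if "x \<in> nodes C" for x using w' that by (simp add: heq_def)
      have "nmap w' x = nmap w x" if "x \<in> V" for x
      proof -
        consider "x \<in> Vl" | "x \<in> V1" | "x \<in> V2" using Vcov \<open>x \<in> V\<close> by blast
        then show ?thesis
        proof cases
          case 1
          then show ?thesis using w' wl by (simp add: heq_def)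
        next
          case 2
          then show ?thesis using n'[of "\<tau> x"] w1 by (simp add: VC(2) g_def half)
        next
          case 3
          then show ?thesis using n'[of "\<rho> x"] w2 by (simp add: VC(2) g_def half)
        qed
      qed
      moreover have "emap w' h = emap w h" if "h \<in> E" for h
        using Ecov[OF that] w' el e12 by (auto simp: heq_def EC g_def)
      ultimately show "heq ?D w' w" by (simp add: heq_def)
    qed
  qed
  \<comment> \<open>The right side gets an ambient hypergraph of its own; the pushout joins it to
    \<open>C\<close>.\<close>
  obtain A' V' E' is' js' where Q: "den S A' r V' E' is' js'" by (rule den_exists[OF r(1)])
  let ?Q = "subhyp A' V' E'"
  have len': "length is' = i" "length js' = j" using den_typing[OF Q] r by auto
  define b\<^sub>1 b\<^sub>2 where b: "b\<^sub>1 = lmap is'" "b\<^sub>2 = lmap js'"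
  have bl: "leg i b\<^sub>1 = is'" "leg j b\<^sub>2 = js'" using leg_lmap[of is'] leg_lmap[of js'] len' by (simp_all add: b)
  have bh: "hyp_hom S (discrete (i + j)) ?Q (copair i b\<^sub>1 b\<^sub>2)"
    unfolding hom_discrete using den_wf[OF Q] by (simp add: bl)
  have ch: "hyp_hom S (discrete (i + j)) C (copair i c\<^sub>1 c\<^sub>2)" using po by (simp add: is_pushout_def)
  obtain G f' g' where po': "is_pushout S (discrete (i + j)) ?Q C G (copair i b\<^sub>1 b\<^sub>2) (copair i c\<^sub>1 c\<^sub>2) f' g'"
    using pushout_exists[OF bh ch] by blast
  obtain zr where zr: "univ S (map_tm Inl r) ?Q zr is' js'" using den_univ[OF Q] by blast
  obtain zl where zl: "univ S (map_tm Inl l) ?L zl is js" using den_univ[OF den(2)] by blast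
  obtain zd where zd: "univ S (map_tm Inl ?d) ?D zd ins outs" using den_univ[OF D] by blast
  have "leg (i + j) (copair i b\<^sub>1 b\<^sub>2) = is' @ js'" "leg (i + j) (copair i c\<^sub>1 c\<^sub>2) = map \<tau> is @ map \<rho> js"
    by (simp_all add: bl lg)
  from context_univ[OF dC1 dC2 VC E12 EC r(1) zr po' this]
  obtain ze where ze: "univ S (map_tm Inl ?e) G ze (map (nmap g') (map \<tau> ins)) (map (nmap g') (map \<rho> outs))"
    using len len' ks(1) by auto
  have rule: "DPO_Rule i j ?L a\<^sub>1 a\<^sub>2 ?Q b\<^sub>1 b\<^sub>2 \<in> dpo_rules S R"
  proof -
    have "tm_class S {} l \<in> homset (free_prop S) i j" "tm_class S {} r \<in> homset (free_prop S) i j"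
      unfolding homset_free using l r by blast+
    moreover have "Cospan 0 (i + j) ?L hid (copair i a\<^sub>1 a\<^sub>2) \<in> Phi S (bend S (free_inj S (tm_class S {} l)))"
      unfolding Phi_bend_iff[OF l] using zl by (auto simp: lg)
    moreover have "Cospan 0 (i + j) ?Q hid (copair i b\<^sub>1 b\<^sub>2) \<in> Phi S (bend S (free_inj S (tm_class S {} r)))"
      unfolding Phi_bend_iff[OF r] using zr by (auto simp: bl)
    ultimately show ?thesis using R unfolding dpo_rules_def by blast
  qed
  have dh: "hyp_hom S (discrete n) C d\<^sub>1" "hyp_hom S (discrete m) C d\<^sub>2"
    "hyp_hom S (discrete (n + m)) C (copair n d\<^sub>1 d\<^sub>2)"
    unfolding hom_discrete using hC wf1(2) wf2(2) by (auto simp: lg VC(2))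
  have dq: "heq (discrete (n + m) :: 'g hgraph) (copair n d\<^sub>1 d\<^sub>2 \<then> g) (copair n q\<^sub>1 q\<^sub>2)"
    unfolding heq_discrete leg_comp leg_copair lg map_append gmap ..
  have dp: "heq (discrete (n + m) :: 'g hgraph) (copair n d\<^sub>1 d\<^sub>2 \<then> g') (copair n (d\<^sub>1 \<then> g') (d\<^sub>2 \<then> g'))"
    unfolding heq_discrete leg_comp leg_copair map_append ..
  have mono: "hyp_mono S ?L ?D hid" using hL by (simp add: hyp_mono_def heq_def)
  have fin: "finite V1" "finite V2" "finite Vl" "finite E1" "finite E2" "finite El"
    using wf1(1) wf2(1) wfl(1) by (auto simp: hyp_def)
  note M1 = mono_eqsD[OF den_mono_eqs[OF den(1)] fin(1,4)] and M2 = mono_eqsD[OF den_mono_eqs[OF den(3)] fin(2,5)]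
    and Ml = mono_eqsD[OF den_mono_eqs[OF den(2)] fin(3,6)]
  \<comment> \<open>The layers are \<open>E1\<close> before, \<open>El\<close> in the match and
    \<open>E2\<close> after. Sources of \<open>E1\<close> exclude its outputs, and these outputs
    contain everything that the past shares with the later layers.\<close>
  have conv: "convex_matching S ?L ?D hid"
    unfolding convex_matching_def convex_sub_def
  proof (intro conjI ballI allI impI mono)
    fix v v' hs assume v: "v \<in> nodes (image_hyp hid ?L ?D)" "v' \<in> nodes (image_hyp hid ?L ?D)" "directed_path ?D v hs v'"
    have "set hs \<subseteq> El"
    proof (rule convex_middle[of ?D E1 El E2 Vl V2 v hs v'])
      show "edges ?D = E1 \<union> El \<union> E2" using E(1) by simp
      show "set (sources ?D h) \<inter> (Vl \<union> V2) = {}" if "h \<in> E1" for h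
      proof -
        have s: "set (sources A h) \<subseteq> V1 - (set ks \<union> set is)" using M1(5)[OF that] by auto
        have "V1 \<inter> (Vl \<union> V2) \<subseteq> set ks \<union> set is" using VV wfl(3) by blast
        then show ?thesis unfolding subhyp_simps using s by blast
      qed
      show "set (targets ?D h) \<subseteq> V2 - Vl" if "h \<in> E2" for h
        using M2(5)[OF that] VV(3) by auto
      show "set (targets ?D h) \<subseteq> Vl" "set (sources ?D h) \<subseteq> Vl" if "h \<in> El" for h
        using Ml(5)[OF that] by auto
    qed (use v in \<open>auto simp: image_hyp_def\<close>)
    then show "set hs \<subseteq> edges (image_hyp hid ?L ?D)" by (simp add: image_hyp_def)
  qed
  have bc: "boundary_complement S i j ?L a\<^sub>1 a\<^sub>2 n m ?D q\<^sub>1 q\<^sub>2 hid C c\<^sub>1 c\<^sub>2 g d\<^sub>1 d\<^sub>2"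
    unfolding boundary_complement_def
  proof (intro conjI mono po dh(1,2) dq)
    have sg: "mono_eqs (subhyp A W F) W F x y \<longleftrightarrow> mono_eqs A W F x y" for W F x y
      by (simp add: mono_eqs_def tgt_mset_def src_mset_def)
    show "monogamous S i j ?L a\<^sub>1 a\<^sub>2"
      unfolding monogamous_iff using wfl(1) den_mono_eqs[OF den(2)] by (simp add: lg sg)
    show "monogamous S n m ?D q\<^sub>1 q\<^sub>2"
      unfolding monogamous_iff using hD den_mono_eqs[OF D] by (simp add: lg sg)
    show "hyp_mono S (discrete (i + j)) C (copair i c\<^sub>1 c\<^sub>2)"
      unfolding mono_discrete
    proof (intro conjI hC)
      show "set (leg (i + j) (copair i c\<^sub>1 c\<^sub>2)) \<subseteq> nodes C" using ch by (simp add: hom_discrete)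
      have "distinct (map \<tau> is)" "distinct (map \<rho> js)"
        using wfl(4,5) inj by (auto simp: distinct_map intro: inj_on_subset)
      moreover have "set (map \<tau> is) \<inter> set (map \<rho> js) = {}"
        using \<tau>\<rho> ks(3) wfl(2) by auto
      ultimately show "distinct (leg (i + j) (copair i c\<^sub>1 c\<^sub>2))" by (simp add: lg)
    qed
    show "monogamous S (j + n) (m + i) C (copair j c\<^sub>2 d\<^sub>1) (copair m d\<^sub>2 c\<^sub>1)"
      unfolding monogamous_iff
    proof (intro conjI hC)
      have f: "finite (\<tau> ` V1)" "finite (\<rho> ` V2)" using fin by simp_all
      have k: "mset_set (\<tau> ` V1 \<inter> \<rho> ` V2) = mset (map \<tau> ks)"
        unfolding VC(1) by (rule mset_set_set) (use ks(2) inj(1) in \<open>auto simp: distinct_map intro: inj_on_subset\<close>)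
      \<comment> \<open>In the sums of the equations for the two halves the wires \<open>ks\<close>
        appear once as a boundary and once through the intersection. Cancelling them leaves exactly
        the boundary demanded of a complement.\<close>
      note N = mset_set_Un_Int[OF f, unfolded k]
      have m1: "mono_eqs C (\<tau> ` V1) E1 (map \<tau> ins) (map \<tau> ks @ map \<tau> is)" by (rule den_mono_eqs[OF dC1])
      have m2: "mono_eqs C (\<rho> ` V2) E2 (map \<tau> ks @ map \<rho> js) (map \<rho> outs)" by (rule den_mono_eqs[OF dC2])
      have "(mset (map \<rho> js @ map \<tau> ins) + tgt_mset C (E1 \<union> E2)) + mset (map \<tau> ks) = mset_set (\<tau> ` V1 \<union> \<rho> ` V2) + mset (map \<tau> ks)"
        unfolding N m1[unfolded mono_eqs_def, THEN conjunct1, symmetric] m2[unfolded mono_eqs_def, THEN conjunct1, symmetric]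
          tgt_mset_Un[OF fin(4,5) E12] mset_append by (simp only: add_ac)
      moreover have "(mset (map \<rho> outs @ map \<tau> is) + src_mset C (E1 \<union> E2)) + mset (map \<tau> ks) = mset_set (\<tau> ` V1 \<union> \<rho> ` V2) + mset (map \<tau> ks)"
        unfolding N m1[unfolded mono_eqs_def, THEN conjunct2, symmetric] m2[unfolded mono_eqs_def, THEN conjunct2, symmetric]
          src_mset_Un[OF fin(4,5) E12] mset_append by (simp only: add_ac)
      ultimately show "mono_eqs C (nodes C) (edges C) (leg (j + n) (copair j c\<^sub>2 d\<^sub>1)) (leg (m + i) (copair m d\<^sub>2 c\<^sub>1))"
        unfolding VC(2) EC mono_eqs_def leg_copair lg by simp
    qed
  qed
  have "convex_dpo_step S (dpo_rules S R) n m ?D q\<^sub>1 q\<^sub>2 G (d\<^sub>1 \<then> g') (d\<^sub>2 \<then> g')"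
    unfolding convex_dpo_step_def
    using rule po po' dh(3) dq dp conv bc by blast
  moreover have "Cospan 0 (n + m) ?D hid (copair n q\<^sub>1 q\<^sub>2) \<in> Phi S (bend S (free_inj S (tm_class S {} ?d)))"
    unfolding Phi_bend_iff[OF d] using zd by (auto simp: lg)
  moreover have "Cospan 0 (n + m) G hid (copair n (d\<^sub>1 \<then> g') (d\<^sub>2 \<then> g')) \<in> Phi S (bend S (free_inj S (tm_class S {} ?e)))"
    unfolding Phi_bend_iff[OF e] leg_comp lg using ze by blast
  ultimately show ?thesis unfolding convex_dpo_def by blast
qed

theorem theorem5p6:
  fixes S :: "'g signature"
    and R :: "('g tm set \<times> 'g tm set) set"
    and d e :: "'g tm set"
    and n m :: nat
  assumes "rewriting_system (free_prop S) R"
    and "d \<in> homset (free_prop S) n m"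
    and "e \<in> homset (free_prop S) n m"
  shows "rewrites_to (free_prop S) R d e \<longleftrightarrow>
    convex_dpo S (dpo_rules S R) n m
      (Phi S (bend S (free_inj S d))) (Phi S (bend S (free_inj S e)))"
proof
  assume "rewrites_to (free_prop S) R d e"
  then obtain n' m' l r i j k c1 c2 where h: "(l, r) \<in> R" "l \<in> homset (free_prop S) i j" "r \<in> homset (free_prop S) i j"
    "c1 \<in> homset (free_prop S) n' (k + i)" "c2 \<in> homset (free_prop S) (k + j) m'"
    "d = cmp (free_prop S) (cmp (free_prop S) c1 (tens (free_prop S) (idt (free_prop S) k) l)) c2"
    "e = cmp (free_prop S) (cmp (free_prop S) c1 (tens (free_prop S) (idt (free_prop S) k) r)) c2"
    unfolding rewrites_to_def by blast
  obtain lt where l: "l = tm_class S {} lt" "wt S lt" "tdom S lt = i" "tcod S lt = j"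
    using h(2) unfolding homset_free by blast
  obtain rt where r: "r = tm_class S {} rt" "wt S rt" "tdom S rt = i" "tcod S rt = j"
    using h(3) unfolding homset_free by blast
  obtain t1 where t1: "c1 = tm_class S {} t1" "wt S t1" "tdom S t1 = n'" "tcod S t1 = k + i"
    using h(4) unfolding homset_free by blast
  obtain t2 where t2: "c2 = tm_class S {} t2" "wt S t2" "tdom S t2 = k + j" "tcod S t2 = m'"
    using h(5) unfolding homset_free by blast
  have de: "d = tm_class S {} (TSeq (TSeq t1 (TPar (TId k) lt)) t2)" "e = tm_class S {} (TSeq (TSeq t1 (TPar (TId k) rt)) t2)"
    unfolding h(6,7) l(1) r(1) t1(1) t2(1) by (rule rewrite_class; use l r t1 t2 in simp)+
  \<comment> \<open>\<open>rewrites_to\<close> quantifies over the outer types \<open>n'\<close> and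
    \<open>m'\<close>; they are recovered as source and target of \<open>d\<close>.\<close>
  have "src (free_prop S) d = n'" "trg (free_prop S) d = m'"
    unfolding de(1) free_prop_def using l t1 t2 by (simp_all add: presented_simps)
  then have nm: "n' = n" "m' = m" using assms(2) by (auto simp: homset_def)
  show "convex_dpo S (dpo_rules S R) n m (Phi S (bend S (free_inj S d))) (Phi S (bend S (free_inj S e)))"
    unfolding de by (rule rewrites_imp_dpo) (use l r t1 t2 nm h(1) in auto)
next
  assume dpo: "convex_dpo S (dpo_rules S R) n m (Phi S (bend S (free_inj S d))) (Phi S (bend S (free_inj S e)))"
  obtain dt where d: "d = tm_class S {} dt" "wt S dt" "tdom S dt = n" "tcod S dt = m"
    using assms(2) unfolding homset_free by blast
  obtain et where e: "e = tm_class S {} et" "wt S et" "tdom S et = n" "tcod S et = m"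
    using assms(3) unfolding homset_free by blast
  show "rewrites_to (free_prop S) R d e"
    using dpo dpo_imp_rewrites[OF d(2-4) e(2-4)] unfolding d(1) e(1) by blast
qed

end
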